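(* For any $\epsilon>0$, there is a $\mathrm{poly}(2^d,n)$ time two-sided distribution-free adaptive algorithm for $\epsilon$-testing the class of Boolean functions with Fourier degree at most $d$ that makes $\tilde O(2^{2d}+2^d/\epsilon)$ queries.
   Context: Here Boolean functions are $f:\{-1,1\}^n\to\{-1,1\}$; each has a unique Fourier representation $f(x)=\sum_{S\subseteq[n]}\hat f_S\prod_{i\in S}x_i$, and its Fourier degree is the largest $|S|$ with $\hat f_S\neq0$. Functions are accessed through a membership-query oracle returning $f(x)$. For a distribution $\mathcal D$ on $\{-1,1\}^n$, $f$ is $\epsilon$-far from a class $C$ with respect to $\mathcal D$ if $\Pr_{x\sim\mathcal D}[f(x)\neq g(x)]\ge\epsilon$ for every $g\in C$. A two-sided distribution-free adaptive algorithm for $\epsilon$-testing $C$ is a randomized algorithm that, given $\epsilon$, membership-query access to an arbitrary $f$, and an oracle returning independent samples from an arbitrary unknown distribution $\mathcal D$, chooses queries possibly adaptively and, for every $\mathcal D$, accepts with probability at least $2/3$ if $f\in C$ and rejects with probability at least $2/3$ if $f$ is $\epsilon$-far from every function in $C$ with respect to $\mathcal D$. Queries count membership queries and samples. $\tilde O(T)$ means $O(T\cdot\mathrm{poly}(\log T))$. *)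

theory Defs
  imports "HOL-Probability.Probability"
begin

section \<open>Boolean functions and their Fourier representation\<close>

text \<open>
  A point of the cube is a function with index set \<open>{..<n}\<close> and values in \<open>{-1, 1}\<close>.
  Points and Boolean functions are extensional, so that equality of functions is equality
  on the cube.
\<close>

definition cube :: "nat \<Rightarrow> (nat \<Rightarrow> real) set" where
  "cube n = {..<n} \<rightarrow>\<^sub>E {-1, 1}"

definition boolean_functions :: "nat \<Rightarrow> ((nat \<Rightarrow> real) \<Rightarrow> real) set" where
  "boolean_functions n = cube n \<rightarrow>\<^sub>E {-1, 1}"

definition is_fourier_rep ::
    "nat \<Rightarrow> ((nat \<Rightarrow> real) \<Rightarrow> real) \<Rightarrow> (nat set \<Rightarrow> real) \<Rightarrow> bool" where
  "is_fourier_rep n f c \<longleftrightarrow>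
     (\<forall>S. \<not> S \<subseteq> {..<n} \<longrightarrow> c S = 0) \<and>
     (\<forall>x\<in>cube n. f x = (\<Sum>S\<in>Pow {..<n}. c S * (\<Prod>i\<in>S. x i)))"

definition fourier_coeff :: "nat \<Rightarrow> ((nat \<Rightarrow> real) \<Rightarrow> real) \<Rightarrow> nat set \<Rightarrow> real" where
  "fourier_coeff n f = (THE c. is_fourier_rep n f c)"

definition fourier_degree :: "nat \<Rightarrow> ((nat \<Rightarrow> real) \<Rightarrow> real) \<Rightarrow> nat" where
  "fourier_degree n f = Max {card S | S. S \<subseteq> {..<n} \<and> fourier_coeff n f S \<noteq> 0}"

definition fourier_degree_class :: "nat \<Rightarrow> nat \<Rightarrow> ((nat \<Rightarrow> real) \<Rightarrow> real) set" where
  "fourier_degree_class n d = {g \<in> boolean_functions n. fourier_degree n g \<le> d}"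

text \<open>The definite description above denotes: the representation exists and is unique.\<close>

lemma finite_cube [simp]: "finite (cube n)"
  unfolding cube_def by (rule finite_PiE) auto

lemma prod_as_full_prod:
  fixes x :: "nat \<Rightarrow> real"
  assumes "S \<subseteq> {..<n}"
  shows "(\<Prod>i\<in>S. x i) = (\<Prod>i<n. if i \<in> S then x i else 1)"
proof -
  have "(\<Prod>i<n. if i \<in> S then x i else 1) = (\<Prod>i\<in>{..<n} \<inter> S. x i)"
    by (subst prod.inter_restrict) auto
  also have "{..<n} \<inter> S = S" using assms by auto
  finally show ?thesis by simp
qed

lemma character_orthogonality:
  assumes S: "S \<subseteq> {..<n}" and T: "T \<subseteq> {..<n}"
  shows "(\<Sum>x\<in>cube n. (\<Prod>i\<in>S. x i) * (\<Prod>i\<in>T. x i)) = (if S = T then 2 ^ n else (0::real))"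
proof -
  let ?h = "\<lambda>i (y::real). (if i \<in> S then y else 1) * (if i \<in> T then y else 1)"
  have "(\<Sum>x\<in>cube n. (\<Prod>i\<in>S. x i) * (\<Prod>i\<in>T. x i)) = (\<Sum>x\<in>cube n. \<Prod>i<n. ?h i (x i))"
    by (simp add: prod_as_full_prod[OF S] prod_as_full_prod[OF T] prod.distrib)
  also have "\<dots> = (\<Prod>i<n. \<Sum>y\<in>{-1, 1}. ?h i y)"
    unfolding cube_def by (subst prod_sum_PiE) auto
  also have "\<dots> = (\<Prod>i<n. if (i \<in> S) = (i \<in> T) then 2 else 0)"
    by (rule prod.cong) auto
  also have "\<dots> = (if S = T then 2 ^ n else 0)"
  proof (cases "S = T")
    case False
    then obtain i where "i < n" "(i \<in> S) \<noteq> (i \<in> T)" using S T by blast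
    then show ?thesis using False by (auto simp: prod_zero_iff)
  qed simp
  finally show ?thesis .
qed

lemma character_completeness:
  assumes x: "x \<in> cube n" and y: "y \<in> cube n"
  shows "(\<Sum>S\<in>Pow {..<n}. (\<Prod>i\<in>S. x i) * (\<Prod>i\<in>S. y i)) = (if x = y then 2 ^ n else (0::real))"
proof -
  have v: "x i \<in> {-1, 1}" "y i \<in> {-1, 1}" if "i < n" for i
    using x y that unfolding cube_def by (auto simp: PiE_def Pi_def)
  have "(\<Sum>S\<in>Pow {..<n}. (\<Prod>i\<in>S. x i) * (\<Prod>i\<in>S. y i)) = (\<Prod>i<n. x i * y i + 1)"
    by (subst prod_add) (auto simp: prod.distrib)
  also have "\<dots> = (\<Prod>i<n. if x i = y i then 2 else 0)"
  proof (rule prod.cong)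
    fix i assume "i \<in> {..<n}"
    then show "x i * y i + 1 = (if x i = y i then 2 else 0)"
      using v[of i] by auto
  qed simp
  also have "\<dots> = (if x = y then 2 ^ n else 0)"
  proof (cases "x = y")
    case False
    then obtain i where "i < n" "x i \<noteq> y i"
      using x y unfolding cube_def by (metis PiE_ext lessThan_iff)
    then show ?thesis using False by (auto simp: prod_zero_iff)
  qed simp
  finally show ?thesis .
qed

lemma is_fourier_rep_formula:
  "is_fourier_rep n f
     (\<lambda>S. if S \<subseteq> {..<n} then (\<Sum>x\<in>cube n. f x * (\<Prod>i\<in>S. x i)) / 2 ^ n else 0)"
  unfolding is_fourier_rep_def
proof (intro conjI allI impI ballI)
  fix x assume x: "x \<in> cube n"
  have "(\<Sum>S\<in>Pow {..<n}. (if S \<subseteq> {..<n} then (\<Sum>y\<in>cube n. f y * (\<Prod>i\<in>S. y i)) / 2 ^ n else 0)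
          * (\<Prod>i\<in>S. x i))
      = (\<Sum>S\<in>Pow {..<n}. \<Sum>y\<in>cube n. f y / 2 ^ n * ((\<Prod>i\<in>S. y i) * (\<Prod>i\<in>S. x i)))"
    by (rule sum.cong) (auto simp: sum_divide_distrib sum_distrib_right intro!: sum.cong)
  also have "\<dots> = (\<Sum>y\<in>cube n. f y / 2 ^ n *
                    (\<Sum>S\<in>Pow {..<n}. (\<Prod>i\<in>S. y i) * (\<Prod>i\<in>S. x i)))"
    by (subst sum.swap) (simp add: sum_distrib_left)
  also have "\<dots> = (\<Sum>y\<in>cube n. if y = x then f x else 0)"
    by (rule sum.cong) (auto simp: character_completeness x)
  also have "\<dots> = f x" using x by simp
  finally show "f x = (\<Sum>S\<in>Pow {..<n}.
      (if S \<subseteq> {..<n} then (\<Sum>y\<in>cube n. f y * (\<Prod>i\<in>S. y i)) / 2 ^ n else 0)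
          * (\<Prod>i\<in>S. x i))" by simp
qed auto

lemma is_fourier_rep_determined:
  assumes c: "is_fourier_rep n f c" and T: "T \<subseteq> {..<n}"
  shows "(\<Sum>x\<in>cube n. f x * (\<Prod>i\<in>T. x i)) = c T * 2 ^ n"
proof -
  have "(\<Sum>x\<in>cube n. f x * (\<Prod>i\<in>T. x i))
      = (\<Sum>x\<in>cube n. \<Sum>S\<in>Pow {..<n}. c S * ((\<Prod>i\<in>S. x i) * (\<Prod>i\<in>T. x i)))"
    using c unfolding is_fourier_rep_def
    by (intro sum.cong) (auto simp: sum_distrib_right mult.assoc)
  also have "\<dots> = (\<Sum>S\<in>Pow {..<n}. c S * (\<Sum>x\<in>cube n. (\<Prod>i\<in>S. x i) * (\<Prod>i\<in>T. x i)))"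
    by (subst sum.swap) (simp add: sum_distrib_left)
  also have "\<dots> = (\<Sum>S\<in>Pow {..<n}. if S = T then c T * 2 ^ n else 0)"
    by (rule sum.cong) (auto simp: character_orthogonality T)
  also have "\<dots> = c T * 2 ^ n" using T by simp
  finally show ?thesis .
qed

lemma fourier_rep_ex1: "\<exists>!c. is_fourier_rep n f c"
proof (rule ex_ex1I)
  show "\<exists>c. is_fourier_rep n f c" using is_fourier_rep_formula by blast
next
  fix c c' assume c: "is_fourier_rep n f c" and c': "is_fourier_rep n f c'"
  show "c = c'"
  proof
    fix S show "c S = c' S"
    proof (cases "S \<subseteq> {..<n}")
      case True
      then show ?thesis
        using is_fourier_rep_determined[OF c True] is_fourier_rep_determined[OF c' True] by simp
    next
      case False
      then show ?thesis using c c' unfolding is_fourier_rep_def by simp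
    qed
  qed
qed

lemma is_fourier_rep_fourier_coeff: "is_fourier_rep n f (fourier_coeff n f)"
  unfolding fourier_coeff_def by (rule theI'[OF fourier_rep_ex1])

text \<open>For a Boolean function the maximum in the degree is over a nonempty finite set.\<close>

lemma fourier_support_finite: "finite {card S | S. S \<subseteq> {..<n} \<and> fourier_coeff n f S \<noteq> 0}"
proof -
  have "finite (card ` Pow {..<n})" by simp
  then show ?thesis by (rule finite_subset[rotated]) auto
qed

lemma fourier_support_nonempty:
  assumes "f \<in> boolean_functions n"
  shows "{card S | S. S \<subseteq> {..<n} \<and> fourier_coeff n f S \<noteq> 0} \<noteq> {}"
proof
  assume "{card S | S. S \<subseteq> {..<n} \<and> fourier_coeff n f S \<noteq> 0} = {}"
  then have z: "\<And>S. S \<subseteq> {..<n} \<Longrightarrow> fourier_coeff n f S = 0" by auto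
  define x where "x = (\<lambda>i\<in>{..<n}. 1::real)"
  have x: "x \<in> cube n" unfolding x_def cube_def by auto
  then have "f x = 0"
    using is_fourier_rep_fourier_coeff[of n f] z unfolding is_fourier_rep_def by simp
  moreover have "f x \<in> {-1, 1}" using assms x unfolding boolean_functions_def by auto
  ultimately show False by simp
qed

section \<open>Distance to a class\<close>

definition far_from ::
    "real \<Rightarrow> (nat \<Rightarrow> real) pmf \<Rightarrow> ((nat \<Rightarrow> real) \<Rightarrow> real) \<Rightarrow> ((nat \<Rightarrow> real) \<Rightarrow> real) set \<Rightarrow> bool" where
  "far_from \<epsilon> D f C \<longleftrightarrow> (\<forall>g\<in>C. measure_pmf.prob D {x. f x \<noteq> g x} \<ge> \<epsilon>)"

section \<open>Randomized oracle programs\<close>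

text \<open>
  Algorithms are programs for a random access machine whose memory is an array of natural
  numbers. The arithmetic operations are addition, truncated subtraction and halving, at unit
  cost. As there is no unit-cost multiplication, the bit length of numbers grows by at most a
  constant per step, and polynomial time on this machine is polynomial time on a Turing machine.

  Oracle commands, where \<open>n\<close> is the number of variables:
  \<open>Flip a\<close> stores a fair coin flip at address \<open>a\<close>;
  \<open>Sample a\<close> stores a fresh sample from the unknown distribution in the \<open>n\<close> cells from \<open>a\<close> on;
  \<open>Query a b\<close> stores at \<open>a\<close> the value of the unknown function at the point held in the \<open>n\<close>
  cells from \<open>b\<close> on;
  \<open>EpsGe a p q\<close> stores at \<open>a\<close> whether \<open>p \<le> q * \<epsilon>\<close>. The last command is how a program is given
  the arbitrary real number \<open>\<epsilon>\<close>.
\<close>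

datatype expr =
    Num nat
  | Cell expr
  | Plus expr expr
  | Minus expr expr
  | Half expr

datatype com =
    Skip
  | Assign expr expr
  | Flip expr
  | Sample expr
  | Query expr expr
  | EpsGe expr expr expr
  | Seq com com
  | Cond expr com com
  | While expr com

record state =
  mem :: "nat \<Rightarrow> nat"
  time :: nat
  queries :: nat

primrec eval_expr :: "expr \<Rightarrow> (nat \<Rightarrow> nat) \<Rightarrow> nat" where
  "eval_expr (Num k) m = k"
| "eval_expr (Cell e) m = m (eval_expr e m)"
| "eval_expr (Plus e1 e2) m = eval_expr e1 m + eval_expr e2 m"
| "eval_expr (Minus e1 e2) m = eval_expr e1 m - eval_expr e2 m"
| "eval_expr (Half e) m = eval_expr e m div 2"

text \<open>In memory the values \<open>1\<close> and \<open>-1\<close> are represented by \<open>1\<close> and \<open>0\<close>.\<close>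

definition encode_sign :: "real \<Rightarrow> nat" where
  "encode_sign v = (if v = 1 then 1 else 0)"

definition read_point :: "nat \<Rightarrow> nat \<Rightarrow> (nat \<Rightarrow> nat) \<Rightarrow> (nat \<Rightarrow> real)" where
  "read_point n b m = (\<lambda>i\<in>{..<n}. if m (b + i) = 0 then -1 else 1)"

definition write_point :: "nat \<Rightarrow> nat \<Rightarrow> (nat \<Rightarrow> real) \<Rightarrow> (nat \<Rightarrow> nat) \<Rightarrow> (nat \<Rightarrow> nat)" where
  "write_point n a x m = (\<lambda>j. if a \<le> j \<and> j < a + n then encode_sign (x (j - a)) else m j)"

text \<open>
  \<open>state_after m t q s\<close> has memory \<open>m\<close>, and \<open>t\<close> time units and \<open>q\<close> queries more than \<open>s\<close>.
  A membership query and a sample each count as one query; as they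
  transfer a point of \<open>n\<close> coordinates, they cost \<open>n + 1\<close> time units.
\<close>

definition state_after :: "(nat \<Rightarrow> nat) \<Rightarrow> nat \<Rightarrow> nat \<Rightarrow> state \<Rightarrow> state" where
  "state_after m t q s = \<lparr>mem = m, time = time s + t, queries = queries s + q\<rparr>"

primrec step ::
    "nat \<Rightarrow> real \<Rightarrow> ((nat \<Rightarrow> real) \<Rightarrow> real) \<Rightarrow> (nat \<Rightarrow> real) pmf \<Rightarrow> com \<Rightarrow> state \<Rightarrow> (com \<times> state) pmf"
where
  "step n \<epsilon> f D Skip s = return_pmf (Skip, s)"
| "step n \<epsilon> f D (Assign a e) s =
     return_pmf (Skip, state_after ((mem s)(eval_expr a (mem s) := eval_expr e (mem s))) 1 0 s)"
| "step n \<epsilon> f D (Flip a) s =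
     map_pmf (\<lambda>b. (Skip, state_after ((mem s)(eval_expr a (mem s) := of_bool b)) 1 0 s))
       (bernoulli_pmf (1/2))"
| "step n \<epsilon> f D (Sample a) s =
     map_pmf (\<lambda>x. (Skip, state_after (write_point n (eval_expr a (mem s)) x (mem s)) (n + 1) 1 s)) D"
| "step n \<epsilon> f D (Query a b) s =
     return_pmf (Skip, state_after
       ((mem s)(eval_expr a (mem s) := encode_sign (f (read_point n (eval_expr b (mem s)) (mem s)))))
       (n + 1) 1 s)"
| "step n \<epsilon> f D (EpsGe a p q) s =
     return_pmf (Skip, state_after
       ((mem s)(eval_expr a (mem s) :=
          of_bool (real (eval_expr p (mem s)) \<le> real (eval_expr q (mem s)) * \<epsilon>))) 1 0 s)"
| "step n \<epsilon> f D (Seq c1 c2) s =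
     (if c1 = Skip then return_pmf (c2, state_after (mem s) 1 0 s)
      else map_pmf (\<lambda>(c, s'). (Seq c c2, s')) (step n \<epsilon> f D c1 s))"
| "step n \<epsilon> f D (Cond e c1 c2) s =
     return_pmf (if eval_expr e (mem s) \<noteq> 0 then c1 else c2, state_after (mem s) 1 0 s)"
| "step n \<epsilon> f D (While e c) s =
     return_pmf (if eval_expr e (mem s) \<noteq> 0 then Seq c (While e c) else Skip,
                 state_after (mem s) 1 0 s)"

text \<open>The program is given \<open>n\<close> and \<open>d\<close> in the first two cells; all other cells are zero.\<close>

definition initial_state :: "nat \<Rightarrow> nat \<Rightarrow> state" where
  "initial_state n d = \<lparr>mem = (\<lambda>_. 0)(0 := n, 1 := d), time = 0, queries = 0\<rparr>"

primrec run ::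
    "nat \<Rightarrow> nat \<Rightarrow> real \<Rightarrow> ((nat \<Rightarrow> real) \<Rightarrow> real) \<Rightarrow> (nat \<Rightarrow> real) pmf \<Rightarrow> com \<Rightarrow> nat \<Rightarrow> (com \<times> state) pmf"
where
  "run n d \<epsilon> f D P 0 = return_pmf (P, initial_state n d)"
| "run n d \<epsilon> f D P (Suc k) = bind_pmf (run n d \<epsilon> f D P k) (\<lambda>(c, s). step n \<epsilon> f D c s)"

text \<open>
  A program halts when it has become \<open>Skip\<close>. It then accepts if cell 0 is nonzero and rejects
  if cell 0 is zero. The probability of having halted with a given answer after \<open>k\<close> steps
  increases with \<open>k\<close>.
\<close>

definition accept_prob ::
    "nat \<Rightarrow> nat \<Rightarrow> real \<Rightarrow> ((nat \<Rightarrow> real) \<Rightarrow> real) \<Rightarrow> (nat \<Rightarrow> real) pmf \<Rightarrow> com \<Rightarrow> real" where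
  "accept_prob n d \<epsilon> f D P =
     (SUP k. measure_pmf.prob (run n d \<epsilon> f D P k) {(c, s). c = Skip \<and> mem s 0 \<noteq> 0})"

definition reject_prob ::
    "nat \<Rightarrow> nat \<Rightarrow> real \<Rightarrow> ((nat \<Rightarrow> real) \<Rightarrow> real) \<Rightarrow> (nat \<Rightarrow> real) pmf \<Rightarrow> com \<Rightarrow> real" where
  "reject_prob n d \<epsilon> f D P =
     (SUP k. measure_pmf.prob (run n d \<epsilon> f D P k) {(c, s). c = Skip \<and> mem s 0 = 0})"

text \<open>
  Worst-case bounds, over the function, the distribution, the coin flips and the samples. Every
  step of a program that has not halted costs at least one time unit
  (\<open>halted_or_time_ge\<close> below), so a time bound forces every run to halt.
\<close>

definition time_bounded :: "com \<Rightarrow> nat \<Rightarrow> nat \<Rightarrow> real \<Rightarrow> real \<Rightarrow> bool" where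
  "time_bounded P n d \<epsilon> T \<longleftrightarrow>
     (\<forall>f\<in>boolean_functions n. \<forall>D. set_pmf D \<subseteq> cube n \<longrightarrow>
        (\<forall>k. \<forall>(c, s)\<in>set_pmf (run n d \<epsilon> f D P k). real (time s) \<le> T))"

definition query_bounded :: "com \<Rightarrow> nat \<Rightarrow> nat \<Rightarrow> real \<Rightarrow> real \<Rightarrow> bool" where
  "query_bounded P n d \<epsilon> Q \<longleftrightarrow>
     (\<forall>f\<in>boolean_functions n. \<forall>D. set_pmf D \<subseteq> cube n \<longrightarrow>
        (\<forall>k. \<forall>(c, s)\<in>set_pmf (run n d \<epsilon> f D P k). real (queries s) \<le> Q))"

definition distribution_free_tester ::
    "com \<Rightarrow> nat \<Rightarrow> nat \<Rightarrow> real \<Rightarrow> ((nat \<Rightarrow> real) \<Rightarrow> real) set \<Rightarrow> bool" where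
  "distribution_free_tester P n d \<epsilon> C \<longleftrightarrow>
     (\<forall>f\<in>boolean_functions n. \<forall>D. set_pmf D \<subseteq> cube n \<longrightarrow>
        (f \<in> C \<longrightarrow> accept_prob n d \<epsilon> f D P \<ge> 2/3) \<and>
        (far_from \<epsilon> D f C \<longrightarrow> reject_prob n d \<epsilon> f D P \<ge> 2/3))"

lemma step_time:
  "(c', s') \<in> set_pmf (step n \<epsilon> f D c s) \<Longrightarrow> c = Skip \<and> c' = Skip \<and> s' = s \<or> time s' \<ge> time s + 1"
  by (induction c arbitrary: c' s')
     (auto simp: state_after_def split: if_splits)

lemma halted_or_time_ge:
  "(c, s) \<in> set_pmf (run n d \<epsilon> f D P k) \<Longrightarrow> c = Skip \<or> time s \<ge> k"
proof (induction k arbitrary: c s)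
  case (Suc k)
  then obtain c0 s0 where r: "(c0, s0) \<in> set_pmf (run n d \<epsilon> f D P k)"
    and st: "(c, s) \<in> set_pmf (step n \<epsilon> f D c0 s0)" by auto
  from Suc.IH[OF r] step_time[OF st] st show ?case by auto
qed simp

text \<open>
  The quantity that a soft-O bound on the number of queries is taken of; it is at least 1, so
  that its logarithm is nonnegative. As drawing this many samples takes at least that much time,
  a time bound polynomial in \<open>2 ^ d\<close> and \<open>n\<close> must be read with a coefficient depending on \<open>\<epsilon>\<close>;
  taking a power of \<open>1 + 1 / \<epsilon>\<close> for it excludes a worse than polynomial dependence.
\<close>

definition query_scale :: "nat \<Rightarrow> real \<Rightarrow> real" where
  "query_scale d \<epsilon> = 2 ^ (2 * d) + 2 ^ d / \<epsilon>"

end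

theory Submission
  imports Defs
begin

text \<open>
  A Boolean function of degree at most \<open>d\<close> satisfies the Reed-Muller condition: its product over
  any cube spanned by \<open>d + 1\<close> vectors is 1. The first stage checks this condition at random base
  points. If a function passes, majority decoding gives a function \<open>g\<close> which satisfies it everywhere
  and differs from \<open>f\<close> on a fraction of at most about \<open>2 ^ (-d) / d\<close> of the cube. The second stage
  checks the condition at points drawn from the unknown distribution; where \<open>f\<close> and \<open>g\<close> differ it
  fails with probability at least 1/2, so after \<open>O(1/\<epsilon>)\<close> samples \<open>f\<close> is close to \<open>g\<close> with respect to
  the distribution, or rejected.

  It remains to detect that \<open>g\<close> has degree more than \<open>d\<close>. The variables are merged at random, two
  blocks at a time, until \<open>O(d\<^sup>2)\<close> blocks are left. A merge lowers the degree to \<open>d\<close> with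
  probability \<open>O(d\<^sup>2 / k\<^sup>2)\<close>, where \<open>k\<close> is the number of blocks: only \<open>O(d)\<close> of the blocks have
  a partner with which merging lowers the degree. So a function of \<open>O(d\<^sup>2)\<close> variables
  has to be tested. Its at most \<open>4 ^ d\<close> coefficients are multiples of \<open>2 ^ (-d)\<close>; they are separated
  by a random linear hash, estimated by sampling, and learned exactly together with their sets, and
  the resulting polynomial of degree at most \<open>d\<close> is compared with the function at random points.
  If it agrees with \<open>g\<close> on a fraction of more than \<open>1 - 4 ^ (-d)\<close> of the points, its square is 1 by
  the Schwartz-Zippel bound, so it is Boolean and equal to \<open>g\<close>, as both satisfy the
  Reed-Muller condition.
\<close>

section \<open>Execution of programs with cost accounting\<close>

text \<open>The Reed-Muller condition bounds the degree over the field of two elements, which is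
  weaker than real degree at most \<open>d\<close> but can be tested locally, at
  \<open>2 ^ (d + 1)\<close> points. The unknown distribution enters only there; whether
  \<open>g\<close> has low degree is then a question about the uniform distribution. The obstacle is
  that learning \<open>g\<close> directly costs a number of queries growing with \<open>n\<close>.
  The collapse probabilities of the merges telescope to \<open>O(d^2 / R)\<close> for
  \<open>R\<close> final blocks, hence a number of blocks independent of \<open>n\<close>. A random
  shift taken before merging makes each point of the small cube uniform in the large one, so the
  disagreement of \<open>f\<close> and \<open>g\<close> is inherited on average. Coefficients are
  multiples of \<open>1 / 2 ^ d\<close>, so \<open>4 ^ d\<close> samples up to factors in
  \<open>d\<close> round them correctly, and one sample serves all hash buckets. Hash and estimates
  matter for acceptance only: soundness rests on the size check and the final comparison, whatever
  table was learned.\<close>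

primrec tcost :: "nat \<Rightarrow> com \<Rightarrow> nat" where
  "tcost W Skip = 0"
| "tcost W (Assign a e) = 1"
| "tcost W (Flip a) = 1"
| "tcost W (Sample a) = W + 1"
| "tcost W (Query a b) = W + 1"
| "tcost W (EpsGe a p q) = 1"
| "tcost W (Seq c1 c2) = tcost W c1 + tcost W c2 + 1"
| "tcost W (Cond e c1 c2) = tcost W c1 + tcost W c2 + 1"
| "tcost W (While e c) = W * (tcost W c + 2) + 1"

text \<open>One number \<open>W\<close> bounds \<open>n\<close> and all iteration counts, so a fixed
  program costs a polynomial in \<open>W\<close> whose degree grows with the nesting of its loops.
  Polynomial time is thereby reduced to a polynomial bound on \<open>W\<close>, given in
  \<open>width_bound\<close>.\<close>

lemma tcost_polynomial: "\<exists>L b. \<forall>W. tcost W c \<le> L * (W + 1) ^ b"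
proof (induction c)
  case (Seq c1 c2)
  then obtain L1 b1 L2 b2 where *: "\<And>W. tcost W c1 \<le> L1 * (W + 1) ^ b1" "\<And>W. tcost W c2 \<le> L2 * (W + 1) ^ b2"
    by blast
  have "tcost W (Seq c1 c2) \<le> (L1 + L2 + 1) * (W + 1) ^ (b1 + b2)" for W
  proof -
    have "L1 * (W + 1) ^ b1 \<le> L1 * (W + 1) ^ (b1 + b2)" "L2 * (W + 1) ^ b2 \<le> L2 * (W + 1) ^ (b1 + b2)"
      by (auto intro!: mult_left_mono power_increasing)
    moreover have "1 \<le> (W + 1) ^ (b1 + b2)" by simp
    ultimately show ?thesis using *(1)[of W] *(2)[of W] by (simp only: tcost.simps ring_distribs)
  qed
  then show ?case by blast
next
  case (Cond e c1 c2)
  then obtain L1 b1 L2 b2 where *: "\<And>W. tcost W c1 \<le> L1 * (W + 1) ^ b1" "\<And>W. tcost W c2 \<le> L2 * (W + 1) ^ b2"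
    by blast
  have "tcost W (Cond e c1 c2) \<le> (L1 + L2 + 1) * (W + 1) ^ (b1 + b2)" for W
  proof -
    have "L1 * (W + 1) ^ b1 \<le> L1 * (W + 1) ^ (b1 + b2)" "L2 * (W + 1) ^ b2 \<le> L2 * (W + 1) ^ (b1 + b2)"
      by (auto intro!: mult_left_mono power_increasing)
    moreover have "1 \<le> (W + 1) ^ (b1 + b2)" by simp
    ultimately show ?thesis using *(1)[of W] *(2)[of W] by (simp only: tcost.simps ring_distribs)
  qed
  then show ?case by blast
next
  case (While e c)
  then obtain L b where *: "\<And>W. tcost W c \<le> L * (W + 1) ^ b" by blast
  have "tcost W (While e c) \<le> (L + 3) * (W + 1) ^ (b + 1)" for W
  proof -
    have "W * tcost W c \<le> (W + 1) * (L * (W + 1) ^ b)"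
      using *[of W] by (intro mult_mono) auto
    also have "\<dots> = L * (W + 1) ^ (b + 1)" by (simp add: algebra_simps)
    finally have 1: "W * tcost W c \<le> L * (W + 1) ^ (b + 1)" .
    have 2: "W + 1 \<le> (W + 1) ^ (b + 1)" using power_increasing[of 1 "b + 1" "W + 1"] by simp
    have "tcost W (While e c) = W * tcost W c + 2 * W + 1" by (simp add: algebra_simps)
    also have "\<dots> \<le> L * (W + 1) ^ (b + 1) + 3 * (W + 1) ^ (b + 1)" using 1 2 by linarith
    finally show ?thesis by (simp only: ring_distribs)
  qed
  then show ?case by blast
next
  case (Sample a)
  show ?case by (rule exI[of _ 1], rule exI[of _ 1]) simp
next
  case (Query a b)
  show ?case by (rule exI[of _ 1], rule exI[of _ 1]) simp
qed (rule exI[of _ 1], rule exI[of _ 0], simp)+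

section \<open>Memory layout and addressing\<close>

record hs =
  sv :: "nat \<Rightarrow> nat"
  bu :: "nat \<Rightarrow> nat"
  ar :: "nat \<Rightarrow> nat \<Rightarrow> nat"

text \<open>Cells below 64 hold scalars, the next \<open>n\<close> cells are the buffer through which points are
  exchanged with the oracles, and the remaining cells are eight interleaved infinite arrays.\<close>

definition conc :: "nat \<Rightarrow> hs \<Rightarrow> nat \<Rightarrow> nat" where
  "conc n h = (\<lambda>a. if a < 64 then sv h a else if a < 64 + n then bu h (a - 64)
     else ar h ((a - 64 - n) mod 8) ((a - 64 - n) div 8))"

text \<open>Multiplication by 8 is written as additions, the machine having no product. The offset
  contains \<open>n\<close>, which the program can only read from cell 0; that cell must therefore
  stay intact until the last assignment.\<close>

definition addr :: "nat \<Rightarrow> expr \<Rightarrow> expr" where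
  "addr k e = Plus (Plus (Num (64 + k)) (Cell (Num 0)))
     (Plus (Plus (Plus e e) (Plus e e)) (Plus (Plus e e) (Plus e e)))"

abbreviation Vr :: "nat \<Rightarrow> expr" where "Vr k \<equiv> Cell (Num k)"
definition Ar :: "nat \<Rightarrow> expr \<Rightarrow> expr" where "Ar k e = Cell (addr k e)"
definition Bu :: "expr \<Rightarrow> expr" where "Bu e = Cell (Plus (Num 64) e)"
definition SetV :: "nat \<Rightarrow> expr \<Rightarrow> com" where "SetV k e = Assign (Num k) e"
definition SetA :: "nat \<Rightarrow> expr \<Rightarrow> expr \<Rightarrow> com" where "SetA k i e = Assign (addr k i) e"
definition SetB :: "expr \<Rightarrow> expr \<Rightarrow> com" where "SetB i e = Assign (Plus (Num 64) i) e"
definition FlipV :: "nat \<Rightarrow> com" where "FlipV k = Flip (Num k)"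
definition FlipA :: "nat \<Rightarrow> expr \<Rightarrow> com" where "FlipA k i = Flip (addr k i)"
definition QueryV :: "nat \<Rightarrow> com" where "QueryV k = Query (Num k) (Num 64)"
definition SampleB :: "com" where "SampleB = Sample (Num 64)"
text \<open>Truncated subtraction serves as the comparison: the test is nonzero exactly while the
  counter is below the bound.\<close>

definition For :: "nat \<Rightarrow> expr \<Rightarrow> com \<Rightarrow> com" where
  "For x b c = Seq (SetV x (Num 0)) (While (Minus b (Vr x)) (Seq c (SetV x (Plus (Vr x) (Num 1)))))"

definition ev_h :: "nat \<Rightarrow> expr \<Rightarrow> hs \<Rightarrow> nat" where
  "ev_h n e h = eval_expr e (conc n h)"

lemma ev_h_simps [simp]:
  "ev_h n (Num k) h = k"
  "ev_h n (Plus a b) h = ev_h n a h + ev_h n b h"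
  "ev_h n (Minus a b) h = ev_h n a h - ev_h n b h"
  "ev_h n (Half a) h = ev_h n a h div 2"
  by (simp_all add: ev_h_def)

lemma ev_h_V [simp]: "k < 64 \<Longrightarrow> ev_h n (Vr k) h = sv h k"
  by (simp add: ev_h_def conc_def)

lemma addr_eval:
  assumes "sv h 0 = n"
  shows "eval_expr (addr k e) (conc n h) = 64 + n + (8 * ev_h n e h + k)"
  using assms by (simp add: addr_def ev_h_def conc_def)

lemma ev_h_Ar [simp]: "sv h 0 = n \<Longrightarrow> k < 8 \<Longrightarrow> ev_h n (Ar k e) h = ar h k (ev_h n e h)"
  using addr_eval[of h n k e] by (simp add: Ar_def ev_h_def conc_def)

lemma ev_h_Bu [simp]: "ev_h n e h < n \<Longrightarrow> ev_h n (Bu e) h = bu h (ev_h n e h)"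
  by (simp add: Bu_def ev_h_def conc_def)

lemma conc_upd_sv: "k < 64 \<Longrightarrow> (conc n h)(k := x) = conc n (h\<lparr>sv := (sv h)(k := x)\<rparr>)"
  by (auto simp: conc_def fun_eq_iff)

lemma conc_upd_bu: "i < n \<Longrightarrow> (conc n h)(64 + i := x) = conc n (h\<lparr>bu := (bu h)(i := x)\<rparr>)"
  by (auto simp: conc_def fun_eq_iff)

lemma conc_upd_ar:
  assumes "k < 8"
  shows "(conc n h)(64 + n + (8 * i + k) := x) = conc n (h\<lparr>ar := (ar h)(k := (ar h k)(i := x))\<rparr>)"
proof
  fix a
  show "((conc n h)(64 + n + (8 * i + k) := x)) a = conc n (h\<lparr>ar := (ar h)(k := (ar h k)(i := x))\<rparr>) a"
  proof (cases "a < 64 + n")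
    case True
    then show ?thesis by (auto simp: conc_def)
  next
    case False
    define b where "b = a - 64 - n"
    have a: "a = 64 + n + b" using False by (simp add: b_def)
    have "b = 8 * (b div 8) + b mod 8" by simp
    then have "b = 8 * i + k \<longleftrightarrow> b mod 8 = k \<and> b div 8 = i" using assms by auto
    then show ?thesis by (auto simp: conc_def a)
  qed
qed

text \<open>Sets encode points: an index is in the set iff the coordinate is \<open>1\<close>.\<close>

definition points_of :: "nat \<Rightarrow> nat set \<Rightarrow> nat \<Rightarrow> real" where
  "points_of n x = (\<lambda>i\<in>{..<n}. if i \<in> x then 1 else -1)"

definition set_of :: "nat \<Rightarrow> (nat \<Rightarrow> real) \<Rightarrow> nat set" where
  "set_of n x = {i. i < n \<and> x i = 1}"

primrec loopM :: "nat \<Rightarrow> nat \<Rightarrow> (nat \<Rightarrow> 'a \<Rightarrow> 'a pmf) \<Rightarrow> 'a \<Rightarrow> 'a pmf" where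
  "loopM 0 i B a = return_pmf a"
| "loopM (Suc N) i B a = bind_pmf (B i a) (loopM N (Suc i) B)"

text \<open>The recursion peels off the first round; inductions on the number of rounds already done
  need the last one.\<close>

lemma loopM_snoc: "loopM (Suc N) i B a = bind_pmf (loopM N i B a) (B (i + N))"
proof (induction N arbitrary: i a)
  case 0
  have "loopM 0 (Suc i) B = return_pmf" by (simp add: fun_eq_iff)
  then show ?case by (simp add: bind_return_pmf bind_return_pmf')
next
  case (Suc N)
  have "loopM (Suc (Suc N)) i B a = bind_pmf (B i a) (loopM (Suc N) (Suc i) B)" by simp
  also have "loopM (Suc N) (Suc i) B = (\<lambda>a. bind_pmf (loopM N (Suc i) B a) (B (Suc i + N)))"
    using Suc.IH by blast
  finally show ?case by (simp add: bind_assoc_pmf)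
qed

lemma loopM_replicate:
  "loopM N i (\<lambda>_ xs. map_pmf (\<lambda>x. xs @ [x]) p) xs = map_pmf ((@) xs) (replicate_pmf N p)"
proof (induction N arbitrary: i xs)
  case (Suc N)
  show ?case
    unfolding loopM.simps replicate_pmf.simps bind_map_pmf Suc.IH
    by (simp add: map_pmf_def bind_assoc_pmf bind_return_pmf)
qed simp

definition tick :: "state \<Rightarrow> state" where "tick s = state_after (mem s) 1 0 s"

lemma tick_simps [simp]: "mem (tick s) = mem s" "time (tick s) = time s + 1" "queries (tick s) = queries s"
  by (simp_all add: tick_def state_after_def)

section \<open>Terminating executions and their coupling with abstract distributions\<close>

locale machine =
  fixes n :: nat and \<epsilon> :: real and f :: "(nat \<Rightarrow> real) \<Rightarrow> real" and D :: "(nat \<Rightarrow> real) pmf" and W :: nat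
  assumes D_cube: "set_pmf D \<subseteq> cube n" and n_le_W: "n \<le> W"
begin

text \<open>Being inductive, the judgement holds only for computations all of whose branches halt,
  and it carries the distribution of final states without a limit over the number of steps. Its
  relation to \<open>run\<close> is established by \<open>run_outcome\<close>.\<close>

inductive ev :: "com \<Rightarrow> state \<Rightarrow> state pmf \<Rightarrow> bool" where
  ev_Skip: "ev Skip s (return_pmf s)"
| ev_step: "c \<noteq> Skip \<Longrightarrow> (\<And>c' s'. (c', s') \<in> set_pmf (step n \<epsilon> f D c s) \<Longrightarrow> ev c' s' (\<mu> (c', s')))
    \<Longrightarrow> ev c s (bind_pmf (step n \<epsilon> f D c s) \<mu>)"

lemma ev_unique: "ev c s \<mu> \<Longrightarrow> ev c s \<mu>' \<Longrightarrow> \<mu> = \<mu>'"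
proof (induction arbitrary: \<mu>' rule: ev.induct)
  case (ev_Skip s)
  then show ?case by cases auto
next
  case (ev_step c s \<mu>)
  from ev_step.prems ev_step.hyps(1) obtain \<nu> where \<nu>: "\<mu>' = bind_pmf (step n \<epsilon> f D c s) \<nu>"
    "\<And>c' s'. (c', s') \<in> set_pmf (step n \<epsilon> f D c s) \<Longrightarrow> ev c' s' (\<nu> (c', s'))"
    by cases auto
  show ?case unfolding \<nu>(1)
    by (intro bind_pmf_cong refl) (use ev_step.IH \<nu>(2) in \<open>metis surj_pair\<close>)
qed

lemma ev_one:
  assumes "c \<noteq> Skip" "step n \<epsilon> f D c s = map_pmf (Pair Skip) \<mu>"
  shows "ev c s \<mu>"
proof -
  have "ev c s (bind_pmf (step n \<epsilon> f D c s) (\<lambda>cs. return_pmf (snd cs)))"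
    using assms by (intro ev_step) (auto intro: ev_Skip)
  also have "bind_pmf (step n \<epsilon> f D c s) (\<lambda>cs. return_pmf (snd cs)) = \<mu>"
    unfolding assms(2) by (simp add: bind_map_pmf bind_return_pmf')
  finally show ?thesis .
qed

lemma ev_jump:
  assumes "c \<noteq> Skip" "step n \<epsilon> f D c s = return_pmf (c', s')" "ev c' s' \<mu>"
  shows "ev c s \<mu>"
  using ev_step[of c s "\<lambda>_. \<mu>"] assms by (auto simp: bind_return_pmf)

lemma ev_Seq:
  assumes "ev c1 s \<mu>" "\<And>s'. s' \<in> set_pmf \<mu> \<Longrightarrow> ev c2 (tick s') (\<nu> s')"
  shows "ev (Seq c1 c2) s (bind_pmf \<mu> \<nu>)"
  using assms
proof (induction rule: ev.induct)
  case (ev_Skip s)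
  then show ?case by - (rule ev_jump[of _ _ c2 "tick s"], auto simp: bind_return_pmf tick_def)
next
  case (ev_step c s \<mu>)
  \<comment> \<open>Every residual program has the form \<open>Seq c0 c2\<close>. Recovering
    \<open>c0\<close> from it allows the final distributions to be given as a function of the
    residual program, as rule \<open>ev_step\<close> requires.\<close>
  define left where "left = (\<lambda>c. case c of Seq a b \<Rightarrow> a | _ \<Rightarrow> Skip)"
  have st: "step n \<epsilon> f D (Seq c c2) s = map_pmf (\<lambda>(c, s'). (Seq c c2, s')) (step n \<epsilon> f D c s)"
    using ev_step.hyps by simp
  have "ev (Seq c c2) s (bind_pmf (step n \<epsilon> f D (Seq c c2) s) (\<lambda>(cc, s'). bind_pmf (\<mu> (left cc, s')) \<nu>))"
  proof (rule ev.ev_step)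
    fix c' s' assume "(c', s') \<in> set_pmf (step n \<epsilon> f D (Seq c c2) s)"
    then obtain c0 where c0: "c' = Seq c0 c2" "(c0, s') \<in> set_pmf (step n \<epsilon> f D c s)" unfolding st by auto
    have "ev (Seq c0 c2) s' (bind_pmf (\<mu> (c0, s')) \<nu>)"
      by (rule ev_step.IH[OF c0(2)]) (use ev_step.prems c0(2) in auto)
    then show "ev c' s' (case (c', s') of (cc, s') \<Rightarrow> bind_pmf (\<mu> (left cc, s')) \<nu>)"
      by (simp add: c0(1) left_def)
  qed simp
  also have "bind_pmf (step n \<epsilon> f D (Seq c c2) s) (\<lambda>(cc, s'). bind_pmf (\<mu> (left cc, s')) \<nu>)
    = bind_pmf (bind_pmf (step n \<epsilon> f D c s) \<mu>) \<nu>"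
    unfolding st bind_assoc_pmf by (simp add: bind_map_pmf left_def case_prod_unfold)
  finally show ?case .
qed

text \<open>A run of \<open>c\<close> is coupled with a draw from the abstract distribution \<open>M\<close>; \<open>R\<close> relates the value
  drawn to the final memory.\<close>

definition exec :: "com \<Rightarrow> hs \<Rightarrow> nat \<Rightarrow> 'a pmf \<Rightarrow> ('a \<Rightarrow> hs \<Rightarrow> bool) \<Rightarrow> bool" where
  "exec c h q M R \<longleftrightarrow> (\<forall>s. mem s = conc n h \<longrightarrow> (\<exists>\<mu>. ev c s \<mu> \<and>
     rel_pmf (\<lambda>a s'. time s' \<le> time s + tcost W c \<and> queries s' \<le> queries s + q \<and>
       (\<exists>h'. mem s' = conc n h' \<and> R a h')) M \<mu>))"

lemma exec_weaken:
  assumes "exec c h q M R" "q \<le> q'" "\<And>a h'. a \<in> set_pmf M \<Longrightarrow> R a h' \<Longrightarrow> R' a h'"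
  shows "exec c h q' M R'"
  unfolding exec_def
proof (intro allI impI)
  fix s :: state assume "mem s = conc n h"
  then obtain \<mu> where \<mu>: "ev c s \<mu>" "rel_pmf (\<lambda>a s'. time s' \<le> time s + tcost W c \<and> queries s' \<le> queries s + q \<and>
       (\<exists>h'. mem s' = conc n h' \<and> R a h')) M \<mu>" using assms(1) unfolding exec_def by blast
  show "\<exists>\<mu>. ev c s \<mu> \<and> rel_pmf (\<lambda>a s'. time s' \<le> time s + tcost W c \<and> queries s' \<le> queries s + q' \<and>
       (\<exists>h'. mem s' = conc n h' \<and> R' a h')) M \<mu>"
    by (rule exI[of _ \<mu>], intro conjI \<mu>(1), rule pmf.rel_mono_strong[OF \<mu>(2)]) (use assms(2,3) in fastforce)
qed

lemma exec_map:
  assumes "exec c h q M R" "\<And>a h'. a \<in> set_pmf M \<Longrightarrow> R a h' \<Longrightarrow> R' (g a) h'"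
  shows "exec c h q (map_pmf g M) R'"
  unfolding exec_def
proof (intro allI impI)
  fix s :: state assume "mem s = conc n h"
  then obtain \<mu> where \<mu>: "ev c s \<mu>" "rel_pmf (\<lambda>a s'. time s' \<le> time s + tcost W c \<and> queries s' \<le> queries s + q \<and>
       (\<exists>h'. mem s' = conc n h' \<and> R a h')) M \<mu>" using assms(1) unfolding exec_def by blast
  show "\<exists>\<mu>. ev c s \<mu> \<and> rel_pmf (\<lambda>a s'. time s' \<le> time s + tcost W c \<and> queries s' \<le> queries s + q \<and>
       (\<exists>h'. mem s' = conc n h' \<and> R' a h')) (map_pmf g M) \<mu>"
    by (rule exI[of _ \<mu>], intro conjI \<mu>(1), unfold pmf.rel_map, rule pmf.rel_mono_strong[OF \<mu>(2)])
      (use assms(2) in fastforce)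
qed

lemma exec_return: "exec c h q (return_pmf ()) (\<lambda>_. R a) \<Longrightarrow> exec c h q (return_pmf a) R"
  using exec_map[of c h q "return_pmf ()" "\<lambda>_. R a" R "\<lambda>_. a"] by simp

lemma exec_Skip: "R () h \<Longrightarrow> exec Skip h 0 (return_pmf ()) R"
  unfolding exec_def by (auto intro!: exI ev_Skip)

lemma exec_Seq:
  assumes "exec c1 h q1 M1 (\<lambda>a h'. exec c2 h' q2 (M2 a) R)"
  shows "exec (Seq c1 c2) h (q1 + q2) (bind_pmf M1 M2) R"
  unfolding exec_def
proof (intro allI impI)
  fix s :: state assume s: "mem s = conc n h"
  define Q1 where "Q1 = (\<lambda>a (s'::state). time s' \<le> time s + tcost W c1 \<and> queries s' \<le> queries s + q1 \<and>
       (\<exists>h'. mem s' = conc n h' \<and> exec c2 h' q2 (M2 a) R))"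
  define Q where "Q = (\<lambda>a (s'::state). time s' \<le> time s + tcost W (Seq c1 c2) \<and> queries s' \<le> queries s + (q1 + q2) \<and>
       (\<exists>h'. mem s' = conc n h' \<and> R a h'))"
  obtain \<mu> where \<mu>: "ev c1 s \<mu>" "rel_pmf Q1 M1 \<mu>"
    using assms s unfolding exec_def[of c1] Q1_def by blast
  have 2: "\<exists>\<nu>. ev c2 (tick s') \<nu> \<and> rel_pmf Q (M2 a) \<nu>" if "Q1 a s'" for a s'
  proof -
    from that obtain h' where h': "mem s' = conc n h'" "exec c2 h' q2 (M2 a) R"
      and t: "time s' \<le> time s + tcost W c1" "queries s' \<le> queries s + q1"
      unfolding Q1_def by blast
    have "mem (tick s') = conc n h'" using h' by simp
    then obtain \<nu> where \<nu>: "ev c2 (tick s') \<nu>" "rel_pmf (\<lambda>a s''. time s'' \<le> time (tick s') + tcost W c2 \<and>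
        queries s'' \<le> queries (tick s') + q2 \<and> (\<exists>h'. mem s'' = conc n h' \<and> R a h')) (M2 a) \<nu>"
      using h'(2) unfolding exec_def by blast
    have "rel_pmf Q (M2 a) \<nu>" by (rule pmf.rel_mono_strong[OF \<nu>(2)]) (use t in \<open>auto simp: Q_def\<close>)
    with \<nu>(1) show ?thesis by blast
  qed
  \<comment> \<open>The coupling supplies a final distribution for each related pair
    \<open>a\<close>, \<open>s'\<close>, whereas the composed run needs one for each
    \<open>s'\<close>. Uniqueness of the final distribution makes any choice agree with all of
    them.\<close>
  define N where "N s' = (SOME \<nu>. ev c2 (tick s') \<nu>)" for s'
  have N: "ev c2 (tick s') (N s')" "rel_pmf Q (M2 a) (N s')" if "Q1 a s'" for a s'
  proof -
    obtain \<nu> where \<nu>: "ev c2 (tick s') \<nu>" "rel_pmf Q (M2 a) \<nu>" using 2[OF \<open>Q1 a s'\<close>] by blast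
    show e: "ev c2 (tick s') (N s')" unfolding N_def by (rule someI[of "ev c2 (tick s')", OF \<nu>(1)])
    have "N s' = \<nu>" by (rule ev_unique[OF e \<nu>(1)])
    then show "rel_pmf Q (M2 a) (N s')" using \<nu>(2) by simp
  qed
  have "ev (Seq c1 c2) s (bind_pmf \<mu> N)"
  proof (rule ev_Seq[OF \<mu>(1)])
    fix s' assume "s' \<in> set_pmf \<mu>"
    then obtain a where "Q1 a s'" using rel_pmf_imp_rel_set[OF \<mu>(2)] unfolding rel_set_def by blast
    then show "ev c2 (tick s') (N s')" by (rule N)
  qed
  moreover have "rel_pmf Q (bind_pmf M1 M2) (bind_pmf \<mu> N)"
    by (rule rel_pmf_bindI[OF \<mu>(2)]) (rule N)
  ultimately show "\<exists>\<mu>. ev (Seq c1 c2) s \<mu> \<and> rel_pmf (\<lambda>a s'. time s' \<le> time s + tcost W (Seq c1 c2) \<and>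
      queries s' \<le> queries s + (q1 + q2) \<and> (\<exists>h'. mem s' = conc n h' \<and> R a h')) (bind_pmf M1 M2) \<mu>"
    unfolding Q_def by blast
qed

lemma exec_then:
  assumes "exec c1 h 0 (return_pmf ()) (\<lambda>_ h'. exec c2 h' q M R)"
  shows "exec (Seq c1 c2) h q M R"
  using exec_Seq[of c1 h 0 "return_pmf ()" c2 q "\<lambda>_. M" R] assms by (simp add: bind_return_pmf)

lemma exec_SeqI:
  assumes "exec c1 h q1 M1 (\<lambda>a h'. exec c2 h' q2 (M2 a) R)" "q = q1 + q2" "M = bind_pmf M1 M2"
  shows "exec (Seq c1 c2) h q M R"
  using exec_Seq assms by simp

lemma exec_Assign:
  assumes "(conc n h)(eval_expr a (conc n h) := ev_h n e h) = conc n h'" "R () h'"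
  shows "exec (Assign a e) h 0 (return_pmf ()) R"
  unfolding exec_def
proof (intro allI impI)
  fix s :: state assume s: "mem s = conc n h"
  show "\<exists>\<mu>. ev (Assign a e) s \<mu> \<and> rel_pmf (\<lambda>a' s'. time s' \<le> time s + tcost W (Assign a e) \<and>
      queries s' \<le> queries s + 0 \<and> (\<exists>h'. mem s' = conc n h' \<and> R a' h')) (return_pmf ()) \<mu>"
    by (rule exI[of _ "return_pmf (state_after (conc n h') 1 0 s)"], intro conjI, rule ev_one)
      (use assms in \<open>auto simp: s ev_h_def state_after_def\<close>)
qed

lemma exec_SetV: "k < 64 \<Longrightarrow> R () (h\<lparr>sv := (sv h)(k := ev_h n e h)\<rparr>) \<Longrightarrow> exec (SetV k e) h 0 (return_pmf ()) R"
  unfolding SetV_def by (rule exec_Assign) (simp_all add: conc_upd_sv)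

lemma exec_SetB: "ev_h n i h < n \<Longrightarrow> R () (h\<lparr>bu := (bu h)(ev_h n i h := ev_h n e h)\<rparr>) \<Longrightarrow>
    exec (SetB i e) h 0 (return_pmf ()) R"
  unfolding SetB_def by (rule exec_Assign) (simp_all add: conc_upd_bu ev_h_def[symmetric])

lemma exec_SetA: "sv h 0 = n \<Longrightarrow> k < 8 \<Longrightarrow>
    R () (h\<lparr>ar := (ar h)(k := (ar h k)(ev_h n i h := ev_h n e h))\<rparr>) \<Longrightarrow> exec (SetA k i e) h 0 (return_pmf ()) R"
  unfolding SetA_def by (rule exec_Assign) (simp_all only: addr_eval conc_upd_ar)

abbreviation coin :: "bool pmf" where "coin \<equiv> bernoulli_pmf (1/2)"

lemma exec_Flip:
  assumes "\<And>b. (conc n h)(eval_expr a (conc n h) := of_bool b) = conc n (h' b)" "\<And>b. R b (h' b)"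
  shows "exec (Flip a) h 0 coin R"
  unfolding exec_def
proof (intro allI impI)
  fix s :: state assume s: "mem s = conc n h"
  show "\<exists>\<mu>. ev (Flip a) s \<mu> \<and> rel_pmf (\<lambda>a' s'. time s' \<le> time s + tcost W (Flip a) \<and>
      queries s' \<le> queries s + 0 \<and> (\<exists>h'. mem s' = conc n h' \<and> R a' h')) coin \<mu>"
  proof (rule exI[of _ "map_pmf (\<lambda>b. state_after (conc n (h' b)) 1 0 s) coin"], intro conjI, rule ev_one)
    show "step n \<epsilon> f D (Flip a) s = map_pmf (Pair Skip) (map_pmf (\<lambda>b. state_after (conc n (h' b)) 1 0 s) coin)"
      using assms(1) by (simp add: s pmf.map_comp o_def)
    show "rel_pmf (\<lambda>a' s'. time s' \<le> time s + tcost W (Flip a) \<and> queries s' \<le> queries s + 0 \<and>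
      (\<exists>h'. mem s' = conc n h' \<and> R a' h')) coin (map_pmf (\<lambda>b. state_after (conc n (h' b)) 1 0 s) coin)"
      unfolding pmf.rel_map by (rule rel_pmf_reflI) (use assms(2) in \<open>auto simp: state_after_def\<close>)
  qed simp
qed

lemma exec_FlipV: "k < 64 \<Longrightarrow> (\<And>b. R b (h\<lparr>sv := (sv h)(k := of_bool b)\<rparr>)) \<Longrightarrow> exec (FlipV k) h 0 coin R"
  unfolding FlipV_def by (rule exec_Flip) (auto simp: conc_upd_sv)

lemma exec_FlipA: "sv h 0 = n \<Longrightarrow> k < 8 \<Longrightarrow>
    (\<And>b. R b (h\<lparr>ar := (ar h)(k := (ar h k)(ev_h n i h := of_bool b))\<rparr>)) \<Longrightarrow> exec (FlipA k i) h 0 coin R"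
  unfolding FlipA_def by (rule exec_Flip) (auto simp only: addr_eval conc_upd_ar)

lemma read_point_conc: "read_point n 64 (conc n h) = points_of n {i. i < n \<and> bu h i \<noteq> 0}"
  by (auto simp: read_point_def points_of_def conc_def)

lemma exec_QueryV:
  assumes "k < 64" "R () (h\<lparr>sv := (sv h)(k := encode_sign (f (points_of n {i. i < n \<and> bu h i \<noteq> 0})))\<rparr>)"
  shows "exec (QueryV k) h 1 (return_pmf ()) R"
  unfolding exec_def
proof (intro allI impI)
  fix s :: state assume s: "mem s = conc n h"
  let ?h = "h\<lparr>sv := (sv h)(k := encode_sign (f (points_of n {i. i < n \<and> bu h i \<noteq> 0})))\<rparr>"
  show "\<exists>\<mu>. ev (QueryV k) s \<mu> \<and> rel_pmf (\<lambda>a' s'. time s' \<le> time s + tcost W (QueryV k) \<and>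
      queries s' \<le> queries s + 1 \<and> (\<exists>h'. mem s' = conc n h' \<and> R a' h')) (return_pmf ()) \<mu>"
    unfolding QueryV_def
    by (rule exI[of _ "return_pmf (state_after (conc n ?h) (n + 1) 1 s)"], intro conjI, rule ev_one)
      (use assms n_le_W in \<open>auto simp: s read_point_conc conc_upd_sv state_after_def\<close>)
qed

lemma exec_EpsV:
  assumes "k < 64" "R () (h\<lparr>sv := (sv h)(k := of_bool (real (ev_h n p h) \<le> real (ev_h n q h) * \<epsilon>))\<rparr>)"
  shows "exec (EpsGe (Num k) p q) h 0 (return_pmf ()) R"
  unfolding exec_def
proof (intro allI impI)
  fix s :: state assume s: "mem s = conc n h"
  let ?h = "h\<lparr>sv := (sv h)(k := of_bool (real (ev_h n p h) \<le> real (ev_h n q h) * \<epsilon>))\<rparr>"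
  show "\<exists>\<mu>. ev (EpsGe (Num k) p q) s \<mu> \<and> rel_pmf (\<lambda>a' s'. time s' \<le> time s + tcost W (EpsGe (Num k) p q) \<and>
      queries s' \<le> queries s + 0 \<and> (\<exists>h'. mem s' = conc n h' \<and> R a' h')) (return_pmf ()) \<mu>"
    by (rule exI[of _ "return_pmf (state_after (conc n ?h) 1 0 s)"], intro conjI, rule ev_one)
      (use assms in \<open>auto simp: s ev_h_def conc_upd_sv state_after_def\<close>)
qed

lemma exec_SampleB:
  assumes "\<And>x b. x \<in> set_pmf D \<Longrightarrow> (\<And>i. i < n \<Longrightarrow> b i = of_bool (i \<in> set_of n x)) \<Longrightarrow> R (set_of n x) (h\<lparr>bu := b\<rparr>)"
  shows "exec SampleB h 1 (map_pmf (set_of n) D) R"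
  unfolding exec_def
proof (intro allI impI)
  fix s :: state assume s: "mem s = conc n h"
  define h' where "h' = (\<lambda>x. h\<lparr>bu := (\<lambda>i. encode_sign (x i))\<rparr>)"
  have w: "write_point n 64 x (conc n h) = conc n (h' x)" for x
    by (auto simp: write_point_def conc_def h'_def fun_eq_iff)
  show "\<exists>\<mu>. ev SampleB s \<mu> \<and> rel_pmf (\<lambda>a' s'. time s' \<le> time s + tcost W SampleB \<and>
      queries s' \<le> queries s + 1 \<and> (\<exists>h'. mem s' = conc n h' \<and> R a' h')) (map_pmf (set_of n) D) \<mu>"
    unfolding SampleB_def
  proof (rule exI[of _ "map_pmf (\<lambda>x. state_after (conc n (h' x)) (n + 1) 1 s) D"], intro conjI, rule ev_one)
    show "step n \<epsilon> f D (Sample (Num 64)) s = map_pmf (Pair Skip) (map_pmf (\<lambda>x. state_after (conc n (h' x)) (n + 1) 1 s) D)"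
      by (simp add: s w pmf.map_comp o_def)
    have "R (set_of n x) (h' x)" if "x \<in> set_pmf D" for x
      unfolding h'_def by (rule assms[OF that]) (auto simp: encode_sign_def set_of_def)
    then show "rel_pmf (\<lambda>a' s'. time s' \<le> time s + tcost W (Sample (Num 64)) \<and> queries s' \<le> queries s + 1 \<and>
      (\<exists>h'. mem s' = conc n h' \<and> R a' h')) (map_pmf (set_of n) D) (map_pmf (\<lambda>x. state_after (conc n (h' x)) (n + 1) 1 s) D)"
      unfolding pmf.rel_map by (intro rel_pmf_reflI) (use n_le_W in \<open>auto simp: state_after_def\<close>)
  qed simp
qed

lemma exec_jump:
  assumes "\<And>s. mem s = conc n h \<Longrightarrow> c \<noteq> Skip \<and> step n \<epsilon> f D c s = return_pmf (c', tick s)"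
    "exec c' h q M R" "tcost W c' < tcost W c"
  shows "exec c h q M R"
  unfolding exec_def
proof (intro allI impI)
  fix s :: state assume s: "mem s = conc n h"
  then have "mem (tick s) = conc n h" by simp
  then obtain \<mu> where \<mu>: "ev c' (tick s) \<mu>" "rel_pmf (\<lambda>a s'. time s' \<le> time (tick s) + tcost W c' \<and>
     queries s' \<le> queries (tick s) + q \<and> (\<exists>h'. mem s' = conc n h' \<and> R a h')) M \<mu>"
    using assms(2) unfolding exec_def by blast
  show "\<exists>\<mu>. ev c s \<mu> \<and> rel_pmf (\<lambda>a s'. time s' \<le> time s + tcost W c \<and>
     queries s' \<le> queries s + q \<and> (\<exists>h'. mem s' = conc n h' \<and> R a h')) M \<mu>"
    by (rule exI[of _ \<mu>], intro conjI, rule ev_jump[of _ _ c' "tick s"], insert \<mu>(1) assms(1)[OF s], simp, simp, simp,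
      rule pmf.rel_mono_strong[OF \<mu>(2)]) (use assms(3) in auto)
qed

lemma exec_Cond:
  assumes "ev_h n e h \<noteq> 0 \<Longrightarrow> exec c1 h q M R" "ev_h n e h = 0 \<Longrightarrow> exec c2 h q M R"
  shows "exec (Cond e c1 c2) h q M R"
  by (rule exec_jump[where c' = "if ev_h n e h \<noteq> 0 then c1 else c2"])
    (use assms in \<open>auto simp: ev_h_def tick_def\<close>)

text \<open>The number of iterations is fixed, so that the whole loop has a known distribution; it must
  not exceed \<open>W\<close>, which makes \<open>tcost\<close> a valid bound.\<close>

lemma exec_While_aux:
  assumes "\<And>i a h. i < N \<Longrightarrow> I i a h \<Longrightarrow> ev_h n e h \<noteq> 0 \<and> exec c h q (B i a) (\<lambda>a' h'. I (Suc i) a' h')"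
    "\<And>a h. I N a h \<Longrightarrow> ev_h n e h = 0" "I i a h" "i + k = N" "mem s = conc n h"
  shows "\<exists>\<mu>. ev (While e c) s \<mu> \<and> rel_pmf (\<lambda>a' s'. time s' \<le> time s + (k * (tcost W c + 2) + 1) \<and>
     queries s' \<le> queries s + k * q \<and> (\<exists>h'. mem s' = conc n h' \<and> I N a' h')) (loopM k i B a) \<mu>"
  using assms(3-5)
proof (induction k arbitrary: i a h s)
  case 0
  then have "ev (While e c) s (return_pmf (tick s))"
    using assms(2) by - (rule ev_one, auto simp: ev_h_def tick_def)
  then show ?case using 0 by (intro exI[of _ "return_pmf (tick s)"]) auto
next
  case (Suc k)
  have i: "i < N" using Suc.prems by simp
  note body = assms(1)[OF i Suc.prems(1)]
  define Q1 where "Q1 = (\<lambda>a' (s'::state). time s' \<le> time s + 1 + tcost W c \<and> queries s' \<le> queries s + q \<and>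
       (\<exists>h'. mem s' = conc n h' \<and> I (Suc i) a' h'))"
  define Q where "Q = (\<lambda>a' (s'::state). time s' \<le> time s + (Suc k * (tcost W c + 2) + 1) \<and>
     queries s' \<le> queries s + Suc k * q \<and> (\<exists>h'. mem s' = conc n h' \<and> I N a' h'))"
  have "mem (tick s) = conc n h" using Suc.prems by simp
  then obtain \<mu> where \<mu>: "ev c (tick s) \<mu>" "rel_pmf (\<lambda>a s'. time s' \<le> time (tick s) + tcost W c \<and>
     queries s' \<le> queries (tick s) + q \<and> (\<exists>h'. mem s' = conc n h' \<and> I (Suc i) a h')) (B i a) \<mu>"
    using body[THEN conjunct2] unfolding exec_def by blast
  have \<mu>2: "rel_pmf Q1 (B i a) \<mu>" by (rule pmf.rel_mono_strong[OF \<mu>(2)]) (auto simp: Q1_def)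
  have 2: "\<exists>\<nu>. ev (While e c) (tick s') \<nu> \<and> rel_pmf Q (loopM k (Suc i) B a') \<nu>" if "Q1 a' s'" for a' s'
  proof -
    from that obtain h' where h': "mem s' = conc n h'" "I (Suc i) a' h'"
      and t: "time s' \<le> time s + 1 + tcost W c" "queries s' \<le> queries s + q"
      unfolding Q1_def by blast
    have "mem (tick s') = conc n h'" "Suc i + k = N" using h' Suc.prems by simp_all
    then obtain \<nu> where \<nu>: "ev (While e c) (tick s') \<nu>" "rel_pmf (\<lambda>a' s''. time s'' \<le> time (tick s') + (k * (tcost W c + 2) + 1) \<and>
     queries s'' \<le> queries (tick s') + k * q \<and> (\<exists>h'. mem s'' = conc n h' \<and> I N a' h')) (loopM k (Suc i) B a') \<nu>"
      using Suc.IH[OF h'(2)] by blast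
    have "rel_pmf Q (loopM k (Suc i) B a') \<nu>" by (rule pmf.rel_mono_strong[OF \<nu>(2)]) (use t in \<open>auto simp: Q_def\<close>)
    with \<nu>(1) show ?thesis by blast
  qed
  define F where "F s' = (SOME \<nu>. ev (While e c) (tick s') \<nu>)" for s'
  have F: "ev (While e c) (tick s') (F s')" "rel_pmf Q (loopM k (Suc i) B a') (F s')" if "Q1 a' s'" for a' s'
  proof -
    obtain \<nu> where \<nu>: "ev (While e c) (tick s') \<nu>" "rel_pmf Q (loopM k (Suc i) B a') \<nu>" using 2[OF \<open>Q1 a' s'\<close>] by blast
    show e: "ev (While e c) (tick s') (F s')" unfolding F_def by (rule someI[of "ev (While e c) (tick s')", OF \<nu>(1)])
    have "F s' = \<nu>" by (rule ev_unique[OF e \<nu>(1)])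
    then show "rel_pmf Q (loopM k (Suc i) B a') (F s')" using \<nu>(2) by simp
  qed
  have "ev (Seq c (While e c)) (tick s) (bind_pmf \<mu> F)"
  proof (rule ev_Seq[OF \<mu>(1)])
    fix s' assume "s' \<in> set_pmf \<mu>"
    then obtain a where "Q1 a s'" using rel_pmf_imp_rel_set[OF \<mu>2] unfolding rel_set_def by blast
    then show "ev (While e c) (tick s') (F s')" by (rule F)
  qed
  then have "ev (While e c) s (bind_pmf \<mu> F)"
    using body[THEN conjunct1] Suc.prems(3) by - (rule ev_jump[of _ _ "Seq c (While e c)" "tick s"], auto simp: ev_h_def tick_def)
  moreover have "rel_pmf Q (loopM (Suc k) i B a) (bind_pmf \<mu> F)"
    unfolding loopM.simps by (rule rel_pmf_bindI[OF \<mu>2]) (rule F)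
  ultimately show ?case unfolding Q_def by blast
qed

lemma exec_While:
  assumes "I 0 a h" "N \<le> W"
    "\<And>i a h. i < N \<Longrightarrow> I i a h \<Longrightarrow> ev_h n e h \<noteq> 0"
    "\<And>i a h. i < N \<Longrightarrow> I i a h \<Longrightarrow> exec c h q (B i a) (\<lambda>a' h'. I (Suc i) a' h')"
    "\<And>a h. I N a h \<Longrightarrow> ev_h n e h = 0" "\<And>a h. I N a h \<Longrightarrow> R a h"
  shows "exec (While e c) h (N * q) (loopM N 0 B a) R"
  unfolding exec_def
proof (intro allI impI)
  fix s :: state assume s: "mem s = conc n h"
  have "\<exists>\<mu>. ev (While e c) s \<mu> \<and> rel_pmf (\<lambda>a' s'. time s' \<le> time s + (N * (tcost W c + 2) + 1) \<and>
     queries s' \<le> queries s + N * q \<and> (\<exists>h'. mem s' = conc n h' \<and> I N a' h')) (loopM N 0 B a) \<mu>"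
    using exec_While_aux[of N I e c q B 0 a h N s] assms(1,3,4,5) s by simp
  then obtain \<mu> where \<mu>: "ev (While e c) s \<mu>" "rel_pmf (\<lambda>a' s'. time s' \<le> time s + (N * (tcost W c + 2) + 1) \<and>
     queries s' \<le> queries s + N * q \<and> (\<exists>h'. mem s' = conc n h' \<and> I N a' h')) (loopM N 0 B a) \<mu>" by blast
  have "N * (tcost W c + 2) \<le> W * (tcost W c + 2)" using assms(2) by (intro mult_right_mono) auto
  then have "rel_pmf (\<lambda>a s'. time s' \<le> time s + tcost W (While e c) \<and> queries s' \<le> queries s + N * q \<and>
      (\<exists>h'. mem s' = conc n h' \<and> R a h')) (loopM N 0 B a) \<mu>"
    by (intro pmf.rel_mono_strong[OF \<mu>(2)]) (use assms(6) in fastforce)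
  with \<mu>(1) show "\<exists>\<mu>. ev (While e c) s \<mu> \<and> rel_pmf (\<lambda>a s'. time s' \<le> time s + tcost W (While e c) \<and>
      queries s' \<le> queries s + N * q \<and> (\<exists>h'. mem s' = conc n h' \<and> R a h')) (loopM N 0 B a) \<mu>" by blast
qed

text \<open>The invariant speaks of states at the loop head, where the counter equals the number of
  finished rounds; the body is specified through the state that results once the pending increment
  is applied.\<close>

lemma exec_For:
  assumes "x < 64" "N \<le> W"
    "I 0 a (h\<lparr>sv := (sv h)(x := 0)\<rparr>)"
    "\<And>i a h. i \<le> N \<Longrightarrow> I i a h \<Longrightarrow> sv h x = i \<and> ev_h n b h = N"
    "\<And>i a h. i < N \<Longrightarrow> I i a h \<Longrightarrow> exec c h q (B i a)
       (\<lambda>a' h'. sv h' x = i \<and> I (Suc i) a' (h'\<lparr>sv := (sv h')(x := Suc i)\<rparr>))"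
    "\<And>a h. I N a h \<Longrightarrow> R a h"
  shows "exec (For x b c) h (N * q) (loopM N 0 B a) R"
  unfolding For_def
proof (rule exec_then, rule exec_SetV[OF assms(1)])
  show "exec (While (Minus b (Vr x)) (Seq c (SetV x (Plus (Vr x) (Num 1))))) (h\<lparr>sv := (sv h)(x := ev_h n (Num 0) h)\<rparr>)
      (N * q) (loopM N 0 B a) R"
  proof (rule exec_While[where I = I])
    show "I 0 a (h\<lparr>sv := (sv h)(x := ev_h n (Num 0) h)\<rparr>)" using assms(3) by simp
  next
    fix i a h assume i: "i < N" "I i a h"
    show "ev_h n (Minus b (Vr x)) h \<noteq> 0" using assms(4)[of i a h] i assms(1) by simp
    show "exec (Seq c (SetV x (Plus (Vr x) (Num 1)))) h q (B i a) (I (Suc i))"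
    proof (rule exec_SeqI)
      show "exec c h q (B i a) (\<lambda>a' h'. exec (SetV x (Plus (Vr x) (Num 1))) h' 0 (return_pmf a') (I (Suc i)))"
        by (rule exec_weaken[OF assms(5)[OF i] order_refl], rule exec_return, rule exec_SetV) (auto simp: assms(1))
    qed (simp_all add: bind_return_pmf')
  next
    fix a h assume "I N a h"
    then show "ev_h n (Minus b (Vr x)) h = 0" "R a h" using assms(4)[of N a h] assms(1,6) by simp_all
  qed (rule assms(2))
qed

end

section \<open>Fourier analysis on the power set\<close>

definition sd :: "nat set \<Rightarrow> nat set \<Rightarrow> nat set" (infixl "\<triangle>" 65) where
  "x \<triangle> y = (x - y) \<union> (y - x)"

lemma sd_assoc: "(x \<triangle> y) \<triangle> z = x \<triangle> (y \<triangle> z)" by (auto simp: sd_def)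
lemma sd_commute: "x \<triangle> y = y \<triangle> x" by (auto simp: sd_def)
lemma sd_left_commute: "x \<triangle> (y \<triangle> z) = y \<triangle> (x \<triangle> z)" by (auto simp: sd_def)
lemmas sd_ac = sd_assoc sd_commute sd_left_commute
lemma sd_self [simp]: "x \<triangle> x = {}" "x \<triangle> (x \<triangle> y) = y" by (auto simp: sd_def)
lemma sd_empty [simp]: "x \<triangle> {} = x" "{} \<triangle> x = x" by (auto simp: sd_def)
lemma sd_subset [simp, intro]: "x \<subseteq> A \<Longrightarrow> y \<subseteq> A \<Longrightarrow> x \<triangle> y \<subseteq> A" by (auto simp: sd_def)
lemma sd_mem: "i \<in> x \<triangle> y \<longleftrightarrow> (i \<in> x) \<noteq> (i \<in> y)" by (auto simp: sd_def)
lemma sd_eq_empty [simp]: "x \<triangle> y = {} \<longleftrightarrow> x = y" by (auto simp: sd_def)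
lemma finite_sd [simp]: "finite x \<Longrightarrow> finite y \<Longrightarrow> finite (x \<triangle> y)" by (auto simp: sd_def)

definition chi :: "nat set \<Rightarrow> nat set \<Rightarrow> real" where
  "chi S x = (\<Prod>i\<in>S. if i \<in> x then -1 else 1)"

lemma chi_values: "chi S x = 1 \<or> chi S x = -1"
  by (cases "finite S") (induction S rule: finite_induct, auto simp: chi_def)

lemma chi_square [simp]: "chi S x * chi S x = 1" "chi S x * (chi S x * c) = c"
  using chi_values[of S x] by auto

lemma chi_nonzero [simp]: "chi S x \<noteq> 0" using chi_values[of S x] by auto

lemma chi_empty [simp]: "chi {} x = 1" "chi S {} = 1" by (simp_all add: chi_def)

lemma chi_sd: "chi S (x \<triangle> y) = chi S x * chi S y"
  unfolding chi_def by (simp add: prod.distrib[symmetric] sd_mem) (rule prod.cong, auto)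

lemma chi_card: "finite S \<Longrightarrow> chi S x = (-1) ^ card (S \<inter> x)"
  unfolding chi_def by (simp add: prod.If_cases)

lemma chi_sym: "finite S \<Longrightarrow> finite x \<Longrightarrow> chi S x = chi x S"
  by (simp add: chi_card Int_commute)

lemma chi_sd_left:
  assumes "finite S" "finite T"
  shows "chi (S \<triangle> T) x = chi S x * chi T x"
proof -
  define u where "u = S \<union> T"
  have u: "finite u" using assms by (simp add: u_def)
  have *: "chi A x = chi A (x \<inter> u)" if "A \<subseteq> u" for A
    unfolding chi_def by (rule prod.cong) (use that in auto)
  have "chi (S \<triangle> T) x = chi (x \<inter> u) (S \<triangle> T)"
    by (subst *) (use assms u in \<open>auto simp: u_def sd_def intro!: chi_sym\<close>)
  also have "\<dots> = chi (x \<inter> u) S * chi (x \<inter> u) T" by (rule chi_sd)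
  also have "chi (x \<inter> u) S = chi S x"
    by (subst *[of S]) (use assms u in \<open>auto simp: u_def intro!: chi_sym\<close>)
  also have "chi (x \<inter> u) T = chi T x"
    by (subst *[of T]) (use assms u in \<open>auto simp: u_def intro!: chi_sym\<close>)
  finally show ?thesis .
qed

lemma chi_single [simp]: "chi {i} x = (if i \<in> x then -1 else 1)" by (simp add: chi_def)

lemma chi_Int: "T \<subseteq> K \<Longrightarrow> finite S \<Longrightarrow> chi S T = chi (S \<inter> K) T"
  by (simp add: chi_card) (metis Int_absorb1 Int_assoc)

section \<open>Averages over the cube and Fourier coefficients\<close>

definition av :: "nat set \<Rightarrow> (nat set \<Rightarrow> real) \<Rightarrow> real" where
  "av V h = (\<Sum>x\<in>Pow V. h x) / 2 ^ card V"

lemma av_cong: "(\<And>x. x \<subseteq> V \<Longrightarrow> h x = h' x) \<Longrightarrow> av V h = av V h'"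
  unfolding av_def by (metis (no_types, lifting) Pow_iff sum.cong)

lemma av_const [simp]: "finite V \<Longrightarrow> av V (\<lambda>_. c) = c"
  by (simp add: av_def card_Pow)

lemma av_add: "av V (\<lambda>x. g x + h x) = av V g + av V h"
  by (simp add: av_def sum.distrib add_divide_distrib)

lemma av_diff: "av V (\<lambda>x. g x - h x) = av V g - av V h"
  by (simp add: av_def sum_subtractf diff_divide_distrib)

lemma av_cmult: "av V (\<lambda>x. c * h x) = c * av V h"
  by (simp add: av_def sum_distrib_left)

lemma av_multc: "av V (\<lambda>x. h x * c) = av V h * c"
  by (simp add: av_def sum_distrib_right)

lemma av_uminus: "av V (\<lambda>x. - h x) = - av V h"
  by (simp add: av_def sum_negf)

lemma av_mono: "(\<And>x. x \<subseteq> V \<Longrightarrow> g x \<le> h x) \<Longrightarrow> av V g \<le> av V h"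
  unfolding av_def by (intro divide_right_mono sum_mono) auto

lemma av_nonneg: "(\<And>x. x \<subseteq> V \<Longrightarrow> 0 \<le> h x) \<Longrightarrow> 0 \<le> av V h"
  unfolding av_def by (intro divide_nonneg_nonneg sum_nonneg) auto

lemma av_sum: "av V (\<lambda>x. \<Sum>j\<in>J. h j x) = (\<Sum>j\<in>J. av V (h j))"
  unfolding av_def by (subst sum.swap) (simp add: sum_divide_distrib)

lemma av_swap: "av V (\<lambda>x. av V' (\<lambda>y. h x y)) = av V' (\<lambda>y. av V (\<lambda>x. h x y))"
  unfolding av_def by (simp add: sum_divide_distrib[symmetric]) (subst sum.swap, simp add: mult.commute)

lemma av_shift:
  assumes "a \<subseteq> V"
  shows "av V (\<lambda>x. h (a \<triangle> x)) = av V h"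
proof -
  have "(\<Sum>x\<in>Pow V. h (a \<triangle> x)) = (\<Sum>x\<in>Pow V. h x)"
    by (rule sum.reindex_bij_witness[of _ "\<lambda>x. a \<triangle> x" "\<lambda>x. a \<triangle> x"]) (use assms in auto)
  then show ?thesis by (simp add: av_def)
qed

lemma av_shift2: "a \<subseteq> V \<Longrightarrow> av V (\<lambda>x. h (x \<triangle> a)) = av V h"
  using av_shift[of a V h] by (simp add: sd_commute)

lemma av_chi:
  assumes "finite V" "S \<subseteq> V"
  shows "av V (chi S) = (if S = {} then 1 else 0)"
proof (cases "S = {}")
  case True
  have "chi {} = (\<lambda>_. 1)" by (simp add: fun_eq_iff)
  then show ?thesis using assms True by simp
next
  case False
  then obtain i where i: "i \<in> S" by blast
  have fS: "finite S" using assms finite_subset by blast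
  have "chi S {i} = chi {i} S" by (rule chi_sym) (use fS in auto)
  then have "chi S {i} = -1" using i by simp
  then have "av V (\<lambda>x. chi S ({i} \<triangle> x)) = - av V (chi S)" by (simp add: chi_sd av_uminus)
  moreover have "av V (\<lambda>x. chi S ({i} \<triangle> x)) = av V (chi S)" by (rule av_shift) (use i assms in auto)
  ultimately show ?thesis using False by simp
qed

lemma av_chi_chi:
  assumes "finite V" "S \<subseteq> V" "T \<subseteq> V"
  shows "av V (\<lambda>x. chi S x * chi T x) = (if S = T then 1 else 0)"
proof -
  have "finite S" "finite T" using assms finite_subset by blast+
  then have "chi (S \<triangle> T) = (\<lambda>x. chi S x * chi T x)" by (simp add: chi_sd_left fun_eq_iff)
  then show ?thesis using av_chi[of V "S \<triangle> T"] assms by auto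
qed

definition fc :: "nat set \<Rightarrow> (nat set \<Rightarrow> real) \<Rightarrow> nat set \<Rightarrow> real" where
  "fc V f S = av V (\<lambda>x. f x * chi S x)"

lemma fc_cong: "(\<And>x. x \<subseteq> V \<Longrightarrow> f x = g x) \<Longrightarrow> fc V f S = fc V g S"
  unfolding fc_def by (rule av_cong) simp

text \<open>The characters are symmetric in set and point, so completeness is their orthogonality
  with the two roles exchanged.\<close>

lemma fc_inversion:
  assumes "finite V" "x \<subseteq> V"
  shows "f x = (\<Sum>S\<in>Pow V. fc V f S * chi S x)"
proof -
  have fx: "finite x" using assms finite_subset by blast
  have "(\<Sum>S\<in>Pow V. fc V f S * chi S x) = av V (\<lambda>y. \<Sum>S\<in>Pow V. f y * chi S y * chi S x)"
    unfolding av_sum fc_def by (simp add: av_multc)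
  also have "\<dots> = av V (\<lambda>y. f y * (if y = x then 2 ^ card V else 0))"
  proof (rule av_cong)
    fix y assume y: "y \<subseteq> V"
    have fy: "finite y" using assms y finite_subset by blast
    have "(\<Sum>S\<in>Pow V. f y * chi S y * chi S x) = f y * (\<Sum>S\<in>Pow V. chi y S * chi x S)"
      unfolding sum_distrib_left
    proof (rule sum.cong)
      fix S assume "S \<in> Pow V"
      then have "finite S" using assms finite_subset by auto
      then show "f y * chi S y * chi S x = f y * (chi y S * chi x S)"
        using chi_sym[of S y] chi_sym[of S x] fx fy by simp
    qed simp
    also have "(\<Sum>S\<in>Pow V. chi y S * chi x S) = (if y = x then 2 ^ card V else 0)"
      using av_chi_chi[OF assms(1) y assms(2)] by (auto simp: av_def split: if_splits)
    finally show "(\<Sum>S\<in>Pow V. f y * chi S y * chi S x) = f y * (if y = x then 2 ^ card V else 0)" .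
  qed
  also have "\<dots> = f x"
    using assms by (simp add: av_def if_distrib[of "\<lambda>c. _ * c"] cong: if_cong)
  finally show ?thesis by simp
qed

lemma parseval:
  assumes "finite V"
  shows "av V (\<lambda>x. f x * f x) = (\<Sum>S\<in>Pow V. (fc V f S)\<^sup>2)"
proof -
  have "av V (\<lambda>x. f x * f x) = av V (\<lambda>x. \<Sum>S\<in>Pow V. fc V f S * (f x * chi S x))"
  proof (rule av_cong)
    fix x assume "x \<subseteq> V"
    then have "f x * f x = f x * (\<Sum>S\<in>Pow V. fc V f S * chi S x)"
      using fc_inversion[OF assms, of x f] by simp
    then show "f x * f x = (\<Sum>S\<in>Pow V. fc V f S * (f x * chi S x))"
      by (simp add: sum_distrib_left algebra_simps)
  qed
  then show ?thesis by (simp add: av_sum av_cmult fc_def[symmetric] power2_eq_square)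
qed

section \<open>Degree, substitutions and subcubes\<close>

definition deg_le :: "nat set \<Rightarrow> nat \<Rightarrow> (nat set \<Rightarrow> real) \<Rightarrow> bool" where
  "deg_le V d f \<longleftrightarrow> (\<forall>S. S \<subseteq> V \<longrightarrow> d < card S \<longrightarrow> fc V f S = 0)"

lemma deg_leD: "deg_le V d f \<Longrightarrow> S \<subseteq> V \<Longrightarrow> d < card S \<Longrightarrow> fc V f S = 0"
  by (simp add: deg_le_def)

lemma deg_le_mono: "deg_le V d f \<Longrightarrow> d \<le> d' \<Longrightarrow> deg_le V d' f"
  by (auto simp: deg_le_def)

lemma deg_le_cong: "(\<And>x. x \<subseteq> V \<Longrightarrow> f x = g x) \<Longrightarrow> deg_le V d f = deg_le V d g"
  unfolding deg_le_def using fc_cong[of V f g] by simp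

lemma deg_le_rep:
  assumes "finite V" "deg_le V d f" "x \<subseteq> V"
  shows "f x = (\<Sum>S\<in>{S\<in>Pow V. card S \<le> d}. fc V f S * chi S x)"
proof -
  have "f x = (\<Sum>S\<in>Pow V. fc V f S * chi S x)" by (rule fc_inversion) fact+
  also have "\<dots> = (\<Sum>S\<in>{S\<in>Pow V. card S \<le> d}. fc V f S * chi S x)"
    by (rule sum.mono_neutral_right) (use assms in \<open>auto simp: deg_le_def not_le\<close>)
  finally show ?thesis .
qed

text \<open>The sets \<open>T j\<close> may coincide: substitutions and products send different sets
  to the same one, and their coefficients then add up.\<close>

lemma fc_chi_sum:
  assumes "finite V" "\<And>j. j \<in> J \<Longrightarrow> T j \<subseteq> V" "\<And>x. x \<subseteq> V \<Longrightarrow> f x = (\<Sum>j\<in>J. c j * chi (T j) x)" "S \<subseteq> V"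
  shows "fc V f S = (\<Sum>j\<in>J. if T j = S then c j else 0)"
proof -
  have "fc V f S = av V (\<lambda>x. \<Sum>j\<in>J. c j * (chi (T j) x * chi S x))"
    unfolding fc_def by (rule av_cong) (simp add: assms(3) sum_distrib_right mult.assoc)
  also have "\<dots> = (\<Sum>j\<in>J. c j * (if T j = S then 1 else 0))"
    unfolding av_sum av_cmult by (rule sum.cong) (use assms av_chi_chi in auto)
  also have "\<dots> = (\<Sum>j\<in>J. if T j = S then c j else 0)" by (rule sum.cong) auto
  finally show ?thesis .
qed

lemma deg_leI:
  assumes "finite V" "\<And>j. j \<in> J \<Longrightarrow> T j \<subseteq> V" "\<And>j. j \<in> J \<Longrightarrow> c j \<noteq> 0 \<Longrightarrow> card (T j) \<le> d"
    "\<And>x. x \<subseteq> V \<Longrightarrow> f x = (\<Sum>j\<in>J. c j * chi (T j) x)"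
  shows "deg_le V d f"
  unfolding deg_le_def
proof (intro allI impI)
  fix S assume S: "S \<subseteq> V" "d < card S"
  have "fc V f S = (\<Sum>j\<in>J. if T j = S then c j else 0)"
    by (rule fc_chi_sum) (use assms S in auto)
  also have "\<dots> = 0" by (rule sum.neutral) (use assms(3) S in force)
  finally show "fc V f S = 0" .
qed

text \<open>Substitution of variable \<open>\<tau> i\<close> for variable \<open>i\<close>. Points
  are carried against the direction of \<open>\<tau>\<close>.\<close>

definition pull :: "(nat \<Rightarrow> nat) \<Rightarrow> nat set \<Rightarrow> nat set \<Rightarrow> nat set" where
  "pull \<tau> V x = {i \<in> V. \<tau> i \<in> x}"

lemma pull_sd: "pull \<tau> V (x \<triangle> y) = pull \<tau> V x \<triangle> pull \<tau> V y"
  by (auto simp: pull_def sd_def)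

lemma pull_subset [simp]: "pull \<tau> V x \<subseteq> V" by (auto simp: pull_def)
lemma pull_empty [simp]: "pull \<tau> V {} = {}" by (auto simp: pull_def)

text \<open>A product of variables becomes the product of their substitutes, in which equal
  variables cancel in pairs; so the set can only shrink.\<close>

lemma chi_pull:
  assumes "finite S" "S \<subseteq> V" "\<And>i. i \<in> S \<Longrightarrow> \<tau> i \<in> V'"
  shows "\<exists>S'\<subseteq>V'. finite S' \<and> card S' \<le> card S \<and> (\<forall>x. chi S (pull \<tau> V x) = chi S' x)"
  using assms
proof (induction S rule: finite_induct)
  case empty
  then show ?case by (intro exI[of _ "{}"]) auto
next
  case (insert i S)
  then obtain S' where S': "S' \<subseteq> V'" "finite S'" "card S' \<le> card S" "\<And>x. chi S (pull \<tau> V x) = chi S' x" by auto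
  have "chi (insert i S) (pull \<tau> V x) = chi (S' \<triangle> {\<tau> i}) x" for x
  proof -
    have "chi (insert i S) (pull \<tau> V x) = chi {i} (pull \<tau> V x) * chi S (pull \<tau> V x)"
      using insert by (simp add: chi_def)
    also have "\<dots> = chi {\<tau> i} x * chi S' x" using insert S'(4) by (simp add: pull_def)
    finally show ?thesis using S'(2) by (simp add: chi_sd_left)
  qed
  moreover have "card (S' \<triangle> {\<tau> i}) \<le> card (insert i S)"
  proof -
    have "card (S' \<triangle> {\<tau> i}) \<le> card (insert (\<tau> i) S')"
      by (rule card_mono) (use S' in \<open>auto simp: sd_def\<close>)
    also have "\<dots> \<le> Suc (card S')" by (simp add: card_insert_le_m1 S' card_insert_if)
    finally show ?thesis using insert S'(3) by simp
  qed
  ultimately show ?case using S' insert.prems by (intro exI[of _ "S' \<triangle> {\<tau> i}"]) auto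
qed

lemma deg_le_pull:
  assumes "finite V" "finite V'" "deg_le V d f" "\<And>i. i \<in> V \<Longrightarrow> \<tau> i \<in> V'" "a \<subseteq> V"
  shows "deg_le V' d (\<lambda>x. f (a \<triangle> pull \<tau> V x))"
proof -
  define J where "J = {S\<in>Pow V. card S \<le> d}"
  have "\<forall>S\<in>J. \<exists>S'\<subseteq>V'. finite S' \<and> card S' \<le> card S \<and> (\<forall>x. chi S (pull \<tau> V x) = chi S' x)"
    using assms by (auto simp: J_def intro!: chi_pull intro: finite_subset)
  then obtain T where T: "\<And>S. S \<in> J \<Longrightarrow> T S \<subseteq> V' \<and> card (T S) \<le> card S \<and> (\<forall>x. chi S (pull \<tau> V x) = chi (T S) x)"
    by metis
  show ?thesis
  proof (rule deg_leI[where J = J and T = T and c = "\<lambda>S. fc V f S * chi S a"])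
    fix x
    have "f (a \<triangle> pull \<tau> V x) = (\<Sum>S\<in>J. fc V f S * chi S (a \<triangle> pull \<tau> V x))"
      unfolding J_def by (rule deg_le_rep) (use assms in auto)
    then show "f (a \<triangle> pull \<tau> V x) = (\<Sum>S\<in>J. fc V f S * chi S a * chi (T S) x)"
      using T by (simp add: chi_sd mult.assoc cong: sum.cong)
  qed (use T assms(2) in \<open>auto simp: J_def intro: le_trans\<close>)
qed

lemma card_sd_le: "finite S \<Longrightarrow> finite T \<Longrightarrow> card (S \<triangle> T) \<le> card S + card T"
  unfolding sd_def by (metis (no_types) Diff_subset Un_mono card_Un_le card_mono finite_UnI le_trans)

lemma deg_le_mult:
  assumes "finite V" "deg_le V d f" "deg_le V e g"
  shows "deg_le V (d + e) (\<lambda>x. f x * g x)"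
proof -
  define J where "J = {S\<in>Pow V. card S \<le> d}"
  define K where "K = {S\<in>Pow V. card S \<le> e}"
  have fin: "finite S" if "S \<subseteq> V" for S using assms(1) that finite_subset by blast
  show ?thesis
  proof (rule deg_leI[where J = "J \<times> K" and T = "\<lambda>(S, T). S \<triangle> T" and c = "\<lambda>(S, T). fc V f S * fc V g T"])
    fix x assume x: "x \<subseteq> V"
    have "f x * g x = (\<Sum>S\<in>J. fc V f S * chi S x) * (\<Sum>S\<in>K. fc V g S * chi S x)"
      using deg_le_rep[OF assms(1,2) x] deg_le_rep[OF assms(1,3) x] unfolding J_def K_def by simp
    also have "\<dots> = (\<Sum>(S, T)\<in>J \<times> K. fc V f S * chi S x * (fc V g T * chi T x))"
      by (simp add: sum_product sum.cartesian_product)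
    also have "\<dots> = (\<Sum>j\<in>J \<times> K. (case j of (S, T) \<Rightarrow> fc V f S * fc V g T) * chi (case j of (S, T) \<Rightarrow> S \<triangle> T) x)"
      by (rule sum.cong) (auto simp: J_def K_def chi_sd_left fin)
    finally show "f x * g x = \<dots>" .
  next
    fix j assume "j \<in> J \<times> K"
    then obtain S T where "j = (S, T)" "S \<subseteq> V" "T \<subseteq> V" "card S \<le> d" "card T \<le> e" by (auto simp: J_def K_def)
    then show "card (case j of (S, T) \<Rightarrow> S \<triangle> T) \<le> d + e"
      using card_sd_le[of S T] fin by auto
  next
    fix j assume "j \<in> J \<times> K"
    then show "(case j of (S, T) \<Rightarrow> S \<triangle> T) \<subseteq> V" by (auto simp: J_def K_def sd_def)
  qed (use assms(1) in auto)
qed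

text \<open>On the subcube at \<open>y\<close> the character of \<open>S\<close> restricts to that
  of \<open>S \<inter> K\<close>, and orthogonality over \<open>K\<close> retains the sets with
  \<open>S \<inter> K = K\<close>.\<close>

lemma subcube_sum:
  assumes "finite V" "K \<subseteq> V" "y \<subseteq> V"
  shows "(\<Sum>T\<in>Pow K. chi K T * f (y \<triangle> T)) = 2 ^ card K * (\<Sum>S\<in>{S\<in>Pow V. K \<subseteq> S}. fc V f S * chi S y)"
proof -
  have fK: "finite K" using assms finite_subset by blast
  have "(\<Sum>T\<in>Pow K. chi K T * f (y \<triangle> T)) = (\<Sum>T\<in>Pow K. \<Sum>S\<in>Pow V. fc V f S * chi S y * (chi K T * chi (S \<inter> K) T))"
  proof (rule sum.cong)
    fix T assume T: "T \<in> Pow K"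
    have "f (y \<triangle> T) = (\<Sum>S\<in>Pow V. fc V f S * chi S (y \<triangle> T))"
      by (rule fc_inversion) (use T assms in auto)
    also have "\<dots> = (\<Sum>S\<in>Pow V. fc V f S * chi S y * chi (S \<inter> K) T)"
    proof (rule sum.cong)
      fix S assume "S \<in> Pow V"
      then have "finite S" using assms finite_subset by auto
      then have "chi S T = chi (S \<inter> K) T" using T by (intro chi_Int) auto
      then show "fc V f S * chi S (y \<triangle> T) = fc V f S * chi S y * chi (S \<inter> K) T" by (simp add: chi_sd)
    qed simp
    finally show "chi K T * f (y \<triangle> T) = (\<Sum>S\<in>Pow V. fc V f S * chi S y * (chi K T * chi (S \<inter> K) T))"
      by (simp add: sum_distrib_left algebra_simps)
  qed simp
  also have "\<dots> = (\<Sum>S\<in>Pow V. fc V f S * chi S y * (\<Sum>T\<in>Pow K. chi K T * chi (S \<inter> K) T))"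
    by (subst sum.swap) (simp add: sum_distrib_left)
  also have "\<dots> = (\<Sum>S\<in>Pow V. fc V f S * chi S y * (if K \<subseteq> S then 2 ^ card K else 0))"
  proof (rule sum.cong)
    fix S
    have "(\<Sum>T\<in>Pow K. chi K T * chi (S \<inter> K) T) = 2 ^ card K * av K (\<lambda>T. chi K T * chi (S \<inter> K) T)"
      by (simp add: av_def)
    also have "\<dots> = 2 ^ card K * (if K = S \<inter> K then 1 else 0)"
      by (subst av_chi_chi) (use fK in auto)
    finally show "fc V f S * chi S y * (\<Sum>T\<in>Pow K. chi K T * chi (S \<inter> K) T)
        = fc V f S * chi S y * (if K \<subseteq> S then 2 ^ card K else 0)" by auto
  qed simp
  also have "\<dots> = (\<Sum>S\<in>{S\<in>Pow V. K \<subseteq> S}. fc V f S * chi S y * 2 ^ card K)"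
    by (rule sum.mono_neutral_cong_right) (use assms in auto)
  finally show ?thesis by (simp add: sum_distrib_left mult.commute)
qed

lemma subcube_sum_zero:
  assumes "finite V" "K \<subseteq> V" "y \<subseteq> V" "deg_le V d f" "d < card K"
  shows "(\<Sum>T\<in>Pow K. chi K T * f (y \<triangle> T)) = 0"
proof -
  have "fc V f S = 0" if "K \<subseteq> S" "S \<subseteq> V" for S
    using that assms card_mono[of S K] finite_subset[of S V] by (intro deg_leD[of V d]) auto
  then have "(\<Sum>S\<in>{S\<in>Pow V. K \<subseteq> S}. fc V f S * chi S y) = 0" by (intro sum.neutral) auto
  then show ?thesis using subcube_sum[OF assms(1-3)] by simp
qed

text \<open>The subcube sum at the empty point, solved for its smallest set. It allows properties of
  subcube sums to be passed to coefficients by induction from large sets to small ones.\<close>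

lemma fc_from_subcube:
  assumes "finite V" "K \<subseteq> V"
  shows "fc V f K = (\<Sum>T\<in>Pow K. chi K T * f T) / 2 ^ card K - (\<Sum>S\<in>{S\<in>Pow V. K \<subset> S}. fc V f S)"
proof -
  have "{S\<in>Pow V. K \<subseteq> S} = insert K {S\<in>Pow V. K \<subset> S}" using assms by auto
  then have "(\<Sum>S\<in>{S\<in>Pow V. K \<subseteq> S}. fc V f S) = fc V f K + (\<Sum>S\<in>{S\<in>Pow V. K \<subset> S}. fc V f S)"
    using assms by simp
  then show ?thesis using subcube_sum[OF assms, of "{}" f] by (simp add: field_simps)
qed

lemma superset_induct [consumes 2, case_names superset]:
  assumes "finite V" "K \<subseteq> V" "\<And>K. K \<subseteq> V \<Longrightarrow> (\<And>S. K \<subset> S \<Longrightarrow> S \<subseteq> V \<Longrightarrow> P S) \<Longrightarrow> P K"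
  shows "P K"
  using assms(2)
proof (induction "card V - card K" arbitrary: K rule: less_induct)
  case less
  show ?case
  proof (rule assms(3)[OF less.prems])
    fix S assume "K \<subset> S" "S \<subseteq> V"
    then have "card K < card S" "card S \<le> card V"
      using assms(1) by (auto intro: psubset_card_mono card_mono finite_subset)
    then show "P S" using less.hyps[of S] \<open>S \<subseteq> V\<close> by simp
  qed
qed

text \<open>Subcubes at the empty point suffice, because the coefficients of all larger sets are
  already known to vanish.\<close>

lemma deg_le_from_subcubes:
  assumes "finite V" "\<And>K. K \<subseteq> V \<Longrightarrow> d < card K \<Longrightarrow> (\<Sum>T\<in>Pow K. chi K T * f T) = 0"
  shows "deg_le V d f"
proof -
  have "d < card K \<longrightarrow> fc V f K = 0" if "K \<subseteq> V" for K
    using assms(1) that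
  proof (induction K rule: superset_induct)
    case (superset K)
    show ?case
    proof
      assume "d < card K"
      have "(\<Sum>S\<in>{S\<in>Pow V. K \<subset> S}. fc V f S) = 0"
      proof (intro sum.neutral ballI)
        fix S assume "S \<in> {S\<in>Pow V. K \<subset> S}"
        then have S: "S \<subseteq> V" "K \<subset> S" by auto
        have "card K < card S" by (rule psubset_card_mono[OF finite_subset[OF S(1) assms(1)] S(2)])
        then show "fc V f S = 0" using superset.IH[OF S(2,1)] \<open>d < card K\<close> by simp
      qed
      then show "fc V f K = 0"
        using fc_from_subcube[OF assms(1) superset.hyps, of f] assms(2)[OF superset.hyps \<open>d < card K\<close>] by simp
    qed
  qed
  then show ?thesis by (simp add: deg_le_def)
qed

section \<open>Granularity and spectrum of sign-valued functions\<close>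

definition pm :: "nat set \<Rightarrow> (nat set \<Rightarrow> real) \<Rightarrow> bool" where
  "pm V f \<longleftrightarrow> (\<forall>x\<subseteq>V. f x = 1 \<or> f x = -1)"

lemma pmD: "pm V f \<Longrightarrow> x \<subseteq> V \<Longrightarrow> f x = 1 \<or> f x = -1" by (simp add: pm_def)

lemma pm_square: "pm V f \<Longrightarrow> x \<subseteq> V \<Longrightarrow> f x * f x = 1" using pmD[of V f x] by auto

lemma even_sum_pm:
  assumes "finite A" "\<And>x. x \<in> A \<Longrightarrow> h x = 1 \<or> h x = (-1::real)"
  shows "\<exists>k::int. (\<Sum>x\<in>A. h x) = real (card A) + 2 * of_int k"
  using assms
proof (induction A rule: finite_induct)
  case empty
  show ?case by (rule exI[of _ 0]) simp
next
  case (insert x A)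
  then obtain k where k: "(\<Sum>x\<in>A. h x) = real (card A) + 2 * of_int k" by auto
  have "h x = 1 \<or> h x = -1" using insert by simp
  then show ?case
  proof
    assume "h x = 1"
    then show ?thesis using insert k by (intro exI[of _ k]) simp
  next
    assume "h x = -1"
    then show ?thesis using insert k by (intro exI[of _ "k - 1"]) simp
  qed
qed

text \<open>A sum of \<open>2 ^ card K\<close> signs is even unless \<open>K\<close> is empty, so
  its average is a multiple of \<open>2 / 2 ^ card K\<close>; supersets are settled by the
  induction. The exponent one below the degree is what makes the sums in
  \<open>deg_le_imp_rm\<close> divisible by 4 and not merely by 2.\<close>

lemma granular:
  assumes "finite V" "pm V f" "deg_le V (Suc d) f" "K \<subseteq> V"
  shows "2 ^ d * fc V f K \<in> \<int>"
  using assms(1,4)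
proof (induction K rule: superset_induct)
  case (superset K)
  have fK: "finite K" using assms(1) superset.hyps finite_subset by blast
  show ?case
  proof (cases "card K \<le> Suc d")
    case False
    then show ?thesis using assms(3) superset.hyps by (simp add: deg_le_def)
  next
    case True
    obtain k :: int where k: "(\<Sum>T\<in>Pow K. chi K T * f T) = real (2 ^ card K) + 2 * of_int k"
    proof -
      have "\<exists>k::int. (\<Sum>T\<in>Pow K. chi K T * f T) = real (card (Pow K)) + 2 * of_int k"
      proof (rule even_sum_pm)
        fix T assume "T \<in> Pow K"
        then have "f T = 1 \<or> f T = -1" using pmD[OF assms(2), of T] superset.hyps by blast
        then show "chi K T * f T = 1 \<or> chi K T * f T = -1" using chi_values[of K T] by auto
      qed (use fK in simp)
      then show ?thesis using that fK by (auto simp: card_Pow)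
    qed
    have "2 ^ d * ((\<Sum>T\<in>Pow K. chi K T * f T) / 2 ^ card K) \<in> \<int>"
    proof (cases "card K = 0")
      case True
      \<comment> \<open>The sum is a single sign here, hence odd, but nothing is divided.\<close>
      then have "K = {}" using fK by simp
      moreover have "f {} = 1 \<or> f {} = -1" using pmD[OF assms(2)] by simp
      ultimately show ?thesis by auto
    next
      case False
      have e: "Suc (d - (card K - 1)) + (card K - 1) = Suc d" using True False by simp
      have "(2::real) ^ d * 2 = 2 ^ (d - (card K - 1)) * 2 ^ card K"
        using True False by (metis e Suc_pred' add_Suc add_Suc_right neq0_conv power_Suc2 power_add)
      then have "2 ^ d * ((\<Sum>T\<in>Pow K. chi K T * f T) / 2 ^ card K) = 2 ^ d + 2 ^ (d - (card K - 1)) * of_int k"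
        unfolding k by (simp add: field_simps)
      then show ?thesis by simp
    qed
    moreover have "2 ^ d * (\<Sum>S\<in>{S\<in>Pow V. K \<subset> S}. fc V f S) \<in> \<int>"
      unfolding sum_distrib_left by (intro Ints_sum superset.IH) auto
    ultimately show ?thesis
      unfolding fc_from_subcube[OF assms(1) superset.hyps, of f] right_diff_distrib by (rule Ints_diff)
  qed
qed

lemma granular_weak:
  assumes "finite V" "pm V f" "deg_le V d f" "K \<subseteq> V"
  shows "2 ^ d * fc V f K \<in> \<int>"
proof (cases d)
  case 0
  have "deg_le V (Suc 0) f" using deg_le_mono[OF assms(3)] 0 by simp
  from granular[OF assms(1,2) this assms(4)] show ?thesis using 0 by simp
next
  case (Suc e)
  have "2 * (2 ^ e * fc V f K) \<in> \<int>"
    by (rule Ints_mult) (use granular[of V f e K] assms Suc in auto)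
  then show ?thesis using Suc by (simp add: mult.assoc)
qed

text \<open>By granularity a nonzero coefficient has square at least \<open>1 / 4 ^ d\<close>, and
  by Parseval the squares sum to 1.\<close>

lemma spectrum_card:
  assumes "finite V" "pm V f" "deg_le V d f"
  shows "card {S \<in> Pow V. fc V f S \<noteq> 0} \<le> 4 ^ d"
proof -
  define Z where "Z = {S \<in> Pow V. fc V f S \<noteq> 0}"
  have fin: "finite Z" using assms(1) by (simp add: Z_def)
  have "1 / 4 ^ d \<le> (fc V f S)\<^sup>2" if "S \<in> Z" for S
  proof -
    have "2 ^ d * fc V f S \<in> \<int>"
      using granular_weak[OF assms, of S] that by (simp add: Z_def)
    then obtain k :: int where k: "2 ^ d * fc V f S = of_int k" by (elim Ints_cases)
    have "k \<noteq> 0" using k that by (auto simp: Z_def)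
    then have "1 \<le> k\<^sup>2" by (metis int_one_le_iff_zero_less zero_less_power2)
    then have "1 \<le> (of_int k :: real)\<^sup>2" by (metis of_int_1_le_iff of_int_power)
    then have "1 \<le> (2 ^ d * fc V f S)\<^sup>2" by (simp only: k)
    moreover have "(2 ^ d * fc V f S)\<^sup>2 = 4 ^ d * (fc V f S)\<^sup>2"
      by (simp add: power_mult_distrib power2_eq_square) (simp flip: power_mult_distrib)
    ultimately have "1 \<le> 4 ^ d * (fc V f S)\<^sup>2" by (simp only:)
    then show ?thesis by (simp add: field_simps)
  qed
  then have "real (card Z) * (1 / 4 ^ d) \<le> (\<Sum>S\<in>Z. (fc V f S)\<^sup>2)"
    using sum_bounded_below[of Z "1 / 4 ^ d" "\<lambda>S. (fc V f S)\<^sup>2"] by simp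
  also have "\<dots> \<le> (\<Sum>S\<in>Pow V. (fc V f S)\<^sup>2)"
    by (rule sum_mono2) (use assms(1) in \<open>auto simp: Z_def\<close>)
  also have "\<dots> = av V (\<lambda>x. f x * f x)" by (rule parseval[symmetric]) fact
  also have "\<dots> = av V (\<lambda>_. 1)" by (rule av_cong) (rule pm_square[OF assms(2)])
  also have "\<dots> = 1" using assms(1) by simp
  finally have "real (card Z) \<le> 4 ^ d" by (simp add: field_simps)
  then have "real (card Z) \<le> real (4 ^ d)" by simp
  then show ?thesis unfolding Z_def of_nat_le_iff .
qed

text \<open>Every coset of the subcube spanned by a maximal set of the spectrum contains a point
  where the polynomial does not vanish.\<close>

lemma nonzero_density:
  assumes "finite V" "deg_le V e f" "x0 \<subseteq> V" "f x0 \<noteq> 0"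
  shows "av V (\<lambda>x. of_bool (f x \<noteq> 0)) \<ge> 1 / 2 ^ e"
proof -
  define Z where "Z = {S \<in> Pow V. fc V f S \<noteq> 0}"
  have "finite Z" using assms(1) by (simp add: Z_def)
  moreover have "Z \<noteq> {}"
  proof
    assume "Z = {}"
    then have "f x0 = 0" unfolding fc_inversion[OF assms(1,3), of f]
      by (intro sum.neutral) (auto simp: Z_def)
    then show False using assms by simp
  qed
  ultimately obtain S where S: "S \<in> Z" "\<And>T. T \<in> Z \<Longrightarrow> S \<subseteq> T \<Longrightarrow> S = T"
    using finite_has_maximal[of Z] by blast
  have SV: "S \<subseteq> V" and nz: "fc V f S \<noteq> 0"
    using S(1) by (auto simp: Z_def)
  have cS: "card S \<le> e" using deg_leD[OF assms(2) SV] nz by (meson not_le)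
  have fS: "finite S" using SV assms(1) finite_subset by blast
  have hit: "1 \<le> (\<Sum>T\<in>Pow S. of_bool (f (x \<triangle> T) \<noteq> 0) :: real)" if x: "x \<subseteq> V" for x
  proof -
    \<comment> \<open>By maximality \<open>S\<close> is the only set of the spectrum that contains
      \<open>S\<close>, so the subcube sum is one nonzero coefficient up to a sign and a power of
      two.\<close>
    have "(\<Sum>T\<in>{T \<in> Pow V. S \<subseteq> T}. fc V f T * chi T x) = (\<Sum>T\<in>{S}. fc V f T * chi T x)"
      by (rule sum.mono_neutral_right) (use assms(1) S SV in \<open>auto simp: Z_def\<close>)
    then have "(\<Sum>T\<in>Pow S. chi S T * f (x \<triangle> T)) \<noteq> 0"
      using subcube_sum[OF assms(1) SV x, of f] nz by simp
    then obtain T where "T \<in> Pow S" "chi S T * f (x \<triangle> T) \<noteq> 0"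
      by (rule sum.not_neutral_contains_not_neutral)
    then have T: "T \<in> Pow S" "f (x \<triangle> T) \<noteq> 0" by auto
    have "(1::real) = of_bool (f (x \<triangle> T) \<noteq> 0)" using T by simp
    also have "\<dots> \<le> (\<Sum>T\<in>Pow S. of_bool (f (x \<triangle> T) \<noteq> 0))"
      by (rule member_le_sum) (use T fS in auto)
    finally show ?thesis .
  qed
  have "1 = av V (\<lambda>_. 1)" using assms(1) by simp
  also have "\<dots> \<le> av V (\<lambda>x. \<Sum>T\<in>Pow S. of_bool (f (x \<triangle> T) \<noteq> 0))" by (rule av_mono) (rule hit)
  also have "\<dots> = (\<Sum>T\<in>Pow S. av V (\<lambda>x. of_bool (f x \<noteq> 0)))"
    unfolding av_sum by (rule sum.cong) (use SV in \<open>auto intro!: av_shift2[of _ V "\<lambda>x. of_bool (f x \<noteq> 0)"]\<close>)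
  also have "\<dots> = 2 ^ card S * av V (\<lambda>x. of_bool (f x \<noteq> 0))" using fS by (simp add: card_Pow)
  also have "\<dots> \<le> 2 ^ e * av V (\<lambda>x. of_bool (f x \<noteq> 0))"
    using cS by (intro mult_right_mono power_increasing av_nonneg) auto
  finally show ?thesis by (simp add: field_simps)
qed

section \<open>The Reed-Muller test and self-correction\<close>

text \<open>An abstract expectation: uniform averages, iterated averages over lists and iterated
  averages over lists of lists are all instances, so union bounds are derived only once.\<close>

definition mean :: "'a set \<Rightarrow> (('a \<Rightarrow> real) \<Rightarrow> real) \<Rightarrow> bool" where
  "mean S A \<longleftrightarrow> (\<forall>c. A (\<lambda>_. c) = c) \<and> (\<forall>g h. A (\<lambda>x. g x + h x) = A g + A h) \<and>
     (\<forall>c h. A (\<lambda>x. c * h x) = c * A h) \<and> (\<forall>g h. (\<forall>x\<in>S. g x \<le> h x) \<longrightarrow> A g \<le> A h)"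

lemma mean_const: "mean S A \<Longrightarrow> A (\<lambda>_. c) = c" by (simp add: mean_def)
lemma mean_add: "mean S A \<Longrightarrow> A (\<lambda>x. g x + h x) = A g + A h" by (simp add: mean_def)
lemma mean_cmult: "mean S A \<Longrightarrow> A (\<lambda>x. c * h x) = c * A h" by (simp add: mean_def)
lemma mean_mono: "mean S A \<Longrightarrow> (\<And>x. x \<in> S \<Longrightarrow> g x \<le> h x) \<Longrightarrow> A g \<le> A h" by (simp add: mean_def)

lemma mean_cong:
  assumes "mean S A" "\<And>x. x \<in> S \<Longrightarrow> g x = h x"
  shows "A g = A h"
  by (rule antisym; rule mean_mono[OF assms(1)]) (simp_all add: assms(2))

lemma mean_nonneg: "mean S A \<Longrightarrow> (\<And>x. x \<in> S \<Longrightarrow> 0 \<le> h x) \<Longrightarrow> 0 \<le> A h"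
  using mean_mono[of S A "\<lambda>_. 0" h] mean_const[of S A 0] by simp

lemma mean_le_const: "mean S A \<Longrightarrow> (\<And>x. x \<in> S \<Longrightarrow> h x \<le> c) \<Longrightarrow> A h \<le> c"
  using mean_mono[of S A h "\<lambda>_. c"] mean_const[of S A c] by simp

lemma mean_ge_const: "mean S A \<Longrightarrow> (\<And>x. x \<in> S \<Longrightarrow> c \<le> h x) \<Longrightarrow> c \<le> A h"
  using mean_mono[of S A "\<lambda>_. c" h] mean_const[of S A c] by simp

lemma mean_or:
  assumes "mean S A" "\<And>x. x \<in> S \<Longrightarrow> P x \<Longrightarrow> Q x \<or> R x"
  shows "A (\<lambda>x. of_bool (P x)) \<le> A (\<lambda>x. of_bool (Q x)) + A (\<lambda>x. of_bool (R x))"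
proof -
  have "A (\<lambda>x. of_bool (P x)) \<le> A (\<lambda>x. of_bool (Q x) + of_bool (R x))"
    by (rule mean_mono[OF assms(1)]) (use assms(2) in auto)
  then show ?thesis by (simp add: mean_add[OF assms(1)])
qed

lemma mean_sum:
  assumes "mean S A" "finite J"
  shows "A (\<lambda>x. \<Sum>j\<in>J. h j x) = (\<Sum>j\<in>J. A (h j))"
  using assms(2) by (induction J rule: finite_induct) (simp_all add: mean_const[OF assms(1)] mean_add[OF assms(1)])

lemma mean_not:
  assumes "mean S A"
  shows "A (\<lambda>x. of_bool (\<not> P x)) = 1 - A (\<lambda>x. of_bool (P x))"
proof -
  have "A (\<lambda>x. of_bool (\<not> P x)) + A (\<lambda>x. of_bool (P x)) = A (\<lambda>_. 1)"
    unfolding mean_add[OF assms, symmetric] by (rule mean_cong[OF assms]) simp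
  then show ?thesis by (simp add: mean_const[OF assms])
qed

lemma mean_exists:
  assumes "mean S A" "A (\<lambda>x. of_bool (P x)) < 1"
  shows "\<exists>x\<in>S. \<not> P x"
proof (rule ccontr)
  assume "\<not> (\<exists>x\<in>S. \<not> P x)"
  then have "1 \<le> A (\<lambda>x. of_bool (P x))" by (intro mean_ge_const[OF assms(1)]) auto
  then show False using assms(2) by simp
qed

lemma mean_av: "finite V \<Longrightarrow> mean (Pow V) (av V)"
  unfolding mean_def by (auto simp: av_add av_cmult intro: av_mono)

primrec itav :: "(('a \<Rightarrow> real) \<Rightarrow> real) \<Rightarrow> nat \<Rightarrow> ('a list \<Rightarrow> real) \<Rightarrow> real" where
  "itav A 0 h = h []"
| "itav A (Suc k) h = A (\<lambda>x. itav A k (\<lambda>xs. h (x # xs)))"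

definition lists_of :: "'a set \<Rightarrow> nat \<Rightarrow> 'a list set" where
  "lists_of S k = {xs. set xs \<subseteq> S \<and> length xs = k}"

lemma lists_of_0 [simp]: "lists_of S 0 = {[]}" by (auto simp: lists_of_def)
lemma lists_of_Cons [simp]: "x # xs \<in> lists_of S (Suc k) \<longleftrightarrow> x \<in> S \<and> xs \<in> lists_of S k"
  by (auto simp: lists_of_def)

lemma lists_of_SucE:
  assumes "ys \<in> lists_of S (Suc k)"
  obtains x xs where "ys = x # xs" "x \<in> S" "xs \<in> lists_of S k"
  using assms by (cases ys) (auto simp: lists_of_def)

lemma mean_itav:
  assumes "mean S A"
  shows "mean (lists_of S k) (itav A k)"
proof (induction k)
  case 0
  show ?case by (simp add: mean_def)
next
  case (Suc k)
  show ?case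
    unfolding mean_def
  proof (intro conjI allI impI)
    fix g h :: "'a list \<Rightarrow> real" assume "\<forall>x\<in>lists_of S (Suc k). g x \<le> h x"
    then show "itav A (Suc k) g \<le> itav A (Suc k) h"
      unfolding itav.simps by (intro mean_mono[OF assms] mean_mono[OF Suc]) auto
  qed (simp_all add: mean_const[OF Suc] mean_const[OF assms] mean_add[OF Suc] mean_add[OF assms]
      mean_cmult[OF Suc] mean_cmult[OF assms])
qed

abbreviation avl :: "nat set \<Rightarrow> nat \<Rightarrow> (nat set list \<Rightarrow> real) \<Rightarrow> real" where
  "avl V \<equiv> itav (av V)"

lemma av_avl_swap: "av V (\<lambda>v. avl V' k (\<lambda>us. h v us)) = avl V' k (\<lambda>us. av V (\<lambda>v. h v us))"
proof (induction k arbitrary: h)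
  case (Suc k)
  show ?case by (simp add: Suc.IH[symmetric]) (rule av_swap)
qed simp

text \<open>The combination over two elements whose coefficients are the binary digits of
  \<open>t\<close>, lowest first. The numbering lets one counter run through a whole cube, with
  \<open>t = 0\<close> at the base point.\<close>

primrec lin :: "nat \<Rightarrow> nat set list \<Rightarrow> nat set" where
  "lin t [] = {}"
| "lin t (u # us) = (if odd t then u else {}) \<triangle> lin (t div 2) us"

lemma lin_0 [simp]: "lin 0 us = {}" by (induction us) auto

lemma lin_subset: "set us \<subseteq> Pow V \<Longrightarrow> lin t us \<subseteq> V"
  by (induction us arbitrary: t) auto

lemma lin_sd: "length us = length vs \<Longrightarrow> lin t (map2 (\<triangle>) us vs) = lin t us \<triangle> lin t vs"
  by (induction us vs arbitrary: t rule: list_induct2) (auto simp: sd_ac)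

text \<open>The iterated multiplicative derivative of \<open>f\<close> in the directions of the
  list, evaluated at \<open>x\<close>.\<close>

primrec cubeP :: "(nat set \<Rightarrow> real) \<Rightarrow> nat set \<Rightarrow> nat set list \<Rightarrow> real" where
  "cubeP f x [] = f x"
| "cubeP f x (u # us) = cubeP f x us * cubeP f (x \<triangle> u) us"

lemma prod_double:
  fixes g :: "nat \<Rightarrow> 'a::comm_monoid_mult"
  shows "(\<Prod>t<2 * m. g t) = (\<Prod>t<m. g (2 * t) * g (2 * t + 1))"
  by (induction m) (simp_all add: mult.assoc)

lemma sum_double:
  fixes g :: "nat \<Rightarrow> 'a::comm_monoid_add"
  shows "(\<Sum>t<2 * m. g t) = (\<Sum>t<m. g (2 * t) + g (2 * t + 1))"
  by (induction m) (simp_all add: add.assoc)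

lemma cubeP_lin: "cubeP f x us = (\<Prod>t<2 ^ length us. f (x \<triangle> lin t us))"
proof (induction us arbitrary: x)
  case (Cons u us)
  have "(\<Prod>t<2 ^ length (u # us). f (x \<triangle> lin t (u # us)))
      = (\<Prod>t<2 ^ length us. f (x \<triangle> lin t us) * f ((x \<triangle> u) \<triangle> lin t us))"
    unfolding length_Cons power_Suc prod_double by (simp add: sd_assoc)
  then show ?case by (simp add: Cons.IH prod.distrib)
qed simp

lemma cubeP_pm: "pm V f \<Longrightarrow> x \<subseteq> V \<Longrightarrow> set us \<subseteq> Pow V \<Longrightarrow> cubeP f x us = 1 \<or> cubeP f x us = -1"
proof (induction us arbitrary: x)
  case Nil
  then show ?case by (simp add: pmD)
next
  case (Cons u us)
  have "cubeP f x us = 1 \<or> cubeP f x us = -1" "cubeP f (x \<triangle> u) us = 1 \<or> cubeP f (x \<triangle> u) us = -1"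
    using Cons by auto
  then show ?case by auto
qed

lemma cubeP_mult: "cubeP (\<lambda>x. f x * g x) x us = cubeP f x us * cubeP g x us"
  by (induction us arbitrary: x) (simp_all add: algebra_simps)

lemma cubeP_shift_function: "cubeP (\<lambda>y. f y * f (y \<triangle> v)) x us = cubeP f x us * cubeP f (x \<triangle> v) us"
  by (induction us arbitrary: x) (simp_all add: sd_assoc sd_commute[of v])

lemma cubeP_pull: "cubeP (\<lambda>y. f (a \<triangle> pull \<tau> V y)) x us = cubeP f (a \<triangle> pull \<tau> V x) (map (pull \<tau> V) us)"
  by (induction us arbitrary: x) (simp_all add: pull_sd sd_assoc)

text \<open>For \<open>f = (-1) ^ P\<close> this says that all derivatives of order
  \<open>d + 1\<close> of \<open>P\<close> vanish, hence that \<open>P\<close> has degree at most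
  \<open>d\<close> over the field of two elements.\<close>

definition rm :: "nat set \<Rightarrow> nat \<Rightarrow> (nat set \<Rightarrow> real) \<Rightarrow> bool" where
  "rm V d f \<longleftrightarrow> (\<forall>x us. x \<subseteq> V \<longrightarrow> set us \<subseteq> Pow V \<longrightarrow> length us = Suc d \<longrightarrow> cubeP f x us = 1)"

lemma rmD: "rm V d f \<Longrightarrow> x \<subseteq> V \<Longrightarrow> set us \<subseteq> Pow V \<Longrightarrow> Suc d \<le> length us \<Longrightarrow> cubeP f x us = 1"
proof (induction us arbitrary: x)
  case (Cons u us)
  show ?case
  proof (cases "Suc d = length (u # us)")
    case True
    then show ?thesis using Cons.prems(1)[unfolded rm_def, rule_format, OF Cons.prems(2,3)] by simp
  next
    case False
    then show ?thesis using Cons by simp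
  qed
qed simp

lemma rm_mult: "rm V d f \<Longrightarrow> rm V d g \<Longrightarrow> rm V d (\<lambda>x. f x * g x)"
  by (simp add: rm_def cubeP_mult)

lemma rm_pull:
  assumes "rm V d f" "a \<subseteq> V"
  shows "rm V' d (\<lambda>y. f (a \<triangle> pull \<tau> V y))"
  unfolding rm_def cubeP_pull
proof (intro allI impI)
  fix x us assume "x \<subseteq> V'" "set us \<subseteq> Pow V'" "length us = Suc d"
  then show "cubeP f (a \<triangle> pull \<tau> V x) (map (pull \<tau> V) us) = 1"
    by (intro rmD[OF assms(1)] sd_subset assms(2) pull_subset) (auto simp: pull_def)
qed

primrec cubeS :: "(nat set \<Rightarrow> real) \<Rightarrow> nat set \<Rightarrow> nat set list \<Rightarrow> real" where
  "cubeS f x [] = f x"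
| "cubeS f x (u # us) = cubeS f x us + cubeS f (x \<triangle> u) us"

lemma cubeS_sum: "cubeS (\<lambda>x. \<Sum>j\<in>J. c j * h j x) x us = (\<Sum>j\<in>J. c j * cubeS (h j) x us)"
  by (induction us arbitrary: x) (simp_all add: sum.distrib distrib_left)

lemma cubeS_cong: "(\<And>x. x \<subseteq> V \<Longrightarrow> f x = g x) \<Longrightarrow> x \<subseteq> V \<Longrightarrow> set us \<subseteq> Pow V \<Longrightarrow> cubeS f x us = cubeS g x us"
  by (induction us arbitrary: x) auto

lemma cubeS_chi: "cubeS (chi S) x us = chi S x * (if \<forall>u\<in>set us. chi S u = 1 then 2 ^ length us else 0)"
proof (induction us arbitrary: x)
  case (Cons u us)
  have "chi S u = 1 \<or> chi S u = -1" by (rule chi_values)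
  then show ?case by (auto simp: Cons.IH chi_sd)
qed simp

text \<open>\<open>N\<close> is the number of vertices with value -1, counted with multiplicity; the
  product is thus determined by the sum modulo 4.\<close>

lemma cubeS_cubeP:
  assumes "pm V f" "x \<subseteq> V" "set us \<subseteq> Pow V"
  shows "\<exists>N::int. cubeS f x us = 2 ^ length us - 2 * of_int N \<and> cubeP f x us = (if even N then 1 else -1)"
  using assms(2,3)
proof (induction us arbitrary: x)
  case Nil
  then have "f x = 1 \<or> f x = -1" using pmD[OF assms(1)] by auto
  then show ?case
  proof
    assume "f x = 1" then show ?thesis by (intro exI[of _ 0]) simp
  next
    assume "f x = -1" then show ?thesis by (intro exI[of _ 1]) simp
  qed
next
  case (Cons u us)
  have "set us \<subseteq> Pow V" "x \<triangle> u \<subseteq> V" using Cons.prems by auto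
  note IH = Cons.IH[OF Cons.prems(1) this(1)] Cons.IH[OF this(2,1)]
  from IH(1) obtain N where "cubeS f x us = 2 ^ length us - 2 * of_int N" "cubeP f x us = (if even N then 1 else -1)"
    by blast
  moreover from IH(2) obtain M where "cubeS f (x \<triangle> u) us = 2 ^ length us - 2 * of_int M"
      "cubeP f (x \<triangle> u) us = (if even M then 1 else -1)"
    by blast
  ultimately show ?case by (intro exI[of _ "N + M"]) auto
qed

text \<open>Over \<open>d + 1\<close> directions a character sums to 0 or, up to sign, to
  \<open>2 ^ (d + 1)\<close>, while coefficients are multiples of \<open>2 / 2 ^ d\<close>. So the
  sum is divisible by 4; since \<open>2 ^ (d + 1)\<close> is too when \<open>d\<close> is positive,
  the number of values -1 is even. Functions of degree 0 are constant.\<close>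

lemma deg_le_imp_rm:
  assumes "finite V" "pm V f" "deg_le V d f"
  shows "rm V d f"
  unfolding rm_def
proof (intro allI impI)
  fix x us assume x: "x \<subseteq> V" and us: "set us \<subseteq> Pow V" and l: "length us = Suc d"
  show "cubeP f x us = 1"
  proof (cases d)
    case 0
    then obtain u where u: "us = [u]" using l by (cases us) auto
    have "{S \<in> Pow V. card S \<le> 0} = {{}}"
      using assms(1) by (auto dest: finite_subset)
    then have c: "f y = fc V f {}" if "y \<subseteq> V" for y
      using deg_le_rep[OF assms(1,3) that] 0 by simp
    have "f (x \<triangle> u) = f x" using c[of "x \<triangle> u"] c[of x] x us u by auto
    then show ?thesis using pm_square[OF assms(2) x] u by simp
  next
    case (Suc e)
    have "cubeS f x us = cubeS (\<lambda>x. \<Sum>S\<in>Pow V. fc V f S * chi S x) x us"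
      by (rule cubeS_cong[OF fc_inversion x us]) (use assms in auto)
    also have "\<dots> = (\<Sum>S\<in>Pow V. 4 * (2 ^ e * fc V f S * (chi S x * (if \<forall>u\<in>set us. chi S u = 1 then 1 else 0))))"
      unfolding cubeS_sum cubeS_chi using l Suc by (intro sum.cong) auto
    also have "\<dots> = 4 * (\<Sum>S\<in>Pow V. 2 ^ e * fc V f S * (chi S x * (if \<forall>u\<in>set us. chi S u = 1 then 1 else 0)))"
      by (simp only: sum_distrib_left)
    finally have S: "cubeS f x us = 4 * (\<Sum>S\<in>Pow V. 2 ^ e * fc V f S * (chi S x * (if \<forall>u\<in>set us. chi S u = 1 then 1 else 0)))" .
    have "chi S x \<in> \<int>" for S using chi_values[of S x] by auto
    then have "(\<Sum>S\<in>Pow V. 2 ^ e * fc V f S * (chi S x * (if \<forall>u\<in>set us. chi S u = 1 then 1 else 0))) \<in> \<int>"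
      using granular[OF assms(1,2), of e] assms(3) Suc
      by (intro Ints_sum) (rule Ints_mult, blast, rule Ints_mult, auto)
    then obtain z :: int where z: "cubeS f x us = 4 * of_int z" using S by (elim Ints_cases) simp
    obtain N :: int where N: "cubeS f x us = 2 ^ length us - 2 * of_int N" "cubeP f x us = (if even N then 1 else -1)"
      using cubeS_cubeP[OF assms(2) x us] by blast
    have "of_int (2 * N) = (of_int (2 ^ Suc d - 4 * z) :: real)" using z N(1) l by simp
    then have "2 * N = 2 ^ Suc d - 4 * z" by (simp only: of_int_eq_iff)
    then have "N = 2 * (2 ^ e - z)" using Suc by simp
    then show ?thesis using N(2) by simp
  qed
qed

section \<open>Distance of functions and error of the Reed-Muller test\<close>

definition disagree :: "nat set \<Rightarrow> (nat set \<Rightarrow> real) \<Rightarrow> (nat set \<Rightarrow> real) \<Rightarrow> real" where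
  "disagree V f g = av V (\<lambda>x. of_bool (f x \<noteq> g x))"

lemma disagree_nonneg: "0 \<le> disagree V f g" unfolding disagree_def by (rule av_nonneg) simp

lemma disagree_triangle: "finite V \<Longrightarrow> disagree V f h \<le> disagree V f g + disagree V g h"
  unfolding disagree_def by (rule mean_or[OF mean_av]) auto

lemma disagree_commute: "disagree V f g = disagree V g f"
  unfolding disagree_def by (simp add: eq_commute)

text \<open>With a random base point every vertex of the cube is uniform; a union bound over the
  \<open>2 ^ k\<close> vertices applies.\<close>

lemma cube_error:
  assumes V: "finite V" and "\<And>x. x \<subseteq> V \<Longrightarrow> h x = 1 \<or> h x = -1"
  shows "av V (\<lambda>y. avl V k (\<lambda>us. of_bool (cubeP h y us \<noteq> 1))) \<le> 2 ^ k * disagree V h (\<lambda>_. 1)"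
proof (induction k)
  case 0
  show ?case by (simp add: disagree_def)
next
  case (Suc k)
  note m = mean_av[OF V] and ml = mean_itav[OF mean_av[OF V], of k]
  have "av V (\<lambda>y. avl V (Suc k) (\<lambda>us. of_bool (cubeP h y us \<noteq> 1)))
    \<le> av V (\<lambda>y. av V (\<lambda>u. avl V k (\<lambda>us. of_bool (cubeP h y us \<noteq> 1)) + avl V k (\<lambda>us. of_bool (cubeP h (y \<triangle> u) us \<noteq> 1))))"
    unfolding itav.simps by (intro mean_mono[OF m] mean_or[OF ml]) auto
  also have "\<dots> = av V (\<lambda>y. avl V k (\<lambda>us. of_bool (cubeP h y us \<noteq> 1)))
       + av V (\<lambda>y. av V (\<lambda>u. avl V k (\<lambda>us. of_bool (cubeP h (y \<triangle> u) us \<noteq> 1))))"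
    by (simp add: av_add V)
  also have "av V (\<lambda>y. av V (\<lambda>u. avl V k (\<lambda>us. of_bool (cubeP h (y \<triangle> u) us \<noteq> 1))))
      = av V (\<lambda>y. av V (\<lambda>u. avl V k (\<lambda>us. of_bool (cubeP h u us \<noteq> 1))))"
    by (rule av_cong) (rule av_shift)
  also have "\<dots> = av V (\<lambda>u. avl V k (\<lambda>us. of_bool (cubeP h u us \<noteq> 1)))" using V by simp
  finally show ?case using Suc by simp
qed

text \<open>Fixing the base point leaves the other \<open>2 ^ k - 1\<close> vertices uniform, which
  is why errors can be corrected at every single point.\<close>

lemma cube_error_at:
  assumes V: "finite V" and h: "\<And>x. x \<subseteq> V \<Longrightarrow> h x = 1 \<or> h x = -1" and x: "x \<subseteq> V"
  shows "avl V k (\<lambda>us. of_bool (cubeP h x us \<noteq> h x)) \<le> (2 ^ k - 1) * disagree V h (\<lambda>_. 1)"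
proof (induction k)
  case 0
  show ?case by simp
next
  case (Suc k)
  note m = mean_av[OF V] and ml = mean_itav[OF mean_av[OF V], of k]
  have "avl V (Suc k) (\<lambda>us. of_bool (cubeP h x us \<noteq> h x))
    \<le> av V (\<lambda>u. avl V k (\<lambda>us. of_bool (cubeP h x us \<noteq> h x)) + avl V k (\<lambda>us. of_bool (cubeP h (x \<triangle> u) us \<noteq> 1)))"
    unfolding itav.simps by (intro mean_mono[OF m] mean_or[OF ml]) auto
  also have "\<dots> = avl V k (\<lambda>us. of_bool (cubeP h x us \<noteq> h x)) + av V (\<lambda>u. avl V k (\<lambda>us. of_bool (cubeP h (x \<triangle> u) us \<noteq> 1)))"
    by (simp add: av_add V)
  also have "av V (\<lambda>u. avl V k (\<lambda>us. of_bool (cubeP h (x \<triangle> u) us \<noteq> 1)))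
      = av V (\<lambda>u. avl V k (\<lambda>us. of_bool (cubeP h u us \<noteq> 1)))"
    by (rule av_shift) (rule x)
  also have "\<dots> \<le> 2 ^ k * disagree V h (\<lambda>_. 1)" by (rule cube_error[OF V h])
  finally show ?case using Suc by (simp add: algebra_simps)
qed

text \<open>The minimum distance of the Reed-Muller code up to a factor of 2, by self-correction:
  the product \<open>h\<close> of both functions is 1 nearly everywhere, so some cube at
  \<open>x\<close> has the product of its other vertices equal to 1, and the condition forces
  \<open>h x = 1\<close>.\<close>

lemma rm_distance:
  assumes V: "finite V" and "pm V f" "pm V g" "rm V d f" "rm V d g" "disagree V f g < 1 / 2 ^ Suc d" "x \<subseteq> V"
  shows "f x = g x"
proof (rule ccontr)
  assume ne: "f x \<noteq> g x"
  define h where "h = (\<lambda>x. f x * g x)"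
  have h: "h y = 1 \<or> h y = -1" if "y \<subseteq> V" for y
    using pmD[OF assms(2) that] pmD[OF assms(3) that] by (auto simp: h_def)
  have hne: "h y \<noteq> 1 \<longleftrightarrow> f y \<noteq> g y" if "y \<subseteq> V" for y
    using pmD[OF assms(2) that] pmD[OF assms(3) that] by (auto simp: h_def)
  have "disagree V h (\<lambda>_. 1) = disagree V f g" unfolding disagree_def by (rule av_cong) (simp add: hne)
  then have small: "(2 ^ Suc d) * disagree V h (\<lambda>_. 1) < 1" using assms(6) by (simp add: field_simps)
  have "avl V (Suc d) (\<lambda>us. of_bool (cubeP h x us \<noteq> h x)) \<le> (2 ^ Suc d - 1) * disagree V h (\<lambda>_. 1)"
    by (rule cube_error_at[OF V h assms(7)])
  also have "\<dots> \<le> 2 ^ Suc d * disagree V h (\<lambda>_. 1)"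
    by (intro mult_right_mono disagree_nonneg) simp
  also note small
  finally obtain us where us: "us \<in> lists_of (Pow V) (Suc d)" "cubeP h x us = h x"
    using mean_exists[OF mean_itav[OF mean_av[OF V]], of "Suc d" "\<lambda>us. cubeP h x us \<noteq> h x"] by auto
  have "rm V d h" unfolding h_def by (rule rm_mult) fact+
  then have "cubeP h x us = 1" using us(1) assms(7) by (simp add: rm_def lists_of_def)
  then show False using us(2) hne[OF assms(7)] ne by simp
qed

definition rm_error :: "nat set \<Rightarrow> nat \<Rightarrow> (nat set \<Rightarrow> real) \<Rightarrow> real" where
  "rm_error V k f = av V (\<lambda>x. avl V k (\<lambda>us. of_bool (cubeP f x us \<noteq> 1)))"

lemma rm_error_nonneg: "finite V \<Longrightarrow> 0 \<le> rm_error V k f"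
  unfolding rm_error_def by (intro av_nonneg mean_nonneg[OF mean_itav[OF mean_av]]) auto

text \<open>The two lists of directions are exchanged one direction at a time; each exchange is an
  instance of the test at a uniformly distributed base point.\<close>

lemma hybrid:
  assumes V: "finite V" and "pm V f" and x: "x \<subseteq> V"
  shows "avl V k (\<lambda>us. avl V k (\<lambda>vs. of_bool (cubeP f x us \<noteq> cubeP f x vs))) \<le> real k * rm_error V k f"
  using assms(2)
proof (induction k arbitrary: f)
  case 0
  show ?case by simp
next
  case (Suc k)
  note m = mean_av[OF V] and ml = mean_itav[OF mean_av[OF V], of k]
  \<comment> \<open>Fixing the first direction \<open>v\<close> means passing to the derivative
    \<open>F v\<close>. The errors of the derivatives in \<open>k\<close> directions average to the
    error of \<open>f\<close> in \<open>Suc k\<close> directions.\<close>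
  define F where "F v = (\<lambda>y. f y * f (y \<triangle> v))" for v
  have pmF: "pm V (F v)" if "v \<subseteq> V" for v
    unfolding pm_def
  proof (intro allI impI)
    fix y assume "y \<subseteq> V"
    then show "F v y = 1 \<or> F v y = -1"
      using that pmD[OF Suc.prems, of y] pmD[OF Suc.prems, of "y \<triangle> v"] by (auto simp: F_def)
  qed
  have cF: "cubeP (F v) y us = cubeP f y (v # us)" for v y us
    by (simp add: F_def cubeP_shift_function)
  have "avl V (Suc k) (\<lambda>us. avl V (Suc k) (\<lambda>vs. of_bool (cubeP f x us \<noteq> cubeP f x vs)))
    = av V (\<lambda>u. av V (\<lambda>v. avl V k (\<lambda>us. avl V k (\<lambda>vs. of_bool (cubeP f x (u # us) \<noteq> cubeP f x (v # vs))))))"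
    unfolding itav.simps by (simp add: av_avl_swap del: cubeP.simps)
  also have "\<dots> \<le> av V (\<lambda>u. av V (\<lambda>v. avl V k (\<lambda>us. avl V k (\<lambda>vs.
       of_bool (cubeP f x (u # us) \<noteq> cubeP f x (v # us)) + of_bool (cubeP f x (v # us) \<noteq> cubeP f x (v # vs))))))"
    by (intro mean_mono[OF m] mean_mono[OF ml]) auto
  also have "\<dots> = av V (\<lambda>u. av V (\<lambda>v. avl V k (\<lambda>us. of_bool (cubeP f x (u # us) \<noteq> cubeP f x (v # us)))))
     + av V (\<lambda>u. av V (\<lambda>v. avl V k (\<lambda>us. avl V k (\<lambda>vs. of_bool (cubeP f x (v # us) \<noteq> cubeP f x (v # vs))))))"
    by (simp only: mean_add[OF ml] mean_const[OF ml] mean_add[OF m])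
  also have "av V (\<lambda>u. av V (\<lambda>v. avl V k (\<lambda>us. avl V k (\<lambda>vs. of_bool (cubeP f x (v # us) \<noteq> cubeP f x (v # vs))))))
     \<le> av V (\<lambda>v. real k * rm_error V k (F v))"
    unfolding mean_const[OF m] cF[symmetric]
    by (intro mean_mono[OF m]) (use Suc.IH[OF pmF] in auto)
  also have "av V (\<lambda>v. real k * rm_error V k (F v)) = real k * rm_error V (Suc k) f"
    unfolding av_cmult rm_error_def cF itav.simps by (intro arg_cong[where f = "(*) (real k)"] av_swap)
  also have "av V (\<lambda>u. av V (\<lambda>v. avl V k (\<lambda>us. of_bool (cubeP f x (u # us) \<noteq> cubeP f x (v # us)))))
     = av V (\<lambda>u. av V (\<lambda>w. avl V k (\<lambda>us. of_bool (cubeP f (x \<triangle> u) (w # us) \<noteq> 1))))"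
  proof (rule av_cong)
    fix u assume u: "u \<subseteq> V"
    \<comment> \<open>The common factor at \<open>x\<close> cancels: comparing directions
      \<open>u\<close> and \<open>v\<close> amounts to a test at base point
      \<open>x \<triangle> u\<close> with first direction \<open>u \<triangle> v\<close>.\<close>
    have "av V (\<lambda>v. avl V k (\<lambda>us. of_bool (cubeP f x (u # us) \<noteq> cubeP f x (v # us))))
      = av V (\<lambda>v. avl V k (\<lambda>us. of_bool (cubeP f (x \<triangle> u) ((u \<triangle> v) # us) \<noteq> 1)))"
    proof (intro mean_cong[OF m] mean_cong[OF ml])
      fix v us assume "v \<in> Pow V" "us \<in> lists_of (Pow V) k"
      then have "cubeP f x us = 1 \<or> cubeP f x us = -1" "cubeP f (x \<triangle> u) us = 1 \<or> cubeP f (x \<triangle> u) us = -1"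
        "cubeP f (x \<triangle> v) us = 1 \<or> cubeP f (x \<triangle> v) us = -1"
        using cubeP_pm[OF Suc.prems] x u by (auto simp: lists_of_def)
      moreover have "(x \<triangle> u) \<triangle> (u \<triangle> v) = x \<triangle> v" by (simp add: sd_assoc)
      ultimately show "of_bool (cubeP f x (u # us) \<noteq> cubeP f x (v # us))
        = (of_bool (cubeP f (x \<triangle> u) ((u \<triangle> v) # us) \<noteq> 1) :: real)" by auto
    qed
    also have "\<dots> = av V (\<lambda>w. avl V k (\<lambda>us. of_bool (cubeP f (x \<triangle> u) (w # us) \<noteq> 1)))" by (rule av_shift[OF u])
    finally show "av V (\<lambda>v. avl V k (\<lambda>us. of_bool (cubeP f x (u # us) \<noteq> cubeP f x (v # us)))) = \<dots>" .
  qed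
  also have "\<dots> = rm_error V (Suc k) f" unfolding rm_error_def itav.simps by (rule av_shift[OF x])
  finally show ?case by (simp add: algebra_simps)
qed

section \<open>Majority decoding by votes along cubes\<close>

definition vote :: "(nat set \<Rightarrow> real) \<Rightarrow> nat set \<Rightarrow> nat set list \<Rightarrow> real" where
  "vote f x us = cubeP f x us * f x"

text \<open>A vote removes the base vertex from the cube product, \<open>f x\<close> being its own
  inverse, and so predicts \<open>f x\<close> from the other vertices. The tie at 1/2 is broken in
  favour of 1.\<close>

definition corrected :: "nat set \<Rightarrow> nat \<Rightarrow> (nat set \<Rightarrow> real) \<Rightarrow> nat set \<Rightarrow> real" where
  "corrected V k f x = (if avl V k (\<lambda>us. of_bool (vote f x us = 1)) \<ge> 1/2 then 1 else -1)"

lemma corrected_pm: "pm V (corrected V' k f)" by (simp add: pm_def corrected_def)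

lemma vote_pm: "pm V f \<Longrightarrow> x \<subseteq> V \<Longrightarrow> set us \<subseteq> Pow V \<Longrightarrow> vote f x us = 1 \<or> vote f x us = -1"
  using cubeP_pm[of V f x us] pmD[of V f x] by (auto simp: vote_def)

text \<open>If a vote is 1 with probability \<open>q\<close>, two independent votes differ with
  probability \<open>2 * q * (1 - q)\<close>, which \<open>hybrid\<close> bounds and which is at
  least the probability of the minority value.\<close>

lemma vote_corrected:
  assumes V: "finite V" and f: "pm V f" and x: "x \<subseteq> V"
  shows "avl V k (\<lambda>us. of_bool (vote f x us \<noteq> corrected V k f x)) \<le> real k * rm_error V k f"
proof -
  note ml = mean_itav[OF mean_av[OF V], of k]
  define A where "A = (\<lambda>us. of_bool (vote f x us = 1) :: real)"
  define q where "q = avl V k A"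
  have q01: "0 \<le> q" "q \<le> 1" unfolding q_def A_def by (auto intro!: mean_nonneg[OF ml] mean_le_const[OF ml])
  have "avl V k (\<lambda>us. avl V k (\<lambda>vs. of_bool (cubeP f x us \<noteq> cubeP f x vs)))
     = avl V k (\<lambda>us. avl V k (\<lambda>vs. A us + (1 + -2 * A us) * A vs))"
  proof (intro mean_cong[OF ml])
    fix us vs assume "us \<in> lists_of (Pow V) k" "vs \<in> lists_of (Pow V) k"
    then have "cubeP f x us = 1 \<or> cubeP f x us = -1" "cubeP f x vs = 1 \<or> cubeP f x vs = -1"
      using cubeP_pm[OF f x] by (auto simp: lists_of_def)
    then show "of_bool (cubeP f x us \<noteq> cubeP f x vs) = A us + (1 + -2 * A us) * A vs"
      using pmD[OF f x] by (auto simp: A_def vote_def)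
  qed
  also have "\<dots> = avl V k (\<lambda>us. A us + (1 + -2 * A us) * q)"
    by (simp only: mean_add[OF ml] mean_const[OF ml] mean_cmult[OF ml] q_def)
  also have "\<dots> = avl V k (\<lambda>us. q + (1 + -2 * q) * A us)"
    by (rule mean_cong[OF ml]) (simp add: algebra_simps)
  also have "\<dots> = q + (1 + -2 * q) * q"
    by (simp only: mean_add[OF ml] mean_const[OF ml] mean_cmult[OF ml] q_def)
  finally have 2: "2 * q * (1 - q) \<le> real k * rm_error V k f"
    using hybrid[OF V f x, of k] by (simp add: algebra_simps)
  have "avl V k (\<lambda>us. of_bool (vote f x us \<noteq> corrected V k f x)) = (if q \<ge> 1/2 then 1 - q else q)"
  proof (cases "q \<ge> 1/2")
    case True
    then have "corrected V k f x = 1" by (simp add: corrected_def q_def A_def)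
    then show ?thesis using True mean_not[OF ml, of "\<lambda>us. vote f x us = 1"] by (simp add: q_def A_def)
  next
    case False
    then have c: "corrected V k f x = -1" by (simp add: corrected_def q_def A_def)
    have "avl V k (\<lambda>us. of_bool (vote f x us \<noteq> -1)) = q" unfolding q_def A_def
    proof (rule mean_cong[OF ml])
      fix us assume "us \<in> lists_of (Pow V) k"
      then have "vote f x us = 1 \<or> vote f x us = -1" by (intro vote_pm[OF f x]) (simp add: lists_of_def)
      then show "(of_bool (vote f x us \<noteq> -1) :: real) = of_bool (vote f x us = 1)" by auto
    qed
    then show ?thesis using False c by simp
  qed
  also have "\<dots> \<le> 2 * q * (1 - q)"
  proof (cases "q \<ge> 1/2")
    case True
    then have "1 * (1 - q) \<le> 2 * q * (1 - q)" using q01 by (intro mult_right_mono) auto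
    then show ?thesis using True by simp
  next
    case False
    then have "q * 1 \<le> q * (2 * (1 - q))" using q01 by (intro mult_left_mono) auto
    then show ?thesis using False by (simp add: algebra_simps)
  qed
  finally show ?thesis using 2 by linarith
qed

text \<open>The product of votes over the cube spanned by the \<open>w\<close> at \<open>x\<close>,
  where the vote at each vertex uses its own directions: \<open>c\<close> at \<open>x\<close>,
  translated by \<open>r\<close> on moving by \<open>w\<close>. This affine dependence is what lets
  the votes be regrouped into cubes of \<open>f\<close>.\<close>

primrec cube2 :: "(nat set \<Rightarrow> real) \<Rightarrow> nat set \<Rightarrow> nat set list \<Rightarrow> (nat set \<times> nat set list) list \<Rightarrow> real" where
  "cube2 f x c [] = vote f x c"
| "cube2 f x c (wr # wrs) = cube2 f x c wrs * cube2 f (x \<triangle> fst wr) (map2 (\<triangle>) c (snd wr)) wrs"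

lemma avl_shift:
  assumes "es \<in> lists_of (Pow V) k"
  shows "avl V k (\<lambda>us. h (map2 (\<triangle>) us es)) = avl V k h"
  using assms
proof (induction k arbitrary: es h)
  case (Suc k)
  from Suc.prems obtain e es' where e: "es = e # es'" "e \<subseteq> V" "es' \<in> lists_of (Pow V) k" by (elim lists_of_SucE) auto
  have "avl V (Suc k) (\<lambda>us. h (map2 (\<triangle>) us es)) = av V (\<lambda>u. avl V k (\<lambda>us. h ((u \<triangle> e) # map2 (\<triangle>) us es')))"
    by (simp add: e)
  also have "\<dots> = av V (\<lambda>u. avl V k (\<lambda>us. h ((u \<triangle> e) # us)))"
    by (rule av_cong) (rule Suc.IH[OF e(3)])
  also have "\<dots> = avl V (Suc k) h" by (simp add: av_shift2[OF e(2), of "\<lambda>u. avl V k (\<lambda>us. h (u # us))"])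
  finally show ?case .
qed simp

lemma avl_lin:
  assumes V: "finite V" and "0 < t" "t < 2 ^ k"
  shows "avl V k (\<lambda>us. h (lin t us)) = av V h"
  using assms(2,3)
proof (induction k arbitrary: t h)
  case (Suc k)
  note ml = mean_itav[OF mean_av[OF V], of k]
  show ?case
  proof (cases "t div 2 = 0")
    case True
    then have "t = 1" using Suc.prems by simp
    then show ?thesis by (simp add: mean_const[OF ml])
  next
    case False
    have "avl V (Suc k) (\<lambda>us. h (lin t us)) = av V (\<lambda>u. avl V k (\<lambda>us. h ((if odd t then u else {}) \<triangle> lin (t div 2) us)))"
      by simp
    also have "\<dots> = av V (\<lambda>u. av V (\<lambda>y. h ((if odd t then u else {}) \<triangle> y)))"
      by (rule av_cong) (rule Suc.IH, use False Suc.prems in auto)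
    also have "\<dots> = av V (\<lambda>u. av V h)"
      by (rule av_cong) (rule av_shift, auto)
    finally show ?thesis using V by simp
  qed
qed simp

lemma lists_of_map2 [simp]: "c \<in> lists_of (Pow V) k \<Longrightarrow> e \<in> lists_of (Pow V) k \<Longrightarrow> map2 (\<triangle>) c e \<in> lists_of (Pow V) k"
proof (induction k arbitrary: c e)
  case (Suc k)
  then show ?case by (elim lists_of_SucE) auto
qed simp

lemma map2_sd_commute: "length c = length r \<Longrightarrow> map2 (\<triangle>) c r = map2 (\<triangle>) r c"
  by (induction c r rule: list_induct2) (simp_all add: sd_commute)

text \<open>At each single vertex the directions of the vote are uniform, although they depend on
  each other across vertices; this is enough for a union bound over the vertices.\<close>

lemma cube2_corrected:
  assumes V: "finite V" and f: "pm V f" and "x \<subseteq> V" "set ws \<subseteq> Pow V"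
  shows "avl V k (\<lambda>c. itav (avl V k) (length ws) (\<lambda>rs. of_bool (cube2 f x c (zip ws rs) \<noteq> cubeP (corrected V k f) x ws)))
     \<le> 2 ^ length ws * (real k * rm_error V k f)"
  using assms(3,4)
proof (induction ws arbitrary: x)
  case Nil
  then show ?case using vote_corrected[OF V f Nil.prems(1), of k] by simp
next
  case (Cons w ws)
  note m = mean_av[OF V] and ml = mean_itav[OF mean_av[OF V], of k]
  note mm = mean_itav[OF ml, of "length ws"]
  let ?g = "corrected V k f"
  define E where "E x c = itav (avl V k) (length ws) (\<lambda>rs. of_bool (cube2 f x c (zip ws rs) \<noteq> cubeP ?g x ws))" for x c
  have "avl V k (\<lambda>c. itav (avl V k) (length (w # ws)) (\<lambda>rs. of_bool (cube2 f x c (zip (w # ws) rs) \<noteq> cubeP ?g x (w # ws))))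
     \<le> avl V k (\<lambda>c. avl V k (\<lambda>r. E x c + E (x \<triangle> w) (map2 (\<triangle>) c r)))"
    unfolding length_Cons itav.simps E_def
    by (intro mean_mono[OF ml] mean_or[OF mm]) auto
  also have "\<dots> = avl V k (\<lambda>c. E x c) + avl V k (\<lambda>c. avl V k (\<lambda>r. E (x \<triangle> w) (map2 (\<triangle>) c r)))"
    by (simp only: mean_add[OF ml] mean_const[OF ml])
  also have "avl V k (\<lambda>c. avl V k (\<lambda>r. E (x \<triangle> w) (map2 (\<triangle>) c r))) = avl V k (\<lambda>c. avl V k (\<lambda>r. E (x \<triangle> w) r))"
  proof (rule mean_cong[OF ml])
    fix c assume c: "c \<in> lists_of (Pow V) k"
    have "avl V k (\<lambda>r. E (x \<triangle> w) (map2 (\<triangle>) c r)) = avl V k (\<lambda>r. E (x \<triangle> w) (map2 (\<triangle>) r c))"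
    proof (rule mean_cong[OF ml])
      fix r assume "r \<in> lists_of (Pow V) k"
      then have "map2 (\<triangle>) c r = map2 (\<triangle>) r c"
        using c by (intro map2_sd_commute) (simp add: lists_of_def)
      then show "E (x \<triangle> w) (map2 (\<triangle>) c r) = E (x \<triangle> w) (map2 (\<triangle>) r c)" by simp
    qed
    also have "\<dots> = avl V k (\<lambda>r. E (x \<triangle> w) r)" by (rule avl_shift[OF c])
    finally show "avl V k (\<lambda>r. E (x \<triangle> w) (map2 (\<triangle>) c r)) = \<dots>" .
  qed
  also have "\<dots> = avl V k (\<lambda>r. E (x \<triangle> w) r)" by (simp only: mean_const[OF ml])
  also have "avl V k (\<lambda>c. E x c) \<le> 2 ^ length ws * (real k * rm_error V k f)"
    unfolding E_def by (rule Cons.IH) (use Cons.prems in auto)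
  also have "avl V k (\<lambda>r. E (x \<triangle> w) r) \<le> 2 ^ length ws * (real k * rm_error V k f)"
    unfolding E_def by (rule Cons.IH) (use Cons.prems in auto)
  finally show ?case by (simp add: algebra_simps)
qed

lemma vote_lin:
  assumes "pm V f" "x \<subseteq> V"
  shows "vote f x c = (\<Prod>t\<in>{0<..<2 ^ length c}. f (x \<triangle> lin t c))"
proof -
  have "{..<2 ^ length c} = insert 0 {0<..<(2::nat) ^ length c}" by auto
  then have "cubeP f x c = f x * (\<Prod>t\<in>{0<..<2 ^ length c}. f (x \<triangle> lin t c))"
    unfolding cubeP_lin by simp
  then show ?thesis using pm_square[OF assms] by (simp add: vote_def mult.commute)
qed

text \<open>The double product over vertices and indices \<open>t\<close> is regrouped by
  \<open>t\<close>: the points of index \<open>t\<close> form a cube of \<open>f\<close> at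
  \<open>x \<triangle> lin t c\<close>. Index 0, the vertices themselves, is missing because votes
  omit the base point.\<close>

lemma cube2_lin:
  assumes f: "pm V f" and "x \<subseteq> V" "set ws \<subseteq> Pow V" "c \<in> lists_of (Pow V) k" "rs \<in> lists_of (lists_of (Pow V) k) (length ws)"
  shows "cube2 f x c (zip ws rs) = (\<Prod>t\<in>{0<..<2 ^ k}. cubeP f (x \<triangle> lin t c) (map2 (\<lambda>w r. w \<triangle> lin t r) ws rs))"
  using assms(2-5)
proof (induction ws arbitrary: x c rs)
  case Nil
  then show ?case using vote_lin[OF f Nil.prems(1), of c] by (simp add: lists_of_def)
next
  case (Cons w ws)
  from Cons.prems(4) obtain r rs' where r: "rs = r # rs'" "r \<in> lists_of (Pow V) k" "rs' \<in> lists_of (lists_of (Pow V) k) (length ws)"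
    by (auto elim: lists_of_SucE)
  have l: "lin t (map2 (\<triangle>) c r) = lin t c \<triangle> lin t r" for t
    by (rule lin_sd) (use Cons.prems r in \<open>auto simp: lists_of_def\<close>)
  have "cube2 f x c (zip ws rs') = (\<Prod>t\<in>{0<..<2 ^ k}. cubeP f (x \<triangle> lin t c) (map2 (\<lambda>w r. w \<triangle> lin t r) ws rs'))"
    by (rule Cons.IH) (use Cons.prems r in auto)
  moreover have "cube2 f (x \<triangle> w) (map2 (\<triangle>) c r) (zip ws rs')
     = (\<Prod>t\<in>{0<..<2 ^ k}. cubeP f (x \<triangle> w \<triangle> lin t (map2 (\<triangle>) c r)) (map2 (\<lambda>w r. w \<triangle> lin t r) ws rs'))"
    by (rule Cons.IH) (use Cons.prems r in auto)
  ultimately show ?case by (simp add: r(1) l prod.distrib[symmetric] sd_ac)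
qed

lemma itav_lin:
  assumes V: "finite V" and "0 < t" "t < 2 ^ k" "set ws \<subseteq> Pow V"
  shows "itav (avl V k) (length ws) (\<lambda>rs. h (map2 (\<lambda>w r. w \<triangle> lin t r) ws rs)) = avl V (length ws) h"
  using assms(4)
proof (induction ws arbitrary: h)
  case (Cons w ws)
  have "itav (avl V k) (length (w # ws)) (\<lambda>rs. h (map2 (\<lambda>w r. w \<triangle> lin t r) (w # ws) rs))
    = avl V k (\<lambda>r. avl V (length ws) (\<lambda>us. h ((w \<triangle> lin t r) # us)))"
    using Cons.IH[of "\<lambda>us. h (_ # us)"] Cons.prems by simp
  also have "\<dots> = av V (\<lambda>y. avl V (length ws) (\<lambda>us. h ((w \<triangle> y) # us)))"
    by (rule avl_lin[OF V assms(2,3), of "\<lambda>y. avl V (length ws) (\<lambda>us. h ((w \<triangle> y) # us))"])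
  also have "\<dots> = avl V (length (w # ws)) h"
    using av_shift[of w V "\<lambda>y. avl V (length ws) (\<lambda>us. h (y # us))"] Cons.prems by simp
  finally show ?case .
qed simp

text \<open>For nonzero \<open>t\<close> the base point and the directions
  \<open>w \<triangle> lin t r\<close> are uniform and independent, so each cube is an honest run of
  the test; there are fewer than \<open>2 ^ k\<close> of them.\<close>

lemma cube2_one:
  assumes V: "finite V" and f: "pm V f" and x: "x \<subseteq> V" and ws: "set ws \<subseteq> Pow V" "length ws = k"
  shows "avl V k (\<lambda>c. itav (avl V k) k (\<lambda>rs. of_bool (cube2 f x c (zip ws rs) \<noteq> 1))) \<le> 2 ^ k * rm_error V k f"
proof -
  note m = mean_av[OF V] and ml = mean_itav[OF mean_av[OF V], of k]
  note mm = mean_itav[OF ml, of k]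
  let ?J = "{0<..<(2::nat) ^ k}"
  define B where "B t c rs = cubeP f (x \<triangle> lin t c) (map2 (\<lambda>w r. w \<triangle> lin t r) ws rs)" for t c rs
  have "avl V k (\<lambda>c. itav (avl V k) k (\<lambda>rs. of_bool (cube2 f x c (zip ws rs) \<noteq> 1)))
    \<le> avl V k (\<lambda>c. itav (avl V k) k (\<lambda>rs. \<Sum>t\<in>?J. of_bool (B t c rs \<noteq> 1)))"
  proof (intro mean_mono[OF ml] mean_mono[OF mm])
    fix c rs assume "c \<in> lists_of (Pow V) k" "rs \<in> lists_of (lists_of (Pow V) k) k"
    then have eq: "cube2 f x c (zip ws rs) = (\<Prod>t\<in>?J. B t c rs)"
      unfolding B_def by (intro cube2_lin[OF f x]) (use ws in auto)
    show "(of_bool (cube2 f x c (zip ws rs) \<noteq> 1) :: real) \<le> (\<Sum>t\<in>?J. of_bool (B t c rs \<noteq> 1))"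
    proof (cases "\<forall>t\<in>?J. B t c rs = 1")
      case True
      then show ?thesis unfolding eq by simp
    next
      case False
      then obtain t where t: "t \<in> ?J" "B t c rs \<noteq> 1" by blast
      have "(of_bool (cube2 f x c (zip ws rs) \<noteq> 1) :: real) \<le> of_bool (B t c rs \<noteq> 1)" using t by simp
      also have "\<dots> \<le> (\<Sum>t\<in>?J. of_bool (B t c rs \<noteq> 1))" by (rule member_le_sum[OF t(1)]) auto
      finally show ?thesis .
    qed
  qed
  also have "\<dots> = (\<Sum>t\<in>?J. avl V k (\<lambda>c. itav (avl V k) k (\<lambda>rs. of_bool (B t c rs \<noteq> 1))))"
    by (simp only: mean_sum[OF mm] mean_sum[OF ml] finite_greaterThanLessThan)
  also have "\<dots> = (\<Sum>t\<in>?J. rm_error V k f)"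
  proof (rule sum.cong)
    fix t assume "t \<in> ?J"
    then have t: "0 < t" "t < 2 ^ k" by auto
    have "avl V k (\<lambda>c. itav (avl V k) k (\<lambda>rs. of_bool (B t c rs \<noteq> 1)))
       = avl V k (\<lambda>c. avl V k (\<lambda>us. of_bool (cubeP f (x \<triangle> lin t c) us \<noteq> 1)))"
      unfolding B_def using itav_lin[OF V t ws(1), of "\<lambda>us. of_bool (cubeP f (x \<triangle> lin t _) us \<noteq> 1)"] ws(2) by simp
    also have "\<dots> = av V (\<lambda>y. avl V k (\<lambda>us. of_bool (cubeP f (x \<triangle> y) us \<noteq> 1)))"
      by (rule avl_lin[OF V t, of "\<lambda>y. avl V k (\<lambda>us. of_bool (cubeP f (x \<triangle> y) us \<noteq> 1))"])
    also have "\<dots> = rm_error V k f" unfolding rm_error_def by (rule av_shift[OF x])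
    finally show "avl V k (\<lambda>c. itav (avl V k) k (\<lambda>rs. of_bool (B t c rs \<noteq> 1))) = rm_error V k f" .
  qed simp
  also have "\<dots> \<le> 2 ^ k * rm_error V k f"
    using rm_error_nonneg[OF V, of k f] by (simp add: mult_right_mono)
  finally show ?thesis .
qed

text \<open>The product of votes equals both the cube product of the corrected function and 1,
  except with total probability below 1 by the two preceding bounds. As the conclusion involves no
  randomness, it holds. The factor \<open>Suc (Suc d)\<close> collects \<open>Suc d\<close> from
  \<open>hybrid\<close> and one from the test itself.\<close>

lemma corrected_rm:
  assumes V: "finite V" and f: "pm V f" and small: "2 ^ Suc d * (real (Suc (Suc d)) * rm_error V (Suc d) f) < 1"
  shows "rm V d (corrected V (Suc d) f)"
  unfolding rm_def
proof (intro allI impI)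
  fix x ws assume x: "x \<subseteq> V" and ws: "set ws \<subseteq> Pow V" "length ws = Suc d"
  let ?k = "Suc d" and ?g = "corrected V (Suc d) f"
  note ml = mean_itav[OF mean_av[OF V], of ?k]
  note mm = mean_itav[OF ml, of ?k]
  have "avl V ?k (\<lambda>c. itav (avl V ?k) ?k (\<lambda>rs. of_bool (cubeP ?g x ws \<noteq> 1)))
    \<le> avl V ?k (\<lambda>c. itav (avl V ?k) ?k (\<lambda>rs. of_bool (cube2 f x c (zip ws rs) \<noteq> cubeP ?g x ws))
       + itav (avl V ?k) ?k (\<lambda>rs. of_bool (cube2 f x c (zip ws rs) \<noteq> 1)))"
    by (intro mean_mono[OF ml] mean_or[OF mm]) auto
  also have "\<dots> = avl V ?k (\<lambda>c. itav (avl V ?k) ?k (\<lambda>rs. of_bool (cube2 f x c (zip ws rs) \<noteq> cubeP ?g x ws)))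
       + avl V ?k (\<lambda>c. itav (avl V ?k) ?k (\<lambda>rs. of_bool (cube2 f x c (zip ws rs) \<noteq> 1)))"
    by (simp only: mean_add[OF ml])
  also have "\<dots> \<le> 2 ^ ?k * (real ?k * rm_error V ?k f) + 2 ^ ?k * rm_error V ?k f"
    using cube2_corrected[OF V f x ws(1), of ?k] cube2_one[OF V f x ws] ws(2) by simp
  also have "\<dots> = 2 ^ ?k * (real (Suc ?k) * rm_error V ?k f)" by (simp add: algebra_simps)
  also note small
  finally have "of_bool (cubeP ?g x ws \<noteq> 1) < (1::real)" by (simp only: mean_const[OF mm] mean_const[OF ml])
  then show "cubeP ?g x ws = 1" by (auto split: if_splits)
qed

text \<open>Where \<open>f\<close> differs from the majority value, the cube product is -1 exactly
  when the vote follows the majority.\<close>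

lemma corrected_reject:
  assumes V: "finite V" and f: "pm V f" and x: "x \<subseteq> V" and ne: "f x \<noteq> corrected V k f x"
    and small: "real k * rm_error V k f \<le> 1 / 2"
  shows "1 / 2 \<le> avl V k (\<lambda>us. of_bool (cubeP f x us \<noteq> 1))"
proof -
  note ml = mean_itav[OF mean_av[OF V], of k]
  have "avl V k (\<lambda>us. of_bool (cubeP f x us \<noteq> 1)) = avl V k (\<lambda>us. of_bool (\<not> (vote f x us \<noteq> corrected V k f x)))"
  proof (rule mean_cong[OF ml])
    fix us assume "us \<in> lists_of (Pow V) k"
    then have "cubeP f x us = 1 \<or> cubeP f x us = -1" using cubeP_pm[OF f x] by (auto simp: lists_of_def)
    then show "(of_bool (cubeP f x us \<noteq> 1) :: real) = of_bool (\<not> (vote f x us \<noteq> corrected V k f x))"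
      using ne pmD[OF f x] pmD[OF corrected_pm x, of V k f] by (auto simp: vote_def)
  qed
  also have "\<dots> = 1 - avl V k (\<lambda>us. of_bool (vote f x us \<noteq> corrected V k f x))" by (rule mean_not[OF ml])
  finally show ?thesis using vote_corrected[OF V f x, of k] small by linarith
qed

lemma corrected_close:
  assumes V: "finite V" and f: "pm V f" and small: "real k * rm_error V k f \<le> 1 / 2"
  shows "disagree V f (corrected V k f) \<le> 2 * rm_error V k f"
proof -
  note m = mean_av[OF V] and ml = mean_itav[OF mean_av[OF V], of k]
  have "1 / 2 * disagree V f (corrected V k f) \<le> rm_error V k f"
    unfolding disagree_def rm_error_def av_cmult[symmetric]
  proof (rule av_mono)
    fix x assume x: "x \<subseteq> V"
    show "1 / 2 * of_bool (f x \<noteq> corrected V k f x) \<le> avl V k (\<lambda>us. of_bool (cubeP f x us \<noteq> 1))"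
    proof (cases "f x = corrected V k f x")
      case True
      then show ?thesis by (simp add: mean_nonneg[OF ml])
    next
      case False
      then show ?thesis using corrected_reject[OF V f x False small] by simp
    qed
  qed
  then show ?thesis by simp
qed

section \<open>Random merging of variables\<close>

lemma cubeP_singles:
  assumes "distinct l"
  shows "cubeP f x (map (\<lambda>i. {i}) l) = (\<Prod>T\<in>Pow (set l). f (x \<triangle> T))"
  using assms
proof (induction l arbitrary: x)
  case (Cons i l)
  have i: "i \<notin> set l" using Cons by simp
  have "(\<Prod>T\<in>Pow (set (i # l)). f (x \<triangle> T))
     = (\<Prod>T\<in>Pow (set l). f (x \<triangle> T)) * (\<Prod>T\<in>insert i ` Pow (set l). f (x \<triangle> T))"
    unfolding set_simps Pow_insert by (rule prod.union_disjoint) (use i in auto)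
  also have "(\<Prod>T\<in>insert i ` Pow (set l). f (x \<triangle> T)) = (\<Prod>T\<in>Pow (set l). f (x \<triangle> insert i T))"
    by (rule prod.reindex_cong[of "insert i"]) (use i in \<open>auto simp: inj_on_def\<close>)
  also have "\<dots> = (\<Prod>T\<in>Pow (set l). f (x \<triangle> {i} \<triangle> T))"
  proof (rule prod.cong)
    fix T assume "T \<in> Pow (set l)"
    then have "insert i T = {i} \<triangle> T" using i by (auto simp: sd_def)
    then show "f (x \<triangle> insert i T) = f (x \<triangle> {i} \<triangle> T)" by (simp add: sd_assoc)
  qed simp
  finally show ?case using Cons by simp
qed simp

lemma rm_subcube:
  assumes "rm V d f" "x \<subseteq> V" "I \<subseteq> V" "finite I" "d < card I"
  shows "(\<Prod>T\<in>Pow I. f (x \<triangle> T)) = 1"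
proof -
  obtain l where l: "set l = I" "distinct l" using finite_distinct_list[OF assms(4)] by blast
  have "cubeP f x (map (\<lambda>i. {i}) l) = 1"
    by (rule rmD[OF assms(1,2)]) (use l assms distinct_card[OF l(2)] in auto)
  then show ?thesis using cubeP_singles[OF l(2)] l(1) by simp
qed

section \<open>Gluing two variables\<close>

definition glue :: "nat \<Rightarrow> nat \<Rightarrow> nat set \<Rightarrow> nat set" where
  "glue i j x = (if j \<in> x then insert i x else x - {i})"

lemma glue_fixed: "(i \<in> x \<longleftrightarrow> j \<in> x) \<Longrightarrow> glue i j x = x" by (auto simp: glue_def)

text \<open>The coefficient of \<open>S\<close> is, up to signs, an average over the cosets of the
  cube spanned by \<open>I\<close> of the coefficients of \<open>S \<inter> I\<close> in the
  restrictions.\<close>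

lemma fc_subcubes:
  assumes V: "finite V" "I \<subseteq> V" "S \<subseteq> V"
    and zero: "\<And>x. x \<subseteq> V \<Longrightarrow> (\<Sum>T\<in>Pow I. chi (S \<inter> I) T * u (x \<triangle> T)) = 0"
  shows "fc V u S = 0"
proof -
  have fI: "finite I" using V finite_subset by blast
  have fS: "finite S" using V finite_subset by blast
  have "fc V u S = av I (\<lambda>T. av V (\<lambda>x. u x * chi S x))" using fI by (simp add: fc_def)
  also have "\<dots> = av I (\<lambda>T. av V (\<lambda>x. u (x \<triangle> T) * chi S (x \<triangle> T)))"
    by (rule av_cong) (use V in \<open>intro av_shift2[symmetric, of _ V "\<lambda>x. u x * chi S x"], auto\<close>)
  also have "\<dots> = av V (\<lambda>x. av I (\<lambda>T. u (x \<triangle> T) * chi S (x \<triangle> T)))" by (rule av_swap)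
  also have "\<dots> = av V (\<lambda>x. 0)"
  proof (rule av_cong)
    fix x assume x: "x \<subseteq> V"
    have "av I (\<lambda>T. u (x \<triangle> T) * chi S (x \<triangle> T)) = av I (\<lambda>T. chi S x * (chi (S \<inter> I) T * u (x \<triangle> T)))"
      by (rule av_cong) (simp add: chi_sd chi_Int[of _ I S] fS)
    then show "av I (\<lambda>T. u (x \<triangle> T) * chi S (x \<triangle> T)) = 0"
      using zero[OF x] by (simp add: av_cmult) (simp add: av_def)
  qed
  finally show ?thesis using V by simp
qed

text \<open>A Boolean function on a cube of dimension more than \<open>2 * d\<close> which has degree \<open>d\<close> except
  possibly at the top vertex: changing its value there gives a real polynomial of degree \<open>d\<close> whose
  square is 1 everywhere, and the Reed-Muller condition fixes the sign of the value.\<close>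

lemma top_vertex:
  assumes fI: "finite I" and card: "2 * d < card I"
    and pm: "\<And>T. T \<subseteq> I \<Longrightarrow> \<phi> T = 1 \<or> \<phi> T = (-1::real)" and prod: "(\<Prod>T\<in>Pow I. \<phi> T) = 1"
    and zero: "\<And>K. K \<subset> I \<Longrightarrow> d < card K \<Longrightarrow> (\<Sum>T\<in>Pow K. chi K T * \<phi> T) = 0"
  shows "deg_le I d \<phi>"
proof -
  \<comment> \<open>The amount to be removed at the vertex \<open>I\<close> for the sum over the
    whole cube to vanish; \<open>chi I I\<close> is a sign and its own inverse.\<close>
  define \<kappa> where "\<kappa> = (\<Sum>T\<in>Pow I. chi I T * \<phi> T) * chi I I"
  define v where "v T = \<phi> T - (if T = I then \<kappa> else 0)" for T
  have v_eq: "v T = \<phi> T" if "T \<noteq> I" for T using that by (simp add: v_def)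
  have dv: "deg_le I d v"
  proof (rule deg_le_from_subcubes[OF fI])
    fix K assume K: "K \<subseteq> I" "d < card K"
    show "(\<Sum>T\<in>Pow K. chi K T * v T) = 0"
    proof (cases "K = I")
      case True
      have "(\<Sum>T\<in>Pow I. chi I T * v T) = (\<Sum>T\<in>Pow I. chi I T * \<phi> T - (if T = I then chi I I * \<kappa> else 0))"
        by (rule sum.cong) (auto simp: v_def algebra_simps)
      also have "\<dots> = (\<Sum>T\<in>Pow I. chi I T * \<phi> T) - chi I I * \<kappa>"
        using fI by (simp add: sum_subtractf)
      also have "\<dots> = 0" by (simp add: \<kappa>_def mult.commute)
      finally show ?thesis using True by simp
    next
      case False
      then have "(\<Sum>T\<in>Pow K. chi K T * v T) = (\<Sum>T\<in>Pow K. chi K T * \<phi> T)"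
        using K by (intro sum.cong) (auto simp: v_def)
      then show ?thesis using zero[of K] K False by auto
    qed
  qed
  \<comment> \<open>The square of \<open>v\<close> has degree at most \<open>2 * d < card I\<close>,
    hence no coefficient at \<open>I\<close>; as it is 1 at every other vertex, it is 1 at
    \<open>I\<close> as well.\<close>
  have "fc I (\<lambda>T. v T * v T) I = 0"
    using deg_le_mult[OF fI dv dv] card by (intro deg_leD[of I "d + d"]) auto
  moreover have "av I (chi I) = 0" using av_chi[OF fI, of I] card by auto
  ultimately have "av I (\<lambda>T. v T * v T * chi I T - chi I T) = 0" by (simp add: av_diff fc_def)
  then have "0 = (\<Sum>T\<in>Pow I. (v T * v T - 1) * chi I T)" by (simp add: av_def algebra_simps)
  also have "\<dots> = (\<Sum>T\<in>{I}. (v T * v T - 1) * chi I T)"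
  proof (rule sum.mono_neutral_right)
    show "\<forall>T\<in>Pow I - {I}. (v T * v T - 1) * chi I T = 0"
    proof
      fix T assume "T \<in> Pow I - {I}"
      then have "v T = 1 \<or> v T = -1" using pm[of T] by (simp add: v_def)
      then show "(v T * v T - 1) * chi I T = 0" by auto
    qed
  qed (use fI in auto)
  finally have "v I * v I = 1" by simp
  then have vI: "v I = 1 \<or> v I = -1" by (simp add: square_eq_1_iff)
  have pmv: "pm I v" unfolding pm_def
  proof (intro allI impI)
    fix T assume "T \<subseteq> I"
    then show "v T = 1 \<or> v T = -1" using vI pm[of T] v_eq[of T] by (cases "T = I") auto
  qed
  have "(\<Prod>T\<in>Pow I. v ({} \<triangle> T)) = 1"
    by (rule rm_subcube[OF deg_le_imp_rm[OF fI pmv dv]]) (use fI card in auto)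
  then have "v I * (\<Prod>T\<in>Pow I - {I}. v T) = \<phi> I * (\<Prod>T\<in>Pow I - {I}. \<phi> T)"
    using prod fI prod.remove[of "Pow I" I v] prod.remove[of "Pow I" I \<phi>] by simp
  moreover have "(\<Prod>T\<in>Pow I - {I}. v T) = (\<Prod>T\<in>Pow I - {I}. \<phi> T)"
    by (rule prod.cong) (auto simp: v_def)
  moreover have "(\<Prod>T\<in>Pow I - {I}. \<phi> T) \<noteq> 0"
  proof -
    have "\<phi> T \<noteq> 0" if "T \<subseteq> I" for T using pm[OF that] by auto
    then show ?thesis using fI by (auto simp: prod_zero_iff)
  qed
  ultimately have "v I = \<phi> I" by simp
  then have "v T = \<phi> T" for T using v_eq[of T] by (cases "T = I") auto
  then have "v = \<phi>" by (simp add: fun_eq_iff)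
  then show ?thesis using dv by simp
qed

text \<open>Gluing replaces \<open>i\<close> by \<open>j\<close> in every character; a set avoiding
  \<open>i\<close> then receives its own coefficient and that of the set in which membership of
  \<open>i\<close> and \<open>j\<close> is toggled.\<close>

lemma fc_glue:
  assumes V: "finite V" and ij: "i \<in> V" "j \<in> V" "i \<noteq> j" and S: "S \<subseteq> V" "i \<notin> S"
  shows "fc V (\<lambda>x. u (glue i j x)) S = fc V u S + fc V u (S \<triangle> {i, j})"
proof -
  define T where "T = (\<lambda>A. if i \<in> A then A \<triangle> {i, j} else A)"
  have "fc V (\<lambda>x. u (glue i j x)) S = (\<Sum>A\<in>Pow V. if T A = S then fc V u A else 0)"
  proof (rule fc_chi_sum[OF V _ _ S(1)])
    fix x assume x: "x \<subseteq> V"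
    have g: "glue i j x \<subseteq> V" using x ij by (auto simp: glue_def)
    have gx: "glue i j x = x \<triangle> (if (i \<in> x) = (j \<in> x) then {} else {i})"
      by (auto simp: glue_def sd_def)
    have "u (glue i j x) = (\<Sum>A\<in>Pow V. fc V u A * chi A (glue i j x))" by (rule fc_inversion[OF V g])
    also have "\<dots> = (\<Sum>A\<in>Pow V. fc V u A * chi (T A) x)"
    proof (rule sum.cong)
      fix A assume "A \<in> Pow V"
      then have fA: "finite A" using V finite_subset by auto
      have "chi A {i} = chi {i} A" using fA by (intro chi_sym) auto
      moreover have "{i, j} = {i} \<triangle> {j}" using ij by (auto simp: sd_def)
      then have "chi {i, j} x = chi {i} x * chi {j} x" by (simp only: chi_sd_left finite.intros)
      ultimately have "chi A (glue i j x) = chi (T A) x"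
        unfolding gx T_def by (auto simp: chi_sd chi_sd_left fA)
      then show "fc V u A * chi A (glue i j x) = fc V u A * chi (T A) x" by simp
    qed simp
    finally show "u (glue i j x) = (\<Sum>A\<in>Pow V. fc V u A * chi (T A) x)" .
  qed (use ij in \<open>auto simp: T_def sd_def\<close>)
  also have "\<dots> = (\<Sum>A\<in>{S, S \<triangle> {i, j}}. fc V u A)"
  proof (rule sum.mono_neutral_cong_right)
    show "\<forall>A\<in>Pow V - {S, S \<triangle> {i, j}}. (if T A = S then fc V u A else 0) = 0"
      using S by (auto simp: T_def sd_assoc)
    have "i \<in> S \<triangle> {i, j}" using S by (simp add: sd_mem)
    then show "(if T A = S then fc V u A else 0) = fc V u A" if "A \<in> {S, S \<triangle> {i, j}}" for A
      using that S by (auto simp: T_def sd_assoc)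
    show "{S, S \<triangle> {i, j}} \<subseteq> Pow V" using S ij by (auto simp: sd_def)
  qed (use V in auto)
  also have "\<dots> = fc V u S + fc V u (S \<triangle> {i, j})"
  proof -
    have "i \<in> S \<triangle> {i, j}" using S by (simp add: sd_mem)
    then have "S \<noteq> S \<triangle> {i, j}" using S by blast
    then show ?thesis by simp
  qed
  finally show ?thesis .
qed

text \<open>Fix the coordinates outside \<open>I\<close>, and with them all partners. On a face of
  the resulting cube where \<open>k\<close> agrees with its partner, gluing \<open>k\<close> changes
  nothing, so that face inherits degree \<open>d\<close>; \<open>top_vertex\<close> extends this
  from the faces to the cube. This settles sets with more than \<open>d\<close> elements in
  \<open>I\<close>, and \<open>fc_glue\<close> moves the others into \<open>I\<close>.\<close>

lemma glued_partners:
  assumes V: "finite V" and u: "pm V u" "rm V d u" and I: "I \<subseteq> V" "2 * d < card I"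
    and p: "\<And>i. i \<in> I \<Longrightarrow> p i \<in> V - I" and deg: "\<And>i. i \<in> I \<Longrightarrow> deg_le V d (\<lambda>x. u (glue i (p i) x))"
  shows "deg_le V d u"
proof -
  have fI: "finite I" using V I finite_subset by blast
  have high: "fc V u S = 0" if S: "S \<subseteq> V" "d < card (S \<inter> I)" for S
  proof (rule fc_subcubes[OF V I(1) S(1)])
    fix x assume x: "x \<subseteq> V"
    define x' where "x' = x - I"
    \<comment> \<open>The vertex of the cube at which all elements of \<open>I\<close> agree with
      their partners.\<close>
    define x0 where "x0 = x' \<union> {i \<in> I. p i \<in> x'}"
    define Q where "Q = x0 \<triangle> x"
    have Q: "Q \<subseteq> I" by (auto simp: Q_def x0_def x'_def sd_def)
    have x0: "x0 \<subseteq> V" using x I by (auto simp: x0_def x'_def)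
    define \<phi> where "\<phi> T = u (x0 \<triangle> T)" for T
    have dphi: "deg_le I d \<phi>"
    proof (rule top_vertex[OF fI I(2)])
      show "\<phi> T = 1 \<or> \<phi> T = -1" if "T \<subseteq> I" for T
        unfolding \<phi>_def by (rule pmD[OF u(1)]) (use x0 that I in auto)
      show "(\<Prod>T\<in>Pow I. \<phi> T) = 1"
        unfolding \<phi>_def by (rule rm_subcube[OF u(2) x0 I(1) fI]) (use I in simp)
      fix K assume K: "K \<subset> I" "d < card K"
      then obtain k where k: "k \<in> I" "k \<notin> K" by blast
      have "(\<Sum>T\<in>Pow K. chi K T * \<phi> T) = (\<Sum>T\<in>Pow K. chi K T * u (glue k (p k) (x0 \<triangle> T)))"
      proof (rule sum.cong)
        fix T assume "T \<in> Pow K"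
        then have "k \<notin> T" "p k \<notin> T" using k p[OF k(1)] K by auto
        then have "glue k (p k) (x0 \<triangle> T) = x0 \<triangle> T"
          using k p[OF k(1)] by (intro glue_fixed) (auto simp: sd_mem x0_def x'_def)
        then show "chi K T * \<phi> T = chi K T * u (glue k (p k) (x0 \<triangle> T))" by (simp add: \<phi>_def)
      qed simp
      also have "\<dots> = 0" by (rule subcube_sum_zero[OF V _ x0 deg[OF k(1)] K(2)]) (use K I in auto)
      finally show "(\<Sum>T\<in>Pow K. chi K T * \<phi> T) = 0" .
    qed
    have "(\<Sum>T\<in>Pow I. chi (S \<inter> I) T * u (x \<triangle> T)) = 2 ^ card I * av I (\<lambda>T. chi (S \<inter> I) T * u (x \<triangle> T))"
      by (simp add: av_def)
    also have "av I (\<lambda>T. chi (S \<inter> I) T * u (x \<triangle> T)) = av I (\<lambda>T. chi (S \<inter> I) (Q \<triangle> T) * u (x \<triangle> (Q \<triangle> T)))"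
      by (rule av_shift[OF Q, of "\<lambda>T. chi (S \<inter> I) T * u (x \<triangle> T)", symmetric])
    also have "\<dots> = av I (\<lambda>T. chi (S \<inter> I) Q * (\<phi> T * chi (S \<inter> I) T))"
      by (rule av_cong) (simp add: chi_sd \<phi>_def Q_def sd_ac)
    also have "\<dots> = chi (S \<inter> I) Q * fc I \<phi> (S \<inter> I)" by (simp add: av_cmult fc_def)
    also have "fc I \<phi> (S \<inter> I) = 0" by (rule deg_leD[OF dphi _ S(2)]) simp
    finally show "(\<Sum>T\<in>Pow I. chi (S \<inter> I) T * u (x \<triangle> T)) = 0" by simp
  qed
  \<comment> \<open>Toggling \<open>i\<close> and its partner gives a set that is no smaller and has
    one more element in \<open>I\<close>. Its coefficient is zero by induction, and the two
    coefficients sum to zero because gluing \<open>i\<close> leaves degree \<open>d\<close>.\<close>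
  have "fc V u S = 0" if "S \<subseteq> V" "d < card S" for S
    using that
  proof (induction "card (I - S)" arbitrary: S rule: less_induct)
    case less
    show ?case
    proof (cases "d < card (S \<inter> I)")
      case True
      then show ?thesis using high less.prems by simp
    next
      case False
      have "\<not> I \<subseteq> S"
      proof
        assume "I \<subseteq> S"
        then have "S \<inter> I = I" by auto
        then show False using False I by simp
      qed
      then obtain i where i: "i \<in> I" "i \<notin> S" by blast
      define S' where "S' = S \<triangle> {i, p i}"
      have pi: "p i \<in> V" "p i \<notin> I" "p i \<noteq> i" using p[OF i(1)] i by auto
      have fS: "finite S" using less.prems V finite_subset by blast
      have S': "S' \<subseteq> V" using less.prems pi i I by (auto simp: S'_def sd_def)
      have "S - {p i} \<union> {i} \<subseteq> S'" using i pi by (auto simp: S'_def sd_def)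
      then have "card (S - {p i} \<union> {i}) \<le> card S'" using S' V finite_subset by (intro card_mono) auto
      moreover have "card (S - {p i} \<union> {i}) = Suc (card (S - {p i}))" using i fS by simp
      moreover have "card S \<le> Suc (card (S - {p i}))" using fS by (cases "p i \<in> S") (auto simp: card_Suc_Diff1)
      ultimately have cS': "card S \<le> card S'" by linarith
      have "I - S' = (I - S) - {i}" using i pi by (auto simp: S'_def sd_def)
      then have "card (I - S') < card (I - S)" using i fI by (metis Diff_iff card_Diff1_less finite_Diff)
      then have "fc V u S' = 0" using less.hyps[of S'] S' cS' less.prems by simp
      moreover have "fc V (\<lambda>x. u (glue i (p i) x)) S = 0"
        by (rule deg_leD[OF deg[OF i(1)] less.prems])
      ultimately show ?thesis
        using fc_glue[OF V _ pi(1) _ less.prems(1) i(2), of u] i I pi by (auto simp: S'_def)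
    qed
  qed
  then show ?thesis by (simp add: deg_le_def)
qed

text \<open>Each element has one image, so some element has at most one preimage. Selecting it and
  discarding its image and preimage uses up at most three elements per selection.\<close>

lemma independent_subset:
  fixes q :: "'a \<Rightarrow> 'a"
  assumes "finite A" "\<And>v. v \<in> A \<Longrightarrow> q v \<noteq> v"
  shows "\<exists>I\<subseteq>A. card A \<le> 3 * card I \<and> (\<forall>v\<in>I. q v \<notin> I)"
  using assms
proof (induction "card A" arbitrary: A rule: less_induct)
  case less
  show ?case
  proof (cases "A = {}")
    case True
    then show ?thesis by auto
  next
    case False
    have "\<exists>v\<in>A. card {w\<in>A. q w = v} \<le> 1"
    proof (rule ccontr)
      assume "\<not> ?thesis"
      then have "2 \<le> card {w\<in>A. q w = v}" if "v \<in> A" for v using that by force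
      then have "(\<Sum>v\<in>A. 2) \<le> (\<Sum>v\<in>A. card {w\<in>A. q w = v})" by (intro sum_mono) auto
      also have "\<dots> = card (\<Union>v\<in>A. {w\<in>A. q w = v})"
        by (rule card_UN_disjoint[symmetric]) (use less.prems in auto)
      also have "\<dots> \<le> card A" by (rule card_mono) (use less.prems in auto)
      finally show False using False less.prems by (auto simp: card_gt_0_iff)
    qed
    then obtain v where v: "v \<in> A" "card {w\<in>A. q w = v} \<le> 1" by blast
    define X where "X = insert v (insert (q v) {w\<in>A. q w = v})"
    have "card X \<le> Suc (Suc (card {w\<in>A. q w = v}))"
      unfolding X_def by (intro order_trans[OF card_insert_le_m1]) (use less.prems in \<open>auto simp: card_insert_if\<close>)
    then have cX: "card X \<le> 3" using v by simp
    have "card (A - X) < card A" using v less.prems by (intro psubset_card_mono) (auto simp: X_def)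
    then obtain J where J: "J \<subseteq> A - X" "card (A - X) \<le> 3 * card J" "\<forall>v\<in>J. q v \<notin> J"
      using less.hyps[of "A - X"] less.prems by auto
    have fJ: "finite J" using J less.prems finite_subset by blast
    have "v \<notin> J" using J by (auto simp: X_def)
    have "card A \<le> card (A - X) + card X"
      using diff_card_le_card_Diff[of X A] less.prems by (simp add: X_def)
    then have "card A \<le> 3 * card (insert v J)" using J cX \<open>v \<notin> J\<close> fJ by simp
    moreover have "\<forall>w\<in>insert v J. q w \<notin> insert v J"
      using J v less.prems by (auto simp: X_def)
    ultimately show ?thesis using J v by (intro exI[of _ "insert v J"]) auto
  qed
qed

definition collapses :: "nat set \<Rightarrow> nat \<Rightarrow> (nat set \<Rightarrow> real) \<Rightarrow> nat \<Rightarrow> nat \<Rightarrow> bool" where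
  "collapses V d u i j \<longleftrightarrow> i \<in> V \<and> j \<in> V \<and> i \<noteq> j \<and> deg_le V d (\<lambda>x. u (glue i j x))"

text \<open>Gluing \<open>i\<close> to \<open>j\<close> and \<open>j\<close> to \<open>i\<close>
  gives the same function up to renaming one variable.\<close>

lemma collapses_sym:
  assumes V: "finite V" and c: "collapses V d u i j"
  shows "collapses V d u j i"
proof -
  have "deg_le V d (\<lambda>x. u (glue i j ({} \<triangle> pull (id(j := i)) V x)))"
    by (rule deg_le_pull[OF V V, of d "\<lambda>x. u (glue i j x)"]) (use c in \<open>auto simp: collapses_def\<close>)
  moreover have "u (glue i j ({} \<triangle> pull (id(j := i)) V x)) = u (glue j i x)" if "x \<subseteq> V" for x
  proof -
    have "pull (id(j := i)) V x = glue j i x"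
      using that c by (auto simp: pull_def glue_def collapses_def)
    moreover have "glue i j (glue j i x) = glue j i x"
      by (rule glue_fixed) (use c in \<open>auto simp: glue_def collapses_def\<close>)
    ultimately show ?thesis by simp
  qed
  ultimately have "deg_le V d (\<lambda>x. u (glue j i x))"
    using deg_le_cong[of V "\<lambda>x. u (glue i j ({} \<triangle> pull (id(j := i)) V x))" "\<lambda>x. u (glue j i x)" d] by blast
  then show ?thesis using c by (auto simp: collapses_def)
qed

text \<open>The constant 6 is \<open>3 * 2\<close>: a third of the collapsing variables have their
  chosen partners outside the selected set, and by \<open>glued_partners\<close> such a set has at
  most \<open>2 * d\<close> elements.\<close>

lemma few_collapses:
  assumes V: "finite V" and u: "pm V u" "rm V d u" "\<not> deg_le V d u"
  shows "card {i. \<exists>j. collapses V d u i j} \<le> 6 * d"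
proof -
  define A where "A = {i. \<exists>j. collapses V d u i j}"
  have A: "A \<subseteq> V" by (auto simp: A_def collapses_def)
  have fA: "finite A" using A V finite_subset by blast
  define q where "q i = (SOME j. collapses V d u i j)" for i
  have q: "collapses V d u i (q i)" if "i \<in> A" for i
    using that unfolding A_def q_def by (auto intro: someI)
  obtain I where I: "I \<subseteq> A" "card A \<le> 3 * card I" "\<forall>v\<in>I. q v \<notin> I"
    using independent_subset[OF fA, of q] q unfolding collapses_def by metis
  have "\<not> 2 * d < card I"
  proof
    assume "2 * d < card I"
    then have "deg_le V d u"
      by (intro glued_partners[OF V u(1,2), of I q]) (use I A q in \<open>auto simp: collapses_def\<close>)
    then show False using u(3) by simp
  qed
  then show ?thesis using I(2) unfolding A_def by linarith
qed

text \<open>Block \<open>R - 1\<close> takes over the label of the vanished block \<open>i\<close>,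
  so that the labels remain an initial segment. The choice \<open>j = i\<close> therefore merges
  \<open>i\<close> with \<open>R - 1\<close>.\<close>

definition mergemap :: "nat \<Rightarrow> nat \<Rightarrow> nat \<Rightarrow> nat \<Rightarrow> nat" where
  "mergemap R i j v = (if v = i then j else if v = R - 1 then i else v)"

lemma mergemap_less: "i < R \<Longrightarrow> j < R - 1 \<Longrightarrow> v < R \<Longrightarrow> mergemap R i j v < R - 1"
  by (auto simp: mergemap_def)

text \<open>The map \<open>\<sigma>\<close> undoes the renaming of the last label, and substituting
  it back turns a merge into a gluing on the original \<open>R\<close> blocks.\<close>

lemma merge_collapses:
  assumes ij: "i < R" "j < R - 1" and deg: "deg_le {..<R - 1} d (\<lambda>y. u (pull (mergemap R i j) {..<R} y))"
  shows "collapses {..<R} d u i (if j = i then R - 1 else j)"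
proof -
  define \<sigma> where "\<sigma> k = (if k = i then R - 1 else k)" for k
  have "deg_le {..<R} d (\<lambda>x. u (pull (mergemap R i j) {..<R} ({} \<triangle> pull \<sigma> {..<R - 1} x)))"
    by (rule deg_le_pull[OF _ _ deg]) (auto simp: \<sigma>_def)
  moreover have "pull (mergemap R i j) {..<R} ({} \<triangle> pull \<sigma> {..<R - 1} x) = glue i (if j = i then R - 1 else j) x"
    if "x \<subseteq> {..<R}" for x
  proof (rule set_eqI)
    fix l
    show "l \<in> pull (mergemap R i j) {..<R} ({} \<triangle> pull \<sigma> {..<R - 1} x) \<longleftrightarrow> l \<in> glue i (if j = i then R - 1 else j) x"
      using ij that by (auto simp: pull_def glue_def \<sigma>_def mergemap_def)
  qed
  ultimately have "deg_le {..<R} d (\<lambda>x. u (glue i (if j = i then R - 1 else j) x))"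
    using deg_le_cong[of "{..<R}" "\<lambda>x. u (pull (mergemap R i j) {..<R} ({} \<triangle> pull \<sigma> {..<R - 1} x))"
        "\<lambda>x. u (glue i (if j = i then R - 1 else j) x)" d] by simp
  then show ?thesis using ij by (auto simp: collapses_def)
qed

section \<open>Probability that random merging lowers the degree\<close>

lemma prob_bind_pmf: "measure_pmf.prob (bind_pmf p q) E = measure_pmf.expectation p (\<lambda>x. measure_pmf.prob (q x) E)"
proof -
  have "ennreal (measure_pmf.prob (bind_pmf p q) E) = (\<integral>\<^sup>+x. ennreal (measure_pmf.prob (q x) E) \<partial>p)"
    by (simp add: measure_pmf.emeasure_eq_measure[symmetric])
  also have "\<dots> = ennreal (measure_pmf.expectation p (\<lambda>x. measure_pmf.prob (q x) E))"
    by (rule nn_integral_eq_integral) (auto intro!: measure_pmf.integrable_const_bound[where B = 1])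
  finally show ?thesis by (simp add: integral_nonneg_AE)
qed

lemma prob_bind_le:
  assumes "\<And>x. x \<in> set_pmf p \<Longrightarrow> x \<in> B \<Longrightarrow> measure_pmf.prob (q x) E \<le> c"
    "\<And>x. x \<in> set_pmf p \<Longrightarrow> x \<notin> B \<Longrightarrow> measure_pmf.prob (q x) E \<le> c'" "c' \<ge> 0"
    "measure_pmf.prob p B \<le> e" "c \<ge> 0"
  shows "measure_pmf.prob (bind_pmf p q) E \<le> e * c + c'"
proof -
  have "measure_pmf.prob (bind_pmf p q) E \<le> measure_pmf.expectation p (\<lambda>x. c * indicator B x + c')"
    unfolding prob_bind_pmf
  proof (rule integral_mono_AE)
    show "AE x in p. measure_pmf.prob (q x) E \<le> c * indicator B x + c'"
    proof (rule AE_pmfI)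
      fix x assume "x \<in> set_pmf p"
      then show "measure_pmf.prob (q x) E \<le> c * indicator B x + c'"
        using assms(1)[of x] assms(2)[of x] assms(3) by (cases "x \<in> B") auto
    qed
    show "integrable p (\<lambda>x. measure_pmf.prob (q x) E)"
      by (rule measure_pmf.integrable_const_bound[where B = 1]) auto
    show "integrable p (\<lambda>x. c * indicator B x + c')"
      by (rule measure_pmf.integrable_const_bound[where B = "\<bar>c\<bar> + \<bar>c'\<bar>"]) (auto split: split_indicator)
  qed
  also have "\<dots> = c * measure_pmf.prob p B + c'"
    by (subst Bochner_Integration.integral_add) (auto intro!: measure_pmf.integrable_const_bound[where B = 1] split: split_indicator)
  also have "\<dots> \<le> c * e + c'" using assms(4,5) by (simp add: mult_left_mono)
  finally show ?thesis by (simp add: mult.commute)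
qed

lemma prob_mono_on_support:
  assumes "set_pmf p \<inter> A \<subseteq> B"
  shows "measure_pmf.prob p A \<le> measure_pmf.prob p B"
proof -
  have "measure_pmf.prob p A = measure_pmf.prob p (A \<inter> set_pmf p)" by (rule measure_Int_set_pmf[symmetric])
  also have "\<dots> \<le> measure_pmf.prob p B" by (rule measure_pmf.finite_measure_mono) (use assms in auto)
  finally show ?thesis .
qed

definition bits :: "nat \<Rightarrow> nat" where "bits R = (LEAST b. R \<le> 2 ^ b)"

text \<open>Fair coins do not in general give a uniform value below \<open>R\<close> in bounded
  time. With a single reduction of a uniform number of \<open>bits R\<close> digits, each value has
  at most twice its fair share, and this factor is absorbed by the constants.\<close>

definition rnd :: "nat \<Rightarrow> nat pmf" where
  "rnd R = map_pmf (\<lambda>t. if R \<le> t then t - R else t) (pmf_of_set {..<2 ^ bits R})"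

lemma bits_ge: "R \<le> 2 ^ bits R"
  unfolding bits_def by (rule LeastI[of _ R]) (simp add: less_imp_le)

lemma bits_less: "b < bits R \<Longrightarrow> 2 ^ b < R"
  unfolding bits_def using not_less_Least by (auto simp: not_le[symmetric])

lemma bits_upper: "0 < R \<Longrightarrow> 2 ^ bits R < 2 * R"
  using bits_less[of "bits R - 1" R] by (cases "bits R") auto

lemma rnd_less: "0 < R \<Longrightarrow> i \<in> set_pmf (rnd R) \<Longrightarrow> i < R"
  using bits_upper[of R] by (auto simp: rnd_def set_pmf_of_set lessThan_empty_iff split: if_splits)

lemma rnd_prob:
  assumes "0 < R" "finite B"
  shows "measure_pmf.prob (rnd R) B \<le> 2 * real (card B) / real R"
proof -
  let ?b = "2 ^ bits R :: nat"
  have "{..<?b} \<inter> (\<lambda>t. if R \<le> t then t - R else t) -` B \<subseteq> B \<union> (+) R ` B"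
  proof
    fix t assume "t \<in> {..<?b} \<inter> (\<lambda>t. if R \<le> t then t - R else t) -` B"
    then show "t \<in> B \<union> (+) R ` B" by (cases "R \<le> t") (auto simp: image_iff intro: bexI[of _ "t - R"])
  qed
  then have "card ({..<?b} \<inter> (\<lambda>t. if R \<le> t then t - R else t) -` B) \<le> card (B \<union> (+) R ` B)"
    using assms by (intro card_mono) auto
  also have "\<dots> \<le> card B + card B"
    by (rule order_trans[OF card_Un_le]) (use card_image_le[OF assms(2)] in simp)
  finally have c: "card ({..<?b} \<inter> (\<lambda>t. if R \<le> t then t - R else t) -` B) \<le> 2 * card B" by simp
  have "measure_pmf.prob (rnd R) B = real (card ({..<?b} \<inter> (\<lambda>t. if R \<le> t then t - R else t) -` B)) / real ?b"
    unfolding rnd_def measure_map_pmf by (subst measure_pmf_of_set) (auto simp: lessThan_empty_iff)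
  also have "\<dots> \<le> real (2 * card B) / real R"
    using c bits_ge[of R] assms(1) by (intro frac_le) (simp_all only: of_nat_le_iff of_nat_0_less_iff of_nat_0_le_iff)
  finally show ?thesis by simp
qed

definition hash_step :: "nat \<Rightarrow> (nat \<Rightarrow> nat) \<Rightarrow> (nat \<Rightarrow> nat) pmf" where
  "hash_step R lab = bind_pmf (rnd R) (\<lambda>i. map_pmf (\<lambda>j. mergemap R i j \<circ> lab) (rnd (R - 1)))"

definition hash :: "nat \<Rightarrow> nat \<Rightarrow> (nat \<Rightarrow> nat) pmf" where
  "hash n N = loopM N 0 (\<lambda>k. hash_step (n - k)) id"

lemma hash_Suc: "hash n (Suc N) = bind_pmf (hash n N) (hash_step (n - N))"
  unfolding hash_def loopM_snoc by simp

lemma hash_0: "hash n 0 = return_pmf id" by (simp add: hash_def)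

lemma hash_less:
  assumes "lab \<in> set_pmf (hash n N)" "N < n" "v < n"
  shows "lab v < n - N"
  using assms
proof (induction N arbitrary: lab)
  case 0
  then show ?case by (simp add: hash_0)
next
  case (Suc N)
  from Suc.prems obtain lab' i j where l: "lab' \<in> set_pmf (hash n N)" "i \<in> set_pmf (rnd (n - N))"
    "j \<in> set_pmf (rnd (n - N - 1))" "lab = mergemap (n - N) i j \<circ> lab'"
    unfolding hash_Suc hash_step_def by auto
  have "lab' v < n - N" using Suc.IH[OF l(1)] Suc.prems by simp
  moreover have "i < n - N" "j < n - N - 1" using l rnd_less Suc.prems by auto
  ultimately have "mergemap (n - N) i j (lab' v) < n - N - 1" by (intro mergemap_less) auto
  then show ?case using l(4) by simp
qed

text \<open>Both merged blocks must be among the at most \<open>6 * d\<close> collapsing ones, and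
  \<open>rnd\<close> loses a factor of 2 in each draw, whence \<open>12 * 12 = 144\<close>.\<close>

lemma hash_step_degree:
  assumes R: "2 \<le> R" and lab: "\<And>v. v < n \<Longrightarrow> lab v < R" and a: "a \<subseteq> {..<n}"
    and g: "pm {..<n} g" "rm {..<n} d g" and nd: "\<not> deg_le {..<R} d (\<lambda>y. g (a \<triangle> pull lab {..<n} y))"
  shows "measure_pmf.prob (hash_step R lab) {l. deg_le {..<R - 1} d (\<lambda>y. g (a \<triangle> pull l {..<n} y))}
     \<le> 144 * (real d)\<^sup>2 / (real R * real (R - 1))"
proof -
  define u where "u y = g (a \<triangle> pull lab {..<n} y)" for y
  define A where "A = {i. \<exists>j. collapses {..<R} d u i j}"
  have u: "pm {..<R} u" "rm {..<R} d u"
    unfolding u_def using rm_pull[OF g(2) a] g(1) a by (auto simp: pm_def)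
  have cA: "card A \<le> 6 * d" unfolding A_def by (rule few_collapses) (use u nd in \<open>auto simp: u_def[abs_def]\<close>)
  have "A \<subseteq> {..<R}" by (auto simp: A_def collapses_def)
  then have fA: "finite A" using finite_subset by blast
  have pu: "g (a \<triangle> pull (mergemap R i j \<circ> lab) {..<n} y) = u (pull (mergemap R i j) {..<R} y)" for i j y
  proof -
    have "pull (mergemap R i j \<circ> lab) {..<n} y = pull lab {..<n} (pull (mergemap R i j) {..<R} y)"
      using lab by (auto simp: pull_def)
    then show ?thesis by (simp add: u_def)
  qed
  let ?E = "{l. deg_le {..<R - 1} d (\<lambda>y. g (a \<triangle> pull l {..<n} y))}"
  have hit: "i \<in> A \<and> (if j = i then R - 1 else j) \<in> A"
    if "i < R" "j < R - 1" "mergemap R i j \<circ> lab \<in> ?E" for i j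
  proof -
    have "deg_le {..<R - 1} d (\<lambda>y. u (pull (mergemap R i j) {..<R} y))" using that(3) pu by simp
    from merge_collapses[OF that(1,2) this] show ?thesis
      using collapses_sym[OF finite_lessThan] unfolding A_def by blast
  qed
  have b1: "measure_pmf.prob (map_pmf (\<lambda>j. mergemap R i j \<circ> lab) (rnd (R - 1))) ?E \<le> 12 * real d / real (R - 1)"
    if i: "i \<in> set_pmf (rnd R)" for i
  proof -
    \<comment> \<open>The draw \<open>j = i\<close> stands for partner \<open>R - 1\<close>, so
      \<open>i\<close> replaces that element in the set of fatal values.\<close>
    define B where "B = (if R - 1 \<in> A then insert i (A - {R - 1}) else A)"
    have "Suc (card A - Suc 0) \<le> card A" if "R - 1 \<in> A" using card_gt_0_iff[of A] fA that by auto
    then have "card B \<le> card A" using fA by (auto simp: B_def card_insert_if)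
    then have cB: "card B \<le> 6 * d" using cA by simp
    have fB: "finite B" using fA by (simp add: B_def)
    have "measure_pmf.prob (map_pmf (\<lambda>j. mergemap R i j \<circ> lab) (rnd (R - 1))) ?E \<le> measure_pmf.prob (rnd (R - 1)) B"
      unfolding measure_map_pmf
    proof (rule prob_mono_on_support)
      show "set_pmf (rnd (R - 1)) \<inter> (\<lambda>j. mergemap R i j \<circ> lab) -` ?E \<subseteq> B"
      proof
        fix j assume j: "j \<in> set_pmf (rnd (R - 1)) \<inter> (\<lambda>j. mergemap R i j \<circ> lab) -` ?E"
        then have "j < R - 1" "i < R" using rnd_less[of "R - 1" j] rnd_less[of R i] R i by auto
        then show "j \<in> B" using hit[of i j] j by (auto simp: B_def split: if_splits)
      qed
    qed
    also have "\<dots> \<le> 2 * real (card B) / real (R - 1)" by (rule rnd_prob) (use R fB in auto)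
    also have "\<dots> \<le> 2 * real (6 * d) / real (R - 1)"
      by (intro divide_right_mono mult_left_mono) (use cB in \<open>simp_all del: of_nat_mult of_nat_numeral\<close>)
    finally show ?thesis by simp
  qed
  have "measure_pmf.prob (hash_step R lab) ?E \<le> (12 * real d / real R) * (12 * real d / real (R - 1)) + 0"
    unfolding hash_step_def
  proof (rule prob_bind_le[where B = A])
    fix i assume i: "i \<in> set_pmf (rnd R)" "i \<notin> A"
    have "measure_pmf.prob (map_pmf (\<lambda>j. mergemap R i j \<circ> lab) (rnd (R - 1))) ?E \<le> measure_pmf.prob (rnd (R - 1)) {}"
      unfolding measure_map_pmf
    proof (rule prob_mono_on_support)
      show "set_pmf (rnd (R - 1)) \<inter> (\<lambda>j. mergemap R i j \<circ> lab) -` ?E \<subseteq> {}"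
      proof
        fix j assume j: "j \<in> set_pmf (rnd (R - 1)) \<inter> (\<lambda>j. mergemap R i j \<circ> lab) -` ?E"
        then have "j < R - 1" "i < R" using rnd_less[of "R - 1" j] rnd_less[of R i] R i by auto
        then show "j \<in> {}" using hit[of i j] j i by auto
      qed
    qed
    then show "measure_pmf.prob (map_pmf (\<lambda>j. mergemap R i j \<circ> lab) (rnd (R - 1))) ?E \<le> 0" by simp
  next
    have "measure_pmf.prob (rnd R) A \<le> 2 * real (card A) / real R" by (rule rnd_prob) (use R fA in auto)
    also have "\<dots> \<le> 2 * real (6 * d) / real R"
      by (intro divide_right_mono mult_left_mono) (use cA in \<open>simp_all del: of_nat_mult of_nat_numeral\<close>)
    finally show "measure_pmf.prob (rnd R) A \<le> 12 * real d / real R" by simp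
  qed (use b1 in auto)
  then show ?thesis by (simp add: power2_eq_square algebra_simps)
qed

text \<open>The step bounds telescope by \<open>1 / (R * (R - 1)) = 1 / (R - 1) - 1 / R\<close>, so
  the total is controlled by the final number of blocks, however many merges are made.\<close>

lemma hash_degree:
  assumes a: "a \<subseteq> {..<n}" and g: "pm {..<n} g" "rm {..<n} d g" "\<not> deg_le {..<n} d g" and N: "N < n"
  shows "measure_pmf.prob (hash n N) {l. deg_le {..<n - N} d (\<lambda>y. g (a \<triangle> pull l {..<n} y))}
     \<le> 144 * (real d)\<^sup>2 * (1 / real (n - N) - 1 / real n)"
  using N
proof (induction N)
  case 0
  \<comment> \<open>Without merges only the shift by \<open>a\<close> remains, which is undone by
    shifting again.\<close>
  have "\<not> deg_le {..<n} d (\<lambda>y. g (a \<triangle> pull id {..<n} y))"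
  proof
    assume "deg_le {..<n} d (\<lambda>y. g (a \<triangle> pull id {..<n} y))"
    then have "deg_le {..<n} d (\<lambda>y. g (a \<triangle> pull id {..<n} (a \<triangle> pull id {..<n} y)))"
      by (intro deg_le_pull[where f = "\<lambda>y. g (a \<triangle> pull id {..<n} y)"]) (use a in auto)
    moreover have "g (a \<triangle> pull id {..<n} (a \<triangle> pull id {..<n} y)) = g y" if "y \<subseteq> {..<n}" for y
    proof -
      have "pull id {..<n} z = z" if "z \<subseteq> {..<n}" for z using that by (auto simp: pull_def)
      then show ?thesis using that a by simp
    qed
    ultimately have "deg_le {..<n} d g"
      using deg_le_cong[of "{..<n}" "\<lambda>y. g (a \<triangle> pull id {..<n} (a \<triangle> pull id {..<n} y))" g d] by blast
    then show False using g by simp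
  qed
  then show ?case by (simp add: hash_0)
next
  case (Suc N)
  define R where "R = n - N"
  have R: "2 \<le> R" "n - Suc N = R - 1" using Suc.prems by (auto simp: R_def)
  let ?B = "{l. deg_le {..<R} d (\<lambda>y. g (a \<triangle> pull l {..<n} y))}"
  let ?E = "{l. deg_le {..<R - 1} d (\<lambda>y. g (a \<triangle> pull l {..<n} y))}"
  have "measure_pmf.prob (hash n (Suc N)) ?E
     \<le> (144 * (real d)\<^sup>2 * (1 / real R - 1 / real n)) * 1 + 144 * (real d)\<^sup>2 / (real R * real (R - 1))"
    unfolding hash_Suc R_def[symmetric]
  proof (rule prob_bind_le[where B = ?B])
    show "measure_pmf.prob (hash n N) ?B \<le> 144 * (real d)\<^sup>2 * (1 / real R - 1 / real n)"
      using Suc unfolding R_def by simp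
    fix lab assume lab: "lab \<in> set_pmf (hash n N)" "lab \<notin> ?B"
    show "measure_pmf.prob (hash_step R lab) ?E \<le> 144 * (real d)\<^sup>2 / (real R * real (R - 1))"
      by (rule hash_step_degree[OF R(1) _ a g(1,2)]) (use lab hash_less[OF lab(1)] Suc.prems in \<open>auto simp: R_def\<close>)
  qed auto
  also have "1 / (real R * real (R - 1)) = 1 / real (R - 1) - 1 / real R" using R by (simp add: field_simps of_nat_diff)
  then have "144 * (real d)\<^sup>2 / (real R * real (R - 1)) = 144 * (real d)\<^sup>2 * (1 / real (R - 1) - 1 / real R)"
    by (metis mult.right_neutral times_divide_eq_right)
  finally show ?case unfolding R(2) by (simp add: algebra_simps)
qed

section \<open>Learning and verifying the spectrum\<close>

text \<open>Hoeffding's lemma for an interval of length 2, where the exponent is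
  \<open>l^2 * 2^2 / 8\<close>.\<close>

lemma mgf_bound:
  fixes Z :: "'a \<Rightarrow> real"
  assumes Z: "\<And>x. \<bar>Z x\<bar> \<le> 1" and l: "0 < l"
  shows "(\<integral>\<^sup>+x. exp (l * (Z x - measure_pmf.expectation q Z)) \<partial>measure_pmf q) \<le> ennreal (exp (l\<^sup>2 / 2))"
proof -
  define v where "v = measure_pmf.expectation q Z"
  have int: "integrable (measure_pmf q) Z" by (rule measure_pmf.integrable_const_bound[where B = 1]) (use Z in auto)
  interpret interval_bounded_random_variable "measure_pmf q" "\<lambda>x. Z x - v" "-1 - v" "1 - v"
  proof
    show "AE x in measure_pmf q. Z x - v \<in> {-1 - v..1 - v}" using Z by (auto simp: abs_le_iff)
  qed auto
  have "measure_pmf.expectation q (\<lambda>x. Z x - v) = 0"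
    unfolding v_def by (subst Bochner_Integration.integral_diff) (use int in auto)
  from Hoeffdings_lemma_nn_integral_0[OF l this]
  show ?thesis unfolding v_def[symmetric] by simp
qed

lemma chernoff_upper:
  fixes Z :: "'a \<Rightarrow> real"
  assumes Z: "\<And>x. \<bar>Z x\<bar> \<le> 1" and k: "0 < k" and c: "0 < c"
  shows "measure_pmf.prob (replicate_pmf k q) {xs. c \<le> sum_list (map Z xs) - real k * measure_pmf.expectation q Z}
    \<le> exp (- c\<^sup>2 / (2 * real k))"
proof -
  define v where "v = measure_pmf.expectation q Z"
  \<comment> \<open>The value that minimizes the exponent
    \<open>- l * c + k * l^2 / 2\<close>.\<close>
  define l where "l = c / real k"
  have l: "0 < l" using k c by (simp add: l_def)
  have mgf: "(\<integral>\<^sup>+xs. exp (l * (sum_list (map Z xs) - real j * v)) \<partial>measure_pmf (replicate_pmf j q)) \<le> ennreal (exp (real j * (l\<^sup>2 / 2)))" for j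
  proof (induction j)
    case 0
    then show ?case by simp
  next
    case (Suc j)
    have e: "ennreal (exp (l * (Z x + sum_list (map Z xs) - real (Suc j) * v)))
        = ennreal (exp (l * (Z x - v))) * ennreal (exp (l * (sum_list (map Z xs) - real j * v)))" for x xs
      by (simp add: ennreal_mult[symmetric] exp_add[symmetric] algebra_simps)
    have "(\<integral>\<^sup>+xs. exp (l * (sum_list (map Z xs) - real (Suc j) * v)) \<partial>measure_pmf (replicate_pmf (Suc j) q))
      = (\<integral>\<^sup>+x. (\<integral>\<^sup>+xs. ennreal (exp (l * (Z x - v))) * ennreal (exp (l * (sum_list (map Z xs) - real j * v))) \<partial>measure_pmf (replicate_pmf j q)) \<partial>measure_pmf q)"
      unfolding replicate_pmf.simps by (simp add: e del: of_nat_Suc)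
    also have "\<dots> = (\<integral>\<^sup>+x. ennreal (exp (l * (Z x - v))) \<partial>measure_pmf q)
        * (\<integral>\<^sup>+xs. ennreal (exp (l * (sum_list (map Z xs) - real j * v))) \<partial>measure_pmf (replicate_pmf j q))"
      by (simp add: nn_integral_cmult nn_integral_multc)
    also have "\<dots> \<le> ennreal (exp (l\<^sup>2 / 2)) * ennreal (exp (real j * (l\<^sup>2 / 2)))"
      by (intro mult_mono Suc) (use mgf_bound[of Z l q] Z l in \<open>simp_all add: v_def\<close>)
    also have "\<dots> = ennreal (exp (real (Suc j) * (l\<^sup>2 / 2)))"
      by (simp add: ennreal_mult[symmetric] exp_add[symmetric] algebra_simps add_divide_distrib)
    finally show ?case .
  qed
  let ?E = "{xs. c \<le> sum_list (map Z xs) - real k * v}"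
  have "ennreal (measure_pmf.prob (replicate_pmf k q) ?E) = (\<integral>\<^sup>+xs. indicator ?E xs \<partial>measure_pmf (replicate_pmf k q))"
    by (simp add: measure_pmf.emeasure_eq_measure)
  also have "\<dots> \<le> (\<integral>\<^sup>+xs. ennreal (exp (- l * c)) * ennreal (exp (l * (sum_list (map Z xs) - real k * v))) \<partial>measure_pmf (replicate_pmf k q))"
  proof (intro nn_integral_mono)
    fix xs
    show "indicator ?E xs \<le> ennreal (exp (- l * c)) * ennreal (exp (l * (sum_list (map Z xs) - real k * v)))"
    proof (cases "xs \<in> ?E")
      case True
      then have "l * c \<le> l * (sum_list (map Z xs) - real k * v)" using l by (intro mult_left_mono) auto
      then have "1 \<le> exp (- l * c + l * (sum_list (map Z xs) - real k * v))" by simp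
      then have "1 \<le> exp (- l * c) * exp (l * (sum_list (map Z xs) - real k * v))" by (simp only: exp_add)
      then have "ennreal 1 \<le> ennreal (exp (- l * c) * exp (l * (sum_list (map Z xs) - real k * v)))" by (intro ennreal_leI)
      then show ?thesis using True by (simp add: ennreal_mult)
    qed simp
  qed
  also have "\<dots> = ennreal (exp (- l * c)) * (\<integral>\<^sup>+xs. ennreal (exp (l * (sum_list (map Z xs) - real k * v))) \<partial>measure_pmf (replicate_pmf k q))"
    by (simp add: nn_integral_cmult)
  also have "\<dots> \<le> ennreal (exp (- l * c)) * ennreal (exp (real k * (l\<^sup>2 / 2)))"
    by (intro mult_left_mono mgf) simp
  also have "\<dots> = ennreal (exp (- c\<^sup>2 / (2 * real k)))"
    using k by (simp add: ennreal_mult[symmetric] exp_add[symmetric] l_def field_simps power2_eq_square)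
  finally show ?thesis by (simp add: v_def)
qed

lemma chernoff:
  fixes Z :: "'a \<Rightarrow> real"
  assumes Z: "\<And>x. \<bar>Z x\<bar> \<le> 1" and k: "0 < k" and c: "0 < c"
  shows "measure_pmf.prob (replicate_pmf k q) {xs. c \<le> \<bar>sum_list (map Z xs) - real k * measure_pmf.expectation q Z\<bar>}
    \<le> 2 * exp (- c\<^sup>2 / (2 * real k))"
proof -
  define v where "v = measure_pmf.expectation q Z"
  have neg: "sum_list (map (\<lambda>x. - Z x) xs) = - sum_list (map Z xs)" for xs
    by (induction xs) auto
  have "measure_pmf.prob (replicate_pmf k q) {xs. c \<le> \<bar>sum_list (map Z xs) - real k * v\<bar>}
    \<le> measure_pmf.prob (replicate_pmf k q) ({xs. c \<le> sum_list (map Z xs) - real k * v} \<union>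
        {xs. c \<le> sum_list (map (\<lambda>x. - Z x) xs) - real k * measure_pmf.expectation q (\<lambda>x. - Z x)})"
    by (rule measure_pmf.finite_measure_mono) (auto simp: neg v_def abs_if)
  also have "\<dots> \<le> exp (- c\<^sup>2 / (2 * real k)) + exp (- c\<^sup>2 / (2 * real k))"
    using chernoff_upper[of Z k c q] chernoff_upper[of "\<lambda>x. - Z x" k c q] assms
    by (intro order_trans[OF measure_Un_le] add_mono) (auto simp: v_def)
  finally show ?thesis by (simp add: v_def)
qed

lemma prob_bind_le_const:
  assumes "\<And>x. x \<in> set_pmf p \<Longrightarrow> measure_pmf.prob (q x) E \<le> c" "0 \<le> c"
  shows "measure_pmf.prob (bind_pmf p q) E \<le> c"
  using prob_bind_le[of p "{}" q E 0 c 0] assms by simp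

abbreviation rset :: "nat set \<Rightarrow> nat set pmf" where "rset V \<equiv> pmf_of_set (Pow V)"

lemma prob_rset: "finite V \<Longrightarrow> measure_pmf.prob (rset V) {x. P x} = av V (\<lambda>x. of_bool (P x))"
proof -
  assume V: "finite V"
  have "(\<Sum>x\<in>Pow V. of_bool (P x)) = real (card (Pow V \<inter> {x. P x}))"
    using V by (simp add: of_bool_def sum.If_cases)
  then show ?thesis using V by (subst measure_pmf_of_set) (auto simp: av_def card_Pow)
qed

lemma expectation_rset: "finite V \<Longrightarrow> measure_pmf.expectation (rset V) h = av V h"
  by (subst integral_pmf_of_set) (auto simp: av_def card_Pow)

lemma prob_rset_list:
  assumes V: "finite V"
  shows "measure_pmf.prob (replicate_pmf k (rset V)) {us. P us} = avl V k (\<lambda>us. of_bool (P us))"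
proof (induction k arbitrary: P)
  case 0
  show ?case by (simp add: indicator_def)
next
  case (Suc k)
  have "measure_pmf.prob (replicate_pmf (Suc k) (rset V)) {us. P us}
    = measure_pmf.expectation (rset V) (\<lambda>u. measure_pmf.prob (map_pmf ((#) u) (replicate_pmf k (rset V))) {us. P us})"
    by (simp only: replicate_pmf.simps prob_bind_pmf map_pmf_def)
  also have "\<dots> = avl V (Suc k) (\<lambda>us. of_bool (P us))"
    using Suc[of "\<lambda>us. P (_ # us)"] by (simp add: expectation_rset[OF V] vimage_def)
  finally show ?case .
qed

lemma set_rset: "finite V \<Longrightarrow> set_pmf (rset V) = Pow V"
  by (rule set_pmf_of_set) auto

lemma loop_check:
  "measure_pmf.prob (loopM N i (\<lambda>_ ok. map_pmf (\<lambda>x. ok \<and> P x) p) ok) {True}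
     = (if ok then measure_pmf.prob p {x. P x} ^ N else 0)"
proof (induction N arbitrary: i ok)
  case 0
  show ?case by (simp add: indicator_def)
next
  case (Suc N)
  have "measure_pmf.prob (loopM (Suc N) i (\<lambda>_ ok. map_pmf (\<lambda>x. ok \<and> P x) p) ok) {True}
    = measure_pmf.expectation p (\<lambda>x. if ok \<and> P x then measure_pmf.prob p {x. P x} ^ N else 0)"
    by (simp add: bind_map_pmf prob_bind_pmf Suc)
  also have "\<dots> = measure_pmf.expectation p (\<lambda>x. (if ok then measure_pmf.prob p {x. P x} ^ N else 0) * indicator {x. P x} x)"
    by (intro Bochner_Integration.integral_cong) (auto simp: indicator_def)
  also have "\<dots> = (if ok then measure_pmf.prob p {x. P x} ^ N else 0) * measure_pmf.prob p {x. P x}" by simp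
  finally show ?case by (simp add: mult.commute)
qed

section \<open>Hashing of sets by their characters at random rows\<close>

primrec dotb :: "nat \<Rightarrow> nat \<Rightarrow> nat \<Rightarrow> bool" where
  "dotb 0 b t = False"
| "dotb (Suc m) b t = ((odd b \<and> odd t) \<noteq> dotb m (b div 2) (t div 2))"

text \<open>The Walsh character of index \<open>b\<close> on binary numbers; its orthogonality
  separates the buckets.\<close>

definition dots :: "nat \<Rightarrow> nat \<Rightarrow> nat \<Rightarrow> real" where "dots m b t = (if dotb m b t then -1 else 1)"

lemma dots_Suc: "dots (Suc m) b t = (if odd b \<and> odd t then -1 else 1) * dots m (b div 2) (t div 2)"
  by (auto simp: dots_def)

lemma dots_0 [simp]: "dots 0 b t = 1" by (simp add: dots_def)

lemma dots_values: "dots m b t = 1 \<or> dots m b t = -1" by (simp add: dots_def)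

lemma dots_orth:
  "b < 2 ^ m \<Longrightarrow> b' < 2 ^ m \<Longrightarrow> (\<Sum>t<2 ^ m. dots m b t * dots m b' t) = (if b = b' then 2 ^ m else 0)"
proof (induction m arbitrary: b b')
  case (Suc m)
  have eq: "b = b' \<longleftrightarrow> (odd b \<longleftrightarrow> odd b') \<and> b div 2 = b' div 2"
    by (metis div_mult_mod_eq odd_iff_mod_2_eq_one even_iff_mod_2_eq_zero)
  have IH: "(\<Sum>t<2 ^ m. dots m (b div 2) t * dots m (b' div 2) t) = (if b div 2 = b' div 2 then 2 ^ m else 0)"
    by (rule Suc.IH) (use Suc.prems in auto)
  have "(\<Sum>t<2 ^ Suc m. dots (Suc m) b t * dots (Suc m) b' t)
     = (\<Sum>t<2 ^ m. (if odd b \<longleftrightarrow> odd b' then 2 else 0) * (dots m (b div 2) t * dots m (b' div 2) t))"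
    unfolding power_Suc sum_double by (rule sum.cong) (auto simp: dots_Suc)
  then show ?case unfolding sum_distrib_left[symmetric] IH using eq by auto
qed simp

primrec code :: "nat set \<Rightarrow> nat set list \<Rightarrow> nat" where
  "code S [] = 0"
| "code S (u # us) = (if chi S u = -1 then 1 else 0) + 2 * code S us"

lemma code_less: "code S us < 2 ^ length us"
  by (induction us) auto

text \<open>On combinations of the rows a character depends only on its code, as the Walsh character
  of that index.\<close>

lemma chi_lin: "chi S (lin t us) = dots (length us) (code S us) t"
proof (induction us arbitrary: t)
  case (Cons u us)
  have "chi S u = 1 \<or> chi S u = -1" by (rule chi_values)
  then show ?case by (auto simp: chi_sd Cons.IH dots_Suc)
qed simp

text \<open>\<open>code S us\<close> is a random linear hash of \<open>S\<close>. With high probability it separates the spectrum, and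
  then a bucket holds a single coefficient, whose sign at \<open>{i}\<close> tells whether \<open>i\<close> is in its set.\<close>

definition bucket :: "nat set \<Rightarrow> (nat set \<Rightarrow> real) \<Rightarrow> nat set list \<Rightarrow> nat set \<Rightarrow> nat \<Rightarrow> real" where
  "bucket V F us e b = (\<Sum>S\<in>{S\<in>Pow V. code S us = b}. fc V F S * chi S e)"

text \<open>A Walsh transform over the indices \<open>t\<close> separates the characters by their
  codes. Characters with equal codes coincide on combinations of the rows, hence the sum in a
  bucket.\<close>

lemma bucket_mean:
  assumes V: "finite V" and us: "set us \<subseteq> Pow V" and e: "e \<subseteq> V" and b: "b < 2 ^ length us"
  shows "(\<Sum>t<2 ^ length us. F (e \<triangle> lin t us) * dots (length us) b t) / 2 ^ length us = bucket V F us e b"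
proof -
  let ?m = "length us"
  have "(\<Sum>t<2 ^ ?m. F (e \<triangle> lin t us) * dots ?m b t)
    = (\<Sum>t<2 ^ ?m. \<Sum>S\<in>Pow V. fc V F S * chi S e * (dots ?m (code S us) t * dots ?m b t))"
  proof (rule sum.cong)
    fix t
    have "F (e \<triangle> lin t us) = (\<Sum>S\<in>Pow V. fc V F S * chi S (e \<triangle> lin t us))"
      by (rule fc_inversion[OF V]) (use lin_subset[OF us] e in auto)
    then show "F (e \<triangle> lin t us) * dots ?m b t = (\<Sum>S\<in>Pow V. fc V F S * chi S e * (dots ?m (code S us) t * dots ?m b t))"
      by (simp add: chi_sd chi_lin sum_distrib_right mult.assoc)
  qed simp
  also have "\<dots> = (\<Sum>S\<in>Pow V. fc V F S * chi S e * (\<Sum>t<2 ^ ?m. dots ?m (code S us) t * dots ?m b t))"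
    by (subst sum.swap) (simp add: sum_distrib_left)
  also have "\<dots> = (\<Sum>S\<in>Pow V. fc V F S * chi S e * (if code S us = b then 2 ^ ?m else 0))"
    by (simp add: dots_orth code_less b)
  also have "\<dots> = (\<Sum>S\<in>{S\<in>Pow V. code S us = b}. fc V F S * chi S e * 2 ^ ?m)"
    by (rule sum.mono_neutral_cong_right) (use V in auto)
  finally show ?thesis by (simp add: bucket_def sum_distrib_right[symmetric])
qed

lemma code_collision:
  assumes V: "finite V" and "S \<subseteq> V" "T \<subseteq> V" "S \<noteq> T"
  shows "avl V k (\<lambda>us. of_bool (code S us = code T us)) = 1 / 2 ^ k"
proof (induction k)
  case (Suc k)
  have fin: "finite S" "finite T" using assms finite_subset by blast+
  note ml = mean_itav[OF mean_av[OF V], of k]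
  have "(of_bool (code S (u # us) = code T (u # us)) :: real)
     = (1 / 2 + 1 / 2 * chi (S \<triangle> T) u) * of_bool (code S us = code T us)" for u us
  proof -
    have "code S (u # us) = code T (u # us) \<longleftrightarrow> chi S u = chi T u \<and> code S us = code T us"
      using chi_values[of S u] chi_values[of T u] by auto presburger+
    then show ?thesis using chi_values[of S u] chi_values[of T u] by (auto simp: chi_sd_left fin)
  qed
  then have "avl V (Suc k) (\<lambda>us. of_bool (code S us = code T us))
    = av V (\<lambda>u. (1 / 2 + 1 / 2 * chi (S \<triangle> T) u) * (1 / 2 ^ k))"
    by (simp only: itav.simps mean_cmult[OF ml] Suc)
  also have "\<dots> = (1 / 2 + 1 / 2 * av V (chi (S \<triangle> T))) * (1 / 2 ^ k)"
    by (simp only: av_multc av_add av_cmult av_const[OF V])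
  also have "av V (chi (S \<triangle> T)) = 0" using av_chi[OF V, of "S \<triangle> T"] assms by auto
  finally show ?case by simp
qed simp

definition spectrum :: "nat set \<Rightarrow> (nat set \<Rightarrow> real) \<Rightarrow> nat set set" where
  "spectrum V F = {S\<in>Pow V. fc V F S \<noteq> 0}"

text \<open>A row separates two distinct sets with probability 1/2, and a spectrum of at most
  \<open>4 ^ d\<close> sets has at most \<open>16 ^ d\<close> ordered pairs.\<close>

lemma code_injective:
  assumes V: "finite V" and F: "pm V F" "deg_le V d F"
  shows "measure_pmf.prob (replicate_pmf k (rset V)) {us. \<not> inj_on (\<lambda>S. code S us) (spectrum V F)} \<le> 16 ^ d / 2 ^ k"
proof -
  define Z where "Z = spectrum V F"
  have fZ: "finite Z" using V by (simp add: Z_def spectrum_def)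
  have cZ: "card Z \<le> 4 ^ d" unfolding Z_def spectrum_def by (rule spectrum_card[OF V F])
  define J where "J = {(S, T)\<in>Z \<times> Z. S \<noteq> T}"
  have fJ: "finite J" unfolding J_def by (rule finite_subset[of _ "Z \<times> Z"]) (use fZ in auto)
  have cJ: "card J \<le> 16 ^ d"
  proof -
    have "card J \<le> card (Z \<times> Z)" unfolding J_def by (rule card_mono) (use fZ in auto)
    also have "\<dots> \<le> 4 ^ d * 4 ^ d" unfolding card_cartesian_product by (rule mult_mono) (use cZ in auto)
    also have "\<dots> = 16 ^ d" by (simp flip: power_mult_distrib)
    finally show ?thesis .
  qed
  note ml = mean_itav[OF mean_av[OF V], of k]
  have "measure_pmf.prob (replicate_pmf k (rset V)) {us. \<not> inj_on (\<lambda>S. code S us) Z}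
    = avl V k (\<lambda>us. of_bool (\<not> inj_on (\<lambda>S. code S us) Z))" by (rule prob_rset_list[OF V])
  also have "\<dots> \<le> avl V k (\<lambda>us. \<Sum>(S, T)\<in>J. of_bool (code S us = code T us))"
  proof (rule mean_mono[OF ml])
    fix us
    show "(of_bool (\<not> inj_on (\<lambda>S. code S us) Z) :: real) \<le> (\<Sum>(S, T)\<in>J. of_bool (code S us = code T us))"
    proof (cases "inj_on (\<lambda>S. code S us) Z")
      case True
      then show ?thesis by (auto intro!: sum_nonneg)
    next
      case False
      then obtain S T where ST: "(S, T) \<in> J" "code S us = code T us" by (auto simp: inj_on_def J_def)
      have "(\<lambda>(S, T). of_bool (code S us = code T us) :: real) (S, T) \<le> (\<Sum>(S, T)\<in>J. of_bool (code S us = code T us))"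
        by (rule member_le_sum[OF ST(1)]) (use fJ in auto)
      then show ?thesis using False ST by simp
    qed
  qed
  also have "\<dots> = (\<Sum>(S, T)\<in>J. 1 / 2 ^ k)"
    unfolding case_prod_unfold mean_sum[OF ml fJ]
  proof (rule sum.cong)
    fix j assume "j \<in> J"
    then show "avl V k (\<lambda>us. of_bool (code (fst j) us = code (snd j) us)) = 1 / 2 ^ k"
      by (intro code_collision[OF V]) (auto simp: J_def Z_def spectrum_def)
  qed simp
  also have "\<dots> = real (card J) / 2 ^ k" by simp
  also have "\<dots> \<le> 16 ^ d / 2 ^ k"
    by (rule divide_right_mono) (use of_nat_mono[OF cJ, where 'a = real] in simp_all)
  finally show ?thesis by (simp add: Z_def)
qed

section \<open>Estimation of the coefficients in the buckets\<close>

definition hits :: "(nat set \<Rightarrow> real) \<Rightarrow> nat set list \<Rightarrow> nat set \<Rightarrow> nat list \<Rightarrow> nat \<Rightarrow> nat" where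
  "hits F us e ts b = length (filter (\<lambda>t. (F (e \<triangle> lin t us) = 1) \<noteq> dotb (length us) b t) ts)"

text \<open>The coefficients are multiples of \<open>1 / 2 ^ d\<close> in \<open>[-1, 1]\<close>; the number \<open>k\<close> stands for \<open>k / 2 ^ d - 1\<close>.\<close>

definition rounded :: "nat \<Rightarrow> (nat \<Rightarrow> nat) \<Rightarrow> nat \<Rightarrow> nat" where
  "rounded u C b = (2 * C b + u div 2) div u"

text \<open>One sample of \<open>M\<close> indices is evaluated for all \<open>2 ^ length us\<close>
  buckets, so the number of queries does not depend on the number of buckets.\<close>

definition estimate :: "(nat set \<Rightarrow> real) \<Rightarrow> nat set list \<Rightarrow> nat \<Rightarrow> nat \<Rightarrow> nat set \<Rightarrow> (nat \<Rightarrow> nat) pmf" where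
  "estimate F us u M e = map_pmf (\<lambda>ts. rounded u (hits F us e ts)) (replicate_pmf M (pmf_of_set {..<2 ^ length us}))"

definition accurate :: "nat set \<Rightarrow> (nat set \<Rightarrow> real) \<Rightarrow> nat set list \<Rightarrow> nat \<Rightarrow> nat set \<Rightarrow> (nat \<Rightarrow> nat) \<Rightarrow> bool" where
  "accurate V F us d e k \<longleftrightarrow> (\<forall>b<2 ^ length us. real (k b) = 2 ^ d + 2 ^ d * bucket V F us e b)"

lemma hits_sum:
  assumes "pm V F" "e \<subseteq> V" "set us \<subseteq> Pow V"
  shows "sum_list (map (\<lambda>t. F (e \<triangle> lin t us) * dots (length us) b t) ts) = 2 * real (hits F us e ts b) - real (length ts)"
proof (induction ts)
  case (Cons t ts)
  have "F (e \<triangle> lin t us) = 1 \<or> F (e \<triangle> lin t us) = -1"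
    by (rule pmD[OF assms(1)]) (use lin_subset[OF assms(3)] assms(2) in auto)
  then show ?case using Cons by (auto simp: hits_def dots_def)
qed (simp add: hits_def)

text \<open>With \<open>M = u * 2 ^ d\<close>, a change of the mean by \<open>1 / 2 ^ d\<close>
  changes the sum of the signs by \<open>u\<close>; adding \<open>u div 2\<close> before dividing
  turns truncation into rounding to the nearest multiple.\<close>

lemma round_correct:
  fixes C u d M :: nat and k :: int
  assumes u: "0 < u" "even u" and M: "M = u * 2 ^ d" and e: "\<bar>2 * real C - real M - real u * of_int k\<bar> < real u / 2"
  shows "real ((2 * C + u div 2) div u) = 2 ^ d + of_int k"
proof -
  have h: "real (u div 2) = real u / 2" using u by auto
  have "int ((2 * C + u div 2) div u) = 2 ^ d + k"
  proof -
    have r: "real u * (2 ^ d + of_int k) < real (2 * C + u div 2)" "real (2 * C + u div 2) < real u * (2 ^ d + of_int k) + real u"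
    proof -
      have e1: "2 * real C - real M - real u * of_int k < real u / 2" "- (2 * real C - real M - real u * of_int k) < real u / 2"
        using e unfolding abs_less_iff by auto
      have c: "real (2 * C + u div 2) = 2 * real C + real u / 2" using h by simp
      show "real u * (2 ^ d + of_int k) < real (2 * C + u div 2)" "real (2 * C + u div 2) < real u * (2 ^ d + of_int k) + real u"
        using e1 unfolding c M by (simp_all add: algebra_simps)
    qed
    have "real_of_int (int u * (2 ^ d + k)) \<le> real_of_int (int (2 * C + u div 2))"
      "real_of_int (int (2 * C + u div 2)) < real_of_int (int u * (2 ^ d + k) + int u)"
      using r by simp_all
    then have i: "int u * (2 ^ d + k) \<le> int (2 * C + u div 2)" "int (2 * C + u div 2) < int u * (2 ^ d + k) + int u"
      by (simp_all only: of_int_le_iff of_int_less_iff)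
    have "int (2 * C + u div 2) div int u = 2 ^ d + k"
      by (rule int_div_pos_eq[of _ _ _ "int (2 * C + u div 2) - int u * (2 ^ d + k)"]) (use i in auto)
    then show ?thesis by (simp only: zdiv_int)
  qed
  then have "real_of_int (int ((2 * C + u div 2) div u)) = real_of_int (2 ^ d + k)" by (simp only:)
  then show ?thesis by simp
qed

lemma bucket_integer:
  assumes V: "finite V" and F: "pm V F" "deg_le V d F"
  shows "\<exists>k::int. 2 ^ d * bucket V F us e b = of_int k"
proof -
  have "chi S e \<in> \<int>" for S using chi_values[of S e] by auto
  then have "(\<Sum>S\<in>{S\<in>Pow V. code S us = b}. 2 ^ d * fc V F S * chi S e) \<in> \<int>"
    by (intro Ints_sum) (rule Ints_mult, use granular_weak[OF V F] in auto)
  then have "2 ^ d * bucket V F us e b \<in> \<int>"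
    by (simp add: bucket_def sum_distrib_left mult.assoc)
  then show ?thesis by (elim Ints_cases) auto
qed

text \<open>Rounding tolerates a deviation below \<open>u / 2\<close> in a sum of
  \<open>M = u * 2 ^ d\<close> signs, giving the exponent
  \<open>(u / 2)^2 / (2 * M) = u / (8 * 2 ^ d)\<close>; the union bound is over the buckets.\<close>

lemma estimate_accurate:
  assumes V: "finite V" and F: "pm V F" "deg_le V d F" and us: "set us \<subseteq> Pow V" and e: "e \<subseteq> V"
    and u: "0 < u" "even u" and M: "M = u * 2 ^ d"
  shows "measure_pmf.prob (estimate F us u M e) {k. \<not> accurate V F us d e k}
     \<le> 2 ^ length us * (2 * exp (- real u / (8 * 2 ^ d)))"
proof -
  let ?m = "length us"
  let ?q = "pmf_of_set {..<(2::nat) ^ ?m}"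
  define Z where "Z b t = F (e \<triangle> lin t us) * dots ?m b t" for b t
  have Fv: "F (e \<triangle> lin t us) = 1 \<or> F (e \<triangle> lin t us) = -1" for t
    by (rule pmD[OF F(1)]) (use lin_subset[OF us] e in auto)
  have Z: "\<bar>Z b t\<bar> \<le> 1" for b t
    using Fv[of t] dots_values[of ?m b t] by (auto simp: Z_def)
  have q: "measure_pmf.expectation ?q (Z b) = bucket V F us e b" if "b < 2 ^ ?m" for b
    using bucket_mean[OF V us e that, of F] by (subst integral_pmf_of_set) (auto simp: Z_def lessThan_empty_iff)
  have M0: "0 < M" using u M by simp
  define bad where "bad b = {ts. real u / 2 \<le> \<bar>sum_list (map (Z b) ts) - real M * bucket V F us e b\<bar>}" for b
  have pbad: "measure_pmf.prob (replicate_pmf M ?q) (bad b) \<le> 2 * exp (- real u / (8 * 2 ^ d))" if "b < 2 ^ ?m" for b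
  proof -
    have "measure_pmf.prob (replicate_pmf M ?q) (bad b) \<le> 2 * exp (- (real u / 2)\<^sup>2 / (2 * real M))"
      unfolding bad_def q[OF that, symmetric] by (rule chernoff[OF Z M0]) (use u in simp)
    also have "(real u / 2)\<^sup>2 / (2 * real M) = real u / (8 * 2 ^ d)"
      using u by (simp add: M power2_eq_square field_simps)
    then have "- (real u / 2)\<^sup>2 / (2 * real M) = - real u / (8 * 2 ^ d)" by (simp only: minus_divide_left[symmetric])
    finally show ?thesis .
  qed
  have "measure_pmf.prob (estimate F us u M e) {k. \<not> accurate V F us d e k}
     \<le> measure_pmf.prob (replicate_pmf M ?q) (\<Union>b\<in>{..<2 ^ ?m}. bad b)"
    unfolding estimate_def measure_map_pmf
  proof (rule prob_mono_on_support)
    show "set_pmf (replicate_pmf M ?q) \<inter> (\<lambda>ts. rounded u (hits F us e ts)) -` {k. \<not> accurate V F us d e k} \<subseteq> (\<Union>b\<in>{..<2 ^ ?m}. bad b)"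
    proof
      fix ts assume ts: "ts \<in> set_pmf (replicate_pmf M ?q) \<inter> (\<lambda>ts. rounded u (hits F us e ts)) -` {k. \<not> accurate V F us d e k}"
      then have l: "length ts = M" by (auto simp: set_replicate_pmf)
      from ts obtain b where b: "b < 2 ^ ?m" "real (rounded u (hits F us e ts) b) \<noteq> 2 ^ d + 2 ^ d * bucket V F us e b"
        by (auto simp: accurate_def)
      obtain k :: int where k: "2 ^ d * bucket V F us e b = of_int k" using bucket_integer[OF V F] by blast
      have Mb: "real M * bucket V F us e b = real u * of_int k" unfolding M using k by (simp add: mult.assoc)
      have "ts \<in> bad b"
      proof (rule ccontr)
        assume "ts \<notin> bad b"
        then have "\<bar>2 * real (hits F us e ts b) - real M - real u * of_int k\<bar> < real u / 2"
          using hits_sum[OF F(1) e us, of b ts] l Mb by (simp add: bad_def Z_def[abs_def])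
        from round_correct[OF u M this] show False using b(2) k by (simp add: rounded_def)
      qed
      then show "ts \<in> (\<Union>b\<in>{..<2 ^ ?m}. bad b)" using b(1) by blast
    qed
  qed
  also have "\<dots> \<le> (\<Sum>b\<in>{..<2 ^ ?m}. measure_pmf.prob (replicate_pmf M ?q) (bad b))"
    by (rule measure_pmf.finite_measure_subadditive_finite) auto
  also have "\<dots> \<le> (\<Sum>b\<in>{..<(2::nat) ^ ?m}. 2 * exp (- real u / (8 * 2 ^ d)))"
    by (intro sum_mono pbad) auto
  also have "\<dots> = 2 ^ ?m * (2 * exp (- real u / (8 * 2 ^ d)))" by simp
  finally show ?thesis .
qed

text \<open>Index \<open>R\<close>, one past the last variable, stands for no shift, so that a
  single loop also yields the unshifted coefficients.\<close>

definition shift :: "nat \<Rightarrow> nat \<Rightarrow> nat set" where "shift R i = (if i < R then {i} else {})"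

definition learn :: "(nat set \<Rightarrow> real) \<Rightarrow> nat set list \<Rightarrow> nat \<Rightarrow> nat \<Rightarrow> nat \<Rightarrow> (nat \<Rightarrow> nat \<Rightarrow> nat) pmf" where
  "learn F us u M R = loopM (Suc R) 0 (\<lambda>i K. map_pmf (\<lambda>k. K(i := k)) (estimate F us u M (shift R i))) (\<lambda>_ _. 0)"

lemma learn_accurate:
  assumes F: "pm {..<R} F" "deg_le {..<R} d F" and us: "set us \<subseteq> Pow {..<R}"
    and u: "0 < u" "even u" and M: "M = u * 2 ^ d"
  shows "measure_pmf.prob (learn F us u M R) {K. \<exists>i\<le>R. \<not> accurate {..<R} F us d (shift R i) (K i)}
     \<le> real (R + 1) * (2 ^ length us * (2 * exp (- real u / (8 * 2 ^ d))))"
proof -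
  define e where "e = 2 ^ length us * (2 * exp (- real u / (8 * 2 ^ d)))"
  define L where "L j = loopM j 0 (\<lambda>i K. map_pmf (\<lambda>k. K(i := k)) (estimate F us u M (shift R i))) (\<lambda>_ _. 0)" for j
  have "measure_pmf.prob (L j) {K. \<exists>i<j. \<not> accurate {..<R} F us d (shift R i) (K i)} \<le> real j * e" for j
  proof (induction j)
    case (Suc j)
    let ?B = "{K. \<exists>i<j. \<not> accurate {..<R} F us d (shift R i) (K i)}"
    let ?E = "{K. \<exists>i<Suc j. \<not> accurate {..<R} F us d (shift R i) (K i)}"
    have "measure_pmf.prob (L (Suc j)) ?E \<le> (real j * e) * 1 + e"
      unfolding L_def loopM_snoc add_0
    proof (rule prob_bind_le[where B = ?B])
      fix K assume K: "K \<notin> ?B"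
      have "measure_pmf.prob (map_pmf (\<lambda>k. K(j := k)) (estimate F us u M (shift R j))) ?E
        \<le> measure_pmf.prob (estimate F us u M (shift R j)) {k. \<not> accurate {..<R} F us d (shift R j) k}"
        unfolding measure_map_pmf by (rule measure_pmf.finite_measure_mono) (use K in \<open>auto simp: less_Suc_eq\<close>)
      also have "\<dots> \<le> e"
        unfolding e_def by (rule estimate_accurate[OF _ F us _ u M]) (auto simp: shift_def)
      finally show "measure_pmf.prob (map_pmf (\<lambda>k. K(j := k)) (estimate F us u M (shift R j))) ?E \<le> e" .
    qed (use Suc in \<open>auto simp: L_def e_def\<close>)
    then show ?case by (simp add: algebra_simps)
  qed simp
  from this[of "Suc R"] show ?thesis by (simp add: L_def learn_def e_def less_Suc_eq_le add.commute)
qed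

section \<open>The learned polynomial and its verification\<close>

definition learned_set :: "nat \<Rightarrow> (nat \<Rightarrow> nat \<Rightarrow> nat) \<Rightarrow> nat \<Rightarrow> nat set" where
  "learned_set R K b = {i. i < R \<and> K i b \<noteq> K R b}"

text \<open>Scaled by \<open>2 ^ d\<close>, so that its values are integers which the program can
  compute exactly.\<close>

definition hypothesis :: "nat \<Rightarrow> nat \<Rightarrow> nat \<Rightarrow> (nat \<Rightarrow> nat \<Rightarrow> nat) \<Rightarrow> nat set \<Rightarrow> real" where
  "hypothesis R m d K y = (\<Sum>b<2 ^ m. (real (K R b) - 2 ^ d) * chi (learned_set R K b) y)"

text \<open>This check makes the degree of the hypothesis certain whatever the table contains.
  Buckets with coefficient 0, encoded as \<open>2 ^ d\<close>, do not enter the hypothesis and are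
  exempt.\<close>

definition size_ok :: "nat \<Rightarrow> nat \<Rightarrow> nat \<Rightarrow> (nat \<Rightarrow> nat \<Rightarrow> nat) \<Rightarrow> bool" where
  "size_ok R m d K \<longleftrightarrow> (\<forall>b<2 ^ m. K R b \<noteq> 2 ^ d \<longrightarrow> card (learned_set R K b) \<le> d)"

lemma hypothesis_correct:
  assumes F: "deg_le {..<R} d F" and m: "length us = m"
    and inj: "inj_on (\<lambda>S. code S us) (spectrum {..<R} F)"
    and K: "\<And>i. i \<le> R \<Longrightarrow> accurate {..<R} F us d (shift R i) (K i)"
  shows "size_ok R m d K \<and> (\<forall>y\<subseteq>{..<R}. hypothesis R m d K y = 2 ^ d * F y)"
proof -
  let ?V = "{..<R}"
  define Z where "Z = spectrum ?V F"
  have fZ: "finite Z" by (simp add: Z_def spectrum_def)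
  have Kv: "real (K i b) = 2 ^ d + 2 ^ d * bucket ?V F us (shift R i) b" if "i \<le> R" "b < 2 ^ m" for i b
    using K[OF that(1)] that(2) m by (simp add: accurate_def)
  have bucket_Z: "bucket ?V F us e (code S us) = fc ?V F S * chi S e" if "S \<in> Z" for S e
  proof -
    have "bucket ?V F us e (code S us) = (\<Sum>S\<in>{S}. fc ?V F S * chi S e)"
      unfolding bucket_def
    proof (rule sum.mono_neutral_right)
      show "\<forall>i\<in>{T \<in> Pow ?V. code T us = code S us} - {S}. fc ?V F i * chi i e = 0"
        using inj that by (auto simp: inj_on_def Z_def spectrum_def)
    qed (use that in \<open>auto simp: Z_def spectrum_def\<close>)
    then show ?thesis by simp
  qed
  have bucket_0: "bucket ?V F us e b = 0" if "b \<notin> (\<lambda>S. code S us) ` Z" for b e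
    unfolding bucket_def by (rule sum.neutral) (use that in \<open>auto simp: Z_def spectrum_def\<close>)
  have cl: "code S us < 2 ^ m" for S using code_less[of S us] m by simp
  have set_Z: "learned_set R K (code S us) = S" if S: "S \<in> Z" for S
  proof -
    have SV: "S \<subseteq> ?V" and nz: "fc ?V F S \<noteq> 0" using S by (auto simp: Z_def spectrum_def)
    have fS: "finite S" using SV finite_subset by blast
    have "K i (code S us) \<noteq> K R (code S us) \<longleftrightarrow> i \<in> S" if i: "i < R" for i
    proof -
      have "chi S {i} = chi {i} S" by (rule chi_sym) (use fS in auto)
      then have "real (K i (code S us)) = 2 ^ d + 2 ^ d * (fc ?V F S * (if i \<in> S then -1 else 1))"
        using Kv[of i "code S us"] i bucket_Z[OF S] cl by (simp add: shift_def)
      moreover have "real (K R (code S us)) = 2 ^ d + 2 ^ d * fc ?V F S"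
        using Kv[of R "code S us"] bucket_Z[OF S] cl by (simp add: shift_def)
      ultimately have "real (K i (code S us)) \<noteq> real (K R (code S us)) \<longleftrightarrow> i \<in> S" using nz by auto
      then show ?thesis by simp
    qed
    then show ?thesis using SV by (auto simp: learned_set_def)
  qed
  have KR: "real (K R b) - 2 ^ d = 0" if "b < 2 ^ m" "b \<notin> (\<lambda>S. code S us) ` Z" for b
    using Kv[of R b] that bucket_0[OF that(2)] by simp
  have "size_ok R m d K"
    unfolding size_ok_def
  proof (intro allI impI)
    fix b assume b: "b < 2 ^ m" "K R b \<noteq> 2 ^ d"
    then have "real (K R b) \<noteq> real (2 ^ d)" by (simp only: of_nat_eq_iff) simp
    then obtain S where S: "S \<in> Z" "b = code S us" using KR[OF b(1)] by auto
    then have "card S \<le> d" using deg_leD[OF F, of S] by (force simp: Z_def spectrum_def not_le[symmetric])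
    then show "card (learned_set R K b) \<le> d" using set_Z S by simp
  qed
  moreover have "hypothesis R m d K y = 2 ^ d * F y" if y: "y \<subseteq> ?V" for y
  proof -
    have "hypothesis R m d K y = (\<Sum>b\<in>(\<lambda>S. code S us) ` Z. (real (K R b) - 2 ^ d) * chi (learned_set R K b) y)"
      unfolding hypothesis_def by (rule sum.mono_neutral_right) (use KR cl in auto)
    also have "\<dots> = (\<Sum>S\<in>Z. (real (K R (code S us)) - 2 ^ d) * chi (learned_set R K (code S us)) y)"
      by (rule sum.reindex_cong[OF inj[folded Z_def]]) auto
    also have "\<dots> = (\<Sum>S\<in>Z. 2 ^ d * (fc ?V F S * chi S y))"
    proof (rule sum.cong)
      fix S assume S: "S \<in> Z"
      show "(real (K R (code S us)) - 2 ^ d) * chi (learned_set R K (code S us)) y = 2 ^ d * (fc ?V F S * chi S y)"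
        using Kv[of R "code S us"] bucket_Z[OF S] cl set_Z[OF S] by (simp add: shift_def)
    qed simp
    also have "\<dots> = 2 ^ d * (\<Sum>S\<in>Pow ?V. fc ?V F S * chi S y)"
      unfolding sum_distrib_left by (rule sum.mono_neutral_left) (auto simp: Z_def spectrum_def)
    also have "\<dots> = 2 ^ d * F y" using fc_inversion[OF _ y, of F] by simp
    finally show ?thesis .
  qed
  ultimately show ?thesis by blast
qed

lemma hypothesis_degree:
  assumes "size_ok R m d K"
  shows "deg_le {..<R} d (\<lambda>y. hypothesis R m d K y / 2 ^ d)"
proof (rule deg_leI[where J = "{..<2 ^ m}" and T = "learned_set R K" and c = "\<lambda>b. (real (K R b) - 2 ^ d) / 2 ^ d"])
  fix b assume "b \<in> {..<(2::nat) ^ m}" "(real (K R b) - 2 ^ d) / 2 ^ d \<noteq> 0"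
  then show "card (learned_set R K b) \<le> d" using assms by (auto simp: size_ok_def)
qed (auto simp: learned_set_def hypothesis_def sum_divide_distrib)

lemma boolean_from_agreement:
  assumes V: "finite V" and F: "pm V F" and H: "deg_le V d H" and close: "disagree V F H < 1 / 4 ^ d"
  shows "pm V H"
proof (rule ccontr)
  assume "\<not> pm V H"
  then obtain x where x: "x \<subseteq> V" "H x \<noteq> 1" "H x \<noteq> -1" by (auto simp: pm_def)
  define q where "q y = H y * H y - 1" for y
  have "deg_le V (d + d) q"
    unfolding deg_le_def
  proof (intro allI impI)
    fix S assume S: "S \<subseteq> V" "d + d < card S"
    then have "S \<noteq> {}" by auto
    then show "fc V q S = 0"
      using deg_leD[OF deg_le_mult[OF V H H] S] av_chi[OF V S(1)]
      by (simp add: fc_def q_def left_diff_distrib av_diff)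
  qed
  moreover have "q x \<noteq> 0" using x by (auto simp: q_def square_eq_1_iff)
  ultimately have "1 / 2 ^ (d + d) \<le> av V (\<lambda>y. of_bool (q y \<noteq> 0))" using nonzero_density[OF V _ x(1)] by blast
  also have "\<dots> \<le> disagree V F H"
    unfolding disagree_def
  proof (rule av_mono)
    fix y assume "y \<subseteq> V"
    then show "(of_bool (q y \<noteq> 0) :: real) \<le> of_bool (F y \<noteq> H y)" using pm_square[OF F, of y] by (auto simp: q_def)
  qed
  finally show False using close by (simp add: power_add) (simp flip: power_mult_distrib)
qed

definition verify :: "(nat set \<Rightarrow> real) \<Rightarrow> nat \<Rightarrow> nat \<Rightarrow> nat \<Rightarrow> nat \<Rightarrow> (nat \<Rightarrow> nat \<Rightarrow> nat) \<Rightarrow> bool pmf" where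
  "verify F R m d N K = loopM N 0 (\<lambda>_ ok. map_pmf (\<lambda>y. ok \<and> hypothesis R m d K y = 2 ^ d * F y) (rset {..<R})) True"

text \<open>The \<open>4 * d + 8\<close> rows reduce the collision probability to
  \<open>16 ^ d / 2 ^ (4 * d + 8) = 1 / 256\<close>. The factor \<open>256 * (d + 1)\<close> gives
  the exponent \<open>32 * (d + 1)\<close> in \<open>estimate_accurate\<close>, enough for a union
  over all buckets and shifts. The \<open>64 * 4 ^ d\<close> comparisons are 16 times the inverse of
  the smallest disagreement \<open>1 / (4 * 4 ^ d)\<close> that must be noticed.\<close>

definition degree_test_on :: "(nat set \<Rightarrow> real) \<Rightarrow> nat \<Rightarrow> nat \<Rightarrow> bool pmf" where
  "degree_test_on F R d =
     bind_pmf (replicate_pmf (4 * d + 8) (rset {..<R})) (\<lambda>us.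
     bind_pmf (learn F us (256 * (d + 1) * 2 ^ d) (256 * (d + 1) * 2 ^ d * 2 ^ d) R) (\<lambda>K.
     map_pmf (\<lambda>ok. size_ok R (4 * d + 8) d K \<and> ok) (verify F R (4 * d + 8) d (64 * 4 ^ d) K)))"

lemma degree_test_numbers:
  assumes "R \<le> 4096 * (d + 1)\<^sup>2"
  shows "real (R + 1) * (2 ^ (4 * d + 8) * (2 * exp (- real (256 * (d + 1) * 2 ^ d) / (8 * 2 ^ d)))) \<le> 1 / 4"
proof -
  define p where "p = d + 1"
  have p: "1 \<le> p" by (simp add: p_def)
  have "real p \<le> 2 ^ p" using less_exp[of p] by (metis of_nat_le_iff of_nat_numeral of_nat_power less_imp_le)
  then have "(real p)\<^sup>2 \<le> (2 ^ p)\<^sup>2" by (intro power_mono) auto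
  then have p2: "(real p)\<^sup>2 \<le> 2 ^ (2 * p)" by (simp add: power_mult[symmetric] mult.commute)
  have "real (R + 1) \<le> 4096 * (real p)\<^sup>2 + 1"
    using assms of_nat_mono[OF assms, where 'a = real] by (simp add: p_def add.commute)
  also have "\<dots> \<le> 4096 * 2 ^ (2 * p) + 2 ^ (2 * p)" using p2 by (intro add_mono mult_left_mono) auto
  also have "\<dots> \<le> 2 ^ 13 * 2 ^ (2 * p)" by simp
  finally have R: "real (R + 1) \<le> 2 ^ (13 + 2 * p)" by (simp only: power_add)
  have "exp (- real (256 * (d + 1) * 2 ^ d) / (8 * 2 ^ d)) = exp (- (real (32 * p)))"
    by (simp add: p_def field_simps)
  also have "\<dots> = (1 / exp 1) ^ (32 * p)"
    by (simp add: exp_minus inverse_eq_divide power_divide exp_of_nat_mult[symmetric])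
  also have "\<dots> \<le> (1 / 2) ^ (32 * p)"
    using exp_ge_add_one_self[of 1] by (intro power_mono frac_le) auto
  finally have E: "exp (- real (256 * (d + 1) * 2 ^ d) / (8 * 2 ^ d)) \<le> (1 / 2) ^ (32 * p)" .
  have "real (R + 1) * (2 ^ (4 * d + 8) * (2 * exp (- real (256 * (d + 1) * 2 ^ d) / (8 * 2 ^ d))))
     \<le> 2 ^ (13 + 2 * p) * (2 ^ (4 * d + 8) * (2 * (1 / 2) ^ (32 * p)))"
    by (intro mult_mono R E mult_nonneg_nonneg) auto
  also have "\<dots> = 2 ^ (18 + 6 * p) * (1 / 2) ^ (32 * p)"
    by (simp add: p_def power_add power_mult algebra_simps)
  also have "\<dots> = (1 / 2) ^ (26 * p) * 2 ^ 18"
  proof -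
    have "(2::real) ^ (6 * p) * (1 / 2) ^ (6 * p) = 1" by (simp add: power_mult_distrib[symmetric])
    moreover have "(1 / 2 :: real) ^ (32 * p) = (1 / 2) ^ (26 * p) * (1 / 2) ^ (6 * p)" by (simp add: power_add[symmetric])
    ultimately show ?thesis by (simp only: power_add) (simp add: algebra_simps)
  qed
  also have "\<dots> \<le> (1 / 2) ^ 26 * 2 ^ 18"
    using p by (intro mult_right_mono power_decreasing) auto
  also have "\<dots> \<le> 1 / 4" by (simp add: power_one_over)
  finally show ?thesis .
qed

lemma degree_test_on_complete:
  assumes F: "pm {..<R} F" "deg_le {..<R} d F" and R: "R \<le> 4096 * (d + 1)\<^sup>2"
  shows "measure_pmf.prob (degree_test_on F R d) {False} \<le> 1 / 3"
proof -
  let ?m = "4 * d + 8" and ?u = "256 * (d + 1) * 2 ^ d"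
  have "measure_pmf.prob (degree_test_on F R d) {False} \<le> (16 ^ d / 2 ^ ?m) * 1 + 1 / 4"
    unfolding degree_test_on_def
  proof (rule prob_bind_le[where B = "{us. \<not> inj_on (\<lambda>S. code S us) (spectrum {..<R} F)}"])
    show "measure_pmf.prob (replicate_pmf ?m (rset {..<R})) {us. \<not> inj_on (\<lambda>S. code S us) (spectrum {..<R} F)} \<le> 16 ^ d / 2 ^ ?m"
      by (rule code_injective) (use F in auto)
    fix us assume us: "us \<in> set_pmf (replicate_pmf ?m (rset {..<R}))" "us \<notin> {us. \<not> inj_on (\<lambda>S. code S us) (spectrum {..<R} F)}"
    have l: "length us = ?m" "set us \<subseteq> Pow {..<R}" using us(1) by (auto simp: set_replicate_pmf set_rset)
    let ?B = "{K. \<exists>i\<le>R. \<not> accurate {..<R} F us d (shift R i) (K i)}"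
    have "measure_pmf.prob (bind_pmf (learn F us ?u (?u * 2 ^ d) R) (\<lambda>K. map_pmf (\<lambda>ok. size_ok R ?m d K \<and> ok) (verify F R ?m d (64 * 4 ^ d) K))) {False}
       \<le> (1 / 4) * 1 + 0"
    proof (rule prob_bind_le[where B = ?B])
      have "measure_pmf.prob (learn F us ?u (?u * 2 ^ d) R) ?B
        \<le> real (R + 1) * (2 ^ length us * (2 * exp (- real ?u / (8 * 2 ^ d))))"
        by (rule learn_accurate[OF F l(2)]) auto
      also have "\<dots> \<le> 1 / 4" unfolding l(1) by (rule degree_test_numbers[OF R])
      finally show "measure_pmf.prob (learn F us ?u (?u * 2 ^ d) R) ?B \<le> 1 / 4" .
      fix K assume "K \<notin> ?B"
      then have K: "accurate {..<R} F us d (shift R i) (K i)" if "i \<le> R" for i using that by auto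
      have ok: "size_ok R ?m d K" "\<And>y. y \<subseteq> {..<R} \<Longrightarrow> hypothesis R ?m d K y = 2 ^ d * F y"
        using hypothesis_correct[OF F(2) l(1) _ K] us(2) by auto
      have "measure_pmf.prob (rset {..<R}) {y. hypothesis R ?m d K y = 2 ^ d * F y} = av {..<R} (\<lambda>y. 1)"
        unfolding prob_rset[OF finite_lessThan] by (rule av_cong) (simp add: ok(2))
      then have "measure_pmf.prob (verify F R ?m d (64 * 4 ^ d) K) {True} = 1"
        unfolding verify_def loop_check by simp
      then have "measure_pmf.prob (verify F R ?m d (64 * 4 ^ d) K) (- {True}) = 0"
        using measure_pmf.prob_compl[of "{True}" "verify F R ?m d (64 * 4 ^ d) K"] by (simp add: Compl_eq_Diff_UNIV)
      moreover have "(\<lambda>ok. size_ok R ?m d K \<and> ok) -` {False} = - {True}" using ok(1) by auto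
      ultimately show "measure_pmf.prob (map_pmf (\<lambda>ok. size_ok R ?m d K \<and> ok) (verify F R ?m d (64 * 4 ^ d) K)) {False} \<le> 0"
        unfolding measure_map_pmf by simp
    qed auto
    then show "measure_pmf.prob (bind_pmf (learn F us ?u (?u * 2 ^ d) R) (\<lambda>K. map_pmf (\<lambda>ok. size_ok R ?m d K \<and> ok) (verify F R ?m d (64 * 4 ^ d) K))) {False} \<le> 1 / 4"
      by simp
  qed auto
  also have "(16::real) ^ d / 2 ^ ?m = 1 / 256"
    by (simp add: power_add power_mult)
  finally show ?thesis by simp
qed

text \<open>The argument applies to every table. A hypothesis disagreeing with \<open>F\<close> by
  less than \<open>1 / (4 * 4 ^ d)\<close> would be Boolean and satisfy the Reed-Muller condition;
  together with \<open>close\<close> its distance from \<open>G\<close> would be below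
  \<open>1 / 2 ^ (d + 1)\<close>, the radius of \<open>rm_distance\<close>, forcing degree
  \<open>d\<close> on \<open>G\<close>. So the comparison meets a larger disagreement and passes
  with probability at most \<open>exp (- 16)\<close>.\<close>

lemma degree_test_on_sound:
  assumes F: "pm {..<R} F" and G: "pm {..<R} G" "rm {..<R} d G" "\<not> deg_le {..<R} d G"
    and close: "disagree {..<R} F G < 1 / 2 ^ d / 4"
  shows "measure_pmf.prob (degree_test_on F R d) {True} \<le> 1 / 10"
proof -
  let ?m = "4 * d + 8" and ?u = "256 * (d + 1) * 2 ^ d" and ?V = "{..<R}"
  have v: "measure_pmf.prob (map_pmf (\<lambda>ok. size_ok R ?m d K \<and> ok) (verify F R ?m d (64 * 4 ^ d) K)) {True} \<le> 1 / 10" for K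
  proof (cases "size_ok R ?m d K")
    case False
    then have "(\<lambda>ok. size_ok R ?m d K \<and> ok) -` {True} = {}" by auto
    then show ?thesis unfolding measure_map_pmf by simp
  next
    case True
    define H where "H y = hypothesis R ?m d K y / 2 ^ d" for y
    have dH: "deg_le ?V d H" unfolding H_def[abs_def] by (rule hypothesis_degree[OF True])
    have far: "1 / 4 ^ d / 4 \<le> disagree ?V F H"
    proof (rule ccontr)
      assume "\<not> ?thesis"
      then have small: "disagree ?V F H < 1 / 4 ^ d / 4" by simp
      moreover have "(1::real) / 4 ^ d / 4 \<le> 1 / 4 ^ d" by (simp add: field_simps)
      ultimately have pmH: "pm ?V H" by (intro boolean_from_agreement[OF _ F dH]) auto
      have rmH: "rm ?V d H" by (rule deg_le_imp_rm[OF _ pmH dH]) simp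
      have "(1::real) / 4 ^ d / 4 \<le> 1 / 2 ^ d / 4" by (intro divide_right_mono frac_le power_mono) auto
      then have "disagree ?V G H < 1 / 2 ^ Suc d"
        using disagree_triangle[of ?V G H F] small close by (simp add: disagree_commute[of ?V G F])
      then have "G y = H y" if "y \<subseteq> ?V" for y using rm_distance[OF _ G(1) pmH G(2) rmH _ that] by simp
      then have "deg_le ?V d G" using dH deg_le_cong[of ?V G H d] by simp
      then show False using G(3) by simp
    qed
    have "measure_pmf.prob (rset ?V) {y. hypothesis R ?m d K y = 2 ^ d * F y} = av ?V (\<lambda>y. of_bool (\<not> (F y \<noteq> H y)))"
      unfolding prob_rset[OF finite_lessThan] by (rule av_cong) (auto simp: H_def field_simps)
    also have "\<dots> = 1 - disagree ?V F H"
      unfolding disagree_def by (rule mean_not[OF mean_av]) simp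
    finally have pr: "measure_pmf.prob (rset ?V) {y. hypothesis R ?m d K y = 2 ^ d * F y} \<le> 1 - 1 / 4 ^ d / 4" using far by simp
    have "measure_pmf.prob (verify F R ?m d (64 * 4 ^ d) K) {True} \<le> (1 - 1 / 4 ^ d / 4) ^ (64 * 4 ^ d)"
      unfolding verify_def loop_check using pr by (simp add: power_mono)
    also have "\<dots> \<le> exp (- (1 / 4 ^ d / 4)) ^ (64 * 4 ^ d)"
    proof (rule power_mono)
      show "1 - 1 / 4 ^ d / 4 \<le> exp (- (1 / 4 ^ d / 4 :: real))" using exp_ge_add_one_self[of "- (1 / 4 ^ d / 4)"] by simp
      have "(1::real) \<le> 4 ^ Suc d" by (rule one_le_power) simp
      then have "1 / 4 ^ Suc d \<le> (1::real)" using divide_le_eq_1_pos[of "4 ^ Suc d" "1::real"] by fastforce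
      then have "(1::real) / 4 ^ d / 4 \<le> 1" by (simp only: power_Suc2 divide_divide_eq_left)
      then show "0 \<le> 1 - (1::real) / 4 ^ d / 4" by simp
    qed
    also have "\<dots> = exp (- 16)" by (simp add: exp_of_nat_mult[symmetric])
    also have "\<dots> \<le> 1 / 10" using exp_ge_add_one_self[of 16] by (simp add: exp_minus field_simps)
    finally have "measure_pmf.prob (verify F R ?m d (64 * 4 ^ d) K) {True} \<le> 1 / 10" .
    moreover have "(\<lambda>ok. size_ok R ?m d K \<and> ok) -` {True} = {True}" using True by auto
    ultimately show ?thesis unfolding measure_map_pmf by simp
  qed
  show ?thesis
    unfolding degree_test_on_def by (intro prob_bind_le_const v) simp_all
qed

text \<open>With \<open>r = 4096 * (d + 1)^2\<close>, the difference \<open>n - (n - r)\<close> is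
  the minimum of \<open>n\<close> and \<open>r\<close>, so small cubes are not merged at all. The
  shift \<open>a\<close> makes each point of the merged cube uniform in the large one.\<close>

definition degree_test :: "nat \<Rightarrow> nat \<Rightarrow> (nat set \<Rightarrow> real) \<Rightarrow> bool pmf" where
  "degree_test n d f = bind_pmf (rset {..<n}) (\<lambda>a. bind_pmf (hash n (n - 4096 * (d + 1)\<^sup>2)) (\<lambda>lab.
     degree_test_on (\<lambda>y. f (a \<triangle> pull lab {..<n} y)) (n - (n - 4096 * (d + 1)\<^sup>2)) d))"

lemma degree_test_complete:
  assumes f: "pm {..<n} f" "deg_le {..<n} d f"
  shows "measure_pmf.prob (degree_test n d f) {False} \<le> 1 / 3"
proof -
  define N where "N = n - 4096 * (d + 1)\<^sup>2"
  have "measure_pmf.prob (degree_test_on (\<lambda>y. f (a \<triangle> pull lab {..<n} y)) (n - N) d) {False} \<le> 1 / 3"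
    if a: "a \<subseteq> {..<n}" and lab: "lab \<in> set_pmf (hash n N)" for a lab
  proof (rule degree_test_on_complete)
    have "lab v < n - N" if "v < n" for v
    proof -
      have "N < n" using that by (auto simp: N_def)
      then show ?thesis using hash_less[OF lab] that by simp
    qed
    then show "deg_le {..<n - N} d (\<lambda>y. f (a \<triangle> pull lab {..<n} y))"
      by (intro deg_le_pull[OF _ _ f(2)]) (use a in auto)
    show "pm {..<n - N} (\<lambda>y. f (a \<triangle> pull lab {..<n} y))" using f(1) a by (auto simp: pm_def)
  qed (simp add: N_def)
  then show ?thesis
    unfolding degree_test_def N_def[symmetric]
    by (intro prob_bind_le_const) (simp_all add: set_rset)
qed

text \<open>Three failures are added: merging lowers the degree
  (\<open>144 / 4096 < 1 / 25\<close>), the merged functions disagree too much (1/20), or the small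
  test errs (1/10). For the second, the shift makes each point uniform for fixed labels, so the
  expected disagreement is that of \<open>f\<close> and \<open>g\<close>, and Markov's inequality
  gives the ratio \<open>(1 / 80) / (1 / 4)\<close>.\<close>

lemma degree_test_sound:
  assumes f: "pm {..<n} f" and g: "pm {..<n} g" "rm {..<n} d g" "\<not> deg_le {..<n} d g"
    and close: "disagree {..<n} f g \<le> 1 / 2 ^ d / (80 * (real d + 1))"
  shows "measure_pmf.prob (degree_test n d f) {True} \<le> 1 / 3"
proof -
  define N where "N = n - 4096 * (d + 1)\<^sup>2"
  define R where "R = n - N"
  have "n \<noteq> 0"
  proof
    assume "n = 0"
    then have "deg_le {..<n} d g" by (auto simp: deg_le_def)
    then show False using g by simp
  qed
  then have N: "N < n" by (simp add: N_def)
  define F where "F al y = f (fst al \<triangle> pull (snd al) {..<n} y)" for al y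
  define G where "G al y = g (fst al \<triangle> pull (snd al) {..<n} y)" for al y
  define B1 where "B1 = {al. deg_le {..<R} d (G al)}"
  define B2 where "B2 = {al. 1 / 2 ^ d / 4 \<le> disagree {..<R} (F al) (G al)}"
  let ?J = "pair_pmf (rset {..<n}) (hash n N)"
  have eq: "degree_test n d f = bind_pmf ?J (\<lambda>al. degree_test_on (F al) R d)"
    by (simp add: degree_test_def N_def R_def F_def[abs_def] pair_pmf_def bind_assoc_pmf bind_return_pmf)
  have p1: "measure_pmf.prob ?J B1 \<le> 1 / 25"
  proof (cases "N = 0")
    case True
    have R: "R = n" using True by (simp add: R_def)
    have b: "measure_pmf.prob (map_pmf (Pair a) (hash n N)) B1 \<le> 0" if a: "a \<subseteq> {..<n}" for a
      using hash_degree[OF a g N] True by (simp add: B1_def G_def[abs_def] vimage_def R)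
    have "measure_pmf.prob ?J B1 \<le> 0 * 1 + 0"
      unfolding pair_pmf_def map_pmf_def[symmetric]
      by (rule prob_bind_le[where B = "{}"]) (use b in \<open>auto simp: set_rset map_pmf_def[symmetric]\<close>)
    then show ?thesis by simp
  next
    case False
    then have R: "R = 4096 * (d + 1)\<^sup>2" by (simp add: R_def N_def)
    have "measure_pmf.prob (map_pmf (Pair a) (hash n N)) B1 \<le> 1 / 25" if a: "a \<subseteq> {..<n}" for a
    proof -
      have "measure_pmf.prob (map_pmf (Pair a) (hash n N)) B1 \<le> 144 * (real d)\<^sup>2 * (1 / real R - 1 / real n)"
        using hash_degree[OF a g N] by (simp add: B1_def G_def[abs_def] vimage_def R_def)
      also have "\<dots> \<le> 144 * (real (d + 1))\<^sup>2 * (1 / real R)"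
      proof -
        have "R \<le> n" "0 < R" by (simp_all add: R_def N)
        then have "1 / real n \<le> 1 / real R" by (intro divide_left_mono) auto
        then show ?thesis by (intro mult_mono power_mono) auto
      qed
      also have "\<dots> = 144 / 4096" by (simp add: R)
      also have "\<dots> \<le> 1 / 25" by simp
      finally show ?thesis .
    qed
    then have "measure_pmf.prob ?J B1 \<le> 0 * 1 + 1 / 25"
      unfolding pair_pmf_def map_pmf_def[symmetric]
      by (intro prob_bind_le[where B = "{}"]) (auto simp: set_rset map_pmf_def[symmetric])
    then show ?thesis by simp
  qed
  have p2: "measure_pmf.prob ?J B2 \<le> 1 / 20"
  proof -
    have b: "measure_pmf.prob (map_pmf (\<lambda>a. (a, lab)) (rset {..<n})) B2 \<le> 1 / 20" for lab
    proof -
      have "1 / 2 ^ d / 4 * av {..<n} (\<lambda>a. of_bool ((a, lab) \<in> B2)) \<le> av {..<n} (\<lambda>a. disagree {..<R} (F (a, lab)) (G (a, lab)))"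
        unfolding av_cmult[symmetric]
        by (rule av_mono) (auto simp: B2_def disagree_nonneg)
      also have "\<dots> = av {..<R} (\<lambda>y. av {..<n} (\<lambda>a. of_bool (f (a \<triangle> pull lab {..<n} y) \<noteq> g (a \<triangle> pull lab {..<n} y))))"
        unfolding disagree_def F_def G_def by (simp add: av_swap[of "{..<n}" "{..<R}"])
      also have "\<dots> = av {..<R} (\<lambda>y. disagree {..<n} f g)"
        unfolding disagree_def
        by (rule av_cong) (rule av_shift2[of _ _ "\<lambda>a. of_bool (f a \<noteq> g a)"], simp)
      also have "\<dots> \<le> 1 / 2 ^ d / (80 * (real d + 1))" using close by simp
      also have "\<dots> \<le> 1 / 2 ^ d / 80" by (intro divide_left_mono) auto
      finally have "av {..<n} (\<lambda>a. of_bool ((a, lab) \<in> B2)) \<le> 1 / 20" by (simp add: field_simps)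
      then show ?thesis using prob_rset[of "{..<n}" "\<lambda>a. (a, lab) \<in> B2"] by (simp add: vimage_def)
    qed
    \<comment> \<open>Shift and labels are independent, so the average over the shift can be taken
      with the labels fixed.\<close>
    have "?J = bind_pmf (hash n N) (\<lambda>lab. map_pmf (\<lambda>a. (a, lab)) (rset {..<n}))"
      unfolding pair_pmf_def map_pmf_def by (rule bind_commute_pmf)
    then have "measure_pmf.prob ?J B2 = measure_pmf.prob (bind_pmf (hash n N) (\<lambda>lab. map_pmf (\<lambda>a. (a, lab)) (rset {..<n}))) B2"
      by simp
    also have "\<dots> \<le> 0 * 1 + 1 / 20" by (rule prob_bind_le[where B = "{}"]) (use b in auto)
    finally show ?thesis by simp
  qed
  have "measure_pmf.prob (degree_test n d f) {True} \<le> (1 / 25 + 1 / 20) * 1 + 1 / 10"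
    unfolding eq
  proof (rule prob_bind_le[where B = "B1 \<union> B2"])
    show "measure_pmf.prob ?J (B1 \<union> B2) \<le> 1 / 25 + 1 / 20"
      using p1 p2 by (intro order_trans[OF measure_Un_le] add_mono) auto
    fix al assume al: "al \<in> set_pmf ?J" "al \<notin> B1 \<union> B2"
    then have a: "fst al \<subseteq> {..<n}" by (auto simp: set_rset)
    show "measure_pmf.prob (degree_test_on (F al) R d) {True} \<le> 1 / 10"
    proof (rule degree_test_on_sound)
      show "pm {..<R} (F al)" "pm {..<R} (G al)" using f g(1) a by (auto simp: pm_def F_def G_def)
      show "rm {..<R} d (G al)" unfolding G_def[abs_def] by (rule rm_pull[OF g(2) a])
      show "\<not> deg_le {..<R} d (G al)" "disagree {..<R} (F al) (G al) < 1 / 2 ^ d / 4"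
        using al(2) by (auto simp: B1_def B2_def)
    qed
  qed auto
  then show ?thesis by simp
qed

section \<open>The program\<close>

text \<open>\<open>XOR a b\<close> is the distance of \<open>a\<close> and \<open>b\<close>, hence \<open>EQ\<close> decides equality of arbitrary numbers;
  \<open>AND\<close> is for bits only.\<close>

abbreviation XOR :: "expr \<Rightarrow> expr \<Rightarrow> expr" where "XOR a b \<equiv> Plus (Minus a b) (Minus b a)"
abbreviation AND :: "expr \<Rightarrow> expr \<Rightarrow> expr" where "AND a b \<equiv> Half (Plus a b)"
abbreviation EQ :: "expr \<Rightarrow> expr \<Rightarrow> expr" where "EQ a b \<equiv> Minus (Num 1) (XOR a b)"
abbreviation NZ :: "expr \<Rightarrow> expr" where "NZ a \<equiv> Minus (Num 1) (Minus (Num 1) a)"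
abbreviation Incr :: "nat \<Rightarrow> expr \<Rightarrow> com" where "Incr k e \<equiv> SetV k (Plus (Vr k) e)"

text \<open>Scalars with a fixed meaning, where \<open>p = d + 1\<close>, \<open>m = 4 * d + 8\<close> and \<open>u = 256 * p * 2 ^ d\<close>:
  0 \<open>n\<close>, then the answer; 1 \<open>d\<close>; 2 \<open>p\<close>; 3 \<open>2 ^ d\<close>; 4 a power of two that is at least \<open>1 / \<epsilon>\<close>;
  5 the number of failed checks; 7 \<open>2 ^ p\<close>; 8 the number of blocks \<open>R\<close>; 9 its bound \<open>4096 * p\<^sup>2\<close>; 10 \<open>m\<close>; 11 \<open>2 ^ m\<close>;
  12 \<open>u\<close>; 13 \<open>u * 2 ^ d\<close>; 20 the index of a linear combination of the rows; 21 the number of rows;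
  22 the result of the last membership query; 44, 47, 49 numbers of repetitions; 63 zero.
  Arrays: 0 the base point, 1 the rows, 2 the block of each variable, 3 the random shift, 4 a vector of
  block values, 5 counters, 6 the table of rounded coefficients.\<close>

definition Pow2 :: "nat \<Rightarrow> nat \<Rightarrow> nat \<Rightarrow> com" where
  "Pow2 z i x = Seq (SetV z (Num 1)) (For i (Vr x) (Incr z (Vr z)))"

definition Mul :: "nat \<Rightarrow> nat \<Rightarrow> nat \<Rightarrow> nat \<Rightarrow> com" where
  "Mul z i x y = Seq (SetV z (Num 0)) (For i (Vr x) (Incr z (Vr y)))"

definition RandVec :: "nat \<Rightarrow> nat \<Rightarrow> nat \<Rightarrow> nat \<Rightarrow> com" where
  "RandVec k off v lm = For v (Vr lm) (FlipA k (Plus (Vr off) (Vr v)))"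

definition RandNum :: com where
  "RandNum = Seq (SetV 20 (Num 0)) (For 26 (Vr 10) (Seq (FlipV 32) (SetV 20 (Plus (Plus (Vr 20) (Vr 20)) (Vr 32)))))"

definition Rnd :: "nat \<Rightarrow> com" where
  "Rnd r = Seq (SetV 30 (Num 0)) (Seq (SetV 31 (Num 1)) (Seq
     (While (Minus (Vr r) (Vr 31)) (Seq (FlipV 32)
        (Seq (SetV 30 (Plus (Plus (Vr 30) (Vr 30)) (Vr 32))) (Incr 31 (Vr 31)))))
     (Cond (Minus (Plus (Vr 30) (Num 1)) (Vr r)) (SetV 30 (Minus (Vr 30) (Vr r))) Skip)))"

text \<open>Queries the point obtained from array 0 by adding the rows selected by the digits of
  cell 20. Cell 25 advances by \<open>n\<close> per row, which replaces the multiplication in the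
  row address, and halving cell 24 peels off the digits.\<close>

definition Eval :: com where
  "Eval = Seq (For 23 (Vr 0) (SetB (Vr 23) (Ar 0 (Vr 23))))
    (Seq (SetV 24 (Vr 20)) (Seq (SetV 25 (Num 0))
    (Seq (For 26 (Vr 21)
       (Seq (SetV 27 (Half (Vr 24))) (Seq (SetV 28 (Minus (Vr 24) (Plus (Vr 27) (Vr 27)))) (Seq (SetV 24 (Vr 27))
       (Seq (For 23 (Vr 0) (SetB (Vr 23) (XOR (Bu (Vr 23)) (AND (Vr 28) (Ar 1 (Plus (Vr 25) (Vr 23)))))))
       (Incr 25 (Vr 0)))))))
    (QueryV 22))))"

definition DrawRows :: com where
  "DrawRows = Seq (SetV 25 (Num 0)) (For 26 (Vr 21) (Seq (RandVec 1 25 23 0) (Incr 25 (Vr 0))))"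

definition RMCheck :: com where
  "RMCheck = Seq (SetV 21 (Vr 2)) (Seq DrawRows (Seq (SetV 6 (Num 0))
     (Seq (For 20 (Vr 7) (Seq Eval (SetV 6 (XOR (Vr 6) (Vr 22))))) (Incr 5 (Vr 6)))))"

definition StageA :: com where
  "StageA = For 48 (Vr 47) (Seq (RandVec 0 63 23 0) RMCheck)"

definition StageB :: com where
  "StageB = For 48 (Vr 49) (Seq SampleB (Seq (For 23 (Vr 0) (SetA 0 (Vr 23) (Bu (Vr 23)))) RMCheck))"

text \<open>Cell 33 holds \<open>i\<close> and cell 30 finally holds \<open>j\<close>. Cell 8 is
  decremented before the second draw, so it serves both as the range of \<open>j\<close> and as the
  label \<open>R - 1\<close> of \<open>mergemap\<close>.\<close>

definition Hash :: com where
  "Hash = Seq (SetV 8 (Vr 0)) (Seq (For 23 (Vr 0) (SetA 2 (Vr 23) (Vr 23)))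
     (While (Minus (Vr 8) (Vr 9)) (Seq (Rnd 8) (Seq (SetV 33 (Vr 30)) (Seq (SetV 8 (Minus (Vr 8) (Num 1)))
       (Seq (Rnd 8) (For 23 (Vr 0)
          (Cond (EQ (Ar 2 (Vr 23)) (Vr 33)) (SetA 2 (Vr 23) (Vr 30))
             (Cond (EQ (Ar 2 (Vr 23)) (Vr 8)) (SetA 2 (Vr 23) (Vr 33)) Skip)))))))))"

text \<open>The rows are drawn on the blocks but stored as vectors over all variables, so that
  \<open>Eval\<close> works on them without regard to the merging.\<close>

definition BlockRows :: com where
  "BlockRows = Seq (SetV 25 (Num 0)) (For 26 (Vr 10) (Seq (RandVec 4 63 23 8)
     (Seq (For 23 (Vr 0) (SetA 1 (Plus (Vr 25) (Vr 23)) (Ar 4 (Ar 2 (Vr 23))))) (Incr 25 (Vr 0)))))"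

definition Dot :: com where
  "Dot = Seq (SetV 37 (Vr 17)) (Seq (SetV 38 (Vr 20)) (Seq (SetV 34 (Num 0))
     (For 26 (Vr 10) (Seq (SetV 39 (Half (Vr 37))) (Seq (SetV 40 (Half (Vr 38)))
       (Seq (SetV 34 (XOR (Vr 34) (AND (Minus (Vr 37) (Plus (Vr 39) (Vr 39))) (Minus (Vr 38) (Plus (Vr 40) (Vr 40))))))
       (Seq (SetV 37 (Vr 39)) (SetV 38 (Vr 40)))))))))"

definition Round :: com where
  "Round = Seq (SetV 35 (Plus (Plus (Ar 5 (Vr 17)) (Ar 5 (Vr 17))) (Half (Vr 12)))) (Seq (SetV 36 (Num 0))
     (Seq (While (Minus (Plus (Vr 35) (Num 1)) (Vr 12)) (Seq (SetV 35 (Minus (Vr 35) (Vr 12))) (Incr 36 (Num 1))))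
       (SetA 6 (Plus (Vr 16) (Vr 17)) (Vr 36))))"

definition Count :: com where
  "Count = Seq (RandNum) (Seq Eval
     (For 17 (Vr 11) (Seq Dot (SetA 5 (Vr 17) (Plus (Ar 5 (Vr 17)) (XOR (Vr 22) (Vr 34)))))))"

definition Estimate :: com where
  "Estimate = Seq (For 23 (Vr 0) (SetA 0 (Vr 23) (XOR (Ar 3 (Vr 23)) (EQ (Ar 2 (Vr 23)) (Vr 14)))))
     (Seq (For 17 (Vr 11) (SetA 5 (Vr 17) (Num 0)))
     (Seq (For 18 (Vr 13) Count)
     (Seq (For 17 (Vr 11) Round) (Incr 16 (Vr 11)))))"

definition Learn :: com where
  "Learn = Seq (SetV 16 (Num 0)) (Seq (SetV 15 (Plus (Vr 8) (Num 1))) (For 14 (Vr 15) Estimate))"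

text \<open>Cell 43 is the offset of the last table row, the unshifted coefficients. Columns are
  walked by adding \<open>2 ^ m\<close> to cell 42.\<close>

definition Size :: com where
  "Size = Seq (SetV 43 (Minus (Vr 16) (Vr 11))) (For 17 (Vr 11) (Seq (SetV 41 (Num 0)) (Seq (SetV 42 (Vr 17))
     (Seq (For 14 (Vr 8) (Seq (Incr 41 (NZ (XOR (Ar 6 (Vr 42)) (Ar 6 (Plus (Vr 43) (Vr 17)))))) (Incr 42 (Vr 11))))
     (Incr 5 (AND (NZ (XOR (Ar 6 (Plus (Vr 43) (Vr 17))) (Vr 3))) (NZ (Minus (Vr 41) (Vr 1)))))))))"

text \<open>A signed sum is kept as the difference of cells 45 and 46: a term
  \<open>K R b - 2 ^ d\<close> adds \<open>K R b\<close> to one cell and \<open>2 ^ d\<close> to the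
  other, and the character decides which.\<close>

definition Term :: com where
  "Term = Seq (SetV 41 (Num 0)) (Seq (SetV 42 (Vr 17))
     (Seq (For 14 (Vr 8) (Seq (SetV 41 (XOR (Vr 41) (AND (NZ (XOR (Ar 6 (Vr 42)) (Ar 6 (Plus (Vr 43) (Vr 17))))) (Ar 4 (Vr 14)))))
        (Incr 42 (Vr 11))))
     (Cond (Vr 41) (Seq (Incr 46 (Ar 6 (Plus (Vr 43) (Vr 17)))) (Incr 45 (Vr 3)))
        (Seq (Incr 45 (Ar 6 (Plus (Vr 43) (Vr 17)))) (Incr 46 (Vr 3))))))"

text \<open>With no rows, cell 21 being 0, \<open>Eval\<close> queries the base point
  itself.\<close>

definition Verify :: com where
  "Verify = Seq (SetV 21 (Num 0)) (For 18 (Vr 44) (Seq (RandVec 4 63 23 8)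
     (Seq (For 23 (Vr 0) (SetA 0 (Vr 23) (XOR (Ar 3 (Vr 23)) (Ar 4 (Ar 2 (Vr 23))))))
     (Seq Eval (Seq (SetV 45 (Num 0)) (Seq (SetV 46 (Num 0)) (Seq (For 17 (Vr 11) Term)
     (Seq (Cond (Vr 22) (Incr 46 (Vr 3)) (Incr 45 (Vr 3))) (Incr 5 (XOR (Vr 45) (Vr 46)))))))))))"

definition StageC :: com where
  "StageC = Seq (RandVec 3 63 23 0) (Seq Hash (Seq BlockRows (Seq (SetV 21 (Vr 10)) (Seq Learn (Seq Size Verify)))))"

text \<open>The number \<open>\<epsilon>\<close> is accessible by comparison only, so a power of two
  that is at least \<open>1 / \<epsilon>\<close> is found by doubling.\<close>

definition Init :: com where
  "Init = Seq (SetV 2 (Plus (Vr 1) (Num 1))) (Seq (Pow2 3 23 1) (Seq (SetV 7 (Plus (Vr 3) (Vr 3)))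
     (Seq (SetV 10 (Plus (Plus (Plus (Vr 1) (Vr 1)) (Plus (Vr 1) (Vr 1))) (Num 8))) (Seq (Pow2 11 23 10)
     (Seq (SetV 50 (Num 320)) (Seq (Mul 51 23 50 2) (Seq (Mul 47 23 3 51)
     (Seq (SetV 50 (Num 256)) (Seq (Mul 51 23 50 2) (Seq (Mul 12 23 3 51) (Seq (Mul 13 23 3 12)
     (Seq (Mul 51 23 2 2) (Seq (SetV 50 (Num 4096)) (Seq (Mul 9 23 50 51)
     (Seq (Mul 51 23 3 3) (Seq (SetV 50 (Num 64)) (Seq (Mul 44 23 50 51)
     (Seq (SetV 4 (Num 1)) (Seq (EpsGe (Num 50) (Num 1) (Vr 4))
     (Seq (While (Minus (Num 1) (Vr 50)) (Seq (Incr 4 (Vr 4)) (EpsGe (Num 50) (Num 1) (Vr 4))))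
       (SetV 49 (Plus (Plus (Vr 4) (Vr 4)) (Plus (Vr 4) (Vr 4))))))))))))))))))))))))"

text \<open>Every stage only adds to cell 5, so acceptance means that no check failed; the answer
  overwrites \<open>n\<close> at the very end.\<close>

definition Tester :: com where
  "Tester = Seq Init (Seq StageA (Seq StageB (Seq StageC (SetV 0 (Minus (Num 1) (Vr 5))))))"

section \<open>Uniform distributions produced by coin flips\<close>

lemma coin_uniform: "bernoulli_pmf (1/2) = pmf_of_set UNIV"
  by (rule bernoulli_pmf_half_conv_pmf_of_set)

lemma pair_pmf_of_set:
  assumes "finite A" "A \<noteq> {}" "finite B" "B \<noteq> {}"
  shows "pair_pmf (pmf_of_set A) (pmf_of_set B) = pmf_of_set (A \<times> B)"
proof (rule pmf_eqI)
  fix ab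
  show "pmf (pair_pmf (pmf_of_set A) (pmf_of_set B)) ab = pmf (pmf_of_set (A \<times> B)) ab"
    by (cases ab) (simp add: assms pmf_pair indicator_def card_cartesian_product)
qed

lemma loopM_trivial [simp]: "loopM N i (\<lambda>_. return_pmf) a = return_pmf a"
  by (induction N arbitrary: i) (simp_all add: bind_return_pmf)

lemma rset_loop: "loopM N 0 (\<lambda>i x. map_pmf (\<lambda>b. if b then insert i x else x) (bernoulli_pmf (1/2))) {} = rset {..<N}"
proof (induction N)
  case 0
  show ?case by (simp add: pmf_of_set_singleton)
next
  case (Suc N)
  have "loopM (Suc N) 0 (\<lambda>i x. map_pmf (\<lambda>b. if b then insert i x else x) (bernoulli_pmf (1/2))) {}
     = map_pmf (\<lambda>(x, b). if b then insert N x else x) (pair_pmf (rset {..<N}) (pmf_of_set UNIV))"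
    unfolding loopM_snoc Suc.IH add_0 unfolding coin_uniform by (simp add: pair_pmf_def map_pmf_def bind_assoc_pmf bind_return_pmf)
  also have "pair_pmf (rset {..<N}) (pmf_of_set UNIV) = pmf_of_set (Pow {..<N} \<times> (UNIV :: bool set))"
    by (rule pair_pmf_of_set) auto
  also have "map_pmf (\<lambda>(x, b). if b then insert N x else x) (pmf_of_set (Pow {..<N} \<times> (UNIV :: bool set))) = rset {..<Suc N}"
  proof (rule map_pmf_of_set_bij_betw)
    show "bij_betw (\<lambda>(x, b). if b then insert N x else x) (Pow {..<N} \<times> UNIV) (Pow {..<Suc N})"
      by (rule bij_betwI[where g = "\<lambda>x. (x - {N}, N \<in> x)"]) (auto simp: less_Suc_eq split: if_splits)
  qed auto
  finally show ?case .
qed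

lemma unif_loop: "loopM N 0 (\<lambda>_ t. map_pmf (\<lambda>b. t + t + of_bool b) (bernoulli_pmf (1/2))) 0 = pmf_of_set {..<2 ^ N :: nat}"
proof (induction N)
  case 0
  have "{..<2 ^ 0 :: nat} = {0}" by auto
  then show ?case by (simp add: pmf_of_set_singleton)
next
  case (Suc N)
  have "loopM (Suc N) 0 (\<lambda>_ t. map_pmf (\<lambda>b. t + t + of_bool b) (bernoulli_pmf (1/2))) (0 :: nat)
     = map_pmf (\<lambda>(t, b). t + t + of_bool b) (pair_pmf (pmf_of_set {..<2 ^ N}) (pmf_of_set (UNIV :: bool set)))"
    unfolding loopM_snoc Suc.IH unfolding coin_uniform by (simp add: pair_pmf_def map_pmf_def bind_assoc_pmf bind_return_pmf)
  also have "pair_pmf (pmf_of_set {..<2 ^ N :: nat}) (pmf_of_set UNIV) = pmf_of_set ({..<2 ^ N} \<times> (UNIV :: bool set))"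
    by (rule pair_pmf_of_set) (auto simp: lessThan_empty_iff)
  also have "map_pmf (\<lambda>(t, b). t + t + of_bool b) (pmf_of_set ({..<2 ^ N} \<times> (UNIV :: bool set))) = pmf_of_set {..<2 ^ Suc N :: nat}"
  proof (rule map_pmf_of_set_bij_betw)
    show "bij_betw (\<lambda>(t, b). t + t + of_bool b) ({..<2 ^ N} \<times> UNIV) {..<2 ^ Suc N :: nat}"
      by (rule bij_betwI[where g = "\<lambda>t. (t div 2, odd t)"]) (auto, (presburger | linarith)+)
  qed (auto simp: lessThan_empty_iff)
  finally show ?case .
qed

text \<open>The loop invariant of \<open>Eval\<close> extends the list of processed rows at its end,
  where the next higher digit of \<open>t\<close> applies.\<close>

lemma lin_snoc: "lin t (us @ [u]) = lin t us \<triangle> (if odd (t div 2 ^ length us) then u else {})"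
proof (induction us arbitrary: t)
  case (Cons w us)
  have "t div 2 div 2 ^ length us = t div (2 * 2 ^ length us)" by (simp add: div_mult2_eq)
  then show ?case by (simp add: Cons.IH sd_assoc)
qed simp

lemma lin_pull: "lin t (map (pull \<tau> V) us) = pull \<tau> V (lin t us)"
  by (induction us arbitrary: t) (simp_all add: pull_sd)

lemma bits_le: "bits R \<le> R"
  unfolding bits_def by (rule Least_le) (simp add: less_imp_le)

lemma points_of_cube: "points_of n x \<in> cube n"
  by (auto simp: points_of_def cube_def)

section \<open>Arithmetic, random and evaluation subroutines\<close>

locale tester = machine +
  assumes fB: "f \<in> boolean_functions n"
begin

definition \<phi> :: "nat set \<Rightarrow> real" where "\<phi> x = f (points_of n x)"

lemma phi_values: "\<phi> x = 1 \<or> \<phi> x = -1"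
  using fB points_of_cube[of n x] by (auto simp: \<phi>_def boolean_functions_def PiE_def Pi_def)

lemma phi_pm: "pm {..<n} \<phi>" using phi_values by (simp add: pm_def)

lemma encode_phi: "encode_sign (\<phi> x) = of_bool (\<phi> x = 1)" by (simp add: encode_sign_def)

lemma exec_bind:
  assumes "exec c h q A (\<lambda>a h'. exec c' h' q' (B a) R)" "q'' = q + q'" "M = bind_pmf A B"
  shows "exec (Seq c c') h q'' M R"
  using assms by (rule exec_SeqI)

definition wf :: "hs \<Rightarrow> bool" where "wf h \<longleftrightarrow> sv h 0 = n"

lemma wfD [simp]: "wf h \<Longrightarrow> sv h 0 = n" by (simp add: wf_def)

lemma wf_upd [simp]:
  "wf (h\<lparr>sv := s\<rparr>) \<longleftrightarrow> s 0 = n" "wf (h\<lparr>ar := a\<rparr>) \<longleftrightarrow> wf h" "wf (h\<lparr>bu := b\<rparr>) \<longleftrightarrow> wf h"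
  by (auto simp: wf_def)

lemma exec_For0:
  assumes "x < 64" "N \<le> W" "I 0 (h\<lparr>sv := (sv h)(x := 0)\<rparr>)"
    "\<And>i h. i \<le> N \<Longrightarrow> I i h \<Longrightarrow> sv h x = i \<and> ev_h n b h = N"
    "\<And>i h. i < N \<Longrightarrow> I i h \<Longrightarrow> exec c h q (return_pmf ())
       (\<lambda>_ h'. sv h' x = i \<and> I (Suc i) (h'\<lparr>sv := (sv h')(x := Suc i)\<rparr>))"
    "\<And>h. I N h \<Longrightarrow> R () h"
  shows "exec (For x b c) h (N * q) (return_pmf ()) R"
  using exec_For[of x N "\<lambda>i _ h. I i h" "()" h b c q "\<lambda>_ _. return_pmf ()" R] assms by simp

lemma exec_For00:
  assumes "x < 64" "N \<le> W" "I 0 (h\<lparr>sv := (sv h)(x := 0)\<rparr>)"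
    "\<And>i h. i \<le> N \<Longrightarrow> I i h \<Longrightarrow> sv h x = i \<and> ev_h n b h = N"
    "\<And>i h. i < N \<Longrightarrow> I i h \<Longrightarrow> exec c h 0 (return_pmf ())
       (\<lambda>_ h'. sv h' x = i \<and> I (Suc i) (h'\<lparr>sv := (sv h')(x := Suc i)\<rparr>))"
    "\<And>h. I N h \<Longrightarrow> R () h"
  shows "exec (For x b c) h 0 (return_pmf ()) R"
  using exec_For0[of x N I h b c 0 R] assms by simp

lemma hs_eq: "h = h' \<longleftrightarrow> sv h = sv h' \<and> bu h = bu h' \<and> ar h = ar h'" for h h' :: hs
  by (cases h; cases h') auto

lemma exec_Pow2:
  assumes "z < 64" "i < 64" "x < 64" "z \<noteq> i" "z \<noteq> x" "i \<noteq> x" "sv h x \<le> W"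
    and R: "R () (h\<lparr>sv := (sv h)(z := 2 ^ sv h x, i := sv h x)\<rparr>)"
  shows "exec (Pow2 z i x) h 0 (return_pmf ()) R"
  unfolding Pow2_def
proof (rule exec_then, rule exec_SetV[OF assms(1)],
    rule exec_For00[where N = "sv h x" and I = "\<lambda>j h'. sv h' = (sv h)(z := 2 ^ j, i := j) \<and> bu h' = bu h \<and> ar h' = ar h"])
  fix h' :: hs assume "sv h' = (sv h)(z := 2 ^ sv h x, i := sv h x) \<and> bu h' = bu h \<and> ar h' = ar h"
  then have "h' = h\<lparr>sv := (sv h)(z := 2 ^ sv h x, i := sv h x)\<rparr>" by (simp add: hs_eq)
  then show "R () h'" using R by simp
qed (use assms(1-7) in \<open>auto intro!: exec_SetV simp: fun_eq_iff\<close>)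

lemma exec_Mul:
  assumes "z < 64" "i < 64" "x < 64" "y < 64" "z \<noteq> i" "z \<noteq> x" "i \<noteq> x" "z \<noteq> y" "i \<noteq> y" "sv h x \<le> W"
    and R: "R () (h\<lparr>sv := (sv h)(z := sv h x * sv h y, i := sv h x)\<rparr>)"
  shows "exec (Mul z i x y) h 0 (return_pmf ()) R"
  unfolding Mul_def
proof (rule exec_then, rule exec_SetV[OF assms(1)],
    rule exec_For00[where N = "sv h x" and I = "\<lambda>j h'. sv h' = (sv h)(z := j * sv h y, i := j) \<and> bu h' = bu h \<and> ar h' = ar h"])
  fix h' :: hs assume "sv h' = (sv h)(z := sv h x * sv h y, i := sv h x) \<and> bu h' = bu h \<and> ar h' = ar h"
  then have "h' = h\<lparr>sv := (sv h)(z := sv h x * sv h y, i := sv h x)\<rparr>" by (simp add: hs_eq)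
  then show "R () h'" using R by simp
qed (use assms(1-10) in \<open>auto intro!: exec_SetV simp: fun_eq_iff\<close>)

definition vec :: "nat \<Rightarrow> nat \<Rightarrow> nat set \<Rightarrow> (nat \<Rightarrow> nat) \<Rightarrow> nat \<Rightarrow> nat" where
  "vec o' N x g = (\<lambda>j. if o' \<le> j \<and> j < o' + N then of_bool (j - o' \<in> x) else g j)"

lemma exec_RandVec:
  assumes "wf h" "k < 8" "v < 64" "off < 64" "lm < 64" "v \<noteq> off" "v \<noteq> lm" "v \<noteq> 0" "sv h lm = N" "N \<le> W"
    and R: "\<And>x. x \<subseteq> {..<N} \<Longrightarrow> R x (h\<lparr>sv := (sv h)(v := N), ar := (ar h)(k := vec (sv h off) N x (ar h k))\<rparr>)"
  shows "exec (RandVec k off v lm) h 0 (rset {..<N}) R"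
proof -
  define I where "I i x h' \<longleftrightarrow> x \<subseteq> {..<i} \<and> h' = h\<lparr>sv := (sv h)(v := i), ar := (ar h)(k := vec (sv h off) i x (ar h k))\<rparr>" for i x and h' :: hs
  have "exec (RandVec k off v lm) h (N * 0) (loopM N 0 (\<lambda>i x. map_pmf (\<lambda>b. if b then insert i x else x) coin) {}) R"
    unfolding RandVec_def
  proof (rule exec_For[where I = I])
    fix i x h' assume i: "i < N" "I i x h'"
    then have x: "x \<subseteq> {..<i}" and h': "h' = h\<lparr>sv := (sv h)(v := i), ar := (ar h)(k := vec (sv h off) i x (ar h k))\<rparr>"
      by (auto simp: I_def)
    show "exec (FlipA k (Plus (Vr off) (Vr v))) h' 0 (map_pmf (\<lambda>b. if b then insert i x else x) coin)
        (\<lambda>a' h'. sv h' v = i \<and> I (Suc i) a' (h'\<lparr>sv := (sv h')(v := Suc i)\<rparr>))"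
    proof (rule exec_map)
      show "exec (FlipA k (Plus (Vr off) (Vr v))) h' 0 coin (\<lambda>b h''. h'' = h'\<lparr>ar := (ar h')(k := (ar h' k)(sv h off + i := of_bool b))\<rparr>)"
        by (rule exec_FlipA) (use assms in \<open>auto simp: h'\<close>)
      fix b h'' assume h'': "h'' = h'\<lparr>ar := (ar h')(k := (ar h' k)(sv h off + i := of_bool b))\<rparr>"
      have "(vec (sv h off) i x (ar h k))(sv h off + i := of_bool b)
          = vec (sv h off) (Suc i) (if b then insert i x else x) (ar h k)"
        using x by (auto simp: vec_def fun_eq_iff)
      then show "sv h'' v = i \<and> I (Suc i) (if b then insert i x else x) (h''\<lparr>sv := (sv h'')(v := Suc i)\<rparr>)"
        using x by (auto simp: I_def h'' h')
    qed
  next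
    have "(ar h)(k := vec (sv h off) 0 {} (ar h k)) = ar h" by (auto simp: fun_eq_iff vec_def)
    then show "I 0 {} (h\<lparr>sv := (sv h)(v := 0)\<rparr>)" by (simp add: I_def hs_eq)
  qed (use assms in \<open>auto simp: I_def\<close>)
  then show ?thesis by (simp add: rset_loop)
qed

lemma exec_RandNum:
  assumes "sv h 10 = N" "N \<le> W"
    and R: "\<And>x h'. x < 2 ^ N \<Longrightarrow> (\<And>k. k \<notin> {20, 26, 32} \<Longrightarrow> sv h' k = sv h k) \<Longrightarrow> sv h' 20 = x \<Longrightarrow> ar h' = ar h \<Longrightarrow> bu h' = bu h \<Longrightarrow> R x h'"
  shows "exec (RandNum) h 0 (pmf_of_set {..<2 ^ N}) R"
proof -
  define I where "I j x h' \<longleftrightarrow> x < 2 ^ j \<and> sv h' 26 = j \<and> sv h' 20 = x \<and> (\<forall>k. k \<notin> {20, 26, 32} \<longrightarrow> sv h' k = sv h k) \<and> ar h' = ar h \<and> bu h' = bu h" for j x and h' :: hs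
  have "exec (RandNum) h (N * 0) (loopM N 0 (\<lambda>_ t. map_pmf (\<lambda>b. t + t + of_bool b) coin) 0) R"
    unfolding RandNum_def
  proof (rule exec_then, rule exec_SetV, simp, rule exec_For[where I = I])
    fix j x h' assume j: "j < N" "I j x h'"
    show "exec (Seq (FlipV 32) (SetV 20 (Plus (Plus (Vr 20) (Vr 20)) (Vr 32)))) h' 0 (map_pmf (\<lambda>b. x + x + of_bool b) coin)
      (\<lambda>a' h'. sv h' 26 = j \<and> I (Suc j) a' (h'\<lparr>sv := (sv h')(26 := Suc j)\<rparr>))"
      by (rule exec_bind[where B = "\<lambda>b. return_pmf (x + x + of_bool b)", OF exec_FlipV])
        (use assms j in \<open>auto intro!: exec_return[OF exec_SetV] simp: I_def map_pmf_def split: if_splits\<close>)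
  qed (use assms in \<open>auto simp: I_def\<close>)
  then show ?thesis by (simp add: unif_loop)
qed

lemma exec_Rnd:
  assumes "r < 64" "r \<notin> {30, 31, 32}" "sv h r = N" "0 < N" "N \<le> W"
    and R: "\<And>x h'. x < N \<Longrightarrow> (\<And>k. k \<notin> {30, 31, 32} \<Longrightarrow> sv h' k = sv h k) \<Longrightarrow> sv h' 30 = x \<Longrightarrow> ar h' = ar h \<Longrightarrow> bu h' = bu h \<Longrightarrow> R x h'"
  shows "exec (Rnd r) h 0 (rnd N) R"
proof -
  define I where "I j x h' \<longleftrightarrow> x < 2 ^ j \<and> sv h' 31 = 2 ^ j \<and> sv h' 30 = x \<and> (\<forall>k. k \<notin> {30, 31, 32} \<longrightarrow> sv h' k = sv h k) \<and> ar h' = ar h \<and> bu h' = bu h" for j x and h' :: hs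
  define c where "c = Seq (FlipV 32) (Seq (SetV 30 (Plus (Plus (Vr 30) (Vr 30)) (Vr 32))) (Incr 31 (Vr 31)))"
  have loop: "exec (While (Minus (Vr r) (Vr 31)) c) h' (bits N * 0) (loopM (bits N) 0 (\<lambda>_ t. map_pmf (\<lambda>b. t + t + of_bool b) coin) 0) (I (bits N))"
    if "I 0 0 h'" for h' :: hs
  proof (rule exec_While[where I = I])
    fix j x h' assume j: "j < bits N" "I j x h'"
    show "exec c h' 0 (map_pmf (\<lambda>b. x + x + of_bool b) coin) (I (Suc j))"
      unfolding c_def
      by (rule exec_bind[where B = "\<lambda>b. return_pmf (x + x + of_bool b)", OF exec_FlipV])
        (use j in \<open>auto intro!: exec_then[OF exec_SetV] exec_return[OF exec_SetV] simp: I_def map_pmf_def split: if_splits\<close>)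
    show "ev_h n (Minus (Vr r) (Vr 31)) h' \<noteq> 0" using j assms bits_less[of j N] by (auto simp: I_def)
  next
    fix x h' assume "I (bits N) x h'"
    then show "ev_h n (Minus (Vr r) (Vr 31)) h' = 0" using assms bits_ge[of N] by (auto simp: I_def)
  qed (use that bits_le[of N] assms in auto)
  have "exec (Rnd r) h 0 (bind_pmf (pmf_of_set {..<2 ^ bits N}) (\<lambda>t. return_pmf (if N \<le> t then t - N else t))) R"
    unfolding Rnd_def c_def[symmetric]
  proof (rule exec_then, rule exec_SetV, simp, rule exec_then, rule exec_SetV, simp, rule exec_bind)
    let ?h = "h\<lparr>sv := (sv h)(30 := 0, 31 := 1)\<rparr>"
    show "exec (While (Minus (Vr r) (Vr 31)) c) (h\<lparr>sv := (sv h)(30 := ev_h n (Num 0) h), sv := (sv (h\<lparr>sv := (sv h)(30 := ev_h n (Num 0) h)\<rparr>))(31 := ev_h n (Num 1) (h\<lparr>sv := (sv h)(30 := ev_h n (Num 0) h)\<rparr>))\<rparr>)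
      0 (pmf_of_set {..<2 ^ bits N})
      (\<lambda>t h'. exec (Cond (Minus (Plus (Vr 30) (Num 1)) (Vr r)) (SetV 30 (Minus (Vr 30) (Vr r))) Skip) h' 0
         (return_pmf (if N \<le> t then t - N else t)) R)"
    proof -
      have "exec (While (Minus (Vr r) (Vr 31)) c) ?h 0 (pmf_of_set {..<2 ^ bits N}) (I (bits N))"
        using loop[of ?h] by (simp add: I_def unif_loop)
      then have "exec (While (Minus (Vr r) (Vr 31)) c) ?h 0 (pmf_of_set {..<2 ^ bits N})
        (\<lambda>t h'. exec (Cond (Minus (Plus (Vr 30) (Num 1)) (Vr r)) (SetV 30 (Minus (Vr 30) (Vr r))) Skip) h' 0
         (return_pmf (if N \<le> t then t - N else t)) R)"
      proof (rule exec_weaken[OF _ order_refl])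
        fix t h' assume I: "I (bits N) t h'"
        have up: "t < 2 * N" using I bits_upper[OF assms(4)] by (auto simp: I_def)
        show "exec (Cond (Minus (Plus (Vr 30) (Num 1)) (Vr r)) (SetV 30 (Minus (Vr 30) (Vr r))) Skip) h' 0
         (return_pmf (if N \<le> t then t - N else t)) R"
          by (rule exec_Cond) (use I up assms(1-4) in \<open>auto intro!: exec_return[OF exec_SetV] exec_return[OF exec_Skip] R simp: I_def\<close>)
      qed
      then show ?thesis by simp
    qed
  qed auto
  then show ?thesis by (simp add: rnd_def map_pmf_def)
qed

definition rows_at :: "nat set list \<Rightarrow> (nat \<Rightarrow> nat) \<Rightarrow> bool" where
  "rows_at us g \<longleftrightarrow> (\<forall>k<length us. \<forall>v<n. g (k * n + v) = of_bool (v \<in> us ! k))"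

lemma exec_Eval:
  assumes h: "wf h" "sv h 21 = length us" "length us \<le> W" "rows_at us (ar h 1)" "set us \<subseteq> Pow {..<n}"
    and x: "x \<subseteq> {..<n}" "\<And>v. v < n \<Longrightarrow> ar h 0 v = of_bool (v \<in> x)"
    and R: "\<And>h'. (\<And>k. k \<notin> {22..28} \<Longrightarrow> sv h' k = sv h k) \<Longrightarrow> ar h' = ar h \<Longrightarrow>
       sv h' 22 = of_bool (\<phi> (x \<triangle> lin (sv h 20) us) = 1) \<Longrightarrow> R () h'"
  shows "exec Eval h 1 (return_pmf ()) R"
proof -
  define fr where "fr h' \<longleftrightarrow> wf h' \<and> (\<forall>k. k \<notin> {22..28} \<longrightarrow> sv h' k = sv h k) \<and> ar h' = ar h" for h' :: hs
  define copied where "copied y h' \<longleftrightarrow> (\<forall>v<n. bu h' v = of_bool (v \<in> y))" for y and h' :: hs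
  let ?t = "sv h 20"
  \<comment> \<open>After \<open>k\<close> rows the buffer holds the base point shifted by their
    combination, and cell 24 holds the digits of \<open>?t\<close> still to be used.\<close>
  define J where "J k h' \<longleftrightarrow> fr h' \<and> sv h' 26 = k \<and> sv h' 24 = ?t div 2 ^ k \<and> sv h' 25 = k * n \<and> copied (x \<triangle> lin ?t (take k us)) h'" for k and h' :: hs
  have step: "exec (Seq (SetV 27 (Half (Vr 24))) (Seq (SetV 28 (Minus (Vr 24) (Plus (Vr 27) (Vr 27)))) (Seq (SetV 24 (Vr 27))
       (Seq (For 23 (Vr 0) (SetB (Vr 23) (XOR (Bu (Vr 23)) (AND (Vr 28) (Ar 1 (Plus (Vr 25) (Vr 23)))))))
       (Incr 25 (Vr 0)))))) h' 0 (return_pmf ()) (\<lambda>_ h'. sv h' 26 = k \<and> J (Suc k) (h'\<lparr>sv := (sv h')(26 := Suc k)\<rparr>))"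
    if k: "k < length us" and J: "J k h'" for k and h' :: hs
  proof -
    define u where "u = us ! k"
    define b where "b = odd (?t div 2 ^ k)"
    define y where "y = x \<triangle> lin ?t (take k us)"
    have u: "u \<subseteq> {..<n}" using k h(5) nth_mem[of k us] unfolding u_def by blast
    have y': "x \<triangle> lin ?t (take (Suc k) us) = y \<triangle> (if b then u else {})"
      using k by (simp add: take_Suc_conv_app_nth lin_snoc y_def b_def u_def sd_assoc)
    define P where "P i h'' \<longleftrightarrow> fr h'' \<and> sv h'' 23 = i \<and> sv h'' 26 = k \<and> sv h'' 28 = of_bool b \<and> sv h'' 24 = ?t div 2 ^ Suc k \<and> sv h'' 25 = k * n \<and>
      (\<forall>v<n. bu h'' v = of_bool (v \<in> (if v < i then y \<triangle> (if b then u else {}) else y)))" for i and h'' :: hs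
    have "?t div 2 ^ k - 2 * (?t div 2 ^ k div 2) = of_bool b" unfolding b_def by (simp add: of_bool_odd_eq_mod_2 minus_mult_div_eq_mod)
    moreover have "?t div 2 ^ k div 2 = ?t div 2 ^ Suc k" by (metis div_mult2_eq power_Suc2)
    ultimately have dv: "?t div 2 ^ k - (?t div 2 ^ k div 2 + ?t div 2 ^ k div 2) = of_bool b" "?t div 2 ^ k div 2 = ?t div 2 ^ Suc k" by simp_all
    have P0: "P 0 (h'\<lparr>sv := (sv h')(27 := ?t div 2 ^ Suc k, 28 := of_bool b, 24 := ?t div 2 ^ Suc k, 23 := 0)\<rparr>)"
      using J by (auto simp: P_def J_def fr_def copied_def y_def)
    have inner: "exec (For 23 (Vr 0) (SetB (Vr 23) (XOR (Bu (Vr 23)) (AND (Vr 28) (Ar 1 (Plus (Vr 25) (Vr 23)))))))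
       (h'\<lparr>sv := (sv h')(27 := ?t div 2 ^ Suc k, 28 := of_bool b, 24 := ?t div 2 ^ Suc k)\<rparr>) 0 (return_pmf ()) (\<lambda>_. P n)"
    proof (rule exec_For00[where N = n and I = P])
      fix i h'' assume i: "i < n" "P i h''"
      have s0: "wf h''" using i h by (auto simp: P_def fr_def)
      have a: "ar h'' 1 (k * n + i) = of_bool (i \<in> u)" using i k h(4) by (auto simp: P_def fr_def rows_at_def u_def)
      show "exec (SetB (Vr 23) (XOR (Bu (Vr 23)) (AND (Vr 28) (Ar 1 (Plus (Vr 25) (Vr 23)))))) h'' 0 (return_pmf ())
        (\<lambda>_ h'. sv h' 23 = i \<and> P (Suc i) (h'\<lparr>sv := (sv h')(23 := Suc i)\<rparr>))"
        by (rule exec_SetB) (use i s0 a in \<open>auto simp: P_def fr_def less_Suc_eq sd_mem\<close>)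
    qed (use P0 n_le_W h in \<open>auto simp: P_def fr_def\<close>)
    have fin: "exec (Incr 25 (Vr 0)) h'' 0 (return_pmf ()) (\<lambda>_ h'. sv h' 26 = k \<and> J (Suc k) (h'\<lparr>sv := (sv h')(26 := Suc k)\<rparr>))" if "P n h''" for h''
      by (rule exec_SetV) (use that h y' in \<open>auto simp: P_def J_def fr_def copied_def\<close>)
    have pre: "sv h' 24 = ?t div 2 ^ k" using J by (simp add: J_def)
    show ?thesis
      apply (rule exec_then, rule exec_SetV, simp)
      apply (rule exec_then, rule exec_SetV, simp)
      apply (rule exec_then, rule exec_SetV, simp)
      apply (rule exec_then, rule exec_weaken[OF _ order_refl fin])
       apply (use inner pre dv in simp)
      apply assumption
      done
  qed
  have 1: "exec (For 23 (Vr 0) (SetB (Vr 23) (Ar 0 (Vr 23)))) h 0 (return_pmf ()) (\<lambda>_ h'. fr h' \<and> copied x h')"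
    by (rule exec_For00[where N = n and I = "\<lambda>i h'. fr h' \<and> sv h' 23 = i \<and> (\<forall>v<i. bu h' v = of_bool (v \<in> x))"])
      (use h n_le_W x in \<open>auto intro!: exec_SetB simp: fr_def copied_def less_Suc_eq\<close>)
  have 2: "exec (For 26 (Vr 21) (Seq (SetV 27 (Half (Vr 24))) (Seq (SetV 28 (Minus (Vr 24) (Plus (Vr 27) (Vr 27)))) (Seq (SetV 24 (Vr 27))
       (Seq (For 23 (Vr 0) (SetB (Vr 23) (XOR (Bu (Vr 23)) (AND (Vr 28) (Ar 1 (Plus (Vr 25) (Vr 23)))))))
       (Incr 25 (Vr 0))))))) h' 0 (return_pmf ()) (\<lambda>_. J (length us))"
    if "J 0 (h'\<lparr>sv := (sv h')(26 := 0)\<rparr>)" for h' :: hs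
    by (rule exec_For00[where N = "length us" and I = J]) (use that step h in \<open>auto simp: J_def fr_def\<close>)
  have 3: "exec (QueryV 22) h' 1 (return_pmf ()) R" if J: "J (length us) h'" for h' :: hs
  proof (rule exec_QueryV)
    have s: "x \<triangle> lin ?t us \<subseteq> {..<n}" using x lin_subset[OF h(5)] by auto
    have "{i. i < n \<and> bu h' i \<noteq> 0} = x \<triangle> lin ?t us"
      using J s by (auto simp: J_def copied_def)
    then have "encode_sign (f (points_of n {i. i < n \<and> bu h' i \<noteq> 0})) = of_bool (\<phi> (x \<triangle> lin ?t us) = 1)"
      using encode_phi by (simp add: \<phi>_def)
    then show "R () (h'\<lparr>sv := (sv h')(22 := encode_sign (f (points_of n {i. i < n \<and> bu h' i \<noteq> 0})))\<rparr>)"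
      by (intro R) (use J in \<open>auto simp: J_def fr_def\<close>)
  qed simp
  show ?thesis
    unfolding Eval_def
    apply (rule exec_then, rule exec_weaken[OF 1 order_refl])
    apply (rule exec_then, rule exec_SetV, simp)
    apply (rule exec_then, rule exec_SetV, simp)
    apply (rule exec_then, rule exec_weaken[OF 2 order_refl 3])
     apply (auto simp: J_def fr_def copied_def)
    done
qed

end

section \<open>Correctness of the program\<close>

primrec parity :: "(nat \<Rightarrow> bool) \<Rightarrow> nat \<Rightarrow> bool" where
  "parity g 0 = False"
| "parity g (Suc N) = (g N \<noteq> parity g N)"

text \<open>The program records the parity of the number of values 1, whereas the sign of a product
  is the parity of the number of values -1; the parity of \<open>N\<close> converts between
  them.\<close>

lemma prod_parity:
  assumes "\<And>s. h s = 1 \<or> h s = (-1::real)"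
  shows "(\<Prod>s<N. h s) = (if parity (\<lambda>s. h s = 1) N = odd N then 1 else -1)"
proof (induction N)
  case (Suc N)
  then show ?case using assms[of N] by auto
qed simp

context tester
begin

definition frame :: "nat set \<Rightarrow> hs \<Rightarrow> hs \<Rightarrow> bool" where
  "frame X h h' \<longleftrightarrow> wf h' \<and> (\<forall>k. k \<notin> X \<longrightarrow> sv h' k = sv h k)"

definition bits_at :: "nat \<Rightarrow> nat set \<Rightarrow> (nat \<Rightarrow> nat) \<Rightarrow> bool" where
  "bits_at N x g \<longleftrightarrow> (\<forall>v<N. g v = of_bool (v \<in> x))"

lemma bits_at_vec [simp]: "bits_at N x (vec 0 N x g)" by (simp add: bits_at_def vec_def)

lemma rows_at_snoc:
  assumes "rows_at us g" "\<And>k v. k < length us \<Longrightarrow> v < n \<Longrightarrow> g' (k * n + v) = g (k * n + v)"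
    "\<And>v. v < n \<Longrightarrow> g' (length us * n + v) = of_bool (v \<in> u)"
  shows "rows_at (us @ [u]) g'"
  using assms unfolding rows_at_def by (auto simp: less_Suc_eq nth_append)

lemma row_less: "k < i \<Longrightarrow> v < N \<Longrightarrow> k * N + v < i * (N::nat)"
proof -
  assume "k < i" "v < N"
  then have "k * N + v < (k + 1) * N" "(k + 1) * N \<le> i * N" by (simp, intro mult_right_mono) auto
  then show ?thesis by linarith
qed

lemma rows_at_vec: "rows_at us g \<Longrightarrow> rows_at (us @ [u]) (vec (length us * n) n u g)"
proof (erule rows_at_snoc)
  fix k v assume "k < length us" "v < n"
  then have "k * n + v < length us * n" by (rule row_less)
  then show "vec (length us * n) n u g (k * n + v) = g (k * n + v)" by (simp add: vec_def)
qed (simp add: vec_def)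

lemma exec_DrawRows:
  assumes h: "wf h" "sv h 21 = N" "N \<le> W"
    and R: "\<And>us h'. length us = N \<Longrightarrow> set us \<subseteq> Pow {..<n} \<Longrightarrow> rows_at us (ar h' 1) \<Longrightarrow> frame {23, 25, 26} h h' \<Longrightarrow>
       (\<And>k. k \<noteq> 1 \<Longrightarrow> ar h' k = ar h k) \<Longrightarrow> R us h'"
  shows "exec DrawRows h 0 (replicate_pmf N (rset {..<n})) R"
proof -
  define rs where "rs us \<longleftrightarrow> set us \<subseteq> Pow {..<n}" for us
  have rs_snoc: "rs us \<Longrightarrow> u \<subseteq> {..<n} \<Longrightarrow> rs (us @ [u])" for us u by (auto simp: rs_def)
  define I where "I i us h' \<longleftrightarrow> frame {23, 25, 26} h h' \<and> length us = i \<and> rs us \<and> rows_at us (ar h' 1) \<and>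
    sv h' 26 = i \<and> sv h' 25 = i * n \<and> (\<forall>k. k \<noteq> 1 \<longrightarrow> ar h' k = ar h k)" for i us and h' :: hs
  have "exec DrawRows h (N * 0) (loopM N 0 (\<lambda>_ us. map_pmf (\<lambda>u. us @ [u]) (rset {..<n})) []) R"
    unfolding DrawRows_def
  proof (rule exec_then, rule exec_SetV, simp, rule exec_For[where I = I])
    fix i us and h' :: hs assume i: "i < N" "I i us h'"
    then have w: "wf h'" by (simp add: I_def frame_def)
    show "exec (Seq (RandVec 1 25 23 0) (Incr 25 (Vr 0))) h' 0 (map_pmf (\<lambda>u. us @ [u]) (rset {..<n}))
      (\<lambda>a' h'. sv h' 26 = i \<and> I (Suc i) a' (h'\<lparr>sv := (sv h')(26 := Suc i)\<rparr>))"
      by (rule exec_bind[where B = "\<lambda>u. return_pmf (us @ [u])", OF exec_RandVec[where N = n]])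
        (use i w n_le_W h in \<open>auto intro!: exec_return[OF exec_SetV] rows_at_vec rs_snoc simp: I_def frame_def map_pmf_def\<close>)
  qed (use h R in \<open>auto simp: I_def frame_def rows_at_def rs_def\<close>)
  moreover have "(@) [] = (\<lambda>us :: nat set list. us)" by auto
  ultimately show ?thesis by (simp add: loopM_replicate)
qed

lemma exec_RMCheck:
  assumes h: "wf h" "sv h 2 = p" "0 < p" "sv h 7 = 2 ^ p" "2 ^ p \<le> W" "p \<le> W" "x \<subseteq> {..<n}" "bits_at n x (ar h 0)"
    and R: "\<And>us h'. frame ({5, 6} \<union> {20..28}) h h' \<Longrightarrow> (sv h' 5 = 0 \<longleftrightarrow> sv h 5 = 0 \<and> cubeP \<phi> x us = 1) \<Longrightarrow>
       (\<And>k. k \<noteq> 1 \<Longrightarrow> ar h' k = ar h k) \<Longrightarrow> R us h'"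
  shows "exec RMCheck h (2 ^ p) (replicate_pmf p (rset {..<n})) R"
proof -
  have rest: "exec (Seq (SetV 6 (Num 0)) (Seq (For 20 (Vr 7) (Seq Eval (SetV 6 (XOR (Vr 6) (Vr 22))))) (Incr 5 (Vr 6)))) h1
     (2 ^ p) (return_pmf us) R"
    if h1: "length us = p" "set us \<subseteq> Pow {..<n}" "rows_at us (ar h1 1)" "frame {21, 23, 25, 26} h h1" "sv h1 21 = p"
      "\<And>k. k \<noteq> 1 \<Longrightarrow> ar h1 k = ar h k" for us h1
  proof (rule exec_then, rule exec_SetV, simp)
    let ?h = "h1\<lparr>sv := (sv h1)(6 := ev_h n (Num 0) h1)\<rparr>"
    define J where "J t h' \<longleftrightarrow> frame ({6} \<union> {20, 22, 23, 24, 25, 26, 27, 28}) h1 h' \<and> ar h' = ar h1 \<and> sv h' 20 = t \<and>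
       sv h' 6 = of_bool (parity (\<lambda>s. \<phi> (x \<triangle> lin s us) = 1) t)" for t and h' :: hs
    have "exec (For 20 (Vr 7) (Seq Eval (SetV 6 (XOR (Vr 6) (Vr 22))))) ?h (2 ^ p * 1) (return_pmf ()) (\<lambda>_. J (2 ^ p))"
    proof (rule exec_For0[where I = J])
      fix t h' assume t: "t < 2 ^ p" "J t h'"
      show "exec (Seq Eval (SetV 6 (XOR (Vr 6) (Vr 22)))) h' 1 (return_pmf ())
        (\<lambda>_ h'. sv h' 20 = t \<and> J (Suc t) (h'\<lparr>sv := (sv h')(20 := Suc t)\<rparr>))"
      proof (rule exec_bind[where A = "return_pmf ()" and B = return_pmf and q = 1 and q' = 0])
        show "exec Eval h' 1 (return_pmf ()) (\<lambda>a h'. exec (SetV 6 (XOR (Vr 6) (Vr 22))) h' 0 (return_pmf a)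
          (\<lambda>_ h'. sv h' 20 = t \<and> J (Suc t) (h'\<lparr>sv := (sv h')(20 := Suc t)\<rparr>)))"
        proof (rule exec_Eval[where us = us and x = x])
          fix h'' :: hs assume h'': "\<And>k. k \<notin> {22..28} \<Longrightarrow> sv h'' k = sv h' k" "ar h'' = ar h'"
            "sv h'' 22 = of_bool (\<phi> (x \<triangle> lin (sv h' 20) us) = 1)"
          have "wf h''" using h''(1)[of 0] t by (auto simp: J_def frame_def wf_def)
          then show "exec (SetV 6 (XOR (Vr 6) (Vr 22))) h'' 0 (return_pmf ())
            (\<lambda>_ h'. sv h' 20 = t \<and> J (Suc t) (h'\<lparr>sv := (sv h')(20 := Suc t)\<rparr>))"
            by (intro exec_SetV) (use t h'' in \<open>auto simp: J_def frame_def\<close>)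
        qed (use t h h1 in \<open>auto simp: J_def frame_def bits_at_def\<close>)
      qed (simp_all add: bind_return_pmf)
    qed (use h h1 in \<open>auto simp: J_def frame_def\<close>)
    then have loop: "exec (For 20 (Vr 7) (Seq Eval (SetV 6 (XOR (Vr 6) (Vr 22))))) ?h (2 ^ p) (return_pmf ()) (\<lambda>_. J (2 ^ p))" by simp
    show "exec (Seq (For 20 (Vr 7) (Seq Eval (SetV 6 (XOR (Vr 6) (Vr 22))))) (Incr 5 (Vr 6))) ?h (2 ^ p) (return_pmf us) R"
    proof (rule exec_bind[where B = "\<lambda>_. return_pmf us" and q' = 0])
      show "exec (For 20 (Vr 7) (Seq Eval (SetV 6 (XOR (Vr 6) (Vr 22))))) ?h (2 ^ p) (return_pmf ())
        (\<lambda>a h'. exec (Incr 5 (Vr 6)) h' 0 (return_pmf us) R)"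
      proof (rule exec_weaken[OF loop order_refl])
        fix h' assume J: "J (2 ^ p) h'"
        \<comment> \<open>Since \<open>0 < p\<close>, the number \<open>2 ^ p\<close> of vertices is
          even, so the two parities coincide.\<close>
        have "cubeP \<phi> x us = 1 \<longleftrightarrow> \<not> parity (\<lambda>s. \<phi> (x \<triangle> lin s us) = 1) (2 ^ p)"
          unfolding cubeP_lin h1(1) by (subst prod_parity) (use phi_values h(3) in auto)
        then show "exec (Incr 5 (Vr 6)) h' 0 (return_pmf us) R"
          by (intro exec_return[OF exec_SetV] R) (use J h h1 in \<open>auto simp: J_def frame_def\<close>)
      qed
    qed (simp_all add: bind_return_pmf)
  qed
  have "exec RMCheck h (0 + 2 ^ p) (bind_pmf (replicate_pmf p (rset {..<n})) return_pmf) R"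
    unfolding RMCheck_def
    by (rule exec_then, rule exec_SetV, simp, rule exec_Seq, rule exec_DrawRows[where N = p], use h in simp, use h in simp, use h in simp, rule rest)
      (use h in \<open>auto simp: frame_def\<close>)
  then show ?thesis by (simp add: bind_return_pmf')
qed

definition rm_test :: "nat \<Rightarrow> nat set pmf \<Rightarrow> bool pmf" where
  "rm_test p \<mu> = bind_pmf \<mu> (\<lambda>x. map_pmf (\<lambda>us. cubeP \<phi> x us = 1) (replicate_pmf p (rset {..<n})))"

definition repeat :: "nat \<Rightarrow> bool pmf \<Rightarrow> bool pmf" where
  "repeat N t = loopM N 0 (\<lambda>_ ok. map_pmf (\<lambda>b. ok \<and> b) t) True"

lemma exec_StageA:
  assumes h: "wf h" "sv h 2 = p" "0 < p" "sv h 7 = 2 ^ p" "2 ^ p \<le> W" "p \<le> W" "sv h 63 = 0" "sv h 47 = N" "N \<le> W"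
    and R: "\<And>ok h'. frame ({5, 6, 48} \<union> {20..28}) h h' \<Longrightarrow> (sv h' 5 = 0 \<longleftrightarrow> sv h 5 = 0 \<and> ok) \<Longrightarrow> R ok h'"
  shows "exec StageA h (N * 2 ^ p) (repeat N (rm_test p (rset {..<n}))) R"
  unfolding StageA_def repeat_def
proof (rule exec_For[where I = "\<lambda>i ok h'. frame ({5, 6, 48} \<union> {20..28}) h h' \<and> (sv h' 5 = 0 \<longleftrightarrow> sv h 5 = 0 \<and> ok) \<and> sv h' 48 = i"])
  fix i ok and h' :: hs
  assume i: "i < N" "frame ({5, 6, 48} \<union> {20..28}) h h' \<and> (sv h' 5 = 0 \<longleftrightarrow> sv h 5 = 0 \<and> ok) \<and> sv h' 48 = i"
  let ?Q = "\<lambda>ok h''. sv h'' 48 = i \<and> frame ({5, 6, 48} \<union> {20..28}) h (h''\<lparr>sv := (sv h'')(48 := Suc i)\<rparr>) \<and>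
    (sv (h''\<lparr>sv := (sv h'')(48 := Suc i)\<rparr>) 5 = 0 \<longleftrightarrow> sv h 5 = 0 \<and> ok) \<and> sv (h''\<lparr>sv := (sv h'')(48 := Suc i)\<rparr>) 48 = Suc i"
  show "exec (Seq (RandVec 0 63 23 0) RMCheck) h' (2 ^ p) (map_pmf (\<lambda>b. ok \<and> b) (rm_test p (rset {..<n}))) ?Q"
  proof (rule exec_bind[where B = "\<lambda>x. map_pmf (\<lambda>us. ok \<and> cubeP \<phi> x us = 1) (replicate_pmf p (rset {..<n}))", OF exec_RandVec[where N = n]])
    fix x assume x: "x \<subseteq> {..<n}"
    let ?h = "h'\<lparr>sv := (sv h')(23 := n), ar := (ar h')(0 := vec (sv h' 63) n x (ar h' 0))\<rparr>"
    show "exec RMCheck ?h (2 ^ p) (map_pmf (\<lambda>us. ok \<and> cubeP \<phi> x us = 1) (replicate_pmf p (rset {..<n}))) ?Q"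
    proof (rule exec_map)
      show "exec RMCheck ?h (2 ^ p) (replicate_pmf p (rset {..<n}))
         (\<lambda>us h''. frame ({5, 6} \<union> {20..28}) ?h h'' \<and> (sv h'' 5 = 0 \<longleftrightarrow> sv ?h 5 = 0 \<and> cubeP \<phi> x us = 1))"
        by (rule exec_RMCheck[where x = x]) (use h i x in \<open>auto simp: frame_def\<close>)
    qed (use i in \<open>auto simp: frame_def\<close>)
  qed (use h i n_le_W in \<open>auto simp: frame_def rm_test_def map_bind_pmf pmf.map_comp o_def\<close>)
qed (use h R in \<open>auto simp: frame_def\<close>)

lemma exec_StageB:
  assumes h: "wf h" "sv h 2 = p" "0 < p" "sv h 7 = 2 ^ p" "2 ^ p \<le> W" "p \<le> W" "sv h 49 = N" "N \<le> W"
    and R: "\<And>ok h'. frame ({5, 6, 48} \<union> {20..28}) h h' \<Longrightarrow> (sv h' 5 = 0 \<longleftrightarrow> sv h 5 = 0 \<and> ok) \<Longrightarrow> R ok h'"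
  shows "exec StageB h (N * (1 + 2 ^ p)) (repeat N (rm_test p (map_pmf (set_of n) D))) R"
  unfolding StageB_def repeat_def
proof (rule exec_For[where I = "\<lambda>i ok h'. frame ({5, 6, 48} \<union> {20..28}) h h' \<and> (sv h' 5 = 0 \<longleftrightarrow> sv h 5 = 0 \<and> ok) \<and> sv h' 48 = i"])
  fix i ok and h' :: hs
  assume i: "i < N" "frame ({5, 6, 48} \<union> {20..28}) h h' \<and> (sv h' 5 = 0 \<longleftrightarrow> sv h 5 = 0 \<and> ok) \<and> sv h' 48 = i"
  let ?Q = "\<lambda>ok h''. sv h'' 48 = i \<and> frame ({5, 6, 48} \<union> {20..28}) h (h''\<lparr>sv := (sv h'')(48 := Suc i)\<rparr>) \<and>
    (sv (h''\<lparr>sv := (sv h'')(48 := Suc i)\<rparr>) 5 = 0 \<longleftrightarrow> sv h 5 = 0 \<and> ok) \<and> sv (h''\<lparr>sv := (sv h'')(48 := Suc i)\<rparr>) 48 = Suc i"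
  let ?M = "\<lambda>x. map_pmf (\<lambda>us. ok \<and> cubeP \<phi> x us = 1) (replicate_pmf p (rset {..<n}))"
  show "exec (Seq SampleB (Seq (For 23 (Vr 0) (SetA 0 (Vr 23) (Bu (Vr 23)))) RMCheck)) h' (1 + 2 ^ p)
     (map_pmf (\<lambda>b. ok \<and> b) (rm_test p (map_pmf (set_of n) D))) ?Q"
  proof (rule exec_bind[where B = ?M, OF exec_SampleB])
    fix y and b :: "nat \<Rightarrow> nat" assume "y \<in> set_pmf D" and b: "\<And>i. i < n \<Longrightarrow> b i = of_bool (i \<in> set_of n y)"
    let ?x = "set_of n y"
    let ?h = "h'\<lparr>bu := b\<rparr>"
    have x: "?x \<subseteq> {..<n}" by (auto simp: set_of_def)
    have copy: "exec (For 23 (Vr 0) (SetA 0 (Vr 23) (Bu (Vr 23)))) ?h 0 (return_pmf ())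
       (\<lambda>_ h''. frame {23} h' h'' \<and> bits_at n ?x (ar h'' 0))"
      by (rule exec_For00[where N = n and I = "\<lambda>j h''. frame {23} h' h'' \<and> bu h'' = b \<and> sv h'' 23 = j \<and> bits_at j ?x (ar h'' 0)"])
        (use i b n_le_W in \<open>auto intro!: exec_SetA simp: frame_def bits_at_def less_Suc_eq\<close>)
    show "exec (Seq (For 23 (Vr 0) (SetA 0 (Vr 23) (Bu (Vr 23)))) RMCheck) ?h (2 ^ p) (?M ?x) ?Q"
    proof (rule exec_then, rule exec_weaken[OF copy order_refl])
      fix h1 assume h1: "frame {23} h' h1 \<and> bits_at n ?x (ar h1 0)"
      show "exec RMCheck h1 (2 ^ p) (?M ?x) ?Q"
      proof (rule exec_map)
        show "exec RMCheck h1 (2 ^ p) (replicate_pmf p (rset {..<n}))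
           (\<lambda>us h''. frame ({5, 6} \<union> {20..28}) h1 h'' \<and> (sv h'' 5 = 0 \<longleftrightarrow> sv h1 5 = 0 \<and> cubeP \<phi> ?x us = 1))"
          by (rule exec_RMCheck[where x = ?x]) (use h i x h1 in \<open>auto simp: frame_def\<close>)
      qed (use i h1 in \<open>auto simp: frame_def\<close>)
    qed
  qed (auto simp: rm_test_def map_bind_pmf pmf.map_comp o_def)
qed (use h R in \<open>auto simp: frame_def\<close>)

lemma exec_Hash:
  assumes h: "wf h" "sv h 9 = r" "0 < r"
    and R: "\<And>lab h'. frame {8, 23, 30, 31, 32, 33} h h' \<Longrightarrow> sv h' 8 = n - (n - r) \<Longrightarrow> (\<And>v. v < n \<Longrightarrow> ar h' 2 v = lab v) \<Longrightarrow>
       (\<And>k. k \<noteq> 2 \<Longrightarrow> ar h' k = ar h k) \<Longrightarrow> R lab h'"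
  shows "exec Hash h 0 (hash n (n - r)) R"
proof -
  define fr where "fr h' \<longleftrightarrow> frame {8, 23, 30, 31, 32, 33} h h' \<and> (\<forall>k. k \<noteq> 2 \<longrightarrow> ar h' k = ar h k)" for h' :: hs
  define I where "I k lab h' \<longleftrightarrow> fr h' \<and> sv h' 8 = n - k \<and> (\<forall>v<n. ar h' 2 v = lab v)" for k lab and h' :: hs
  define body where "body = Cond (EQ (Ar 2 (Vr 23)) (Vr 33)) (SetA 2 (Vr 23) (Vr 30))
             (Cond (EQ (Ar 2 (Vr 23)) (Vr 8)) (SetA 2 (Vr 23) (Vr 33)) Skip)"
  define step where "step = Seq (Rnd 8) (Seq (SetV 33 (Vr 30)) (Seq (SetV 8 (Minus (Vr 8) (Num 1))) (Seq (Rnd 8) (For 23 (Vr 0) body))))"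
  have init: "exec (For 23 (Vr 0) (SetA 2 (Vr 23) (Vr 23))) (h\<lparr>sv := (sv h)(8 := ev_h n (Vr 0) h)\<rparr>) 0 (return_pmf ()) (\<lambda>_. I 0 id)"
    by (rule exec_For00[where N = n and I = "\<lambda>i h'. fr h' \<and> sv h' 8 = sv h' 0 \<and> sv h' 23 = i \<and> (\<forall>v<i. ar h' 2 v = v)"])
      (use h n_le_W in \<open>auto intro!: exec_SetA simp: I_def fr_def frame_def less_Suc_eq\<close>)
  have relabel: "exec (For 23 (Vr 0) body) h' 0 (return_pmf (mergemap (n - k) i j \<circ> lab)) (I (Suc k))"
    if h': "fr h'" "sv h' 8 = n - k - 1" "sv h' 33 = i" "sv h' 30 = j" "\<forall>v<n. ar h' 2 v = lab v" for h' k i j lab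
  proof (rule exec_return)
    define J where "J v h'' \<longleftrightarrow> fr h'' \<and> sv h'' 8 = n - k - 1 \<and> sv h'' 33 = i \<and> sv h'' 30 = j \<and> sv h'' 23 = v \<and>
      (\<forall>w<n. ar h'' 2 w = (if w < v then mergemap (n - k) i j (lab w) else lab w))" for v and h'' :: hs
    show "exec (For 23 (Vr 0) body) h' 0 (return_pmf ()) (\<lambda>_. I (Suc k) (mergemap (n - k) i j \<circ> lab))"
    proof (rule exec_For00[where N = n and I = J])
      fix v h'' assume v: "v < n" "J v h''"
      have w: "wf h''" using v by (auto simp: J_def fr_def frame_def)
      have l: "ar h'' 2 v = lab v" using v by (simp add: J_def)
      have upd: "J (Suc v) (h''\<lparr>ar := (ar h'')(2 := (ar h'' 2)(v := mergemap (n - k) i j (lab v))), sv := (sv h'')(23 := Suc v)\<rparr>)"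
        using v by (auto simp: J_def fr_def frame_def less_Suc_eq)
      have upd2: "J (Suc v) (h''\<lparr>sv := (sv h'')(23 := Suc v)\<rparr>)" if "mergemap (n - k) i j (lab v) = lab v"
        using v that by (auto simp: J_def fr_def frame_def less_Suc_eq)
      show "exec body h'' 0 (return_pmf ()) (\<lambda>_ h'. sv h' 23 = v \<and> J (Suc v) (h'\<lparr>sv := (sv h')(23 := Suc v)\<rparr>))"
        unfolding body_def
      proof (rule exec_Cond; (rule exec_Cond)?)
        assume "ev_h n (EQ (Ar 2 (Vr 23)) (Vr 33)) h'' \<noteq> 0"
        then have "lab v = i" using v w by (auto simp: J_def split: if_splits)
        then show "exec (SetA 2 (Vr 23) (Vr 30)) h'' 0 (return_pmf ()) (\<lambda>_ h'. sv h' 23 = v \<and> J (Suc v) (h'\<lparr>sv := (sv h')(23 := Suc v)\<rparr>))"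
          using upd v w by (intro exec_SetA) (auto simp: mergemap_def J_def)
      next
        assume e1: "ev_h n (EQ (Ar 2 (Vr 23)) (Vr 33)) h'' = 0"
        then have ne: "lab v \<noteq> i" using v w by (auto simp: J_def)
        {
          assume "ev_h n (EQ (Ar 2 (Vr 23)) (Vr 8)) h'' \<noteq> 0"
          then have "lab v = n - k - 1" using v w by (auto simp: J_def split: if_splits)
          then show "exec (SetA 2 (Vr 23) (Vr 33)) h'' 0 (return_pmf ()) (\<lambda>_ h'. sv h' 23 = v \<and> J (Suc v) (h'\<lparr>sv := (sv h')(23 := Suc v)\<rparr>))"
            using upd v w ne by (intro exec_SetA) (auto simp: mergemap_def J_def)
        next
          assume "ev_h n (EQ (Ar 2 (Vr 23)) (Vr 8)) h'' = 0"
          then have "lab v \<noteq> n - k - 1" using v w by (auto simp: J_def)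
          then show "exec Skip h'' 0 (return_pmf ()) (\<lambda>_ h'. sv h' 23 = v \<and> J (Suc v) (h'\<lparr>sv := (sv h')(23 := Suc v)\<rparr>))"
            using upd2 v ne by (intro exec_Skip) (auto simp: mergemap_def J_def)
        }
      qed
    qed (use h' n_le_W in \<open>auto simp: J_def I_def fr_def frame_def\<close>)
  qed
  have "exec (While (Minus (Vr 8) (Vr 9)) step) h' ((n - r) * 0) (loopM (n - r) 0 (\<lambda>k. hash_step (n - k)) id) R"
    if "I 0 id h'" for h'
  proof (rule exec_While[where I = I])
    fix k lab and h1 :: hs assume k: "k < n - r" "I k lab h1"
    show "ev_h n (Minus (Vr 8) (Vr 9)) h1 \<noteq> 0" using k h by (auto simp: I_def fr_def frame_def)
    show "exec step h1 0 (hash_step (n - k) lab) (I (Suc k))"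
      unfolding step_def hash_step_def
    proof (rule exec_bind[where q = 0 and q' = 0, OF exec_Rnd[where N = "n - k"]])
      fix i and h2 :: hs assume h2: "i < n - k" "\<And>k. k \<notin> {30, 31, 32} \<Longrightarrow> sv h2 k = sv h1 k" "sv h2 30 = i" "ar h2 = ar h1"
      let ?h = "h2\<lparr>sv := (sv h2)(33 := i, 8 := n - k - 1)\<rparr>"
      have w: "wf h2" using k h2(2)[of 0] by (auto simp: I_def fr_def frame_def wf_def)
      have s8: "sv h2 8 = n - k" using h2(2)[of 8] k by (simp add: I_def)
      have "exec (Seq (Rnd 8) (For 23 (Vr 0) body)) ?h 0 (map_pmf (\<lambda>j. mergemap (n - k) i j \<circ> lab) (rnd (n - k - 1))) (I (Suc k))"
        unfolding map_pmf_def
      proof (rule exec_bind[where q = 0 and q' = 0, OF exec_Rnd[where N = "n - k - 1"]])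
        fix j and h3 :: hs assume h3: "\<And>k. k \<notin> {30, 31, 32} \<Longrightarrow> sv h3 k = sv ?h k" "sv h3 30 = j" "ar h3 = ar ?h"
        show "exec (For 23 (Vr 0) body) h3 0 (return_pmf (mergemap (n - k) i j \<circ> lab)) (I (Suc k))"
          by (rule relabel) (use k h2 h3 w in \<open>auto simp: I_def fr_def frame_def wf_def\<close>)
      qed (use k h n_le_W in auto)
      then show "exec (Seq (SetV 33 (Vr 30)) (Seq (SetV 8 (Minus (Vr 8) (Num 1))) (Seq (Rnd 8) (For 23 (Vr 0) body)))) h2 0
         (map_pmf (\<lambda>j. mergemap (n - k) i j \<circ> lab) (rnd (n - k - 1))) (I (Suc k))"
        using h2(3) s8 by - (rule exec_then, rule exec_SetV, simp, rule exec_then, rule exec_SetV, simp, simp)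
    qed (use k h n_le_W in \<open>auto simp: I_def\<close>)
  next
    fix lab and h1 :: hs assume "I (n - r) lab h1"
    then show "ev_h n (Minus (Vr 8) (Vr 9)) h1 = 0" "R lab h1"
      using h by (auto intro!: R simp: I_def fr_def frame_def)
  qed (use that n_le_W in auto)
  then have loop: "exec (While (Minus (Vr 8) (Vr 9)) step) h' 0 (hash n (n - r)) R" if "I 0 id h'" for h'
    using that by (simp add: hash_def)
  show ?thesis
    unfolding Hash_def body_def[symmetric] step_def[symmetric]
    by (rule exec_then, rule exec_SetV, simp, rule exec_then, rule exec_weaken[OF init order_refl loop])
qed

end

section \<open>Subroutines for learning and verification\<close>

context tester
begin

lemma exec_then_q:
  assumes "exec c1 h q (return_pmf ()) (\<lambda>_ h'. exec c2 h' q' M R)" "q'' = q + q'"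
  shows "exec (Seq c1 c2) h q'' M R"
  using exec_Seq[of c1 h q "return_pmf ()" c2 q' "\<lambda>_. M" R] assms by (simp add: bind_return_pmf)

definition vecs :: "nat \<Rightarrow> nat set list \<Rightarrow> bool" where "vecs N us \<longleftrightarrow> set us \<subseteq> Pow {..<N}"

lemma vecs_snoc: "vecs N us \<Longrightarrow> u \<subseteq> {..<N} \<Longrightarrow> vecs N (us @ [u])" by (auto simp: vecs_def)
lemma vecs_Nil [simp]: "vecs N []" by (simp add: vecs_def)

definition labels :: "nat \<Rightarrow> (nat \<Rightarrow> nat) \<Rightarrow> (nat \<Rightarrow> nat) \<Rightarrow> bool" where
  "labels R lab g \<longleftrightarrow> (\<forall>v<n. g v = lab v \<and> lab v < R)"

abbreviation lift :: "(nat \<Rightarrow> nat) \<Rightarrow> nat set \<Rightarrow> nat set" where "lift lab \<equiv> pull lab {..<n}"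

lemma exec_BlockRows:
  assumes h: "wf h" "sv h 10 = m" "m \<le> W" "sv h 8 = R" "R \<le> W" "sv h 63 = 0" "labels R lab (ar h 2)"
    and Q: "\<And>us h'. length us = m \<Longrightarrow> vecs R us \<Longrightarrow> rows_at (map (lift lab) us) (ar h' 1) \<Longrightarrow> frame {23, 25, 26} h h' \<Longrightarrow>
       (\<And>k. k \<notin> {1, 4} \<Longrightarrow> ar h' k = ar h k) \<Longrightarrow> Q us h'"
  shows "exec BlockRows h 0 (replicate_pmf m (rset {..<R})) Q"
proof -
  define I where "I i us h' \<longleftrightarrow> frame {23, 25, 26} h h' \<and> length us = i \<and> vecs R us \<and> rows_at (map (lift lab) us) (ar h' 1) \<and>
    sv h' 26 = i \<and> sv h' 25 = i * n \<and> (\<forall>k. k \<notin> {1, 4} \<longrightarrow> ar h' k = ar h k)" for i us and h' :: hs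
  have "exec BlockRows h (m * 0) (loopM m 0 (\<lambda>_ us. map_pmf (\<lambda>u. us @ [u]) (rset {..<R})) []) Q"
    unfolding BlockRows_def
  proof (rule exec_then, rule exec_SetV, simp, rule exec_For[where I = I])
    fix i us and h1 :: hs assume i: "i < m" "I i us h1"
    then have w: "wf h1" by (simp add: I_def frame_def)
    let ?Q = "\<lambda>a' h'. sv h' 26 = i \<and> I (Suc i) a' (h'\<lparr>sv := (sv h')(26 := Suc i)\<rparr>)"
    show "exec (Seq (RandVec 4 63 23 8) (Seq (For 23 (Vr 0) (SetA 1 (Plus (Vr 25) (Vr 23)) (Ar 4 (Ar 2 (Vr 23))))) (Incr 25 (Vr 0))))
       h1 0 (map_pmf (\<lambda>u. us @ [u]) (rset {..<R})) ?Q"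
    proof (rule exec_bind[where B = "\<lambda>u. return_pmf (us @ [u])", OF exec_RandVec[where N = R]])
      fix u assume u: "u \<subseteq> {..<R}"
      let ?h = "h1\<lparr>sv := (sv h1)(23 := R), ar := (ar h1)(4 := vec (sv h1 63) R u (ar h1 4))\<rparr>"
      \<comment> \<open>Rows drawn earlier lie below \<open>i * n\<close> and are untouched, while
        the current row grows one variable at a time.\<close>
      define J where "J v h2 \<longleftrightarrow> frame {23} h1 h2 \<and> sv h2 23 = v \<and> bits_at R u (ar h2 4) \<and> (\<forall>k. k \<notin> {1, 4} \<longrightarrow> ar h2 k = ar h k) \<and>
        (\<forall>w<v. ar h2 1 (i * n + w) = of_bool (w \<in> lift lab u)) \<and> (\<forall>j<i * n. ar h2 1 j = ar h1 1 j)" for v and h2 :: hs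
      have copy: "exec (For 23 (Vr 0) (SetA 1 (Plus (Vr 25) (Vr 23)) (Ar 4 (Ar 2 (Vr 23))))) ?h 0 (return_pmf ()) (\<lambda>_. J n)"
      proof (rule exec_For00[where N = n and I = J])
        fix v and h2 :: hs assume v: "v < n" "J v h2"
        have w2: "wf h2" using v by (simp add: J_def frame_def)
        have "ar h2 2 v = lab v" "lab v < R" using v h(7) by (auto simp: J_def labels_def)
        then have a: "ar h2 4 (ar h2 2 v) = of_bool (v \<in> lift lab u)" using v by (auto simp: J_def bits_at_def pull_def)
        have o: "sv h2 25 = i * n" using v i by (simp add: J_def I_def frame_def)
        show "exec (SetA 1 (Plus (Vr 25) (Vr 23)) (Ar 4 (Ar 2 (Vr 23)))) h2 0 (return_pmf ())
          (\<lambda>_ h'. sv h' 23 = v \<and> J (Suc v) (h'\<lparr>sv := (sv h')(23 := Suc v)\<rparr>))"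
          by (rule exec_SetA) (use v w2 a o in \<open>auto simp: J_def frame_def less_Suc_eq\<close>)
      next
        have "sv h1 63 = 0" using i h by (simp add: I_def frame_def)
        then show "J 0 (?h\<lparr>sv := (sv ?h)(23 := 0)\<rparr>)"
          using i w by (auto simp: J_def frame_def I_def)
      qed (use n_le_W in \<open>auto simp: J_def frame_def\<close>)
      have fin: "exec (Incr 25 (Vr 0)) h2 0 (return_pmf (us @ [u])) ?Q" if J: "J n h2" for h2
      proof (rule exec_return, rule exec_SetV)
        have "rows_at (map (lift lab) us @ [lift lab u]) (ar h2 1)"
        proof (rule rows_at_snoc[where g = "ar h1 1"])
          show "rows_at (map (lift lab) us) (ar h1 1)" using i by (simp add: I_def)
          fix k v assume kv: "k < length (map (lift lab) us)" "v < n"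
          then have "k * n + v < i * n" using i by (intro row_less) (auto simp: I_def)
          then show "ar h2 1 (k * n + v) = ar h1 1 (k * n + v)" using J by (simp add: J_def)
        qed (use J i in \<open>auto simp: J_def I_def\<close>)
        then show "sv (h2\<lparr>sv := (sv h2)(25 := ev_h n (Plus (Vr 25) (Vr 0)) h2)\<rparr>) 26 = i \<and>
          I (Suc i) (us @ [u]) (h2\<lparr>sv := (sv h2)(25 := ev_h n (Plus (Vr 25) (Vr 0)) h2),
            sv := (sv (h2\<lparr>sv := (sv h2)(25 := ev_h n (Plus (Vr 25) (Vr 0)) h2)\<rparr>))(26 := Suc i)\<rparr>)"
          using J i w u by (auto simp: J_def I_def frame_def intro!: vecs_snoc)
      qed simp
      show "exec (Seq (For 23 (Vr 0) (SetA 1 (Plus (Vr 25) (Vr 23)) (Ar 4 (Ar 2 (Vr 23))))) (Incr 25 (Vr 0))) ?h 0 (return_pmf (us @ [u])) ?Q"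
        by (rule exec_then, rule exec_weaken[OF copy order_refl fin])
    qed (use i w h in \<open>auto simp: I_def frame_def map_pmf_def\<close>)
  qed (use h Q in \<open>auto simp: I_def frame_def rows_at_def\<close>)
  moreover have "(@) [] = (\<lambda>us :: nat set list. us)" by auto
  ultimately show ?thesis by (simp add: loopM_replicate)
qed

lemma exec_Dot:
  assumes h: "wf h" "sv h 10 = m" "m \<le> W"
    and R: "\<And>h'. frame ({26, 34} \<union> {37..40}) h h' \<Longrightarrow> ar h' = ar h \<Longrightarrow> sv h' 34 = of_bool (dotb m (sv h 17) (sv h 20)) \<Longrightarrow> R () h'"
  shows "exec Dot h 0 (return_pmf ()) R"
proof -
  let ?b = "sv h 17" and ?t = "sv h 20"
  \<comment> \<open>\<open>dotb\<close> recurses from the lowest digit, so the parity accumulated in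
    cell 34 is described by what is missing: combined with the product of the remaining digits it
    gives the result.\<close>
  define I where "I k h' \<longleftrightarrow> frame ({26, 34} \<union> {37..40}) h h' \<and> ar h' = ar h \<and> sv h' 26 = k \<and> sv h' 37 = ?b div 2 ^ k \<and> sv h' 38 = ?t div 2 ^ k \<and>
    (\<exists>y. sv h' 34 = of_bool y \<and> (y \<noteq> dotb (m - k) (?b div 2 ^ k) (?t div 2 ^ k)) = dotb m ?b ?t)" for k and h' :: hs
  have bit: "(x::nat) - (x div 2 + x div 2) = of_bool (odd x)" for x by (cases "even x") (auto elim!: evenE oddE)
  have dv: "(x::nat) div 2 ^ k div 2 = x div 2 ^ Suc k" for x k by (metis div_mult2_eq power_Suc2)
  show ?thesis
    unfolding Dot_def
  proof (rule exec_then, rule exec_SetV, simp, rule exec_then, rule exec_SetV, simp, rule exec_then, rule exec_SetV, simp,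
      rule exec_For00[where N = m and I = I])
    fix k h' assume k: "k < m" "I k h'"
    then obtain y where y: "sv h' 34 = of_bool y" "(y \<noteq> dotb (m - k) (?b div 2 ^ k) (?t div 2 ^ k)) = dotb m ?b ?t"
      by (auto simp: I_def)
    have mk: "m - k = Suc (m - Suc k)" using k by simp
    define P where "P = odd (?b div 2 ^ k)"
    define P' where "P' = odd (?t div 2 ^ k)"
    define z where "z = (y \<noteq> (P \<and> P'))"
    have y2: "(z \<noteq> dotb (m - Suc k) (?b div 2 ^ Suc k) (?t div 2 ^ Suc k)) = dotb m ?b ?t"
      using y(2) unfolding mk z_def P_def P'_def by (auto simp: dv)
    have nxt: "I (Suc k) (h'\<lparr>sv := (sv h')(39 := ?b div 2 ^ Suc k, 40 := ?t div 2 ^ Suc k, 34 := of_bool z, 37 := ?b div 2 ^ Suc k, 38 := ?t div 2 ^ Suc k, 26 := Suc k)\<rparr>)"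
      unfolding I_def by (intro conjI exI[of _ z]) (use k y2 in \<open>auto simp: I_def frame_def\<close>)
    have xo: "of_bool y - (of_bool P + of_bool P') div 2 + ((of_bool P + of_bool P') div 2 - of_bool y) = (of_bool z :: nat)"
      unfolding z_def by (cases y; cases P; cases P') simp_all
    have st: "sv h' 26 = k" "sv h' 37 = ?b div 2 ^ k" "sv h' 38 = ?t div 2 ^ k" using k by (simp_all add: I_def)
    have bt: "?b div 2 ^ k - (?b div 2 ^ Suc k + ?b div 2 ^ Suc k) = of_bool P" "?t div 2 ^ k - (?t div 2 ^ Suc k + ?t div 2 ^ Suc k) = of_bool P'"
      unfolding P_def P'_def dv[symmetric] by (rule bit)+
    show "exec (Seq (SetV 39 (Half (Vr 37))) (Seq (SetV 40 (Half (Vr 38)))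
       (Seq (SetV 34 (XOR (Vr 34) (AND (Minus (Vr 37) (Plus (Vr 39) (Vr 39))) (Minus (Vr 38) (Plus (Vr 40) (Vr 40))))))
       (Seq (SetV 37 (Vr 39)) (SetV 38 (Vr 40)))))) h' 0 (return_pmf ()) (\<lambda>_ h'. sv h' 26 = k \<and> I (Suc k) (h'\<lparr>sv := (sv h')(26 := Suc k)\<rparr>))"
      apply (rule exec_then, rule exec_SetV, simp)
      apply (rule exec_then, rule exec_SetV, simp)
      apply (rule exec_then, rule exec_SetV, simp)
      apply (rule exec_then, rule exec_SetV, simp)
      apply (rule exec_SetV, simp)
      using nxt by (simp add: st y(1) bt xo dv del: power_Suc)
  next
    fix h' assume "I m h'"
    then show "R () h'" by (intro R) (auto simp: I_def)
  qed (use h in \<open>auto simp: I_def frame_def intro!: exI[of _ False]\<close>)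
qed

definition cframe :: "nat set" where "cframe = {17, 20, 32, 34} \<union> {22..28} \<union> {37..40}"

text \<open>A single query is charged: its answer is compared with the inner product of every bucket
  without further access to the oracle.\<close>

lemma exec_Count:
  assumes h: "wf h" "sv h 10 = m" "m \<le> W" "sv h 21 = m" "sv h 11 = 2 ^ m" "2 ^ m \<le> W"
    "rows_at vs (ar h 1)" "length vs = m" "vecs n vs" "x \<subseteq> {..<n}" "bits_at n x (ar h 0)"
    and R: "\<And>t h'. t < 2 ^ m \<Longrightarrow> frame cframe h h' \<Longrightarrow> (\<And>k. k \<noteq> 5 \<Longrightarrow> ar h' k = ar h k) \<Longrightarrow>
      (\<And>b. b < 2 ^ m \<Longrightarrow> ar h' 5 b = ar h 5 b + of_bool ((\<phi> (x \<triangle> lin t vs) = 1) \<noteq> dotb m b t)) \<Longrightarrow> R t h'"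
  shows "exec Count h 1 (pmf_of_set {..<2 ^ m}) R"
  unfolding Count_def
proof (rule exec_bind[where B = return_pmf and q = 0 and q' = 1, OF exec_RandNum[where N = m]])
  fix t and h1 :: hs assume t: "t < 2 ^ m" and h1: "\<And>k. k \<notin> {20, 26, 32} \<Longrightarrow> sv h1 k = sv h k" "sv h1 20 = t" "ar h1 = ar h"
  have w1: "wf h1" using h1(1)[of 0] h(1) by (simp add: wf_def)
  let ?w = "\<phi> (x \<triangle> lin t vs) = 1"
  show "exec (Seq Eval (For 17 (Vr 11) (Seq Dot (SetA 5 (Vr 17) (Plus (Ar 5 (Vr 17)) (XOR (Vr 22) (Vr 34))))))) h1 1 (return_pmf t) R"
  proof (rule exec_then_q[where q = 1 and q' = 0], rule exec_Eval[where us = vs and x = x])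
    fix h2 :: hs assume h2: "\<And>k. k \<notin> {22..28} \<Longrightarrow> sv h2 k = sv h1 k" "ar h2 = ar h1" "sv h2 22 = of_bool (\<phi> (x \<triangle> lin (sv h1 20) vs) = 1)"
    have w2: "wf h2" using h2(1)[of 0] w1 by (simp add: wf_def)
    define J where "J b h3 \<longleftrightarrow> frame cframe h h3 \<and> (\<forall>k. k \<noteq> 5 \<longrightarrow> ar h3 k = ar h k) \<and> sv h3 17 = b \<and> sv h3 20 = t \<and> sv h3 22 = of_bool ?w \<and>
      (\<forall>b'. ar h3 5 b' = ar h 5 b' + (if b' < b then of_bool (?w \<noteq> dotb m b' t) else 0))" for b and h3 :: hs
    show "exec (For 17 (Vr 11) (Seq Dot (SetA 5 (Vr 17) (Plus (Ar 5 (Vr 17)) (XOR (Vr 22) (Vr 34)))))) h2 0 (return_pmf t) R"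
    proof (rule exec_return, rule exec_For00[where N = "2 ^ m" and I = J])
      fix b h3 assume b: "b < 2 ^ m" "J b h3"
      then have w3: "wf h3" by (simp add: J_def frame_def)
      show "exec (Seq Dot (SetA 5 (Vr 17) (Plus (Ar 5 (Vr 17)) (XOR (Vr 22) (Vr 34))))) h3 0 (return_pmf ())
        (\<lambda>_ h'. sv h' 17 = b \<and> J (Suc b) (h'\<lparr>sv := (sv h')(17 := Suc b)\<rparr>))"
      proof (rule exec_then, rule exec_Dot[where m = m])
        fix h4 assume h4: "frame ({26, 34} \<union> {37..40}) h3 h4" "ar h4 = ar h3" "sv h4 34 = of_bool (dotb m (sv h3 17) (sv h3 20))"
        have w4: "wf h4" using h4 by (simp add: frame_def)
        have s4: "sv h4 17 = b" "sv h4 20 = t" "sv h4 22 = of_bool ?w" "sv h4 34 = of_bool (dotb m b t)"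
          using h4 b by (auto simp: frame_def J_def)
        have f4: "frame cframe h (h4\<lparr>ar := g, sv := (sv h4)(17 := Suc b)\<rparr>)" for g
          using h4 b w4 by (auto simp: frame_def J_def cframe_def)
        have xo: "of_bool ?w - of_bool (dotb m b t) + (of_bool (dotb m b t) - of_bool ?w) = (of_bool (?w \<noteq> dotb m b t) :: nat)"
          by (cases ?w; cases "dotb m b t") auto
        show "exec (SetA 5 (Vr 17) (Plus (Ar 5 (Vr 17)) (XOR (Vr 22) (Vr 34)))) h4 0 (return_pmf ())
          (\<lambda>_ h'. sv h' 17 = b \<and> J (Suc b) (h'\<lparr>sv := (sv h')(17 := Suc b)\<rparr>))"
        proof (rule exec_SetA)
          show "sv (h4\<lparr>ar := (ar h4)(5 := (ar h4 5)(ev_h n (Vr 17) h4 := ev_h n (Plus (Ar 5 (Vr 17)) (XOR (Vr 22) (Vr 34))) h4))\<rparr>) 17 = b \<and>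
            J (Suc b) (h4\<lparr>ar := (ar h4)(5 := (ar h4 5)(ev_h n (Vr 17) h4 := ev_h n (Plus (Ar 5 (Vr 17)) (XOR (Vr 22) (Vr 34))) h4)),
              sv := (sv (h4\<lparr>ar := (ar h4)(5 := (ar h4 5)(ev_h n (Vr 17) h4 := ev_h n (Plus (Ar 5 (Vr 17)) (XOR (Vr 22) (Vr 34))) h4))\<rparr>))(17 := Suc b)\<rparr>)"
            unfolding J_def using b h4(2) w4 s4 f4 xo by (simp add: J_def less_Suc_eq)
        qed (use w4 in auto)
      qed (use b h w3 in \<open>auto simp: J_def frame_def cframe_def\<close>)
    next
      fix h3 assume "J (2 ^ m) h3"
      then show "R t h3" using t by (intro R) (auto simp: J_def)
    next
      show "J 0 (h2\<lparr>sv := (sv h2)(17 := 0)\<rparr>)"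
        using h1 h2 w2 by (auto simp: J_def frame_def cframe_def)
    qed (use h in \<open>auto simp: J_def frame_def cframe_def\<close>)
  qed (use h h1 w1 in \<open>auto simp: bits_at_def vecs_def\<close>)
qed (use h in \<open>auto simp: bind_return_pmf'\<close>)

lemma exec_Round:
  assumes h: "wf h" "sv h 12 = u" "0 < u" "(2 * ar h 5 (sv h 17) + u div 2) div u \<le> W"
    and R: "\<And>h'. frame {35, 36} h h' \<Longrightarrow> (\<And>k. k \<noteq> 6 \<Longrightarrow> ar h' k = ar h k) \<Longrightarrow>
      ar h' 6 = (ar h 6)(sv h 16 + sv h 17 := (2 * ar h 5 (sv h 17) + u div 2) div u) \<Longrightarrow> R () h'"
  shows "exec Round h 0 (return_pmf ()) R"
proof -
  define x where "x = 2 * ar h 5 (sv h 17) + u div 2"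
  define N where "N = x div u"
  define I where "I i h' \<longleftrightarrow> frame {35, 36} h h' \<and> ar h' = ar h \<and> sv h' 35 = x - i * u \<and> sv h' 36 = i" for i and h' :: hs
  have Nu: "N * u \<le> x" "x < N * u + u" unfolding N_def using h(3) by (simp_all add: div_times_less_eq_dividend dividend_less_div_times add.commute)
  have "exec (While (Minus (Plus (Vr 35) (Num 1)) (Vr 12)) (Seq (SetV 35 (Minus (Vr 35) (Vr 12))) (Incr 36 (Num 1)))) h' (N * 0)
     (loopM N 0 (\<lambda>_ _. return_pmf ()) ()) (\<lambda>_. I N)" if "I 0 h'" for h'
  proof (rule exec_While[where I = "\<lambda>i _. I i"])
    fix i and a :: unit and h1 :: hs assume i: "i < N" "I i h1"
    have "(i + 1) * u \<le> N * u" using i by (intro mult_right_mono) auto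
    then have le: "i * u + u \<le> x" using Nu by simp
    show "ev_h n (Minus (Plus (Vr 35) (Num 1)) (Vr 12)) h1 \<noteq> 0" using i h le by (auto simp: I_def frame_def)
    show "exec (Seq (SetV 35 (Minus (Vr 35) (Vr 12))) (Incr 36 (Num 1))) h1 0 (return_pmf ()) (\<lambda>_. I (Suc i))"
      by (rule exec_then, rule exec_SetV, simp, rule exec_SetV, simp) (use i h le in \<open>auto simp: I_def frame_def\<close>)
  next
    fix a :: unit and h1 :: hs assume "I N h1"
    then show "ev_h n (Minus (Plus (Vr 35) (Num 1)) (Vr 12)) h1 = 0" "I N h1" using h Nu by (auto simp: I_def frame_def)
  qed (use that h in \<open>auto simp: N_def x_def\<close>)
  then have loop: "exec (While (Minus (Plus (Vr 35) (Num 1)) (Vr 12)) (Seq (SetV 35 (Minus (Vr 35) (Vr 12))) (Incr 36 (Num 1)))) h' 0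
     (return_pmf ()) (\<lambda>_. I N)" if "I 0 h'" for h' using that by simp
  have fin: "exec (SetA 6 (Plus (Vr 16) (Vr 17)) (Vr 36)) h' 0 (return_pmf ()) R" if "I N h'" for h'
    by (rule exec_SetA) (use that in \<open>auto intro!: R simp: I_def frame_def N_def x_def\<close>)
  show ?thesis
    unfolding Round_def
    by (rule exec_then, rule exec_SetV, simp, rule exec_then, rule exec_SetV, simp, rule exec_then,
        rule exec_weaken[OF loop order_refl fin])
      (use h in \<open>auto simp: I_def frame_def x_def\<close>)
qed

lemma hits_le: "hits F us e ts b \<le> length ts"
  unfolding hits_def by (rule length_filter_le)

definition eframe :: "nat set" where "eframe = {16, 17, 18, 20, 32} \<union> {22..28} \<union> {34..40}"

definition ready :: "nat \<Rightarrow> nat \<Rightarrow> nat \<Rightarrow> nat \<Rightarrow> (nat \<Rightarrow> nat) \<Rightarrow> nat set \<Rightarrow> nat set list \<Rightarrow> hs \<Rightarrow> bool" where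
  "ready R m u M lab a us h \<longleftrightarrow> wf h \<and> sv h 8 = R \<and> sv h 10 = m \<and> sv h 21 = m \<and> sv h 11 = 2 ^ m \<and> sv h 12 = u \<and> sv h 13 = M \<and>
    labels R lab (ar h 2) \<and> bits_at n a (ar h 3) \<and> rows_at (map (lift lab) us) (ar h 1)"

lemma exec_Estimate:
  assumes h: "ready R m u M lab a us h" "sv h 14 = i" "i \<le> R"
    and b: "m \<le> W" "2 ^ m \<le> W" "M \<le> W" "0 < u" "(2 * M + u div 2) div u \<le> W"
    and us: "length us = m" "vecs R us" "a \<subseteq> {..<n}"
    and Q: "\<And>k h'. frame eframe h h' \<Longrightarrow> sv h' 16 = sv h 16 + 2 ^ m \<Longrightarrow> (\<And>k. k \<notin> {0, 5, 6} \<Longrightarrow> ar h' k = ar h k) \<Longrightarrow>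
       (\<And>j. j < sv h 16 \<Longrightarrow> ar h' 6 j = ar h 6 j) \<Longrightarrow> (\<And>b. b < 2 ^ m \<Longrightarrow> ar h' 6 (sv h 16 + b) = k b) \<Longrightarrow> Q k h'"
  shows "exec Estimate h M (estimate (\<lambda>y. \<phi> (a \<triangle> lift lab y)) us u M (shift R i)) Q"
proof -
  define F where "F y = \<phi> (a \<triangle> lift lab y)" for y
  define e where "e = shift R i"
  define x where "x = a \<triangle> lift lab e"
  let ?vs = "map (lift lab) us"
  have x: "x \<subseteq> {..<n}" unfolding x_def using us by simp
  have vs: "vecs n ?vs" by (auto simp: vecs_def pull_def)
  \<comment> \<open>Lifting is linear, so combinations of block vectors correspond to combinations
    of the stored rows.\<close>
  have Fx: "F (e \<triangle> lin t us) = \<phi> (x \<triangle> lin t ?vs)" for t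
    by (simp add: F_def x_def lin_pull pull_sd sd_assoc)
  define fr where "fr h' \<longleftrightarrow> frame (eframe - {16}) h h' \<and> (\<forall>k. k \<notin> {0, 5, 6} \<longrightarrow> ar h' k = ar h k)" for h' :: hs
  have w: "wf h" using h by (simp add: ready_def)
  \<comment> \<open>All labels are below \<open>R\<close>, so for \<open>i = R\<close> the equality
    test never succeeds and no shift takes place.\<close>
  have xbit: "of_bool (v \<in> a) - (1 - (lab v - i + (i - lab v))) + (1 - (lab v - i + (i - lab v)) - of_bool (v \<in> a)) = (of_bool (v \<in> x) :: nat)"
    if "v < n" for v
  proof -
    have "lab v < R" using that h by (auto simp: ready_def labels_def)
    then have "v \<in> lift lab e \<longleftrightarrow> lab v = i" using that h(3) by (auto simp: e_def shift_def pull_def)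
    then have vx: "v \<in> x \<longleftrightarrow> (v \<in> a) \<noteq> (lab v = i)" by (simp add: x_def sd_mem)
    show ?thesis
    proof (cases "lab v = i")
      case False
      then have "1 - (lab v - i + (i - lab v)) = 0" by auto
      then show ?thesis using vx False by simp
    qed (use vx in auto)
  qed
  have p1: "exec (For 23 (Vr 0) (SetA 0 (Vr 23) (XOR (Ar 3 (Vr 23)) (EQ (Ar 2 (Vr 23)) (Vr 14))))) h 0 (return_pmf ())
    (\<lambda>_ h'. fr h' \<and> ar h' 6 = ar h 6 \<and> bits_at n x (ar h' 0))"
  proof (rule exec_For00[where N = n and I = "\<lambda>v h'. fr h' \<and> ar h' 6 = ar h 6 \<and> sv h' 23 = v \<and> bits_at v x (ar h' 0)"])
    fix v h' assume v: "v < n" "fr h' \<and> ar h' 6 = ar h 6 \<and> sv h' 23 = v \<and> bits_at v x (ar h' 0)"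
    have w': "wf h'" using v by (simp add: fr_def frame_def)
    have "ar h' 3 v = of_bool (v \<in> a)" "ar h' 2 v = lab v" "sv h' 14 = i"
      using v h by (auto simp: fr_def frame_def eframe_def ready_def labels_def bits_at_def)
    then have ev: "ev_h n (XOR (Ar 3 (Vr 23)) (EQ (Ar 2 (Vr 23)) (Vr 14))) h' = of_bool (v \<in> x)"
      using xbit[OF v(1)] v w' by simp
    show "exec (SetA 0 (Vr 23) (XOR (Ar 3 (Vr 23)) (EQ (Ar 2 (Vr 23)) (Vr 14)))) h' 0 (return_pmf ())
      (\<lambda>_ h'. sv h' 23 = v \<and> (\<lambda>v h'. fr h' \<and> ar h' 6 = ar h 6 \<and> sv h' 23 = v \<and> bits_at v x (ar h' 0)) (Suc v) (h'\<lparr>sv := (sv h')(23 := Suc v)\<rparr>))"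
      by (rule exec_SetA) (use v w' ev in \<open>auto simp: fr_def frame_def bits_at_def less_Suc_eq eframe_def\<close>)
  qed (use w n_le_W in \<open>auto simp: fr_def frame_def bits_at_def eframe_def\<close>)
  define st where "st h' \<longleftrightarrow> fr h' \<and> ar h' 6 = ar h 6 \<and> bits_at n x (ar h' 0)" for h' :: hs
  have p2: "exec (For 17 (Vr 11) (SetA 5 (Vr 17) (Num 0))) h' 0 (return_pmf ()) (\<lambda>_ h'. st h' \<and> (\<forall>b<2 ^ m. ar h' 5 b = 0))"
    if "st h'" for h'
    by (rule exec_For00[where N = "2 ^ m" and I = "\<lambda>j h'. st h' \<and> sv h' 17 = j \<and> (\<forall>b<j. ar h' 5 b = 0)"])
      (use that w h b in \<open>auto intro!: exec_SetA simp: st_def fr_def frame_def eframe_def less_Suc_eq ready_def\<close>)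
  define G where "G ts h' \<longleftrightarrow> st h' \<and> (\<forall>b<2 ^ m. ar h' 5 b = hits F us e ts b)" for ts and h' :: hs
  have p3: "exec (For 18 (Vr 13) Count) h' M (replicate_pmf M (pmf_of_set {..<2 ^ m})) (\<lambda>ts h'. length ts = M \<and> G ts h')"
    if h': "st h'" "\<forall>b<2 ^ m. ar h' 5 b = 0" for h'
  proof -
    have "exec (For 18 (Vr 13) Count) h' (M * 1) (loopM M 0 (\<lambda>_ ts. map_pmf (\<lambda>t. ts @ [t]) (pmf_of_set {..<2 ^ m})) []) (\<lambda>ts h'. length ts = M \<and> G ts h')"
    proof (rule exec_For[where I = "\<lambda>j ts h'. length ts = j \<and> G ts h' \<and> sv h' 18 = j"])
      fix j ts and h1 :: hs assume j: "j < M" "length ts = j \<and> G ts h1 \<and> sv h1 18 = j"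
      show "exec Count h1 1 (map_pmf (\<lambda>t. ts @ [t]) (pmf_of_set {..<2 ^ m}))
        (\<lambda>a' h'. sv h' 18 = j \<and> length a' = Suc j \<and> G a' (h'\<lparr>sv := (sv h')(18 := Suc j)\<rparr>) \<and> sv (h'\<lparr>sv := (sv h')(18 := Suc j)\<rparr>) 18 = Suc j)"
      proof (rule exec_map)
        show "exec Count h1 1 (pmf_of_set {..<2 ^ m}) (\<lambda>t h2. frame cframe h1 h2 \<and> (\<forall>k. k \<noteq> 5 \<longrightarrow> ar h2 k = ar h1 k) \<and>
           (\<forall>b<2 ^ m. ar h2 5 b = ar h1 5 b + of_bool ((\<phi> (x \<triangle> lin t ?vs) = 1) \<noteq> dotb m b t)))"
          by (rule exec_Count[where x = x and vs = ?vs])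
            (use j h b x vs us in \<open>auto simp: G_def st_def fr_def frame_def eframe_def ready_def\<close>)
        fix t h2 assume h2: "frame cframe h1 h2 \<and> (\<forall>k. k \<noteq> 5 \<longrightarrow> ar h2 k = ar h1 k) \<and>
           (\<forall>b<2 ^ m. ar h2 5 b = ar h1 5 b + of_bool ((\<phi> (x \<triangle> lin t ?vs) = 1) \<noteq> dotb m b t))"
        have s: "st (h2\<lparr>sv := (sv h2)(18 := Suc j)\<rparr>)"
          using h2 j by (auto simp: G_def st_def fr_def frame_def eframe_def cframe_def)
        have c: "ar h2 5 b = hits F us e (ts @ [t]) b" if "b < 2 ^ m" for b
          using h2 j that us(1) by (auto simp: G_def hits_def Fx)
        show "sv h2 18 = j \<and> length (ts @ [t]) = Suc j \<and> G (ts @ [t]) (h2\<lparr>sv := (sv h2)(18 := Suc j)\<rparr>) \<and> sv (h2\<lparr>sv := (sv h2)(18 := Suc j)\<rparr>) 18 = Suc j"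
          using s c h2 j by (auto simp: G_def frame_def cframe_def)
      qed
    qed (use h' h b in \<open>auto simp: G_def st_def fr_def frame_def eframe_def ready_def hits_def\<close>)
    moreover have "(@) [] = (\<lambda>ts :: nat list. ts)" by auto
    ultimately show ?thesis by (simp add: loopM_replicate)
  qed
  have p4: "exec (Seq (For 17 (Vr 11) Round) (Incr 16 (Vr 11))) h' 0 (return_pmf (rounded u (hits F us e ts))) Q"
    if h': "length ts = M" "G ts h'" for ts h'
  proof (rule exec_return, rule exec_then)
    define J where "J c h1 \<longleftrightarrow> fr h1 \<and> sv h1 17 = c \<and> (\<forall>b<2 ^ m. ar h1 5 b = hits F us e ts b) \<and>
      (\<forall>j<sv h 16. ar h1 6 j = ar h 6 j) \<and> (\<forall>b<c. ar h1 6 (sv h 16 + b) = rounded u (hits F us e ts) b)" for c and h1 :: hs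
    have "exec (For 17 (Vr 11) Round) h' 0 (return_pmf ()) (\<lambda>_. J (2 ^ m))"
    proof (rule exec_For00[where N = "2 ^ m" and I = J])
      fix c h1 assume c: "c < 2 ^ m" "J c h1"
      have w1: "wf h1" "sv h1 12 = u" "sv h1 16 = sv h 16" using c h by (auto simp: J_def fr_def frame_def ready_def eframe_def)
      have c5: "ar h1 5 (sv h1 17) = hits F us e ts c" using c by (simp add: J_def)
      have "(2 * ar h1 5 (sv h1 17) + u div 2) div u \<le> (2 * M + u div 2) div u"
        unfolding c5 using hits_le[of F us e ts c] h' by (intro div_le_mono) auto
      then have le: "(2 * ar h1 5 (sv h1 17) + u div 2) div u \<le> W" using b by linarith
      show "exec Round h1 0 (return_pmf ()) (\<lambda>_ h'. sv h' 17 = c \<and> J (Suc c) (h'\<lparr>sv := (sv h')(17 := Suc c)\<rparr>))"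
      proof (rule exec_Round[OF w1(1,2) b(4) le])
        fix h2 assume h2: "frame {35, 36} h1 h2" "\<And>k. k \<noteq> 6 \<Longrightarrow> ar h2 k = ar h1 k"
          "ar h2 6 = (ar h1 6)(sv h1 16 + sv h1 17 := (2 * ar h1 5 (sv h1 17) + u div 2) div u)"
        have "fr (h2\<lparr>sv := (sv h2)(17 := Suc c)\<rparr>)" using h2 c by (auto simp: J_def fr_def frame_def eframe_def)
        then show "sv h2 17 = c \<and> J (Suc c) (h2\<lparr>sv := (sv h2)(17 := Suc c)\<rparr>)"
          using h2 c w1 c5 by (auto simp: J_def frame_def less_Suc_eq rounded_def)
      qed
    next
      show "J 0 (h'\<lparr>sv := (sv h')(17 := 0)\<rparr>)"
        using h' by (auto simp: J_def G_def st_def fr_def frame_def eframe_def)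
    qed (use h b in \<open>auto simp: J_def fr_def frame_def eframe_def ready_def\<close>)
    then show "exec (For 17 (Vr 11) Round) h' 0 (return_pmf ()) (\<lambda>_ h'. exec (Incr 16 (Vr 11)) h' 0 (return_pmf ()) (\<lambda>_. Q (rounded u (hits F us e ts))))"
    proof (rule exec_weaken[OF _ order_refl])
      fix h1 assume J: "J (2 ^ m) h1"
      show "exec (Incr 16 (Vr 11)) h1 0 (return_pmf ()) (\<lambda>_. Q (rounded u (hits F us e ts)))"
        by (rule exec_SetV) (use J h in \<open>auto intro!: Q simp: J_def fr_def frame_def eframe_def ready_def\<close>)
    qed
  qed
  have "exec Estimate h M (bind_pmf (replicate_pmf M (pmf_of_set {..<2 ^ m})) (\<lambda>ts. return_pmf (rounded u (hits F us e ts)))) Q"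
    unfolding Estimate_def
  proof (rule exec_then, rule exec_weaken[OF p1 order_refl], rule exec_then)
    fix h1 assume "fr h1 \<and> ar h1 6 = ar h 6 \<and> bits_at n x (ar h1 0)"
    then have "st h1" by (simp add: st_def)
    then show "exec (For 17 (Vr 11) (SetA 5 (Vr 17) (Num 0))) h1 0 (return_pmf ())
      (\<lambda>_ h'. exec (Seq (For 18 (Vr 13) Count) (Seq (For 17 (Vr 11) Round) (Incr 16 (Vr 11)))) h' M
        (bind_pmf (replicate_pmf M (pmf_of_set {..<2 ^ m})) (\<lambda>ts. return_pmf (rounded u (hits F us e ts)))) Q)"
    proof (rule exec_weaken[OF p2 order_refl])
      fix h2 assume h2: "st h2 \<and> (\<forall>b<2 ^ m. ar h2 5 b = 0)"
      show "exec (Seq (For 18 (Vr 13) Count) (Seq (For 17 (Vr 11) Round) (Incr 16 (Vr 11)))) h2 M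
        (bind_pmf (replicate_pmf M (pmf_of_set {..<2 ^ m})) (\<lambda>ts. return_pmf (rounded u (hits F us e ts)))) Q"
        by (rule exec_bind[where q = M and q' = 0], rule exec_weaken[OF p3 order_refl p4]) (use h2 in auto)
    qed
  qed
  then show ?thesis by (simp add: estimate_def map_pmf_def F_def[abs_def] e_def us(1))
qed

end

context tester
begin

definition table :: "nat \<Rightarrow> nat \<Rightarrow> (nat \<Rightarrow> nat \<Rightarrow> nat) \<Rightarrow> (nat \<Rightarrow> nat) \<Rightarrow> bool" where
  "table N m K g \<longleftrightarrow> (\<forall>i<N. \<forall>b<2 ^ m. g (i * 2 ^ m + b) = K i b)"

lemma tableD: "table N m K g \<Longrightarrow> i < N \<Longrightarrow> b < 2 ^ m \<Longrightarrow> g (i * 2 ^ m + b) = K i b"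
  by (simp add: table_def)

lemma table_Suc:
  assumes "table j m K g" "\<And>x. x < j * 2 ^ m \<Longrightarrow> g' x = g x" "\<And>b. b < 2 ^ m \<Longrightarrow> g' (j * 2 ^ m + b) = k b"
  shows "table (Suc j) m (K(j := k)) g'"
  unfolding table_def
proof (intro allI impI)
  fix i b :: nat assume i: "i < Suc j" and b: "b < 2 ^ m"
  show "g' (i * 2 ^ m + b) = (K(j := k)) i b"
  proof (cases "i = j")
    case False
    then have "i < j" using i by simp
    then have "i * 2 ^ m + b < j * 2 ^ m" using b by (rule row_less)
    then show ?thesis using assms(1,2) False \<open>i < j\<close> b by (simp add: table_def)
  qed (use assms(3) b in simp)
qed

lemma ready_frame:
  assumes "ready R m u M lab a us h" "frame X h h'" "X \<inter> {8, 10, 11, 12, 13, 21} = {}" "\<And>k. k \<notin> {0, 5, 6} \<Longrightarrow> ar h' k = ar h k"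
  shows "ready R m u M lab a us h'"
proof -
  have "wf h'" "\<And>k. k \<in> {8, 10, 11, 12, 13, 21} \<Longrightarrow> sv h' k = sv h k" using assms(2,3) by (auto simp: frame_def)
  then show ?thesis using assms(1,4) by (simp add: ready_def)
qed

lemma exec_Learn:
  assumes h: "ready R m u M lab a us h"
    and b: "Suc R \<le> W" "m \<le> W" "2 ^ m \<le> W" "M \<le> W" "0 < u" "(2 * M + u div 2) div u \<le> W"
    and us: "length us = m" "vecs R us" "a \<subseteq> {..<n}"
    and Q: "\<And>K h'. frame (eframe \<union> {14, 15}) h h' \<Longrightarrow> sv h' 16 = Suc R * 2 ^ m \<Longrightarrow> (\<And>k. k \<notin> {0, 5, 6} \<Longrightarrow> ar h' k = ar h k) \<Longrightarrow>
       table (Suc R) m K (ar h' 6) \<Longrightarrow> Q K h'"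
  shows "exec Learn h (Suc R * M) (learn (\<lambda>y. \<phi> (a \<triangle> lift lab y)) us u M R) Q"
proof -
  define I where "I j K h' \<longleftrightarrow> frame (eframe \<union> {14, 15}) h h' \<and> sv h' 14 = j \<and> sv h' 15 = Suc R \<and> sv h' 16 = j * 2 ^ m \<and>
    (\<forall>k. k \<notin> {0, 5, 6} \<longrightarrow> ar h' k = ar h k) \<and> table j m K (ar h' 6)" for j K and h' :: hs
  have w: "wf h" "sv h 8 = R" using h by (simp_all add: ready_def)
  show ?thesis
    unfolding Learn_def learn_def
  proof (rule exec_then, rule exec_SetV, simp, rule exec_then, rule exec_SetV, simp, rule exec_For[where I = I])
    fix j K h1 assume j: "j < Suc R" "I j K h1"
    have ar1: "\<And>k. k \<notin> {0, 5, 6} \<Longrightarrow> ar h1 k = ar h k" using j by (simp add: I_def)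
    have r: "ready R m u M lab a us h1"
      by (rule ready_frame[OF h, where X = "eframe \<union> {14, 15}"]) (use j ar1 in \<open>auto simp: I_def eframe_def\<close>)
    show "exec Estimate h1 M (map_pmf (\<lambda>k. K(j := k)) (estimate (\<lambda>y. \<phi> (a \<triangle> lift lab y)) us u M (shift R j)))
      (\<lambda>K' h'. sv h' 14 = j \<and> I (Suc j) K' (h'\<lparr>sv := (sv h')(14 := Suc j)\<rparr>))"
    proof (rule exec_map, rule exec_Estimate[OF r _ _ b(2-) us])
      fix k h2
      assume h2: "frame eframe h1 h2" "sv h2 16 = sv h1 16 + 2 ^ m" "\<And>k. k \<notin> {0, 5, 6} \<Longrightarrow> ar h2 k = ar h1 k"
        "\<And>j. j < sv h1 16 \<Longrightarrow> ar h2 6 j = ar h1 6 j" "\<And>b. b < 2 ^ m \<Longrightarrow> ar h2 6 (sv h1 16 + b) = k b"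
      have "table (Suc j) m (K(j := k)) (ar h2 6)"
        by (rule table_Suc[where g = "ar h1 6"]) (use j h2 in \<open>auto simp: I_def\<close>)
      then show "sv h2 14 = j \<and> I (Suc j) (K(j := k)) (h2\<lparr>sv := (sv h2)(14 := Suc j)\<rparr>)"
        using h2(1-3) j ar1 by (auto simp: I_def frame_def eframe_def)
    qed (use j in \<open>auto simp: I_def\<close>)
  next
    fix K h' assume "I (Suc R) K h'"
    then show "Q K h'" by (intro Q) (auto simp: I_def)
  qed (use w b in \<open>auto simp: I_def frame_def table_def eframe_def\<close>)
qed

lemma nonzero_code: "Suc 0 - (Suc 0 - (x - y + (y - x))) = of_bool (x \<noteq> y)"
  by (cases "x = y") auto

lemma exec_Size:
  assumes h: "wf h" "sv h 1 = d" "sv h 3 = 2 ^ d" "sv h 8 = R" "R \<le> W" "sv h 11 = 2 ^ m" "2 ^ m \<le> W"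
      "sv h 16 = Suc R * 2 ^ m" "table (Suc R) m K (ar h 6)"
    and Q: "\<And>h'. frame {5, 14, 17, 41, 42, 43} h h' \<Longrightarrow> ar h' = ar h \<Longrightarrow> sv h' 43 = R * 2 ^ m \<Longrightarrow>
      (sv h' 5 = 0 \<longleftrightarrow> sv h 5 = 0 \<and> size_ok R m d K) \<Longrightarrow> Q () h'"
  shows "exec Size h 0 (return_pmf ()) Q"
proof -
  define I where "I b h' \<longleftrightarrow> frame {5, 14, 17, 41, 42, 43} h h' \<and> ar h' = ar h \<and> sv h' 43 = R * 2 ^ m \<and> sv h' 17 = b \<and>
    (sv h' 5 = 0 \<longleftrightarrow> sv h 5 = 0 \<and> (\<forall>b'<b. K R b' \<noteq> 2 ^ d \<longrightarrow> card (learned_set R K b') \<le> d))" for b and h' :: hs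
  have step: "exec (Seq (SetV 41 (Num 0)) (Seq (SetV 42 (Vr 17))
     (Seq (For 14 (Vr 8) (Seq (Incr 41 (NZ (XOR (Ar 6 (Vr 42)) (Ar 6 (Plus (Vr 43) (Vr 17)))))) (Incr 42 (Vr 11))))
     (Incr 5 (AND (NZ (XOR (Ar 6 (Plus (Vr 43) (Vr 17))) (Vr 3))) (NZ (Minus (Vr 41) (Vr 1)))))))) h1 0 (return_pmf ())
     (\<lambda>_ h'. sv h' 17 = b \<and> I (Suc b) (h'\<lparr>sv := (sv h')(17 := Suc b)\<rparr>))" if b: "b < 2 ^ m" "I b h1" for b h1
  proof -
    define c where "c j = card {i. i < j \<and> K i b \<noteq> K R b}" for j
    have c0: "c 0 = 0" by (simp add: c_def)
    have cS: "c (Suc j) = c j + of_bool (K j b \<noteq> K R b)" for j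
    proof -
      have "{i. i < Suc j \<and> K i b \<noteq> K R b} = {i. i < j \<and> K i b \<noteq> K R b} \<union> (if K j b \<noteq> K R b then {j} else {})"
        by (auto simp: less_Suc_eq)
      then show ?thesis by (simp add: c_def)
    qed
    define J where "J j h' \<longleftrightarrow> frame {14, 41, 42} h1 h' \<and> ar h' = ar h1 \<and> sv h' 14 = j \<and> sv h' 41 = c j \<and> sv h' 42 = j * 2 ^ m + b" for j and h' :: hs
    have tab: "ar h1 6 (j * 2 ^ m + b) = K j b" if "j \<le> R" for j
      using tableD[OF h(9), of j b] that b by (simp add: I_def)
    have w1: "wf h1" "sv h1 8 = R" "sv h1 11 = 2 ^ m" "sv h1 43 = R * 2 ^ m" "sv h1 17 = b" "sv h1 3 = 2 ^ d" "sv h1 1 = d"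
      using b h by (auto simp: I_def frame_def)
    have loop: "exec (For 14 (Vr 8) (Seq (Incr 41 (NZ (XOR (Ar 6 (Vr 42)) (Ar 6 (Plus (Vr 43) (Vr 17)))))) (Incr 42 (Vr 11)))) h' 0 (return_pmf ()) (\<lambda>_. J R)"
      if "J 0 (h'\<lparr>sv := (sv h')(14 := 0)\<rparr>)" for h'
    proof (rule exec_For00[where N = R and I = J])
      fix j h2 assume j: "j < R" "J j h2"
      have w2: "wf h2" "sv h2 11 = 2 ^ m" "sv h2 43 = R * 2 ^ m" "sv h2 17 = b" "sv h2 42 = j * 2 ^ m + b" "sv h2 41 = c j" "ar h2 = ar h1" "sv h2 14 = j"
        using j w1 by (auto simp: J_def frame_def)
      have nxt: "J (Suc j) (h2\<lparr>sv := (sv h2)(41 := c j + of_bool (K j b \<noteq> K R b), 42 := j * 2 ^ m + b + 2 ^ m, 14 := Suc j)\<rparr>)"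
        using j cS[of j] by (auto simp: J_def frame_def)
      show "exec (Seq (Incr 41 (NZ (XOR (Ar 6 (Vr 42)) (Ar 6 (Plus (Vr 43) (Vr 17)))))) (Incr 42 (Vr 11))) h2 0 (return_pmf ())
        (\<lambda>_ h'. sv h' 14 = j \<and> J (Suc j) (h'\<lparr>sv := (sv h')(14 := Suc j)\<rparr>))"
        by (rule exec_then, rule exec_SetV, simp, rule exec_SetV, simp)
          (use nxt j in \<open>cases "K j b = K R b"; simp add: w2 nonzero_code tab\<close>)
    qed (use that h w1 in \<open>auto simp: J_def frame_def\<close>)
    show ?thesis
    proof (rule exec_then, rule exec_SetV, simp, rule exec_then, rule exec_SetV, simp, rule exec_then, rule exec_weaken[OF loop order_refl])
      fix h2 assume J: "J R h2"
      have w2: "wf h2" "sv h2 43 = R * 2 ^ m" "sv h2 17 = b" "sv h2 41 = c R" "ar h2 = ar h1" "sv h2 3 = 2 ^ d" "sv h2 1 = d" "sv h2 5 = sv h1 5"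
        using J w1 by (auto simp: J_def frame_def)
      have cR: "c R = card (learned_set R K b)" by (simp add: c_def learned_set_def)
      have fr: "frame {5, 14, 17, 41, 42, 43} h (h2\<lparr>sv := (sv h2)(5 := z, 17 := Suc b)\<rparr>)" for z
        using J b by (auto simp: J_def I_def frame_def)
      have nxt: "I (Suc b) (h2\<lparr>sv := (sv h2)(5 := sv h1 5 + (of_bool (K R b \<noteq> 2 ^ d) + of_bool (d < c R)) div 2, 17 := Suc b)\<rparr>)"
        unfolding I_def using fr b J w2 by (auto simp: I_def J_def less_Suc_eq cR not_less)
      show "exec (Incr 5 (AND (NZ (XOR (Ar 6 (Plus (Vr 43) (Vr 17))) (Vr 3))) (NZ (Minus (Vr 41) (Vr 1))))) h2 0 (return_pmf ())
        (\<lambda>_ h'. sv h' 17 = b \<and> I (Suc b) (h'\<lparr>sv := (sv h')(17 := Suc b)\<rparr>))"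
        by (rule exec_SetV, simp) (use nxt w2(7) in \<open>cases "K R b = 2 ^ d"; cases "d < c R"; simp add: w2 nonzero_code tab\<close>)
    qed (use w1 c0 in \<open>auto simp: J_def frame_def\<close>)
  qed
  show ?thesis
    unfolding Size_def
    by (rule exec_then, rule exec_SetV, simp, rule exec_For00[where N = "2 ^ m" and I = I, OF _ _ _ _ step])
      (use h Q in \<open>auto simp: I_def frame_def size_ok_def\<close>)
qed

lemma exec_Term:
  assumes h: "wf h" "sv h 3 = 2 ^ d" "sv h 8 = R" "R \<le> W" "sv h 11 = 2 ^ m" "sv h 17 = b" "b < 2 ^ m"
      "sv h 43 = R * 2 ^ m" "table (Suc R) m K (ar h 6)" "bits_at R y (ar h 4)"
    and Q: "\<And>h'. frame {14, 41, 42, 45, 46} h h' \<Longrightarrow> ar h' = ar h \<Longrightarrow>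
      real (sv h' 45) - real (sv h' 46) = real (sv h 45) - real (sv h 46) + (real (K R b) - 2 ^ d) * chi (learned_set R K b) y \<Longrightarrow> Q () h'"
  shows "exec Term h 0 (return_pmf ()) Q"
proof -
  \<comment> \<open>The character of the learned set at \<open>y\<close> is the parity of their
    intersection; \<open>o'\<close> is that parity for the first \<open>j\<close> variables.\<close>
  define o' where "o' j \<longleftrightarrow> odd (card ({i. i < j \<and> K i b \<noteq> K R b} \<inter> y))" for j
  have o0: "\<not> o' 0" by (simp add: o'_def)
  have oS: "o' (Suc j) = (o' j \<noteq> (K j b \<noteq> K R b \<and> j \<in> y))" for j
  proof -
    have "{i. i < Suc j \<and> K i b \<noteq> K R b} \<inter> y = ({i. i < j \<and> K i b \<noteq> K R b} \<inter> y) \<union> (if K j b \<noteq> K R b \<and> j \<in> y then {j} else {})"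
      by (auto simp: less_Suc_eq)
    then show ?thesis by (simp add: o'_def)
  qed
  have xo: "of_bool A - (of_bool B + of_bool C) div 2 + ((of_bool B + of_bool C) div 2 - of_bool A) = (of_bool (A \<noteq> (B \<and> C)) :: nat)" for A B C
    by (cases A; cases B; cases C) simp_all
  have chi: "chi (learned_set R K b) y = (if o' R then -1 else 1)"
    by (simp add: learned_set_def chi_card o'_def)
  define J where "J j h' \<longleftrightarrow> frame {14, 41, 42} h h' \<and> ar h' = ar h \<and> sv h' 14 = j \<and> sv h' 41 = of_bool (o' j) \<and> sv h' 42 = j * 2 ^ m + b" for j and h' :: hs
  have tab: "ar h 6 (j * 2 ^ m + b) = K j b" if "j \<le> R" for j
    using tableD[OF h(9), of j b] that h by simp
  have loop: "exec (For 14 (Vr 8) (Seq (SetV 41 (XOR (Vr 41) (AND (NZ (XOR (Ar 6 (Vr 42)) (Ar 6 (Plus (Vr 43) (Vr 17))))) (Ar 4 (Vr 14)))))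
        (Incr 42 (Vr 11)))) h' 0 (return_pmf ()) (\<lambda>_. J R)"
    if "J 0 (h'\<lparr>sv := (sv h')(14 := 0)\<rparr>)" for h'
  proof (rule exec_For00[where N = R and I = J])
    fix j h2 assume j: "j < R" "J j h2"
    have w2: "wf h2" "sv h2 11 = 2 ^ m" "sv h2 43 = R * 2 ^ m" "sv h2 17 = b" "sv h2 42 = j * 2 ^ m + b" "sv h2 41 = of_bool (o' j)" "ar h2 = ar h" "sv h2 14 = j"
      using j h by (auto simp: J_def frame_def)
    have yb: "ar h 4 j = of_bool (j \<in> y)" using h(10) j by (simp add: bits_at_def)
    have nxt: "J (Suc j) (h2\<lparr>sv := (sv h2)(41 := of_bool (o' j \<noteq> (K j b \<noteq> K R b \<and> j \<in> y)), 42 := j * 2 ^ m + b + 2 ^ m, 14 := Suc j)\<rparr>)"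
      using j unfolding oS[symmetric] by (auto simp: J_def frame_def)
    have e1: "ev_h n (XOR (Vr 41) (AND (NZ (XOR (Ar 6 (Vr 42)) (Ar 6 (Plus (Vr 43) (Vr 17))))) (Ar 4 (Vr 14)))) h2 = of_bool (o' j \<noteq> (K j b \<noteq> K R b \<and> j \<in> y))"
      using j unfolding xo[symmetric] by (simp add: w2 nonzero_code tab yb)
    show "exec (Seq (SetV 41 (XOR (Vr 41) (AND (NZ (XOR (Ar 6 (Vr 42)) (Ar 6 (Plus (Vr 43) (Vr 17))))) (Ar 4 (Vr 14)))))
        (Incr 42 (Vr 11))) h2 0 (return_pmf ()) (\<lambda>_ h'. sv h' 14 = j \<and> J (Suc j) (h'\<lparr>sv := (sv h')(14 := Suc j)\<rparr>))"
      by (rule exec_then, rule exec_SetV, simp, unfold e1, rule exec_SetV, simp) (use nxt in \<open>simp add: w2 del: of_bool_eq_1_iff of_bool_eq_0_iff\<close>)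
  qed (use that h in \<open>auto simp: J_def frame_def\<close>)
  show ?thesis
    unfolding Term_def
  proof (rule exec_then, rule exec_SetV, simp, rule exec_then, rule exec_SetV, simp, rule exec_then, rule exec_weaken[OF loop order_refl])
    fix h2 assume J: "J R h2"
    have w2: "wf h2" "sv h2 43 = R * 2 ^ m" "sv h2 17 = b" "sv h2 41 = of_bool (o' R)" "ar h2 = ar h" "sv h2 3 = 2 ^ d"
      "sv h2 45 = sv h 45" "sv h2 46 = sv h 46"
      using J h by (auto simp: J_def frame_def)
    have fr: "frame {14, 41, 42, 45, 46} h (h2\<lparr>sv := (sv h2)(46 := z, 45 := z')\<rparr>)" "frame {14, 41, 42, 45, 46} h (h2\<lparr>sv := (sv h2)(45 := z, 46 := z')\<rparr>)" for z z'
      using J h by (auto simp: J_def frame_def)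
    show "exec (Cond (Vr 41) (Seq (Incr 46 (Ar 6 (Plus (Vr 43) (Vr 17)))) (Incr 45 (Vr 3)))
        (Seq (Incr 45 (Ar 6 (Plus (Vr 43) (Vr 17)))) (Incr 46 (Vr 3)))) h2 0 (return_pmf ()) Q"
    proof (rule exec_Cond)
      assume "ev_h n (Vr 41) h2 \<noteq> 0"
      then have "o' R" using w2 by (auto split: if_splits)
      then show "exec (Seq (Incr 46 (Ar 6 (Plus (Vr 43) (Vr 17)))) (Incr 45 (Vr 3))) h2 0 (return_pmf ()) Q"
        by - (rule exec_then, rule exec_SetV, simp, rule exec_SetV, simp, rule Q, use fr in \<open>simp_all add: w2 tab chi\<close>)
    next
      assume "ev_h n (Vr 41) h2 = 0"
      then have "\<not> o' R" using w2 by (auto split: if_splits)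
      then show "exec (Seq (Incr 45 (Ar 6 (Plus (Vr 43) (Vr 17)))) (Incr 46 (Vr 3))) h2 0 (return_pmf ()) Q"
        by - (rule exec_then, rule exec_SetV, simp, rule exec_SetV, simp, rule Q, use fr in \<open>simp_all add: w2 tab chi\<close>)
    qed
  qed (use h o0 in \<open>auto simp: J_def frame_def\<close>)
qed

definition vframe :: "nat set" where "vframe = {5, 14, 17, 18, 21, 41, 42, 45, 46} \<union> {22..28}"

lemma exec_Verify:
  assumes h: "wf h" "sv h 3 = 2 ^ d" "sv h 8 = R" "R \<le> W" "sv h 11 = 2 ^ m" "2 ^ m \<le> W" "sv h 44 = N" "N \<le> W" "sv h 63 = 0"
      "sv h 43 = R * 2 ^ m" "table (Suc R) m K (ar h 6)" "labels R lab (ar h 2)" "bits_at n a (ar h 3)" "a \<subseteq> {..<n}"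
    and Q: "\<And>ok h'. frame vframe h h' \<Longrightarrow> (sv h' 5 = 0 \<longleftrightarrow> sv h 5 = 0 \<and> ok) \<Longrightarrow> Q ok h'"
  shows "exec Verify h N (verify (\<lambda>y. \<phi> (a \<triangle> lift lab y)) R m d N K) Q"
proof -
  define F where "F y = \<phi> (a \<triangle> lift lab y)" for y
  define I where "I i ok h' \<longleftrightarrow> frame vframe h h' \<and> (\<forall>k. k \<notin> {0, 4} \<longrightarrow> ar h' k = ar h k) \<and> sv h' 18 = i \<and> sv h' 21 = 0 \<and>
    (sv h' 5 = 0 \<longleftrightarrow> sv h 5 = 0 \<and> ok)" for i :: nat and ok and h' :: hs
  have "exec Verify h (N * 1) (loopM N 0 (\<lambda>_ ok. map_pmf (\<lambda>y. ok \<and> hypothesis R m d K y = 2 ^ d * F y) (rset {..<R})) True) Q"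
    unfolding Verify_def
  proof (rule exec_then, rule exec_SetV, simp, rule exec_For[where I = I])
    fix i ok and h1 :: hs assume i: "i < N" "I i ok h1"
    have w1: "wf h1" "sv h1 63 = 0" "sv h1 8 = R" "sv h1 3 = 2 ^ d" "sv h1 11 = 2 ^ m" "sv h1 43 = R * 2 ^ m"
      using i h by (auto simp: I_def frame_def vframe_def)
    let ?Q = "\<lambda>ok h'. sv h' 18 = i \<and> I (Suc i) ok (h'\<lparr>sv := (sv h')(18 := Suc i)\<rparr>)"
    show "exec (Seq (RandVec 4 63 23 8) (Seq (For 23 (Vr 0) (SetA 0 (Vr 23) (XOR (Ar 3 (Vr 23)) (Ar 4 (Ar 2 (Vr 23))))))
     (Seq Eval (Seq (SetV 45 (Num 0)) (Seq (SetV 46 (Num 0)) (Seq (For 17 (Vr 11) Term)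
     (Seq (Cond (Vr 22) (Incr 46 (Vr 3)) (Incr 45 (Vr 3))) (Incr 5 (XOR (Vr 45) (Vr 46)))))))))) h1 1
      (map_pmf (\<lambda>y. ok \<and> hypothesis R m d K y = 2 ^ d * F y) (rset {..<R})) ?Q"
    proof (rule exec_bind[where q = 0 and q' = 1 and B = "\<lambda>y. return_pmf (ok \<and> hypothesis R m d K y = 2 ^ d * F y)", OF exec_RandVec[where N = R]])
      fix y assume y: "y \<subseteq> {..<R}"
      define x where "x = a \<triangle> lift lab y"
      have x: "x \<subseteq> {..<n}" unfolding x_def using h by simp
      define h2 where "h2 = h1\<lparr>sv := (sv h1)(23 := R), ar := (ar h1)(4 := vec (sv h1 63) R y (ar h1 4))\<rparr>"
      have h2: "frame {23} h1 h2" "bits_at R y (ar h2 4)" "\<And>k. k \<noteq> 4 \<Longrightarrow> ar h2 k = ar h1 k"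
        using w1 by (auto simp: h2_def frame_def)
      define J where "J v h' \<longleftrightarrow> frame {23} h1 h' \<and> ar h' 4 = ar h2 4 \<and> (\<forall>k. k \<notin> {0, 4} \<longrightarrow> ar h' k = ar h1 k) \<and> sv h' 23 = v \<and> bits_at v x (ar h' 0)" for v and h' :: hs
      have xbit: "of_bool (v \<in> a) - of_bool (lab v \<in> y) + (of_bool (lab v \<in> y) - of_bool (v \<in> a)) = (of_bool (v \<in> x) :: nat)" if "v < n" for v
        using that by (cases "v \<in> a"; cases "lab v \<in> y") (auto simp: x_def sd_mem pull_def)
      have copy: "exec (For 23 (Vr 0) (SetA 0 (Vr 23) (XOR (Ar 3 (Vr 23)) (Ar 4 (Ar 2 (Vr 23)))))) h2 0 (return_pmf ()) (\<lambda>_. J n)"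
      proof (rule exec_For00[where N = n and I = J])
        fix v h3 assume v: "v < n" "J v h3"
        have w3: "wf h3" using v by (simp add: J_def frame_def)
        have "ar h3 3 v = of_bool (v \<in> a)" "ar h3 2 v = lab v" "lab v < R"
          using v i h by (auto simp: J_def I_def labels_def bits_at_def)
        moreover have "ar h3 4 (lab v) = of_bool (lab v \<in> y)" using h2(2) calculation v by (simp add: J_def bits_at_def)
        ultimately have ev: "ev_h n (XOR (Ar 3 (Vr 23)) (Ar 4 (Ar 2 (Vr 23)))) h3 = of_bool (v \<in> x)"
          using xbit[OF v(1)] v w3 by (simp add: J_def)
        show "exec (SetA 0 (Vr 23) (XOR (Ar 3 (Vr 23)) (Ar 4 (Ar 2 (Vr 23))))) h3 0 (return_pmf ())
          (\<lambda>_ h'. sv h' 23 = v \<and> J (Suc v) (h'\<lparr>sv := (sv h')(23 := Suc v)\<rparr>))"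
          by (rule exec_SetA) (use v w3 ev in \<open>auto simp: J_def frame_def bits_at_def less_Suc_eq\<close>)
      qed (use h2 w1 n_le_W in \<open>auto simp: J_def frame_def bits_at_def\<close>)
      \<comment> \<open>The signed value represented by the two nonnegative cells.\<close>
      define s where "s h' = real (sv h' 45) - real (sv h' 46)" for h' :: hs
      define V where "V h' \<longleftrightarrow> frame ({14, 17, 41, 42, 45, 46} \<union> {22..28}) h1 h' \<and> bits_at R y (ar h' 4) \<and>
         (\<forall>k. k \<notin> {0, 4} \<longrightarrow> ar h' k = ar h1 k) \<and> sv h' 22 = of_bool (\<phi> x = 1)" for h' :: hs
      have terms: "exec (For 17 (Vr 11) Term) h' 0 (return_pmf ()) (\<lambda>_ h'. V h' \<and> s h' = hypothesis R m d K y)"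
        if h': "V h'" "sv h' 45 = 0" "sv h' 46 = 0" for h'
      proof (rule exec_For00[where N = "2 ^ m" and I = "\<lambda>b h'. V h' \<and> sv h' 17 = b \<and> s h' = (\<Sum>b<b. (real (K R b) - 2 ^ d) * chi (learned_set R K b) y)"])
        fix b h3 assume b: "b < 2 ^ m" "V h3 \<and> sv h3 17 = b \<and> s h3 = (\<Sum>b<b. (real (K R b) - 2 ^ d) * chi (learned_set R K b) y)"
        have w3: "wf h3" "sv h3 3 = 2 ^ d" "sv h3 8 = R" "sv h3 11 = 2 ^ m" "sv h3 17 = b" "sv h3 43 = R * 2 ^ m" "table (Suc R) m K (ar h3 6)" "bits_at R y (ar h3 4)"
          using b i h w1 by (auto simp: V_def I_def frame_def)
        show "exec Term h3 0 (return_pmf ()) (\<lambda>_ h'. sv h' 17 = b \<and> (\<lambda>b h'. V h' \<and> sv h' 17 = b \<and>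
            s h' = (\<Sum>b<b. (real (K R b) - 2 ^ d) * chi (learned_set R K b) y)) (Suc b) (h'\<lparr>sv := (sv h')(17 := Suc b)\<rparr>))"
        proof (rule exec_Term[OF w3(1-3) h(4) w3(4,5) b(1) w3(6-)])
          fix h4 :: hs assume h4: "frame {14, 41, 42, 45, 46} h3 h4" "ar h4 = ar h3"
            "real (sv h4 45) - real (sv h4 46) = real (sv h3 45) - real (sv h3 46) + (real (K R b) - 2 ^ d) * chi (learned_set R K b) y"
          then have "s (h4\<lparr>sv := (sv h4)(17 := Suc b)\<rparr>) = (\<Sum>b<Suc b. (real (K R b) - 2 ^ d) * chi (learned_set R K b) y)"
            using b by (simp add: s_def)
          moreover have "V (h4\<lparr>sv := (sv h4)(17 := Suc b)\<rparr>)" "sv h4 17 = b" using h4(1,2) b by (auto simp: V_def frame_def)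
          ultimately show "sv h4 17 = b \<and> (\<lambda>b h'. V h' \<and> sv h' 17 = b \<and>
            s h' = (\<Sum>b<b. (real (K R b) - 2 ^ d) * chi (learned_set R K b) y)) (Suc b) (h4\<lparr>sv := (sv h4)(17 := Suc b)\<rparr>)"
            by simp
        qed
      next
        fix b h' assume "b \<le> 2 ^ m" "V h' \<and> sv h' 17 = b \<and> s h' = (\<Sum>b<b. (real (K R b) - 2 ^ d) * chi (learned_set R K b) y)"
        then show "sv h' 17 = b \<and> ev_h n (Vr 11) h' = 2 ^ m" using w1 by (auto simp: V_def frame_def)
      qed (use h' h in \<open>auto simp: V_def frame_def s_def hypothesis_def\<close>)
      have fin: "exec (Seq (Cond (Vr 22) (Incr 46 (Vr 3)) (Incr 45 (Vr 3))) (Incr 5 (XOR (Vr 45) (Vr 46)))) h' 0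
         (return_pmf ()) (\<lambda>_. ?Q (ok \<and> hypothesis R m d K y = 2 ^ d * F y))" if h': "V h'" "s h' = hypothesis R m d K y" for h'
      proof (rule exec_then)
        have w': "wf h'" "sv h' 3 = 2 ^ d" "sv h' 22 = of_bool (\<phi> x = 1)" using h' w1 by (auto simp: V_def frame_def)
        have phx: "\<phi> x = F y" by (simp add: x_def F_def)
        have "exec (Cond (Vr 22) (Incr 46 (Vr 3)) (Incr 45 (Vr 3))) h' 0 (return_pmf ())
          (\<lambda>_ h3. V h3 \<and> s h3 = hypothesis R m d K y - 2 ^ d * F y)"
        proof (rule exec_Cond)
          assume "ev_h n (Vr 22) h' \<noteq> 0"
          then have "F y = 1" using w' phx by (auto split: if_splits)
          then show "exec (Incr 46 (Vr 3)) h' 0 (return_pmf ()) (\<lambda>_ h3. V h3 \<and> s h3 = hypothesis R m d K y - 2 ^ d * F y)"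
            by - (rule exec_SetV, simp, use h' w' in \<open>auto simp: V_def s_def frame_def\<close>)
        next
          assume "ev_h n (Vr 22) h' = 0"
          then have "F y = -1" using w' phx phi_values[of x] by (auto split: if_splits)
          then show "exec (Incr 45 (Vr 3)) h' 0 (return_pmf ()) (\<lambda>_ h3. V h3 \<and> s h3 = hypothesis R m d K y - 2 ^ d * F y)"
            by - (rule exec_SetV, simp, use h' w' in \<open>auto simp: V_def s_def frame_def\<close>)
        qed
        then show "exec (Cond (Vr 22) (Incr 46 (Vr 3)) (Incr 45 (Vr 3))) h' 0 (return_pmf ())
          (\<lambda>_ h3. exec (Incr 5 (XOR (Vr 45) (Vr 46))) h3 0 (return_pmf ()) (\<lambda>_. ?Q (ok \<and> hypothesis R m d K y = 2 ^ d * F y)))"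
        proof (rule exec_weaken[OF _ order_refl])
          fix h3 assume h3: "V h3 \<and> s h3 = hypothesis R m d K y - 2 ^ d * F y"
          \<comment> \<open>The value of the function has been subtracted as well, so equality means
            that both cells agree.\<close>
          then have eq: "hypothesis R m d K y = 2 ^ d * F y \<longleftrightarrow> sv h3 45 - sv h3 46 + (sv h3 46 - sv h3 45) = 0"
            by (auto simp: s_def)
          have s5: "sv h3 5 = sv h1 5" "sv h3 18 = i" "sv h3 21 = 0" "wf h3" using h3 i by (auto simp: V_def frame_def I_def)
          have fr: "frame vframe h (h3\<lparr>sv := (sv h3)(5 := z, 18 := Suc i)\<rparr>)" for z
            using h3 i by (auto simp: V_def frame_def I_def vframe_def)
          have a3: "\<And>k. k \<notin> {0, 4} \<Longrightarrow> ar h3 k = ar h k" using h3 i by (auto simp: V_def I_def)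
          have i5: "(sv h1 5 = 0) = (sv h 5 = 0 \<and> ok)" using i by (simp add: I_def)
          show "exec (Incr 5 (XOR (Vr 45) (Vr 46))) h3 0 (return_pmf ()) (\<lambda>_. ?Q (ok \<and> hypothesis R m d K y = 2 ^ d * F y))"
            unfolding eq by (rule exec_SetV, simp) (use s5 fr a3 i5 in \<open>auto simp: I_def\<close>)
        qed
      qed
      have "exec (Seq Eval (Seq (SetV 45 (Num 0)) (Seq (SetV 46 (Num 0)) (Seq (For 17 (Vr 11) Term)
        (Seq (Cond (Vr 22) (Incr 46 (Vr 3)) (Incr 45 (Vr 3))) (Incr 5 (XOR (Vr 45) (Vr 46)))))))) h3 1
        (return_pmf (ok \<and> hypothesis R m d K y = 2 ^ d * F y)) ?Q" if h3: "J n h3" for h3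
      proof (rule exec_return, rule exec_then_q[where q = 1 and q' = 0], rule exec_Eval[where us = "[]" and x = x])
        fix h4 :: hs assume h4: "\<And>k. k \<notin> {22..28} \<Longrightarrow> sv h4 k = sv h3 k" "ar h4 = ar h3" "sv h4 22 = of_bool (\<phi> (x \<triangle> lin (sv h3 20) []) = 1)"
        have "wf h4" using h4(1)[of 0] h3 by (simp add: J_def frame_def wf_def)
        then have V4: "V (h4\<lparr>sv := (sv h4)(45 := 0, 46 := 0)\<rparr>)"
          using h4 h3 h2(2) by (auto simp: V_def J_def frame_def)
        show "exec (Seq (SetV 45 (Num 0)) (Seq (SetV 46 (Num 0)) (Seq (For 17 (Vr 11) Term)
          (Seq (Cond (Vr 22) (Incr 46 (Vr 3)) (Incr 45 (Vr 3))) (Incr 5 (XOR (Vr 45) (Vr 46))))))) h4 0 (return_pmf ())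
          (\<lambda>_. ?Q (ok \<and> hypothesis R m d K y = 2 ^ d * F y))"
          by (rule exec_then, rule exec_SetV, simp, rule exec_then, rule exec_SetV, simp, rule exec_then, rule exec_weaken[OF terms order_refl fin])
            (use V4 in simp_all)
      qed (use h3 i x w1 in \<open>auto simp: J_def I_def frame_def bits_at_def rows_at_def\<close>)
      then show "exec (Seq (For 23 (Vr 0) (SetA 0 (Vr 23) (XOR (Ar 3 (Vr 23)) (Ar 4 (Ar 2 (Vr 23))))))
        (Seq Eval (Seq (SetV 45 (Num 0)) (Seq (SetV 46 (Num 0)) (Seq (For 17 (Vr 11) Term)
        (Seq (Cond (Vr 22) (Incr 46 (Vr 3)) (Incr 45 (Vr 3))) (Incr 5 (XOR (Vr 45) (Vr 46)))))))))
        (h1\<lparr>sv := (sv h1)(23 := R), ar := (ar h1)(4 := vec (sv h1 63) R y (ar h1 4))\<rparr>) 1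
        (return_pmf (ok \<and> hypothesis R m d K y = 2 ^ d * F y)) ?Q"
        unfolding h2_def[symmetric] by (rule exec_then[OF exec_weaken[OF copy order_refl]])
    qed (use w1 h in \<open>auto simp: map_pmf_def\<close>)
  next
    fix ok h' assume "I N ok h'"
    then show "Q ok h'" by (intro Q) (auto simp: I_def)
  qed (use h in \<open>auto simp: I_def frame_def vframe_def\<close>)
  then show ?thesis by (simp add: verify_def F_def)
qed

end

context tester
begin

definition sframe :: "nat set" where "sframe = {5, 8} \<union> {14..18} \<union> {20..28} \<union> {30..43} \<union> {45, 46}"

lemma frame_trans: "frame X h h' \<Longrightarrow> frame Y h' h'' \<Longrightarrow> X \<subseteq> Z \<Longrightarrow> Y \<subseteq> Z \<Longrightarrow> frame Z h h''"
  unfolding frame_def by (metis subsetD)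

lemma frame_sv: "frame X h h' \<Longrightarrow> k \<notin> X \<Longrightarrow> sv h' k = sv h k"
  by (simp add: frame_def)

lemma exec_StageC:
  assumes h: "wf h" "sv h 1 = d" "sv h 3 = 2 ^ d" "sv h 9 = 4096 * (d + 1)\<^sup>2" "sv h 10 = 4 * d + 8" "sv h 11 = 2 ^ (4 * d + 8)"
      "sv h 12 = 256 * (d + 1) * 2 ^ d" "sv h 13 = 256 * (d + 1) * 2 ^ d * 2 ^ d" "sv h 44 = 64 * 4 ^ d" "sv h 63 = 0"
    and b: "Suc n \<le> W" "4 * d + 8 \<le> W" "2 ^ (4 * d + 8) \<le> W" "256 * (d + 1) * 2 ^ d * 2 ^ d \<le> W" "64 * 4 ^ d \<le> W" "2 * 2 ^ d \<le> W"
    and Q: "\<And>ok h'. frame sframe h h' \<Longrightarrow> (sv h' 5 = 0 \<longleftrightarrow> sv h 5 = 0 \<and> ok) \<Longrightarrow> Q ok h'"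
  shows "exec StageC h ((4096 * (d + 1)\<^sup>2 + 1) * (256 * (d + 1) * 2 ^ d * 2 ^ d) + 64 * 4 ^ d) (degree_test n d \<phi>) Q"
proof -
  define r where "r = 4096 * (d + 1)\<^sup>2"
  define m where "m = 4 * d + 8"
  define u where "u = 256 * (d + 1) * (2 ^ d :: nat)"
  define M where "M = u * 2 ^ d"
  define N where "N = 64 * (4 ^ d :: nat)"
  define R where "R = n - (n - r)"
  have r: "0 < r" by (simp add: r_def)
  have u: "0 < u" by (simp add: u_def)
  have Rb: "R \<le> n" "R \<le> r" by (auto simp: R_def)
  have hh: "sv h 9 = r" "sv h 10 = m" "sv h 11 = 2 ^ m" "sv h 12 = u" "sv h 13 = M" "sv h 44 = N"
    using h by (simp_all add: r_def m_def u_def M_def N_def)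
  note hw = h(1,2,3,10)
  have bb: "Suc R \<le> W" "m \<le> W" "2 ^ m \<le> W" "M \<le> W" "N \<le> W"
    using b Rb by (simp_all add: m_def u_def M_def N_def)
  \<comment> \<open>The rounding loop runs at most \<open>2 * 2 ^ d\<close> times, the number that
    encodes the coefficient 1.\<close>
  have rb: "(2 * M + u div 2) div u \<le> W"
  proof -
    have "2 * M + u div 2 = u div 2 + (2 * 2 ^ d) * u" by (simp add: M_def)
    then have "(2 * M + u div 2) div u = 2 * 2 ^ d + u div 2 div u" using u by (simp only: div_mult_self1)
    also have "u div 2 div u = 0" using u by simp
    finally show ?thesis using b by simp
  qed
  define test where "test a lab K = map_pmf (\<lambda>ok. size_ok R m d K \<and> ok) (verify (\<lambda>y. \<phi> (a \<triangle> lift lab y)) R m d N K)" for a lab K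
  have s6: "exec (Seq Size Verify) h' N (test a lab K) Q"
    if a: "a \<subseteq> {..<n}" and lab: "labels R lab (ar h' 2)" "bits_at n a (ar h' 3)"
      and h': "frame (sframe - {5}) h h'" "sv h' 8 = R" "sv h' 16 = Suc R * 2 ^ m" "table (Suc R) m K (ar h' 6)" for a lab us K h'
    unfolding test_def
  proof (rule exec_then, rule exec_Size[where R = R and m = m and d = d and K = K])
    fix h2 assume h2: "frame {5, 14, 17, 41, 42, 43} h' h2" "ar h2 = ar h'" "sv h2 43 = R * 2 ^ m" "(sv h2 5 = 0) = (sv h' 5 = 0 \<and> size_ok R m d K)"
    have f2: "frame sframe h h2"
      by (rule frame_trans[OF h'(1) h2(1)]) (auto simp: sframe_def)
    have v2: "wf h2" "sv h2 3 = 2 ^ d" "sv h2 8 = R" "sv h2 11 = 2 ^ m" "sv h2 44 = N" "sv h2 63 = 0" "table (Suc R) m K (ar h2 6)"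
      "labels R lab (ar h2 2)" "bits_at n a (ar h2 3)"
      using frame_sv[OF h2(1), of 8] frame_sv[OF f2, of 3] frame_sv[OF f2, of 11] frame_sv[OF f2, of 44] frame_sv[OF f2, of 63] f2 hw hh h' h2 lab
      by (simp_all add: sframe_def frame_def[of _ _ h2])
    have Rn: "R \<le> W" using bb by simp
    show "exec Verify h2 N (map_pmf (\<lambda>ok. size_ok R m d K \<and> ok) (verify (\<lambda>y. \<phi> (a \<triangle> lift lab y)) R m d N K)) Q"
    proof (rule exec_map, rule exec_Verify[OF v2(1-3) Rn v2(4) bb(3) v2(5) bb(5) v2(6) h2(3) v2(7-9) a])
      fix ok h3 assume h3: "frame vframe h2 h3" "(sv h3 5 = 0) = (sv h2 5 = 0 \<and> ok)"
      have "frame sframe h h3" by (rule frame_trans[OF f2 h3(1)]) (auto simp: sframe_def vframe_def)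
      then show "frame sframe h h3 \<and> (sv h3 5 = 0 \<longleftrightarrow> sv h 5 = 0 \<and> size_ok R m d K \<and> ok)"
        using h3 h2(4) frame_sv[OF h'(1), of 5] by simp
    next
      fix ok h3 assume "frame sframe h h3 \<and> (sv h3 5 = 0 \<longleftrightarrow> sv h 5 = 0 \<and> size_ok R m d K \<and> ok)"
      then show "Q (size_ok R m d K \<and> ok) h3" by (intro Q) auto
    qed
  next
    show "wf h'" "sv h' 1 = d" "sv h' 3 = 2 ^ d" "sv h' 11 = 2 ^ m"
      using h'(1) frame_sv[OF h'(1), of 1] frame_sv[OF h'(1), of 3] frame_sv[OF h'(1), of 11] hw hh by (simp_all add: sframe_def frame_def[of _ _ h'])
  qed (use h' bb in simp_all)
  define fr where "fr h' \<longleftrightarrow> frame {8, 21, 23, 25, 26, 30, 31, 32, 33} h h' \<and> sv h' 8 = R" for h' :: hs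
  have s5: "exec (Seq (SetV 21 (Vr 10)) (Seq Learn (Seq Size Verify))) h' (Suc R * M + N)
      (bind_pmf (learn (\<lambda>y. \<phi> (a \<triangle> lift lab y)) us u M R) (test a lab)) Q"
    if a: "a \<subseteq> {..<n}" and lab: "labels R lab (ar h' 2)" "bits_at n a (ar h' 3)" and fr': "fr h'"
      and us: "length us = m" "vecs R us" "rows_at (map (lift lab) us) (ar h' 1)" for a lab us h'
  proof (rule exec_then, rule exec_SetV, simp, rule exec_bind[OF exec_Learn[where R = R and m = m and u = u and M = M and lab = lab and a = a and us = us]])
    let ?h = "h'\<lparr>sv := (sv h')(21 := ev_h n (Vr 10) h')\<rparr>"
    fix K h2 assume h2: "frame (eframe \<union> {14, 15}) ?h h2" "sv h2 16 = Suc R * 2 ^ m" "\<And>k. k \<notin> {0, 5, 6} \<Longrightarrow> ar h2 k = ar ?h k"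
      "table (Suc R) m K (ar h2 6)"
    show "exec (Seq Size Verify) h2 N (test a lab K) Q"
      by (rule s6[OF a]) (use h2 lab fr' in \<open>auto simp: fr_def frame_def eframe_def sframe_def\<close>)
  qed (use hw hh bb rb u us lab a fr' in \<open>auto simp: fr_def frame_def ready_def\<close>)
  have s4: "exec (Seq BlockRows (Seq (SetV 21 (Vr 10)) (Seq Learn (Seq Size Verify)))) h' (Suc R * M + N)
      (bind_pmf (replicate_pmf m (rset {..<R})) (\<lambda>us. bind_pmf (learn (\<lambda>y. \<phi> (a \<triangle> lift lab y)) us u M R) (test a lab))) Q"
    if a: "a \<subseteq> {..<n}" and lab: "labels R lab (ar h' 2)" "bits_at n a (ar h' 3)" and fr': "fr h'" for a lab h'
  proof (rule exec_bind[OF exec_BlockRows[where R = R and m = m and lab = lab]])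
    fix us h2 assume h2: "length us = m" "vecs R us" "rows_at (map (lift lab) us) (ar h2 1)" "frame {23, 25, 26} h' h2"
      "\<And>k. k \<notin> {1, 4} \<Longrightarrow> ar h2 k = ar h' k"
    show "exec (Seq (SetV 21 (Vr 10)) (Seq Learn (Seq Size Verify))) h2 (Suc R * M + N)
      (bind_pmf (learn (\<lambda>y. \<phi> (a \<triangle> lift lab y)) us u M R) (test a lab)) Q"
      by (rule s5[OF a]) (use h2 lab fr' in \<open>auto simp: fr_def frame_def\<close>)
  qed (use hw hh bb lab fr' in \<open>auto simp: fr_def frame_def\<close>)
  have s3: "exec (Seq Hash (Seq BlockRows (Seq (SetV 21 (Vr 10)) (Seq Learn (Seq Size Verify))))) h' (Suc R * M + N)
      (bind_pmf (hash n (n - r)) (\<lambda>lab. bind_pmf (replicate_pmf m (rset {..<R}))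
        (\<lambda>us. bind_pmf (learn (\<lambda>y. \<phi> (a \<triangle> lift lab y)) us u M R) (test a lab)))) Q"
    if a: "a \<subseteq> {..<n}" and h': "bits_at n a (ar h' 3)" "frame {23} h h'" for a h'
  proof (rule exec_bind, rule exec_weaken[OF exec_Hash[where r = r] order_refl])
    fix lab h2 assume "frame {8, 23, 30, 31, 32, 33} h' h2" "sv h2 8 = n - (n - r)" "\<And>v. v < n \<Longrightarrow> ar h2 2 v = lab v"
       "\<And>k. k \<noteq> 2 \<Longrightarrow> ar h2 k = ar h' k"
    then show "fr h2 \<and> bits_at n a (ar h2 3) \<and> (\<forall>v<n. ar h2 2 v = lab v)"
      using h' by (auto simp: fr_def frame_def R_def)
  next
    fix lab h2 assume lab: "lab \<in> set_pmf (hash n (n - r))" and h2: "fr h2 \<and> bits_at n a (ar h2 3) \<and> (\<forall>v<n. ar h2 2 v = lab v)"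
    have "lab v < R" if "v < n" for v using hash_less[OF lab _ that] r that by (simp add: R_def)
    then show "exec (Seq BlockRows (Seq (SetV 21 (Vr 10)) (Seq Learn (Seq Size Verify)))) h2 (Suc R * M + N)
      (bind_pmf (replicate_pmf m (rset {..<R})) (\<lambda>us. bind_pmf (learn (\<lambda>y. \<phi> (a \<triangle> lift lab y)) us u M R) (test a lab))) Q"
      by (intro s4[OF a]) (use h2 in \<open>auto simp: labels_def\<close>)
  qed (use hw hh h' r in \<open>auto simp: frame_def\<close>)
  have "exec StageC h (Suc R * M + N) (bind_pmf (rset {..<n}) (\<lambda>a. bind_pmf (hash n (n - r)) (\<lambda>lab. bind_pmf (replicate_pmf m (rset {..<R}))
        (\<lambda>us. bind_pmf (learn (\<lambda>y. \<phi> (a \<triangle> lift lab y)) us u M R) (test a lab))))) Q"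
    unfolding StageC_def
  proof (rule exec_bind[OF exec_RandVec[where N = n]])
    fix a assume a: "a \<subseteq> {..<n}"
    show "exec (Seq Hash (Seq BlockRows (Seq (SetV 21 (Vr 10)) (Seq Learn (Seq Size Verify)))))
      (h\<lparr>sv := (sv h)(23 := n), ar := (ar h)(3 := vec (sv h 63) n a (ar h 3))\<rparr>) (Suc R * M + N)
      (bind_pmf (hash n (n - r)) (\<lambda>lab. bind_pmf (replicate_pmf m (rset {..<R}))
        (\<lambda>us. bind_pmf (learn (\<lambda>y. \<phi> (a \<triangle> lift lab y)) us u M R) (test a lab)))) Q"
      by (rule s3[OF a]) (use hw in \<open>auto simp: frame_def\<close>)
  qed (use hw n_le_W in auto)
  also have "bind_pmf (rset {..<n}) (\<lambda>a. bind_pmf (hash n (n - r)) (\<lambda>lab. bind_pmf (replicate_pmf m (rset {..<R}))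
        (\<lambda>us. bind_pmf (learn (\<lambda>y. \<phi> (a \<triangle> lift lab y)) us u M R) (test a lab)))) = degree_test n d \<phi>"
    by (simp only: degree_test_def degree_test_on_def test_def[abs_def] r_def R_def m_def u_def M_def N_def)
  finally have "exec StageC h (Suc R * M + N) (degree_test n d \<phi>) Q" .
  moreover have "Suc R * M + N \<le> (r + 1) * M + N" using Rb by (intro add_right_mono mult_right_mono) auto
  ultimately have "exec StageC h ((r + 1) * M + N) (degree_test n d \<phi>) Q" by (rule exec_weaken)
  then show ?thesis by (simp only: r_def M_def u_def N_def)
qed

end

section \<open>Runs of the program\<close>

lemma step_monotone:
  "(c', s') \<in> set_pmf (step n \<epsilon> f D c s) \<Longrightarrow> time s \<le> time s' \<and> queries s \<le> queries s'"
  by (induction c arbitrary: c' s') (auto simp: state_after_def split: if_splits)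

lemma rel_pmf_prob:
  assumes "rel_pmf R M \<mu>" "\<And>x y. R x y \<Longrightarrow> x \<in> A \<Longrightarrow> y \<in> B"
  shows "measure_pmf.prob M A \<le> measure_pmf.prob \<mu> B"
proof -
  have "measure_pmf.prob M A \<le> measure_pmf.prob \<mu> {y. \<exists>x\<in>A. R x y}" using assms(1) by (rule rel_pmf_measureD)
  also have "\<dots> \<le> measure_pmf.prob \<mu> B" by (rule measure_pmf.finite_measure_mono) (use assms(2) in auto)
  finally show ?thesis .
qed

context machine
begin

lemma ev_monotone: "ev c s \<mu> \<Longrightarrow> s' \<in> set_pmf \<mu> \<Longrightarrow> time s \<le> time s' \<and> queries s \<le> queries s'"
proof (induction arbitrary: s' rule: ev.induct)
  case (ev_step c s \<mu>)
  then obtain c1 s1 where "(c1, s1) \<in> set_pmf (step n \<epsilon> f D c s)" "s' \<in> set_pmf (\<mu> (c1, s1))" by auto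
  then show ?case using ev_step.IH step_monotone by (meson order_trans)
qed simp

definition outcome :: "com \<Rightarrow> state \<Rightarrow> state pmf" where "outcome c s = (THE \<mu>. ev c s \<mu>)"

lemma outcome_eq: "ev c s \<mu> \<Longrightarrow> outcome c s = \<mu>"
  unfolding outcome_def using ev_unique by blast

lemma step_outcome:
  assumes "ev c s \<mu>"
  shows "(\<forall>(c', s')\<in>set_pmf (step n \<epsilon> f D c s). \<exists>\<nu>. ev c' s' \<nu>) \<and>
    bind_pmf (step n \<epsilon> f D c s) (\<lambda>(c', s'). outcome c' s') = \<mu>"
  using assms
proof cases
  case ev_Skip
  then show ?thesis using outcome_eq[OF ev.ev_Skip, of s] by (auto simp: bind_return_pmf intro: ev.ev_Skip)
next
  case (ev_step \<nu>)
  have "bind_pmf (step n \<epsilon> f D c s) (\<lambda>(c', s'). outcome c' s') = bind_pmf (step n \<epsilon> f D c s) \<nu>"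
    by (intro bind_pmf_cong refl) (use ev_step in \<open>auto intro: outcome_eq\<close>)
  then show ?thesis using ev_step by auto
qed

text \<open>The final distributions of the configurations reached after \<open>k\<close> steps
  always average to the same \<open>\<mu>\<close>, because a step only unfolds the average
  once.\<close>

lemma run_outcome:
  assumes "ev P (initial_state n d) \<mu>"
  shows "(\<forall>(c, s)\<in>set_pmf (run n d \<epsilon> f D P k). \<exists>\<nu>. ev c s \<nu>) \<and>
    bind_pmf (run n d \<epsilon> f D P k) (\<lambda>(c, s). outcome c s) = \<mu>"
proof (induction k)
  case 0
  show ?case using assms outcome_eq[OF assms] by (auto simp: bind_return_pmf)
next
  case (Suc k)
  have "\<exists>\<nu>. ev c s \<nu>" if cs: "(c, s) \<in> set_pmf (run n d \<epsilon> f D P (Suc k))" for c s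
  proof -
    obtain c0 s0 where 0: "(c0, s0) \<in> set_pmf (run n d \<epsilon> f D P k)" "(c, s) \<in> set_pmf (step n \<epsilon> f D c0 s0)"
      using cs by (fastforce simp: case_prod_unfold)
    then obtain \<nu> where "ev c0 s0 \<nu>" using Suc.IH by blast
    from step_outcome[OF this] 0(2) show ?thesis by blast
  qed
  moreover have "bind_pmf (run n d \<epsilon> f D P (Suc k)) (\<lambda>(c, s). outcome c s)
      = bind_pmf (run n d \<epsilon> f D P k) (\<lambda>(c0, s0). bind_pmf (step n \<epsilon> f D c0 s0) (\<lambda>(c, s). outcome c s))"
    by (simp add: bind_assoc_pmf case_prod_unfold)
  moreover have "\<dots> = bind_pmf (run n d \<epsilon> f D P k) (\<lambda>(c, s). outcome c s)"
  proof (intro bind_pmf_cong refl)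
    fix cs assume "cs \<in> set_pmf (run n d \<epsilon> f D P k)"
    then obtain \<nu> where "ev (fst cs) (snd cs) \<nu>" using Suc.IH by (auto simp: case_prod_unfold)
    then show "(case cs of (c0, s0) \<Rightarrow> bind_pmf (step n \<epsilon> f D c0 s0) (\<lambda>(c, s). outcome c s)) = (case cs of (c, s) \<Rightarrow> outcome c s)"
      using step_outcome outcome_eq by (simp add: case_prod_unfold)
  qed
  ultimately show ?case using Suc.IH by (metis (no_types, lifting) case_prod_conv prod.collapse case_prodI2)
qed

text \<open>Cost never decreases and each reached configuration leads to some final state, so bounds
  on final states hold at all times.\<close>

lemma run_below_outcome:
  assumes "ev P (initial_state n d) \<mu>" "(c, s) \<in> set_pmf (run n d \<epsilon> f D P k)"
  shows "\<exists>s'\<in>set_pmf \<mu>. time s \<le> time s' \<and> queries s \<le> queries s'"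
proof -
  obtain \<nu> where \<nu>: "ev c s \<nu>" using run_outcome[OF assms(1), of k] assms(2) by blast
  obtain s' where s': "s' \<in> set_pmf \<nu>" using set_pmf_not_empty by fast
  have "s' \<in> set_pmf (bind_pmf (run n d \<epsilon> f D P k) (\<lambda>(c, s). outcome c s))"
    using assms(2) s' outcome_eq[OF \<nu>] by (auto intro!: bexI[of _ "(c, s)"])
  then show ?thesis using run_outcome[OF assms(1), of k] ev_monotone[OF \<nu> s'] by auto
qed

text \<open>Each step before halting costs a time unit, so no run can still be active once
  \<open>k\<close> exceeds every final time.\<close>

lemma run_halted:
  assumes "ev P (initial_state n d) \<mu>" "\<And>s. s \<in> set_pmf \<mu> \<Longrightarrow> time s < k"
  shows "\<And>c s. (c, s) \<in> set_pmf (run n d \<epsilon> f D P k) \<Longrightarrow> c = Skip" "map_pmf snd (run n d \<epsilon> f D P k) = \<mu>"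
proof -
  show halted: "c = Skip" if cs: "(c, s) \<in> set_pmf (run n d \<epsilon> f D P k)" for c s
    using halted_or_time_ge[OF cs] run_below_outcome[OF assms(1) cs] assms(2) by force
  have "bind_pmf (run n d \<epsilon> f D P k) (\<lambda>(c, s). outcome c s) = bind_pmf (run n d \<epsilon> f D P k) (\<lambda>cs. return_pmf (snd cs))"
  proof (intro bind_pmf_cong refl)
    fix cs assume "cs \<in> set_pmf (run n d \<epsilon> f D P k)"
    then show "(case cs of (c, s) \<Rightarrow> outcome c s) = return_pmf (snd cs)"
      using halted[of "fst cs" "snd cs"] outcome_eq[OF ev_Skip] by (simp add: case_prod_unfold)
  qed
  then show "map_pmf snd (run n d \<epsilon> f D P k) = \<mu>" using run_outcome[OF assms(1), of k] by (simp add: map_pmf_def)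
qed

lemma exec_run:
  assumes P: "exec P h q M (\<lambda>ok h'. (sv h' 0 \<noteq> 0) = ok)" and h: "mem (initial_state n d) = conc n h"
  shows "\<And>c s k. (c, s) \<in> set_pmf (run n d \<epsilon> f D P k) \<Longrightarrow> time s \<le> tcost W P \<and> queries s \<le> q"
    "measure_pmf.prob M {True} \<le> accept_prob n d \<epsilon> f D P"
    "measure_pmf.prob M {False} \<le> reject_prob n d \<epsilon> f D P"
proof -
  obtain \<mu> where \<mu>: "ev P (initial_state n d) \<mu>" and rel: "rel_pmf (\<lambda>a s'. time s' \<le> time (initial_state n d) + tcost W P \<and>
     queries s' \<le> queries (initial_state n d) + q \<and> (\<exists>h'. mem s' = conc n h' \<and> (sv h' 0 \<noteq> 0) = a)) M \<mu>"
    using P h unfolding exec_def by blast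
  let ?R = "\<lambda>a s'. time s' \<le> tcost W P \<and> queries s' \<le> q \<and> (mem s' 0 \<noteq> 0) = a"
  have rel: "rel_pmf ?R M \<mu>"
    by (rule pmf.rel_mono_strong[OF rel]) (auto simp: initial_state_def conc_def)
  have bound: "time s' \<le> tcost W P \<and> queries s' \<le> q" if "s' \<in> set_pmf \<mu>" for s'
    using rel_setD2[OF rel_pmf_imp_rel_set[OF rel] that] by auto
  show "time s \<le> tcost W P \<and> queries s \<le> q" if "(c, s) \<in> set_pmf (run n d \<epsilon> f D P k)" for c s k
    using run_below_outcome[OF \<mu> that] bound by (meson order_trans)
  \<comment> \<open>One step past the time bound everything has halted; this single term bounds the
    supremum from below.\<close>
  let ?k = "Suc (tcost W P)"
  have halt: "\<And>c s. (c, s) \<in> set_pmf (run n d \<epsilon> f D P ?k) \<Longrightarrow> c = Skip" "map_pmf snd (run n d \<epsilon> f D P ?k) = \<mu>"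
    using run_halted[OF \<mu>, of ?k] bound by (auto simp: less_Suc_eq_le)
  have final: "measure_pmf.prob \<mu> {s. Q s} \<le> measure_pmf.prob (run n d \<epsilon> f D P ?k) {(c, s). c = Skip \<and> Q s}" for Q
    unfolding halt(2)[symmetric] measure_map_pmf by (rule prob_mono_on_support) (use halt(1) in \<open>auto simp del: run.simps\<close>)
  have bdd: "bdd_above (range (\<lambda>k. measure_pmf.prob (run n d \<epsilon> f D P k) {(c, s). c = Skip \<and> Q s}))" for Q
    by (rule bdd_aboveI[of _ 1]) auto
  have "measure_pmf.prob M {True} \<le> measure_pmf.prob \<mu> {s. mem s 0 \<noteq> 0}"
    by (rule rel_pmf_prob[OF rel]) auto
  also note final
  also have "measure_pmf.prob (run n d \<epsilon> f D P ?k) {(c, s). c = Skip \<and> mem s 0 \<noteq> 0} \<le> accept_prob n d \<epsilon> f D P"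
    unfolding accept_prob_def by (rule cSUP_upper[OF UNIV_I bdd])
  finally show "measure_pmf.prob M {True} \<le> accept_prob n d \<epsilon> f D P" .
  have "measure_pmf.prob M {False} \<le> measure_pmf.prob \<mu> {s. mem s 0 = 0}"
    by (rule rel_pmf_prob[OF rel]) auto
  also note final
  also have "measure_pmf.prob (run n d \<epsilon> f D P ?k) {(c, s). c = Skip \<and> mem s 0 = 0} \<le> reject_prob n d \<epsilon> f D P"
    unfolding reject_prob_def by (rule cSUP_upper[OF UNIV_I bdd])
  finally show "measure_pmf.prob M {False} \<le> reject_prob n d \<epsilon> f D P" .
qed

end

context tester
begin

text \<open>The repetitions \<open>320 * (d + 1) * 2 ^ d\<close> are matched to the error rate
  \<open>1 / (160 * (d + 1) * 2 ^ d)\<close>, and \<open>4 * q\<close> to the rejection probability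
  \<open>\<epsilon> / 2\<close> with \<open>q * \<epsilon> \<ge> 1\<close>: in both cases two
  rejections are expected, enough for \<open>power_le_third\<close>.\<close>

definition verdict :: "nat \<Rightarrow> nat \<Rightarrow> bool pmf" where
  "verdict d q = bind_pmf (repeat (320 * (d + 1) * 2 ^ d) (rm_test (d + 1) (rset {..<n}))) (\<lambda>a.
     bind_pmf (repeat (4 * q) (rm_test (d + 1) (map_pmf (set_of n) D))) (\<lambda>b.
     map_pmf (\<lambda>c. a \<and> b \<and> c) (degree_test n d \<phi>)))"

definition prepared :: "nat \<Rightarrow> nat \<Rightarrow> hs \<Rightarrow> bool" where
  "prepared d q h \<longleftrightarrow> wf h \<and> sv h 1 = d \<and> sv h 2 = d + 1 \<and> sv h 3 = 2 ^ d \<and> sv h 5 = 0 \<and> sv h 7 = 2 ^ (d + 1) \<and>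
     sv h 9 = 4096 * (d + 1)\<^sup>2 \<and> sv h 10 = 4 * d + 8 \<and> sv h 11 = 2 ^ (4 * d + 8) \<and>
     sv h 12 = 256 * (d + 1) * 2 ^ d \<and> sv h 13 = 256 * (d + 1) * 2 ^ d * 2 ^ d \<and> sv h 44 = 64 * 4 ^ d \<and>
     sv h 47 = 320 * (d + 1) * 2 ^ d \<and> sv h 49 = 4 * q \<and> sv h 63 = 0"

definition sufficient :: "nat \<Rightarrow> nat \<Rightarrow> bool" where
  "sufficient d q \<longleftrightarrow> Suc n \<le> W \<and> d + 1 \<le> W \<and> 2 ^ (d + 1) \<le> W \<and> 4 * d + 8 \<le> W \<and> 2 ^ (4 * d + 8) \<le> W \<and>
     256 * (d + 1) * 2 ^ d * 2 ^ d \<le> W \<and> 320 * (d + 1) * 2 ^ d \<le> W \<and> 64 * 4 ^ d \<le> W \<and> 4096 \<le> W \<and> 4 * q \<le> W"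

lemma exec_Init_SetV:
  assumes "k < 64" "ev_h n e (h\<lparr>sv := S\<rparr>) = v" "exec c (h\<lparr>sv := S(k := v)\<rparr>) q M R"
  shows "exec (Seq (SetV k e) c) (h\<lparr>sv := S\<rparr>) q M R"
  by (rule exec_then, rule exec_SetV) (use assms in simp_all)

lemma exec_Init_Pow2:
  assumes "z < 64 \<and> i < 64 \<and> x < 64 \<and> z \<noteq> i \<and> z \<noteq> x \<and> i \<noteq> x" "S x = a" "a \<le> W" "exec c (h\<lparr>sv := S(z := 2 ^ a, i := a)\<rparr>) q M R"
  shows "exec (Seq (Pow2 z i x) c) (h\<lparr>sv := S\<rparr>) q M R"
  by (rule exec_then, rule exec_Pow2) (use assms in simp_all)

lemma exec_Init_Mul:
  assumes "z < 64 \<and> i < 64 \<and> x < 64 \<and> y < 64 \<and> z \<noteq> i \<and> z \<noteq> x \<and> i \<noteq> x \<and> z \<noteq> y \<and> i \<noteq> y" "S x = a" "S y = b" "a \<le> W"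
    "exec c (h\<lparr>sv := S(z := a * b, i := a)\<rparr>) q M R"
  shows "exec (Seq (Mul z i x y) c) (h\<lparr>sv := S\<rparr>) q M R"
  by (rule exec_then, rule exec_Mul) (use assms in simp_all)

lemma exec_Init:
  assumes h: "sv h = (\<lambda>_. 0)(0 := n, 1 := d)" and W: "sufficient d q"
    and k: "q = 2 ^ k" "1 \<le> 2 ^ k * \<epsilon>" "\<And>j. j < k \<Longrightarrow> 2 ^ j * \<epsilon> < 1"
    and Q: "\<And>h'. prepared d q h' \<Longrightarrow> Q () h'"
  shows "exec Init h 0 (return_pmf ()) Q"
proof -
  have h2: "h = h\<lparr>sv := (\<lambda>_. 0)(0 := n, 1 := d)\<rparr>" using h by simp
  have four: "(4 :: nat) ^ d = 2 ^ d * 2 ^ d" by (simp flip: power_mult_distrib)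
  define pre where "pre h' \<longleftrightarrow> prepared d 0 (h'\<lparr>sv := (sv h')(49 := 0)\<rparr>)" for h' :: hs
  have W: "d \<le> W" "Suc d \<le> W" "4 * d + 8 \<le> W" "d + d + (d + d) + 8 \<le> W" "320 \<le> W" "256 \<le> W" "4096 \<le> W" "64 \<le> W" "2 ^ d \<le> W" "k \<le> W"
  proof -
    have "2 ^ d \<le> (2 ^ (d + 1) :: nat)" by simp
    then show "2 ^ d \<le> W" using W unfolding sufficient_def by linarith
    have "k < 2 ^ k" by (rule less_exp)
    moreover have "4 * 2 ^ k \<le> W" using W k by (simp add: sufficient_def)
    ultimately show "k \<le> W" by linarith
  qed (use W in \<open>auto simp: sufficient_def\<close>)
  have loop: "exec (Seq (SetV 4 (Num 1)) (Seq (EpsGe (Num 50) (Num 1) (Vr 4))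
     (Seq (While (Minus (Num 1) (Vr 50)) (Seq (Incr 4 (Vr 4)) (EpsGe (Num 50) (Num 1) (Vr 4))))
       (SetV 49 (Plus (Plus (Vr 4) (Vr 4)) (Plus (Vr 4) (Vr 4))))))) h' 0 (return_pmf ()) Q" if h': "pre h'" for h'
  proof -
    define I where "I j h' \<longleftrightarrow> pre h' \<and> sv h' 4 = 2 ^ j \<and> sv h' 50 = of_bool (1 \<le> 2 ^ j * \<epsilon>)" for j and h' :: hs
    have while: "exec (While (Minus (Num 1) (Vr 50)) (Seq (Incr 4 (Vr 4)) (EpsGe (Num 50) (Num 1) (Vr 4)))) h1 (k * 0)
       (loopM k 0 (\<lambda>_ _. return_pmf ()) ()) (\<lambda>_. I k)" if "I 0 h1" for h1
    proof (rule exec_While[where I = "\<lambda>j _. I j"])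
      fix j and a :: unit and h2 assume j: "j < k" "I j h2"
      show "ev_h n (Minus (Num 1) (Vr 50)) h2 \<noteq> 0" using j k(3)[of j] by (simp add: I_def)
      show "exec (Seq (Incr 4 (Vr 4)) (EpsGe (Num 50) (Num 1) (Vr 4))) h2 0 (return_pmf ()) (\<lambda>_. I (Suc j))"
        by (rule exec_then, rule exec_SetV, simp, rule exec_EpsV, simp)
          (use j in \<open>auto simp: I_def pre_def prepared_def mult_2[symmetric]\<close>)
    next
      fix a :: unit and h2 assume "I k h2"
      then show "ev_h n (Minus (Num 1) (Vr 50)) h2 = 0" using k(2) by (simp add: I_def)
    qed (use that W in auto)
    have fin: "exec (SetV 49 (Plus (Plus (Vr 4) (Vr 4)) (Plus (Vr 4) (Vr 4)))) h1 0 (return_pmf ()) Q" if "I k h1" for h1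
      by (rule exec_SetV, simp, rule Q) (use that k(1) in \<open>auto simp: I_def pre_def prepared_def\<close>)
    have while: "exec (While (Minus (Num 1) (Vr 50)) (Seq (Incr 4 (Vr 4)) (EpsGe (Num 50) (Num 1) (Vr 4)))) h1 0
       (return_pmf ()) (\<lambda>_. I k)" if "I 0 h1" for h1 using while[OF that] by simp
    show ?thesis
      by (rule exec_then, rule exec_SetV, simp, rule exec_then, rule exec_EpsV, simp, rule exec_then, rule exec_weaken[OF while order_refl fin])
        (use h' in \<open>auto simp: I_def pre_def prepared_def\<close>)
  qed
  show ?thesis
    unfolding Init_def
    apply (subst h2)
    apply (rule exec_Init_SetV, simp, simp)
    apply (rule exec_Init_Pow2, simp, simp, simp add: W)
    apply (rule exec_Init_SetV, simp, simp)
    apply (rule exec_Init_SetV, simp, simp)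
    apply (rule exec_Init_Pow2, simp, simp, simp add: W)
    apply (rule exec_Init_SetV, simp, simp)
    apply (rule exec_Init_Mul, simp, simp, simp, simp add: W)
    apply (rule exec_Init_Mul, simp, simp, simp, simp add: W)
    apply (rule exec_Init_SetV, simp, simp)
    apply (rule exec_Init_Mul, simp, simp, simp, simp add: W)
    apply (rule exec_Init_Mul, simp, simp, simp, simp add: W)
    apply (rule exec_Init_Mul, simp, simp, simp, simp add: W)
    apply (rule exec_Init_Mul, simp, simp, simp, simp add: W)
    apply (rule exec_Init_SetV, simp, simp)
    apply (rule exec_Init_Mul, simp, simp, simp, simp add: W)
    apply (rule exec_Init_Mul, simp, simp, simp, simp add: W)
    apply (rule exec_Init_SetV, simp, simp)
    apply (rule exec_Init_Mul, simp, simp, simp, simp add: W)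
    apply (rule loop)
    apply (simp add: pre_def prepared_def power2_eq_square four mult_ac)
    done
qed

lemma exec_Tester:
  assumes h: "sv h = (\<lambda>_. 0)(0 := n, 1 := d)" and W: "sufficient d q"
    and k: "q = 2 ^ k" "1 \<le> 2 ^ k * \<epsilon>" "\<And>j. j < k \<Longrightarrow> 2 ^ j * \<epsilon> < 1"
  shows "exec Tester h (320 * (d + 1) * 2 ^ d * 2 ^ (d + 1) + (4 * q * (1 + 2 ^ (d + 1)) +
      ((4096 * (d + 1)\<^sup>2 + 1) * (256 * (d + 1) * 2 ^ d * 2 ^ d) + 64 * 4 ^ d))) (verdict d q) (\<lambda>ok h'. (sv h' 0 \<noteq> 0) = ok)"
  unfolding Tester_def
proof (rule exec_then, rule exec_Init[OF h W k])
  fix h1 assume p: "prepared d q h1"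
  let ?A = "repeat (320 * (d + 1) * 2 ^ d) (rm_test (d + 1) (rset {..<n}))"
  let ?B = "repeat (4 * q) (rm_test (d + 1) (map_pmf (set_of n) D))"
  let ?C = "degree_test n d \<phi>"
  let ?N = "(4096 * (d + 1)\<^sup>2 + 1) * (256 * (d + 1) * 2 ^ d * 2 ^ d) + 64 * 4 ^ d"
  let ?X = "{5, 6, 48} \<union> {20..28} :: nat set"
  let ?Q = "\<lambda>ok h'. (sv h' 0 \<noteq> 0) = ok"
  have prep: "prepared d q h''" if "prepared d q (h'\<lparr>sv := (sv h')(5 := 0)\<rparr>)" "frame ?X h' h''" "sv h'' 5 = 0" for h' h''
    using that frame_sv[OF that(2)] by (simp add: prepared_def frame_def)
  show "exec (Seq StageA (Seq StageB (Seq StageC (SetV 0 (Minus (Num 1) (Vr 5)))))) h1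
     (320 * (d + 1) * 2 ^ d * 2 ^ (d + 1) + (4 * q * (1 + 2 ^ (d + 1)) + ?N)) (verdict d q) ?Q"
    unfolding verdict_def
  proof (rule exec_bind[OF exec_StageA[where p = "d + 1" and N = "320 * (d + 1) * 2 ^ d"]])
    fix a h2 assume h2: "frame ?X h1 h2" "(sv h2 5 = 0) = (sv h1 5 = 0 \<and> a)"
    show "exec (Seq StageB (Seq StageC (SetV 0 (Minus (Num 1) (Vr 5))))) h2 (4 * q * (1 + 2 ^ (d + 1)) + ?N)
        (bind_pmf ?B (\<lambda>b. map_pmf (\<lambda>c. a \<and> b \<and> c) ?C)) ?Q"
    proof (rule exec_bind[OF exec_StageB[where p = "d + 1" and N = "4 * q"]])
      fix b h3 assume h3: "frame ?X h2 h3" "(sv h3 5 = 0) = (sv h2 5 = 0 \<and> b)"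
      have f: "frame ?X h1 h3" by (rule frame_trans[OF h2(1) h3(1)]) auto
      show "exec (Seq StageC (SetV 0 (Minus (Num 1) (Vr 5)))) h3 ?N (map_pmf (\<lambda>c. a \<and> b \<and> c) ?C) ?Q"
      proof (rule exec_bind[where q' = 0 and B = "\<lambda>c. return_pmf (a \<and> b \<and> c)", OF exec_StageC[where d = d]])
        fix c h4 assume h4: "frame sframe h3 h4" "(sv h4 5 = 0) = (sv h3 5 = 0 \<and> c)"
        show "exec (SetV 0 (Minus (Num 1) (Vr 5))) h4 0 (return_pmf (a \<and> b \<and> c)) ?Q"
          by (rule exec_return, rule exec_SetV) (use h2 h3 h4 p in \<open>auto simp: prepared_def\<close>)
      qed (use f p W frame_sv[OF f] in \<open>simp_all add: prepared_def sufficient_def frame_def map_pmf_def\<close>)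
    qed (use h2 p W frame_sv[OF h2(1)] in \<open>simp_all add: prepared_def sufficient_def frame_def\<close>)
  qed (use p W in \<open>simp_all add: prepared_def sufficient_def\<close>)
qed

end

section \<open>Completeness, soundness and complexity\<close>

lemma set_of_points_of: "x \<subseteq> {..<n} \<Longrightarrow> set_of n (points_of n x) = x"
  by (auto simp: set_of_def points_of_def)

lemma points_of_set_of: "x \<in> cube n \<Longrightarrow> points_of n (set_of n x) = x"
  unfolding cube_def points_of_def set_of_def
  by (rule PiE_ext[where k = "{..<n}" and s = "\<lambda>_. {-1, 1}"]) (auto simp: PiE_def Pi_def)

lemma set_of_subset: "set_of n x \<subseteq> {..<n}" by (auto simp: set_of_def)

text \<open>A point is encoded by the set of its coordinates \<open>1\<close>, whereas \<open>chi\<close> is negative at the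
  elements of a set; hence the sign.\<close>

lemma character_chi:
  assumes "S \<subseteq> {..<n}"
  shows "(\<Prod>i\<in>S. points_of n x i) = (-1) ^ card S * chi S x"
proof -
  have "(\<Prod>i\<in>S. points_of n x i) = (\<Prod>i\<in>S. (-1) * (if i \<in> x then -1 else 1))"
    by (rule prod.cong) (use assms in \<open>auto simp: points_of_def\<close>)
  then show ?thesis by (simp only: prod.distrib prod_constant chi_def)
qed

text \<open>The two expansions differ by the sign \<open>(-1) ^ card S\<close> in each coefficient,
  which leaves the degree unchanged; uniqueness of the representation identifies the
  coefficients.\<close>

lemma fourier_degree_class_iff:
  assumes f: "f \<in> boolean_functions n"
  shows "f \<in> fourier_degree_class n d \<longleftrightarrow> deg_le {..<n} d (\<lambda>x. f (points_of n x))"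
proof
  assume "f \<in> fourier_degree_class n d"
  then have deg: "fourier_degree n f \<le> d" by (simp add: fourier_degree_class_def)
  let ?c = "fourier_coeff n f"
  have rep: "is_fourier_rep n f ?c" by (rule is_fourier_rep_fourier_coeff)
  have card: "card S \<le> d" if "S \<subseteq> {..<n}" "?c S \<noteq> 0" for S
  proof -
    have "card S \<le> fourier_degree n f"
      unfolding fourier_degree_def by (rule Max_ge[OF fourier_support_finite]) (use that in auto)
    then show ?thesis using deg by simp
  qed
  show "deg_le {..<n} d (\<lambda>x. f (points_of n x))"
  proof (rule deg_leI[where J = "Pow {..<n}" and T = "\<lambda>S. S" and c = "\<lambda>S. ?c S * (-1) ^ card S"])
    fix x
    have "f (points_of n x) = (\<Sum>S\<in>Pow {..<n}. ?c S * (\<Prod>i\<in>S. points_of n x i))"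
      using rep points_of_cube unfolding is_fourier_rep_def by blast
    also have "\<dots> = (\<Sum>S\<in>Pow {..<n}. ?c S * (-1) ^ card S * chi S x)"
      by (rule sum.cong) (simp_all add: character_chi mult.assoc)
    finally show "f (points_of n x) = (\<Sum>S\<in>Pow {..<n}. ?c S * (-1) ^ card S * chi S x)" .
  qed (use card in auto)
next
  let ?f = "\<lambda>x. f (points_of n x)"
  assume deg: "deg_le {..<n} d ?f"
  define c where "c S = (if S \<subseteq> {..<n} \<and> card S \<le> d then fc {..<n} ?f S * (-1) ^ card S else 0)" for S
  have "is_fourier_rep n f c"
    unfolding is_fourier_rep_def
  proof (intro conjI allI impI ballI)
    fix x assume x: "x \<in> cube n"
    have "f x = ?f (set_of n x)" using points_of_set_of[OF x] by simp
    also have "\<dots> = (\<Sum>S\<in>{S\<in>Pow {..<n}. card S \<le> d}. fc {..<n} ?f S * chi S (set_of n x))"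
      by (rule deg_le_rep[OF _ deg set_of_subset]) simp
    also have "\<dots> = (\<Sum>S\<in>Pow {..<n}. c S * (\<Prod>i\<in>S. x i))"
    proof (rule sum.mono_neutral_cong_left)
      fix S assume S: "S \<in> {S\<in>Pow {..<n}. card S \<le> d}"
      then have "(\<Prod>i\<in>S. x i) = (-1) ^ card S * chi S (set_of n x)"
        using character_chi[of S n "set_of n x"] points_of_set_of[OF x] by auto
      then show "fc {..<n} ?f S * chi S (set_of n x) = c S * (\<Prod>i\<in>S. x i)"
        using S by (simp add: c_def flip: power_mult_distrib)
    qed (auto simp: c_def)
    finally show "f x = (\<Sum>S\<in>Pow {..<n}. c S * (\<Prod>i\<in>S. x i))" .
  qed (simp add: c_def)
  then have "fourier_coeff n f = c" using fourier_rep_ex1 is_fourier_rep_fourier_coeff by blast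
  then have "fourier_degree n f \<le> d"
    unfolding fourier_degree_def using fourier_support_finite fourier_support_nonempty[OF f]
    by (subst Max_le_iff) (auto simp: c_def split: if_splits)
  then show "f \<in> fourier_degree_class n d" using f by (simp add: fourier_degree_class_def)
qed

lemma prob_bind_bool:
  fixes A :: "bool pmf"
  shows "measure_pmf.prob (bind_pmf A F) E =
    measure_pmf.prob A {True} * measure_pmf.prob (F True) E + measure_pmf.prob A {False} * measure_pmf.prob (F False) E"
  unfolding prob_bind_pmf by (subst integral_measure_pmf_real[of UNIV]) (auto simp: UNIV_bool measure_pmf_single mult.commute)

lemma prob_False: "measure_pmf.prob A {False} = 1 - measure_pmf.prob A {True}"
proof -
  have "measure_pmf.prob A (space (measure_pmf A) - {True}) = 1 - measure_pmf.prob A {True}" by (rule measure_pmf.prob_compl) simp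
  moreover have "space (measure_pmf A) - {True} = {False}" by auto
  ultimately show ?thesis by simp
qed

text \<open>From \<open>1 - x \<le> exp (- x)\<close> and \<open>exp 2 \<ge> 3\<close>.\<close>

lemma power_le_third:
  assumes "x \<le> 1" "2 \<le> x * real N"
  shows "(1 - x) ^ N \<le> 1 / 3"
proof -
  have "(1 - x) ^ N \<le> exp (- x) ^ N"
    using exp_ge_add_one_self[of "- x"] assms(1) by (intro power_mono) auto
  also have "\<dots> = exp (- (x * real N))" by (simp add: exp_of_nat_mult[symmetric] mult.commute)
  also have "\<dots> \<le> exp (- 2)" using assms(2) by simp
  also have "\<dots> \<le> 1 / 3" using exp_ge_add_one_self[of 2] by (simp add: exp_minus field_simps)
  finally show ?thesis .
qed

context tester
begin

lemma prob_repeat: "measure_pmf.prob (repeat N t) {True} = measure_pmf.prob t {True} ^ N"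
proof -
  have "{x. x} = {True}" by auto
  then show ?thesis using loop_check[of N 0 "\<lambda>b. b" t True] by (simp add: repeat_def)
qed

lemma prob_verdict:
  "measure_pmf.prob (verdict d q) {True} =
     measure_pmf.prob (rm_test (d + 1) (rset {..<n})) {True} ^ (320 * (d + 1) * 2 ^ d) *
     (measure_pmf.prob (rm_test (d + 1) (map_pmf (set_of n) D)) {True} ^ (4 * q) *
      measure_pmf.prob (degree_test n d \<phi>) {True})"
proof -
  have "(\<and>) True -` {True} = {True}" "(\<and>) False -` {True} = {}" by auto
  then show ?thesis unfolding verdict_def by (simp add: prob_bind_bool prob_repeat del: mult_Suc_right)
qed

lemma prob_rm_test:
  "measure_pmf.prob (rm_test p \<mu>) {False} = measure_pmf.expectation \<mu> (\<lambda>x. avl {..<n} p (\<lambda>us. of_bool (cubeP \<phi> x us \<noteq> 1)))"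
proof -
  have "measure_pmf.prob (map_pmf (\<lambda>us. cubeP \<phi> x us = 1) (replicate_pmf p (rset {..<n}))) {False} =
     avl {..<n} p (\<lambda>us. of_bool (cubeP \<phi> x us \<noteq> 1))" for x
    unfolding measure_map_pmf by (subst prob_rset_list[symmetric]) (auto simp: vimage_def)
  then show ?thesis by (simp add: rm_test_def prob_bind_pmf)
qed

lemma prob_rm_test_uniform: "measure_pmf.prob (rm_test p (rset {..<n})) {True} = 1 - rm_error {..<n} p \<phi>"
  using prob_rm_test[of p "rset {..<n}"] by (simp add: prob_False expectation_rset rm_error_def)

lemma rm_test_complete:
  assumes "rm {..<n} d \<phi>" "set_pmf \<mu> \<subseteq> Pow {..<n}"
  shows "measure_pmf.prob (rm_test (d + 1) \<mu>) {True} = 1"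
proof -
  have "cubeP \<phi> x us = 1" if "x \<in> set_pmf \<mu>" "us \<in> set_pmf (replicate_pmf (d + 1) (rset {..<n}))" for x us
  proof -
    have "us \<in> {us\<in>lists (Pow {..<n}). length us = d + 1}"
      using that(2) by (simp only: set_replicate_pmf set_rset[OF finite_lessThan])
    then have "set us \<subseteq> Pow {..<n}" "length us = Suc d" by auto
    then show ?thesis using assms that(1) unfolding rm_def by blast
  qed
  then have "set_pmf (rm_test (d + 1) \<mu>) \<subseteq> {True}" unfolding rm_test_def by auto
  then show ?thesis by (subst measure_pmf.prob_eq_1) (auto simp: AE_measure_pmf_iff)
qed

lemma rm_test_sample:
  assumes small: "real p * rm_error {..<n} p \<phi> \<le> 1 / 2" and \<mu>: "set_pmf \<mu> \<subseteq> Pow {..<n}"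
    and far: "\<epsilon> \<le> measure_pmf.prob \<mu> {x. \<phi> x \<noteq> corrected {..<n} p \<phi> x}"
  shows "measure_pmf.prob (rm_test p \<mu>) {True} \<le> 1 - \<epsilon> / 2"
proof -
  let ?B = "{x. \<phi> x \<noteq> corrected {..<n} p \<phi> x}"
  let ?g = "\<lambda>x. avl {..<n} p (\<lambda>us. of_bool (cubeP \<phi> x us \<noteq> 1))"
  have g: "?g x = measure_pmf.prob (replicate_pmf p (rset {..<n})) {us. cubeP \<phi> x us \<noteq> 1}" for x
    by (rule prob_rset_list[symmetric]) simp
  have "1 / 2 * measure_pmf.prob \<mu> ?B = measure_pmf.expectation \<mu> (\<lambda>x. 1 / 2 * indicator ?B x)" by simp
  also have "\<dots> \<le> measure_pmf.expectation \<mu> ?g"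
  proof (rule integral_mono_AE)
    show "AE x in measure_pmf \<mu>. 1 / 2 * indicator ?B x \<le> ?g x"
      unfolding AE_measure_pmf_iff
    proof
      fix x assume "x \<in> set_pmf \<mu>"
      then have x: "x \<subseteq> {..<n}" using \<mu> by auto
      show "1 / 2 * indicator ?B x \<le> ?g x"
      proof (cases "x \<in> ?B")
        case True
        then have "1 / 2 \<le> ?g x" by (intro corrected_reject[OF _ phi_pm x _ small]) auto
        then show ?thesis using True by simp
      qed (simp add: g)
    qed
  next
    show "integrable (measure_pmf \<mu>) (\<lambda>x. (1 / 2 :: real) * indicator ?B x)"
      by (rule measure_pmf.integrable_const_bound[where B = 1]) (auto simp: AE_measure_pmf_iff indicator_def)
    show "integrable (measure_pmf \<mu>) ?g"
      unfolding g by (rule measure_pmf.integrable_const_bound[where B = 1]) auto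
  qed
  finally show ?thesis using far prob_rm_test[of p \<mu>] by (simp add: prob_False)
qed

lemma verdict_complete:
  assumes "f \<in> fourier_degree_class n d"
  shows "2 / 3 \<le> measure_pmf.prob (verdict d q) {True}"
proof -
  have "deg_le {..<n} d (\<lambda>x. f (points_of n x))" using assms fourier_degree_class_iff[OF fB] by simp
  moreover have "(\<lambda>x. f (points_of n x)) = \<phi>" by (simp add: \<phi>_def fun_eq_iff)
  ultimately have deg: "deg_le {..<n} d \<phi>" by simp
  have rm: "rm {..<n} d \<phi>" by (rule deg_le_imp_rm[OF _ phi_pm deg]) simp
  have "measure_pmf.prob (verdict d q) {True} = measure_pmf.prob (degree_test n d \<phi>) {True}"
    unfolding prob_verdict by (subst (1 2) rm_test_complete[OF rm]) (auto simp: set_rset set_of_def)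
  then show ?thesis using degree_test_complete[OF phi_pm deg] by (simp add: prob_False)
qed

text \<open>Acceptance has the product of three probabilities, of which one is small in each case. A
  large error \<open>\<eta>\<close> is caught by the uniform test. Otherwise the corrected function
  \<open>g\<close> satisfies the Reed-Muller condition: if it has degree at most \<open>d\<close>,
  it belongs to the class, so \<open>f\<close> is far from it under \<open>D\<close> and the sampled
  test rejects; if not, the degree test does, \<open>g\<close> being close to
  \<open>f\<close>.\<close>

lemma verdict_sound:
  assumes far: "far_from \<epsilon> D f (fourier_degree_class n d)" and q: "1 \<le> real q * \<epsilon>" and eps: "0 < \<epsilon>"
  shows "2 / 3 \<le> measure_pmf.prob (verdict d q) {False}"
proof -
  define A where "A = measure_pmf.prob (rm_test (d + 1) (rset {..<n})) {True} ^ (320 * (d + 1) * 2 ^ d)"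
  define B where "B = measure_pmf.prob (rm_test (d + 1) (map_pmf (set_of n) D)) {True} ^ (4 * q)"
  define C where "C = measure_pmf.prob (degree_test n d \<phi>) {True}"
  have unit: "0 \<le> A" "A \<le> 1" "0 \<le> B" "B \<le> 1" "0 \<le> C" "C \<le> 1"
    by (auto simp: A_def B_def C_def intro: power_le_one)
  have small: "x * (y * z) \<le> 1 / 3" if "0 \<le> x" "x \<le> 1" "0 \<le> y" "y \<le> 1" "0 \<le> z" "z \<le> 1" "x \<le> 1 / 3 \<or> y \<le> 1 / 3 \<or> z \<le> 1 / 3" for x y z :: real
  proof -
    have "y * z \<le> y" "y * z \<le> z" "0 \<le> y * z" "y * z \<le> 1" using that by (auto intro: mult_left_le mult_left_le_one_le mult_le_one)
    then have "x * (y * z) \<le> x" "x * (y * z) \<le> y * z" using that by (auto intro: mult_left_le mult_left_le_one_le)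
    then show ?thesis using that \<open>y * z \<le> y\<close> \<open>y * z \<le> z\<close> by linarith
  qed
  define \<eta> where "\<eta> = rm_error {..<n} (d + 1) \<phi>"
  define P where "P = real (d + 1) * 2 ^ d"
  have P: "1 \<le> P" "real (d + 1) \<le> P" "0 < P"
  proof -
    have "1 \<le> (2 :: real) ^ d" by simp
    then have "real (d + 1) * 1 \<le> P" unfolding P_def by (intro mult_left_mono) auto
    then show "1 \<le> P" "real (d + 1) \<le> P" "0 < P" by simp_all
  qed
  have "A \<le> 1 / 3 \<or> B \<le> 1 / 3 \<or> C \<le> 1 / 3"
  \<comment> \<open>The threshold is dictated by \<open>degree_test_sound\<close>, which asks for
    \<open>2 * \<eta> \<le> 1 / (80 * P)\<close>; it also gives \<open>4 * P * \<eta> < 1\<close>,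
    as used for \<open>corrected_rm\<close>.\<close>
  proof (cases "1 / (160 * P) \<le> \<eta>")
    case True
    have e1: "\<eta> \<le> 1" using prob_rm_test_uniform[of "d + 1"] measure_nonneg[of "measure_pmf (rm_test (d + 1) (rset {..<n}))" "{True}"] by (simp add: \<eta>_def)
    have "2 \<le> \<eta> * (320 * P)" using True P by (simp add: field_simps)
    also have "320 * P = real (320 * (d + 1) * 2 ^ d)" by (simp add: P_def)
    finally have "A \<le> 1 / 3" unfolding A_def prob_rm_test_uniform \<eta>_def[symmetric] by (rule power_le_third[OF e1])
    then show ?thesis by simp
  next
    case False
    then have e: "\<eta> < 1 / (160 * P)" by simp
    have e0: "0 \<le> \<eta>" unfolding \<eta>_def by (rule rm_error_nonneg) simp
    have eP: "P * \<eta> < 1 / 160" using e P by (simp add: field_simps)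
    have "real (d + 1) * \<eta> \<le> P * \<eta>" using P e0 by (intro mult_right_mono) auto
    then have half: "real (d + 1) * rm_error {..<n} (d + 1) \<phi> \<le> 1 / 2" using eP by (simp add: \<eta>_def)
    define g where "g = corrected {..<n} (d + 1) \<phi>"
    have g_pm: "pm {..<n} g" unfolding g_def by (rule corrected_pm)
    have "2 ^ Suc d * (real (Suc (Suc d)) * \<eta>) \<le> 2 ^ Suc d * (2 * real (d + 1) * \<eta>)"
      using e0 by (intro mult_left_mono mult_right_mono) auto
    also have "\<dots> = 4 * (P * \<eta>)" by (simp add: P_def)
    also have "\<dots> < 1" using eP by simp
    finally have rm: "rm {..<n} d g" unfolding g_def \<eta>_def using corrected_rm[of "{..<n}" \<phi> d] phi_pm by simp
    show ?thesis
    proof (cases "deg_le {..<n} d g")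
      case True
      define G where "G = (\<lambda>x\<in>cube n. g (set_of n x))"
      have GB: "G \<in> boolean_functions n"
        using pmD[OF g_pm set_of_subset] by (auto simp: G_def boolean_functions_def)
      have "deg_le {..<n} d (\<lambda>x. G (points_of n x))"
        unfolding deg_le_def
      proof (intro allI impI)
        fix S assume "S \<subseteq> {..<n}" "d < card S"
        then have "fc {..<n} g S = 0" using True by (simp add: deg_le_def)
        also have "fc {..<n} g S = fc {..<n} (\<lambda>x. G (points_of n x)) S"
          by (rule fc_cong) (simp add: G_def points_of_cube set_of_points_of)
        finally show "fc {..<n} (\<lambda>x. G (points_of n x)) S = 0" .
      qed
      then have "G \<in> fourier_degree_class n d" using fourier_degree_class_iff[OF GB] by simp
      then have "\<epsilon> \<le> measure_pmf.prob D {x. f x \<noteq> G x}" using far by (simp add: far_from_def)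
      also have "\<dots> \<le> measure_pmf.prob D {x. \<phi> (set_of n x) \<noteq> g (set_of n x)}"
        by (rule prob_mono_on_support) (use D_cube points_of_set_of in \<open>auto simp: G_def \<phi>_def\<close>)
      also have "\<dots> = measure_pmf.prob (map_pmf (set_of n) D) {x. \<phi> x \<noteq> g x}" by (simp add: vimage_def)
      finally have far': "\<epsilon> \<le> measure_pmf.prob (map_pmf (set_of n) D) {x. \<phi> x \<noteq> g x}" .
      then have e1: "\<epsilon> \<le> 1" using measure_pmf.prob_le_1 order_trans by blast
      have "measure_pmf.prob (rm_test (d + 1) (map_pmf (set_of n) D)) {True} \<le> 1 - \<epsilon> / 2"
        by (rule rm_test_sample[OF half]) (use far' set_of_subset in \<open>auto simp: g_def\<close>)
      then have "B \<le> (1 - \<epsilon> / 2) ^ (4 * q)" unfolding B_def by (rule power_mono) simp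
      also have "\<dots> \<le> 1 / 3" by (rule power_le_third) (use e1 q in \<open>auto simp: mult.commute[of \<epsilon>]\<close>)
      finally show ?thesis by simp
    next
      case False
      have "disagree {..<n} \<phi> g \<le> 2 * \<eta>" unfolding g_def \<eta>_def by (rule corrected_close[OF _ phi_pm half]) simp
      also have "\<dots> \<le> 1 / 2 ^ d / (80 * (real d + 1))" proof -
        have "2 ^ d * (80 * (real d + 1)) = 80 * P" by (simp add: P_def algebra_simps)
        then have "1 / 2 ^ d / (80 * (real d + 1)) = 2 * (1 / (160 * P))" by (simp only: divide_divide_eq_left)
        then show ?thesis using e by linarith
      qed
      finally have "C \<le> 1 / 3" unfolding C_def by (intro degree_test_sound[OF phi_pm g_pm rm False])
      then show ?thesis by simp
    qed
  qed
  then have "A * (B * C) \<le> 1 / 3" using unit by (intro small) auto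
  then show ?thesis unfolding prob_False prob_verdict A_def[symmetric] B_def[symmetric] C_def[symmetric] by simp
qed

end

section \<open>Query and time bounds\<close>

definition rounds :: "real \<Rightarrow> nat" where "rounds \<epsilon> = (LEAST k. 1 \<le> 2 ^ k * \<epsilon>)"

text \<open>In the last bound the summand 1 covers \<open>\<epsilon> \<ge> 1\<close>, where nothing
  is doubled; otherwise half the power is still below \<open>1 / \<epsilon>\<close>.\<close>

lemma rounds:
  assumes "0 < \<epsilon>"
  shows "1 \<le> 2 ^ rounds \<epsilon> * \<epsilon>" "\<And>j. j < rounds \<epsilon> \<Longrightarrow> 2 ^ j * \<epsilon> < 1" "2 ^ rounds \<epsilon> \<le> 1 + 2 / \<epsilon>"
proof -
  obtain k where "1 / \<epsilon> < 2 ^ k" using real_arch_pow[of 2 "1 / \<epsilon>"] by auto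
  then have "1 \<le> 2 ^ k * \<epsilon>" using assms by (simp add: field_simps)
  then show "1 \<le> 2 ^ rounds \<epsilon> * \<epsilon>" unfolding rounds_def by (rule LeastI)
  show less: "2 ^ j * \<epsilon> < 1" if "j < rounds \<epsilon>" for j
    using not_less_Least[OF that[unfolded rounds_def]] by simp
  show "2 ^ rounds \<epsilon> \<le> 1 + 2 / \<epsilon>"
  proof (cases "rounds \<epsilon>")
    case 0
    then show ?thesis using assms by simp
  next
    case (Suc j)
    then have "2 ^ j * \<epsilon> < 1" by (intro less) simp
    then show ?thesis using Suc assms by (simp add: field_simps)
  qed
qed

text \<open>The term \<open>16 ^ d\<close> comes from the \<open>2 ^ (4 * d + 8)\<close> buckets,
  which are visited in loops, and the power of two covers the repetitions of the sampled test. The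
  factor 5000 is above 4096, the largest constant that serves as a loop count.\<close>

definition width :: "nat \<Rightarrow> nat \<Rightarrow> real \<Rightarrow> nat" where
  "width n d \<epsilon> = n + 4 * 2 ^ rounds \<epsilon> + 5000 * 16 ^ d"

definition total_queries :: "nat \<Rightarrow> nat \<Rightarrow> nat" where
  "total_queries d q = 320 * (d + 1) * 2 ^ d * 2 ^ (d + 1) + (4 * q * (1 + 2 ^ (d + 1)) +
     ((4096 * (d + 1)\<^sup>2 + 1) * (256 * (d + 1) * 2 ^ d * 2 ^ d) + 64 * 4 ^ d))"

lemma (in tester) width_sufficient: "W = width n d \<epsilon> \<Longrightarrow> sufficient d (2 ^ rounds \<epsilon>)"
proof -
  assume W: "W = width n d \<epsilon>"
  define X where "X = (2 :: nat) ^ d"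
  have X1: "1 \<le> X" by (simp add: X_def)
  have pX: "d + 1 \<le> X" using less_exp[of d] by (simp add: X_def Suc_le_eq)
  have pows: "(4 :: nat) ^ d = X ^ 2" "(16 :: nat) ^ d = X ^ 4" "2 ^ (4 * d + 8) = 256 * X ^ 4"
  proof -
    have "(4 :: nat) ^ d = (2 ^ 2) ^ d" "(16 :: nat) ^ d = (2 ^ 4) ^ d" by simp_all
    then show "(4 :: nat) ^ d = X ^ 2" "(16 :: nat) ^ d = X ^ 4" "2 ^ (4 * d + 8) = 256 * X ^ 4"
      by (simp_all only: X_def power_mult[symmetric] mult.commute[of d]) (simp_all add: power_add power_mult)
  qed
  have le: "X \<le> X ^ 4" "X ^ 2 \<le> X ^ 4" "X ^ 3 \<le> X ^ 4" "1 \<le> X ^ 4"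
    using power_increasing[of 1 4 X] power_increasing[of 2 4 X] power_increasing[of 3 4 X] X1 by simp_all
  have p1: "(d + 1) * X \<le> X ^ 2" using mult_right_mono[OF pX, of X] by (simp add: power2_eq_square)
  then have "(d + 1) * X * X \<le> X ^ 2 * X" by (rule mult_right_mono) simp
  then have p2: "(d + 1) * X * X \<le> X ^ 3" by (simp add: power2_eq_square power3_eq_cube)
  have q: "1 \<le> (2 :: nat) ^ rounds \<epsilon>" by simp
  show ?thesis
    unfolding sufficient_def unfolding W width_def pows unfolding X_def[symmetric] power_add power_one_right mult.assoc[of _ "d + 1"] mult.assoc[of _ "(d + 1) * X"]
    using pX le p1 p2 q by auto
qed

text \<open>The estimates take \<open>O((d + 1)^2)\<close> shifts with
  \<open>O((d + 1) * 4 ^ d)\<close> queries each. The resulting factor \<open>(d + 1) ^ 3\<close> is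
  polylogarithmic, as \<open>2 ^ d\<close> is at most the query scale.\<close>

lemma total_queries_bound:
  assumes "0 < \<epsilon>"
  shows "real (total_queries d (2 ^ rounds \<epsilon>)) \<le> 2000000 * query_scale d \<epsilon> * (1 + log 2 (query_scale d \<epsilon>)) ^ 3"
proof -
  define X where "X = (2 :: real) ^ d"
  define p where "p = real (d + 1)"
  define q where "q = real (2 ^ rounds \<epsilon>)"
  define S where "S = query_scale d \<epsilon>"
  have S: "S = X * X + X / \<epsilon>" by (simp add: S_def query_scale_def X_def power_mult power2_eq_square mult.commute[of 2] power_mult)
  have X1: "1 \<le> X" by (simp add: X_def)
  have p1: "1 \<le> p" by (simp add: p_def)
  have XX: "X \<le> X * X" using X1 by simp
  have Xe: "0 \<le> X / \<epsilon>" using X1 assms by simp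
  have q: "q \<le> 1 + 2 / \<epsilon>" using rounds(3)[OF assms] by (simp add: q_def)
  have four: "(4 :: real) ^ d = X * X" by (simp add: X_def flip: power_mult_distrib)
  have tot: "real (total_queries d (2 ^ rounds \<epsilon>)) =
     640 * p * (X * X) + 4 * q * (1 + 2 * X) + (4096 * p\<^sup>2 + 1) * (256 * p * (X * X)) + 64 * (X * X)"
    by (simp add: total_queries_def p_def X_def[symmetric] q_def four algebra_simps)
  have p3: "p \<le> p ^ 3" "1 \<le> p ^ 3" "p\<^sup>2 * p = p ^ 3"
    using power_increasing[of 1 3 p] p1 one_le_power[OF p1, of 3] by (simp_all only: power_one_right) (simp_all add: power2_eq_square power3_eq_cube)
  have t1: "640 * p * (X * X) \<le> 640 * (p ^ 3 * S)"
  proof -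
    have "p * (X * X) \<le> p ^ 3 * S" using p3 p1 Xe X1 by (intro mult_mono) (auto simp: S)
    then show ?thesis by simp
  qed
  have t0: "X * X \<le> p ^ 3 * S"
  proof -
    have "1 * (X * X) \<le> p ^ 3 * S" using p3 p1 Xe X1 by (intro mult_mono) (auto simp: S)
    then show ?thesis by simp
  qed
  have t2: "4 * q * (1 + 2 * X) \<le> 24 * (p ^ 3 * S)"
  proof -
    have "q * (1 + 2 * X) \<le> (1 + 2 / \<epsilon>) * (3 * X)" using q X1 assms by (intro mult_mono) (auto simp: q_def)
    also have "\<dots> = 3 * X + 6 * (X / \<epsilon>)" by (simp add: algebra_simps)
    also have "3 * X \<le> 6 * (X * X)" using XX X1 by linarith
    finally have "4 * (q * (1 + 2 * X)) \<le> 4 * (6 * (1 * S))" by (intro mult_left_mono) (simp_all add: S distrib_left)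
    then have "4 * q * (1 + 2 * X) \<le> 24 * (1 * S)" by simp
    also have "1 * S \<le> p ^ 3 * S" using p3 Xe X1 by (intro mult_right_mono) (auto simp: S)
    finally show ?thesis by simp
  qed
  have t3: "(4096 * p\<^sup>2 + 1) * (256 * p * (X * X)) \<le> 1048832 * (p ^ 3 * S)"
  proof -
    have "(4096 * p\<^sup>2 + 1) * (256 * p * (X * X)) = 1048576 * (p ^ 3 * (X * X)) + 256 * (p * (X * X))"
      by (simp add: p3(3)[symmetric] algebra_simps)
    moreover have "p ^ 3 * (X * X) \<le> p ^ 3 * S" using p3 p1 Xe by (intro mult_left_mono) (auto simp: S)
    moreover have "p * (X * X) \<le> p ^ 3 * S" using t1 by simp
    ultimately show ?thesis by linarith
  qed
  have S0: "0 \<le> S" "X \<le> S" using XX Xe X1 unfolding S by linarith+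
  have "real (total_queries d (2 ^ rounds \<epsilon>)) \<le> 2000000 * (p ^ 3 * S)"
  proof -
    have "a + b + c + 64 * e \<le> 2000000 * T" if "a \<le> 640 * T" "b \<le> 24 * T" "c \<le> 1048832 * T" "e \<le> T" "0 \<le> T" for a b c e T :: real
      using that by linarith
    from this[OF t1 t2 t3 t0] show ?thesis unfolding tot using p1 S0 by simp
  qed
  also have "\<dots> \<le> 2000000 * ((1 + log 2 S) ^ 3 * S)"
  proof -
    have "real d = log 2 X" by (simp add: X_def)
    also have "\<dots> \<le> log 2 S" using S0 X1 by simp
    finally have "p \<le> 1 + log 2 S" by (simp add: p_def)
    then have "p ^ 3 \<le> (1 + log 2 S) ^ 3" using p1 by (intro power_mono) auto
    then show ?thesis using S0 by (intro mult_left_mono mult_right_mono) auto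
  qed
  finally show ?thesis by (simp add: S_def mult_ac)
qed

text \<open>The fourth power originates from \<open>16 ^ d = (2 ^ d) ^ 4\<close>.\<close>

lemma width_bound:
  assumes "0 < \<epsilon>"
  shows "real (width n d \<epsilon> + 1) \<le> 6000 * ((1 + 1 / \<epsilon>) * (2 ^ d + real n) ^ 4)"
proof -
  define Y where "Y = 2 ^ d + real n"
  define E where "E = 1 + 1 / \<epsilon>"
  have Y1: "1 \<le> Y" unfolding Y_def using one_le_power[of "2 :: real" d] by linarith
  have E1: "1 \<le> E" "1 / \<epsilon> = E - 1" using assms by (simp_all add: E_def)
  have Y4: "Y \<le> Y ^ 4" "1 \<le> Y ^ 4" using power_increasing[of 1 4 Y] Y1 by simp_all
  have "(16 :: real) ^ d = (2 ^ 4) ^ d" by simp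
  also have "\<dots> = (2 ^ d) ^ 4" by (simp only: power_mult[symmetric] mult.commute)
  also have "\<dots> \<le> Y ^ 4" by (intro power_mono) (auto simp: Y_def)
  finally have X4: "(16 :: real) ^ d \<le> Y ^ 4" .
  have n: "real n \<le> Y" by (simp add: Y_def)
  have EY: "Y ^ 4 \<le> E * Y ^ 4" "E \<le> E * Y ^ 4" using E1 Y4 by (simp_all add: mult_le_cancel_right1 mult_le_cancel_left1)
  have "real (width n d \<epsilon> + 1) = real n + 4 * 2 ^ rounds \<epsilon> + 5000 * 16 ^ d + 1" by (simp add: width_def)
  also have "\<dots> \<le> real n + 4 * (1 + 2 * (E - 1)) + 5000 * 16 ^ d + 1" using rounds(3)[OF assms] E1(2) by simp
  also have "\<dots> \<le> 6000 * (E * Y ^ 4)" proof -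
    have *: "real n \<le> E * Y ^ 4" "16 ^ d \<le> E * Y ^ 4" "E \<le> E * Y ^ 4" "1 \<le> E * Y ^ 4" using n X4 Y4 EY by simp_all
    have "a + 4 * (1 + 2 * (E - 1)) + 5000 * b + 1 \<le> 6000 * c" if "a \<le> c" "b \<le> c" "E \<le> c" "1 \<le> c" for a b c :: real
    proof -
      have "4 * (1 + 2 * (E - 1)) \<le> 8 * c" "5000 * b \<le> 5000 * c" using that by simp_all
      then show ?thesis using that by linarith
    qed
    from this[OF *] show ?thesis .
  qed
  finally show ?thesis by (simp add: E_def Y_def)
qed

lemma initial_state_conc:
  "mem (initial_state n d) = conc n \<lparr>sv = (\<lambda>_. 0)(0 := n, 1 := d), bu = \<lambda>_. 0, ar = \<lambda>_ _. 0\<rparr>"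
  by (auto simp: initial_state_def conc_def fun_eq_iff)

lemma Tester_run:
  assumes eps: "0 < \<epsilon>" and f: "f \<in> boolean_functions n" and D: "set_pmf D \<subseteq> cube n"
  shows "\<And>c s k. (c, s) \<in> set_pmf (run n d \<epsilon> f D Tester k) \<Longrightarrow>
      time s \<le> tcost (width n d \<epsilon>) Tester \<and> queries s \<le> total_queries d (2 ^ rounds \<epsilon>)"
    "f \<in> fourier_degree_class n d \<Longrightarrow> 2 / 3 \<le> accept_prob n d \<epsilon> f D Tester"
    "far_from \<epsilon> D f (fourier_degree_class n d) \<Longrightarrow> 2 / 3 \<le> reject_prob n d \<epsilon> f D Tester"
proof -
  interpret tester n \<epsilon> f D "width n d \<epsilon>"
    by unfold_locales (use f D in \<open>auto simp: width_def\<close>)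
  note suff = width_sufficient[OF refl]
  have ex: "exec Tester \<lparr>sv = (\<lambda>_. 0)(0 := n, 1 := d), bu = \<lambda>_. 0, ar = \<lambda>_ _. 0\<rparr> (total_queries d (2 ^ rounds \<epsilon>))
     (verdict d (2 ^ rounds \<epsilon>)) (\<lambda>ok h'. (sv h' 0 \<noteq> 0) = ok)"
    unfolding total_queries_def by (rule exec_Tester[OF _ suff refl]) (use rounds[OF eps] in auto)
  note run = exec_run[OF ex initial_state_conc]
  show "time s \<le> tcost (width n d \<epsilon>) Tester \<and> queries s \<le> total_queries d (2 ^ rounds \<epsilon>)"
    if "(c, s) \<in> set_pmf (run n d \<epsilon> f D Tester k)" for c s k using that by (rule run(1))
  show "2 / 3 \<le> accept_prob n d \<epsilon> f D Tester" if "f \<in> fourier_degree_class n d"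
    using verdict_complete[OF that] run(2) by (rule order_trans)
  show "2 / 3 \<le> reject_prob n d \<epsilon> f D Tester" if "far_from \<epsilon> D f (fourier_degree_class n d)"
    by (rule order_trans[OF verdict_sound[OF that _ eps] run(3)]) (use rounds(1)[OF eps] in simp)
qed

lemma Tester_time: "\<exists>L b. \<forall>\<epsilon>>0. \<forall>n d. real (tcost (width n d \<epsilon>) Tester) \<le> L * (1 + 1 / \<epsilon>) ^ b * (2 ^ d + real n) ^ b"
proof -
  obtain L b where Lb: "\<And>W. tcost W Tester \<le> L * (W + 1) ^ b" using tcost_polynomial by blast
  have "real (tcost (width n d \<epsilon>) Tester) \<le> (real L * 6000 ^ b) * (1 + 1 / \<epsilon>) ^ (4 * b) * (2 ^ d + real n) ^ (4 * b)"
    if eps: "0 < \<epsilon>" for \<epsilon> n d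
  proof -
    define Y where "Y = 2 ^ d + real n"
    define E where "E = 1 + 1 / \<epsilon>"
    have E1: "1 \<le> E" using eps by (simp add: E_def)
    have Y0: "0 \<le> Y" by (simp add: Y_def)
    have "real (tcost (width n d \<epsilon>) Tester) \<le> real (L * (width n d \<epsilon> + 1) ^ b)" using Lb by (simp only: of_nat_le_iff)
    also have "\<dots> = real L * real (width n d \<epsilon> + 1) ^ b" by simp
    also have "\<dots> \<le> real L * (6000 * (E * Y ^ 4)) ^ b"
      using width_bound[OF eps, of n d] by (intro mult_left_mono power_mono) (auto simp: E_def Y_def)
    also have "\<dots> = real L * 6000 ^ b * (E ^ b * Y ^ (4 * b))" by (simp add: power_mult_distrib mult_ac flip: power_mult)
    \<comment> \<open>Padding the exponent of \<open>E\<close> gives both factors the common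
      exponent that the statement asks for.\<close>
    also have "\<dots> \<le> real L * 6000 ^ b * (E ^ (4 * b) * Y ^ (4 * b))"
      using E1 Y0 by (intro mult_left_mono mult_right_mono power_increasing) auto
    finally show ?thesis by (simp add: E_def Y_def mult.assoc)
  qed
  then show ?thesis by blast
qed

theorem theorem12:
  shows "\<exists>P :: com.
    (\<forall>\<epsilon>>0. \<forall>n d. distribution_free_tester P n d \<epsilon> (fourier_degree_class n d)) \<and>
    (\<exists>(K::real) (a::nat). \<forall>\<epsilon>>0. \<forall>n d.
       query_bounded P n d \<epsilon> (K * query_scale d \<epsilon> * (1 + log 2 (query_scale d \<epsilon>)) ^ a)) \<and>
    (\<exists>(L::real) (b::nat). \<forall>\<epsilon>>0. \<forall>n d.
       time_bounded P n d \<epsilon> (L * (1 + 1 / \<epsilon>) ^ b * (2 ^ d + real n) ^ b))"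
proof (rule exI[of _ Tester], intro conjI)
  show "\<forall>\<epsilon>>0. \<forall>n d. distribution_free_tester Tester n d \<epsilon> (fourier_degree_class n d)"
    unfolding distribution_free_tester_def using Tester_run(2,3) by blast
  have "query_bounded Tester n d \<epsilon> (2000000 * query_scale d \<epsilon> * (1 + log 2 (query_scale d \<epsilon>)) ^ 3)" if "0 < \<epsilon>" for \<epsilon> n d
    unfolding query_bounded_def
  proof (intro ballI allI impI, clarify)
    fix f D k c s assume "f \<in> boolean_functions n" "set_pmf D \<subseteq> cube n" "(c, s) \<in> set_pmf (run n d \<epsilon> f D Tester k)"
    then have "queries s \<le> total_queries d (2 ^ rounds \<epsilon>)" using Tester_run(1)[OF that] by blast
    then have "real (queries s) \<le> real (total_queries d (2 ^ rounds \<epsilon>))" by (simp only: of_nat_le_iff)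
    also note total_queries_bound[OF that]
    finally show "real (queries s) \<le> 2000000 * query_scale d \<epsilon> * (1 + log 2 (query_scale d \<epsilon>)) ^ 3" .
  qed
  then show "\<exists>K a. \<forall>\<epsilon>>0. \<forall>n d. query_bounded Tester n d \<epsilon> (K * query_scale d \<epsilon> * (1 + log 2 (query_scale d \<epsilon>)) ^ a)"
    by blast
  obtain L b where Lb: "\<And>\<epsilon> n d. 0 < \<epsilon> \<Longrightarrow> real (tcost (width n d \<epsilon>) Tester) \<le> L * (1 + 1 / \<epsilon>) ^ b * (2 ^ d + real n) ^ b"
    using Tester_time by blast
  have "time_bounded Tester n d \<epsilon> (L * (1 + 1 / \<epsilon>) ^ b * (2 ^ d + real n) ^ b)" if "0 < \<epsilon>" for \<epsilon> n d
    unfolding time_bounded_def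
  proof (intro ballI allI impI, clarify)
    fix f D k c s assume "f \<in> boolean_functions n" "set_pmf D \<subseteq> cube n" "(c, s) \<in> set_pmf (run n d \<epsilon> f D Tester k)"
    then have "time s \<le> tcost (width n d \<epsilon>) Tester" using Tester_run(1)[OF that] by blast
    then have "real (time s) \<le> real (tcost (width n d \<epsilon>) Tester)" by (simp only: of_nat_le_iff)
    also note Lb[OF that]
    finally show "real (time s) \<le> L * (1 + 1 / \<epsilon>) ^ b * (2 ^ d + real n) ^ b" .
  qed
  then show "\<exists>L b. \<forall>\<epsilon>>0. \<forall>n d. time_bounded Tester n d \<epsilon> (L * (1 + 1 / \<epsilon>) ^ b * (2 ^ d + real n) ^ b)" by blast
qed

end
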